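(* Let $1<p<n$, let $\Omega\subset\mathbb{R}^n$ be a bounded open set with smooth boundary (e.g. of class $C^{2,\alpha}$) which is star-shaped (with respect to some point), and let $q=p^*=\frac{np}{n-p}$. Then for every $\lambda\le0$ the problem $$\Delta^{\mathcal A}_p u = u^{p^*-1}+\lambda u^{p-1}\ \text{ in }\Omega,\qquad u=0\ \text{ on }\partial\Omega,$$ admits no nontrivial nonnegative weak solution.
   Context: Notation. $n\ge2$. $\mathbb{S}^{n-1}$ is the unit sphere of $\mathbb{R}^n$ with surface measure $\sigma$; $\omega_s=\pi^{s/2}/\Gamma(\frac s2+1)$ (the volume of the unit ball of $\mathbb{R}^s$ for integer $s$). $W^{1,p}_0(\Omega)$ is the completion of $C_0^\infty(\Omega)$ in the norm $\|\nabla u\|_{L^p(\Omega)}$. For $\xi\in\mathbb{S}^{n-1}$, $\nabla_\xi u=\nabla u\cdot\xi$. Affine $L^p$ energy: for $u\in W^{1,p}_0(\Omega)$, $$\mathcal{E}_{p,\Omega}(u)=\alpha_{n,p}\left(\int_{\mathbb{S}^{n-1}}\left(\int_\Omega|\nabla_\xi u|^p\,dx\right)^{-\frac np}d\sigma(\xi)\right)^{-\frac1n},\quad \alpha_{n,p}=(2\omega_{n+p-2})^{-\frac1p}(n\omega_n\omega_{p-1})^{\frac1p}(n\omega_n)^{\frac1n},$$ with the convention $0^{-n/p}=\infty$, $\infty^{-1/n}=0$ (so $\mathcal{E}_{p,\Omega}(0)=0$). Affine $p$-Laplace operator: for $u\in W^{1,p}_0(\Omega)\setminus\{0\}$, $\Delta^{\mathcal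 A}_p u=-\mathrm{div}\left(H_u^{p-1}(\nabla u)\nabla H_u(\nabla u)\right)$, where for $\zeta\in\mathbb{R}^n$ $$H_u^p(\zeta)=\alpha_{n,p}^{-n}\,\mathcal{E}_{p,\Omega}^{n+p}(u)\int_{\mathbb{S}^{n-1}}\left(\int_\Omega|\nabla_\xi u|^p\,dx\right)^{-\frac{n+p}{p}}|\langle\xi,\zeta\rangle|^p\,d\sigma(\xi),$$ and $H_u^{p-1}\nabla H_u=\frac1p\nabla(H_u^p)$ (equal to $0$ at $\zeta=0$). Weak solution: a nonnegative $u_0\in W^{1,p}_0(\Omega)\setminus\{0\}$ with $\int_\Omega H_{u_0}^{p-1}(\nabla u_0)\nabla H_{u_0}(\nabla u_0)\cdot\nabla\varphi\,dx=\int_\Omega u_0^{p^*-1}\varphi\,dx+\lambda\int_\Omega u_0^{p-1}\varphi\,dx$ for all $\varphi\in W^{1,p}_0(\Omega)$. *)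

theory Defs
  imports "HOL-Analysis.Analysis"
begin

definition grad :: "('a::euclidean_space \<Rightarrow> real) \<Rightarrow> 'a \<Rightarrow> 'a" where
  "grad f x = (THE g. GDERIV f x :> g)"

(* f is k times differentiable on the whole space and all its directional derivatives
   of order exactly k have the property P. *)
fun derivs_satisfy :: "(('a::euclidean_space \<Rightarrow> real) \<Rightarrow> bool) \<Rightarrow> nat \<Rightarrow> ('a \<Rightarrow> real) \<Rightarrow> bool" where
  "derivs_satisfy P 0 f \<longleftrightarrow> P f"
| "derivs_satisfy P (Suc k) f \<longleftrightarrow>
     (\<exists>g. (\<forall>x. GDERIV f x :> g x) \<and> (\<forall>v. derivs_satisfy P k (\<lambda>x. g x \<bullet> v)))"

definition smooth :: "('a::euclidean_space \<Rightarrow> real) \<Rightarrow> bool" where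
  "smooth f \<longleftrightarrow> (\<forall>k. derivs_satisfy (continuous_on UNIV) k f)"

definition locally_Hoelder :: "real \<Rightarrow> ('a::euclidean_space \<Rightarrow> real) \<Rightarrow> bool" where
  "locally_Hoelder \<alpha> f \<longleftrightarrow>
     (\<forall>K. compact K \<longrightarrow> (\<exists>L. \<forall>x\<in>K. \<forall>y\<in>K. \<bar>f x - f y\<bar> \<le> L * dist x y powr \<alpha>))"

(* Near each boundary point, \<Omega> is the strict epigraph, in some direction e, of a
   C^{k,\<alpha>} function of the variable in the hyperplane orthogonal to e; only the
   restriction of \<gamma> to that hyperplane matters. *)
definition Hoelder_boundary :: "nat \<Rightarrow> real \<Rightarrow> 'a::euclidean_space set \<Rightarrow> bool" where
  "Hoelder_boundary k \<alpha> \<Omega> \<longleftrightarrow>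
     (\<forall>x0\<in>frontier \<Omega>. \<exists>r>0. \<exists>e \<gamma>. norm e = 1 \<and> derivs_satisfy (locally_Hoelder \<alpha>) k \<gamma> \<and>
        \<Omega> \<inter> ball x0 r = {x \<in> ball x0 r. \<gamma> (x - (x \<bullet> e) *\<^sub>R e) < x \<bullet> e})"

(* C_0^\<infinity>(\<Omega>), its elements being extended by zero to the whole space. *)
definition test_function :: "'a::euclidean_space set \<Rightarrow> ('a \<Rightarrow> real) \<Rightarrow> bool" where
  "test_function \<Omega> \<phi> \<longleftrightarrow>
     smooth \<phi> \<and> compact (closure {x. \<phi> x \<noteq> 0}) \<and> closure {x. \<phi> x \<noteq> 0} \<subseteq> \<Omega>"

definition in_Lp :: "real \<Rightarrow> 'a::euclidean_space set \<Rightarrow> ('a \<Rightarrow> 'b::euclidean_space) \<Rightarrow> bool" where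
  "in_Lp p \<Omega> f \<longleftrightarrow> f \<in> borel_measurable (lebesgue_on \<Omega>) \<and>
     integrable (lebesgue_on \<Omega>) (\<lambda>x. norm (f x) powr p)"

definition Lp_norm :: "real \<Rightarrow> 'a::euclidean_space set \<Rightarrow> ('a \<Rightarrow> 'b::euclidean_space) \<Rightarrow> real" where
  "Lp_norm p \<Omega> f = (\<integral>x. norm (f x) powr p \<partial>lebesgue_on \<Omega>) powr (1 / p)"

definition locally_integrable ::
    "'a::euclidean_space set \<Rightarrow> ('a \<Rightarrow> 'b::euclidean_space) \<Rightarrow> bool" where
  "locally_integrable \<Omega> f \<longleftrightarrow>
     (\<forall>K. compact K \<and> K \<subseteq> \<Omega> \<longrightarrow> integrable (lebesgue_on K) f)"

definition has_weak_gradient ::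
    "'a::euclidean_space set \<Rightarrow> ('a \<Rightarrow> real) \<Rightarrow> ('a \<Rightarrow> 'a) \<Rightarrow> bool" where
  "has_weak_gradient \<Omega> u g \<longleftrightarrow> locally_integrable \<Omega> u \<and> locally_integrable \<Omega> g \<and>
     (\<forall>\<psi>. test_function \<Omega> \<psi> \<longrightarrow>
        (\<integral>x. u x *\<^sub>R grad \<psi> x \<partial>lebesgue_on \<Omega>) = - (\<integral>x. \<psi> x *\<^sub>R g x \<partial>lebesgue_on \<Omega>))"

(* The weak gradient is unique up to null sets; below it only occurs under integrals. *)
definition weak_grad :: "'a::euclidean_space set \<Rightarrow> ('a \<Rightarrow> real) \<Rightarrow> 'a \<Rightarrow> 'a" where
  "weak_grad \<Omega> u = (SOME g. has_weak_gradient \<Omega> u g)"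

(* The completion of C_0^\<infinity>(\<Omega>) in the norm of the gradient in L^p, realised as a space of
   functions. For bounded \<Omega>, the Poincare inequality makes every sequence of test functions
   that is Cauchy in that norm converge in L^p(\<Omega>), and the limit determines the element of
   the completion. Functions that agree almost everywhere on \<Omega> are identified implicitly. *)
definition W0 :: "real \<Rightarrow> 'a::euclidean_space set \<Rightarrow> ('a \<Rightarrow> real) set" where
  "W0 p \<Omega> = {u. in_Lp p \<Omega> u \<and> (\<exists>g. has_weak_gradient \<Omega> u g \<and> in_Lp p \<Omega> g \<and>
     (\<exists>\<phi>. (\<forall>k::nat. test_function \<Omega> (\<phi> k)) \<and>
        (\<lambda>k. Lp_norm p \<Omega> (\<lambda>x. \<phi> k x - u x)) \<longlonglongrightarrow> 0 \<and>
        (\<lambda>k. Lp_norm p \<Omega> (\<lambda>x. grad (\<phi> k) x - g x)) \<longlonglongrightarrow> 0))}"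

(* Surface measure on the unit sphere: \<sigma>(A) is n times the volume of the cone
   {t \<xi> | 0 < t < 1, \<xi> \<in> A} over A. *)
definition sphere_measure :: "'a::euclidean_space measure" where
  "sphere_measure =
     distr (density (restrict_space lborel (ball 0 1 - {0})) (\<lambda>_. ennreal (real DIM('a))))
       (restrict_space borel (sphere 0 1)) (\<lambda>x. x /\<^sub>R norm x)"

(* unit_ball_vol s is \<omega>_s, for real s. *)
definition affine_const :: "nat \<Rightarrow> real \<Rightarrow> real" where
  "affine_const n p =
     (2 * unit_ball_vol (real n + p - 2)) powr (- 1 / p) *
     (real n * unit_ball_vol (real n) * unit_ball_vol (p - 1)) powr (1 / p) *
     (real n * unit_ball_vol (real n)) powr (1 / real n)"

definition dir_integral :: "real \<Rightarrow> 'a::euclidean_space set \<Rightarrow> ('a \<Rightarrow> real) \<Rightarrow> 'a \<Rightarrow> real" where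
  "dir_integral p \<Omega> u \<xi> = (\<integral>x. \<bar>weak_grad \<Omega> u x \<bullet> \<xi>\<bar> powr p \<partial>lebesgue_on \<Omega>)"

(* The negative powers are reciprocals in ennreal, so that 0^(-n/p) = \<infinity> and
   \<infinity>^(-1/n) = 0, whereas 0 powr a = 0 on the reals. *)
definition affine_energy :: "real \<Rightarrow> 'a::euclidean_space set \<Rightarrow> ('a \<Rightarrow> real) \<Rightarrow> real" where
  "affine_energy p \<Omega> u = affine_const DIM('a) p *
     enn2real (inverse (\<integral>\<^sup>+\<xi>. inverse (ennreal (dir_integral p \<Omega> u \<xi> powr (real DIM('a) / p)))
       \<partial>sphere_measure)) powr (1 / real DIM('a))"

(* H_u^p, for u in W0 p \<Omega> not a.e. zero; then dir_integral p \<Omega> u is positive on the sphere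
   and the negative real power has its usual meaning. *)
definition affine_H_pow ::
    "real \<Rightarrow> 'a::euclidean_space set \<Rightarrow> ('a \<Rightarrow> real) \<Rightarrow> 'a \<Rightarrow> real" where
  "affine_H_pow p \<Omega> u \<zeta> =
     affine_const DIM('a) p powr (- real DIM('a)) *
     affine_energy p \<Omega> u powr (real DIM('a) + p) *
     (\<integral>\<xi>. dir_integral p \<Omega> u \<xi> powr (- (real DIM('a) + p) / p) * \<bar>\<xi> \<bullet> \<zeta>\<bar> powr p
       \<partial>sphere_measure)"

definition affine_H ::
    "real \<Rightarrow> 'a::euclidean_space set \<Rightarrow> ('a \<Rightarrow> real) \<Rightarrow> 'a \<Rightarrow> real" where
  "affine_H p \<Omega> u \<zeta> = affine_H_pow p \<Omega> u \<zeta> powr (1 / p)"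

(* H_u^(p-1) \<nabla>H_u. The value at 0 is prescribed because H_u, being positively homogeneous
   of degree 1, is not differentiable there. *)
definition affine_flux ::
    "real \<Rightarrow> 'a::euclidean_space set \<Rightarrow> ('a \<Rightarrow> real) \<Rightarrow> 'a \<Rightarrow> 'a" where
  "affine_flux p \<Omega> u \<zeta> =
     (if \<zeta> = 0 then 0
      else affine_H p \<Omega> u \<zeta> powr (p - 1) *\<^sub>R grad (affine_H p \<Omega> u) \<zeta>)"

(* Nontrivial nonnegative weak solutions of
   - div (H_u^(p-1)(\<nabla>u) \<nabla>H_u(\<nabla>u)) = u^(q-1) + lam u^(p-1) in \<Omega>,  u = 0 on the boundary. *)
definition weak_solution ::
    "real \<Rightarrow> real \<Rightarrow> real \<Rightarrow> 'a::euclidean_space set \<Rightarrow> ('a \<Rightarrow> real) \<Rightarrow> bool" where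
  "weak_solution p q lam \<Omega> u \<longleftrightarrow>
     u \<in> W0 p \<Omega> \<and>
     \<not> (AE x in lebesgue_on \<Omega>. u x = 0) \<and>
     (AE x in lebesgue_on \<Omega>. 0 \<le> u x) \<and>
     (\<forall>\<phi>\<in>W0 p \<Omega>.
        (\<integral>x. affine_flux p \<Omega> u (weak_grad \<Omega> u x) \<bullet> weak_grad \<Omega> \<phi> x \<partial>lebesgue_on \<Omega>) =
        (\<integral>x. u x powr (q - 1) * \<phi> x \<partial>lebesgue_on \<Omega>) +
        lam * (\<integral>x. u x powr (p - 1) * \<phi> x \<partial>lebesgue_on \<Omega>))"

end

theory Submission
  imports Defs
begin

text \<open>
  For a fixed nontrivial \<open>u\<close> the weight in the definition of the affine operator is a bounded positive
  function on the sphere, so the operator is an anisotropic \<open>p\<close>-Laplacian: there is a finite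
  measure \<open>\<mu>\<close> on the sphere such that the \<open>p\<close>-th power of the norm is
  \<open>N \<zeta> = (\<integral>\<xi>. \<bar>\<xi> \<bullet> \<zeta>\<bar> powr p \<partial>\<mu>)\<close> and the flux is \<open>a\<close>, one \<open>p\<close>-th of the gradient of \<open>N\<close>
  (\<open>affine_flux_structure\<close>). It remains to show that a nonnegative \<open>v\<close> with gradient \<open>g\<close> that solves
  the equation for the fixed flux \<open>a\<close> weakly vanishes (\<open>trivial_on_starlike_domain\<close>).

  The classical argument combines the Pohozaev identity with Hopf's lemma and presupposes regularity up
  to the boundary. Both ingredients are replaced by arguments for weak solutions.

  Let \<open>b\<close> be a centre of the domain and \<open>v\<^sub>t\<close> the dilated function \<open>v (b + t (x - b))\<close> with
  \<open>t \<ge> 1\<close>. It vanishes outside the domain, so \<open>v\<^sub>t - v\<close> is an admissible test function. Convexity of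
  \<open>N\<close> and of powers turns the weak equation into an inequality between integrals that scale
  like powers of \<open>t\<close> (\<open>dilation_inequality\<close>). Since \<open>n p / q = n - p\<close>, where \<open>n\<close> is the
  dimension, the first order terms cancel except for \<open>p lam \<integral>v\<^sup>p\<close>, and what remains is
  \<open>0 \<le> (p - 1) E(t) \<le> p lam (t - 1) (\<integral>v\<^sup>p) + o(t - 1)\<close>, where \<open>E(t)\<close> is the energy of \<open>v\<close>
  in the boundary layer that the dilation throws out of the domain. The error term is
  under control because \<open>v\<close> belongs to all Lebesgue spaces of exponent at least \<open>p\<close>, by Moser iteration
  (\<open>all_powers_integrable\<close>). So \<open>lam < 0\<close> is impossible, and \<open>lam = 0\<close> leaves
  \<open>E(t) = o(t - 1)\<close> along a sequence \<open>t \<rightarrow> 1\<close> (\<open>boundary_energy_negligible\<close>). For smooth \<open>v\<close> this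
  would say that the normal derivative vanishes on the part of the boundary that is transversal to the
  rays from \<open>b\<close>.

  At the boundary point farthest from \<open>b\<close> the boundary is transversal to the ray, and the layers have
  height and volume of order \<open>t - 1\<close>. Hence no flux leaves the domain there: the extension
  of \<open>v\<close> by zero is a supersolution across the boundary (\<open>supersolution_boundary\<close>). It vanishes on a set
  of positive measure near that point, and a supersolution with this property vanishes in a whole ball:
  the gradient of \<open>ln (v + \<epsilon>)\<close> is bounded in the mean independently of \<open>\<epsilon>\<close>, which contradicts
  the Poincare inequality unless \<open>v\<close> is zero (\<open>zero_set_fills_ball\<close>). The same principle spreads the
  zeros over the connected domain.

  The Sobolev space enters through pairs of Borel functions on the whole space that are limits of
  continuously differentiable functions with compact support in the domain, together with their gradients
  (\<open>sobolev0\<close>); \<open>W0_sobolev0\<close> and \<open>sobolev0_in_W0\<close> translate between such pairs and the Sobolev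
  space. The Sobolev, Poincare and dilation inequalities all come from the fundamental theorem of
  calculus along segments (\<open>segment_inequality\<close>).
\<close>

section \<open>Continuously differentiable functions\<close>

definition C1 :: "('a::euclidean_space \<Rightarrow> real) \<Rightarrow> ('a \<Rightarrow> 'a) \<Rightarrow> bool" where
  "C1 f d \<longleftrightarrow> (\<forall>x. GDERIV f x :> d x) \<and> continuous_on UNIV d"

definition C1c :: "'a::euclidean_space set \<Rightarrow> ('a \<Rightarrow> real) \<Rightarrow> ('a \<Rightarrow> 'a) \<Rightarrow> bool" where
  "C1c \<Omega> f d \<longleftrightarrow> C1 f d \<and> (\<exists>K. compact K \<and> K \<subseteq> \<Omega> \<and> (\<forall>x. x \<notin> K \<longrightarrow> f x = 0))"

lemma gderiv_unique:
  assumes "GDERIV f x :> a" "GDERIV f x :> b" shows "a = b"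
proof -
  have "(\<lambda>h. h \<bullet> a) = (\<lambda>h. h \<bullet> b)"
    using assms unfolding gderiv_def by (rule has_derivative_unique)
  then have "(a - b) \<bullet> a = (a - b) \<bullet> b" by metis
  then have "(a - b) \<bullet> (a - b) = 0" by (simp add: inner_diff_right)
  then show ?thesis by simp
qed

lemma grad_eq: "GDERIV f x :> g \<Longrightarrow> grad f x = g"
  unfolding grad_def using gderiv_unique by blast

lemma GDERIV_cong_open:
  assumes "GDERIV f x :> g" "open U" "x \<in> U" "\<And>y. y \<in> U \<Longrightarrow> f y = h y"
  shows "GDERIV h x :> g"
  using assms unfolding gderiv_def by (metis has_derivative_transform_within_open)

lemma GDERIV_isCont: "GDERIV f x :> g \<Longrightarrow> isCont f x"
  unfolding gderiv_def by (rule has_derivative_continuous)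

lemma C1_continuous: "C1 f d \<Longrightarrow> continuous_on UNIV f"
  unfolding C1_def by (auto intro!: continuous_at_imp_continuous_on GDERIV_isCont)

lemma C1_grad: "C1 f d \<Longrightarrow> grad f = d"
  unfolding C1_def by (auto intro!: grad_eq)

lemma C1_measurable:
  assumes "C1 f d" shows "f \<in> borel_measurable borel" "d \<in> borel_measurable borel"
  using C1_continuous[OF assms] assms
  by (auto simp: C1_def intro: borel_measurable_continuous_onI)

lemma C1_line:
  assumes "C1 f d"
  shows "((\<lambda>s. f (x + s *\<^sub>R v)) has_real_derivative d (x + s *\<^sub>R v) \<bullet> v) (at s within S)"
proof -
  have "(f has_derivative (\<lambda>h. h \<bullet> d (x + s *\<^sub>R v))) (at (x + s *\<^sub>R v))"
    using assms by (auto simp: C1_def gderiv_def)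
  then have 1: "(f has_derivative (\<lambda>h. h \<bullet> d (x + s *\<^sub>R v)))
      (at (x + s *\<^sub>R v) within (\<lambda>s. x + s *\<^sub>R v) ` S)"
    using has_derivative_at_withinI by blast
  have 2: "((\<lambda>s. x + s *\<^sub>R v) has_derivative (\<lambda>h. h *\<^sub>R v)) (at s within S)"
    by (auto intro!: derivative_eq_intros)
  have "((\<lambda>s. f (x + s *\<^sub>R v)) has_derivative (\<lambda>h. (h *\<^sub>R v) \<bullet> d (x + s *\<^sub>R v))) (at s within S)"
    using has_derivative_in_compose[OF 2 1] by simp
  then show ?thesis
    by (simp add: has_field_derivative_def inner_commute mult.commute[of "d (x + s *\<^sub>R v) \<bullet> v"] mult_commute_abs)
qed

lemma C1_mvt:
  assumes "C1 f d"
  obtains t where "0 < t" "t < 1" "f (x + v) - f x = d (x + t *\<^sub>R v) \<bullet> v"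
proof -
  have "\<exists>z>0. z < 1 \<and> f (x + 1 *\<^sub>R v) - f (x + 0 *\<^sub>R v) = (1 - 0) * (d (x + z *\<^sub>R v) \<bullet> v)"
    by (rule MVT2[where f = "\<lambda>s. f (x + s *\<^sub>R v)"]) (use C1_line[OF assms] in auto)
  then show ?thesis using that by auto
qed

lemma C1_add: "C1 f d \<Longrightarrow> C1 g e \<Longrightarrow> C1 (\<lambda>x. f x + g x) (\<lambda>x. d x + e x)"
  unfolding C1_def by (auto intro!: GDERIV_add continuous_intros)

lemma C1_diff: "C1 f d \<Longrightarrow> C1 g e \<Longrightarrow> C1 (\<lambda>x. f x - g x) (\<lambda>x. d x - e x)"
  unfolding C1_def by (auto intro!: GDERIV_diff continuous_intros)

lemma C1_const: "C1 (\<lambda>x. c) (\<lambda>x. 0)"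
  unfolding C1_def by (auto intro!: GDERIV_const continuous_intros)

lemma C1_mult:
  assumes "C1 f d" "C1 g e" shows "C1 (\<lambda>x. f x * g x) (\<lambda>x. f x *\<^sub>R e x + g x *\<^sub>R d x)"
  using assms C1_continuous[OF assms(1)] C1_continuous[OF assms(2)]
  unfolding C1_def by (auto intro!: GDERIV_mult continuous_intros)

lemma C1_compose:
  assumes f: "C1 f d" and F: "\<And>s. (F has_real_derivative F' s) (at s)" and c: "continuous_on UNIV F'"
  shows "C1 (\<lambda>x. F (f x)) (\<lambda>x. F' (f x) *\<^sub>R d x)"
proof -
  have "continuous_on UNIV (\<lambda>x. F' (f x))"
    using continuous_on_compose2[OF c C1_continuous[OF f]] by simp
  then show ?thesis
    using f GDERIV_DERIV_compose[OF _ F] unfolding C1_def by (auto intro!: continuous_intros)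
qed

lemma C1_affine:
  assumes f: "C1 f d" shows "C1 (\<lambda>x. f (b + c *\<^sub>R x)) (\<lambda>x. c *\<^sub>R d (b + c *\<^sub>R x))"
proof -
  have "GDERIV (\<lambda>x. f (b + c *\<^sub>R x)) x :> c *\<^sub>R d (b + c *\<^sub>R x)" for x
  proof -
    have 1: "(f has_derivative (\<lambda>h. h \<bullet> d (b + c *\<^sub>R x))) (at (b + c *\<^sub>R x))"
      using f by (auto simp: C1_def gderiv_def)
    have 2: "((\<lambda>x. b + c *\<^sub>R x) has_derivative (\<lambda>h. c *\<^sub>R h)) (at x)"
      by (auto intro!: derivative_eq_intros)
    show ?thesis using has_derivative_compose[OF 2 1] by (simp add: gderiv_def)
  qed
  moreover have "continuous_on UNIV (\<lambda>x. d (b + c *\<^sub>R x))"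
    using f by (auto simp: C1_def intro!: continuous_on_compose2[of UNIV d] continuous_intros)
  ultimately show ?thesis unfolding C1_def by (auto intro!: continuous_intros)
qed

lemma C1c_C1: "C1c \<Omega> f d \<Longrightarrow> C1 f d"
  by (simp add: C1c_def)

lemma C1_support:
  assumes "C1 f d" "compact K" "\<And>x. x \<notin> K \<Longrightarrow> f x = 0" "x \<notin> K"
  shows "d x = 0"
proof -
  have "open (- K)" using assms compact_imp_closed by blast
  have "GDERIV f x :> d x" using assms by (simp add: C1_def)
  then have "GDERIV (\<lambda>_. 0) x :> d x"
    using \<open>open (-K)\<close> by (rule GDERIV_cong_open) (use assms in auto)
  then show ?thesis using GDERIV_const gderiv_unique by blast
qed

lemma C1c_support:
  assumes "C1c \<Omega> f d"
  obtains K where "compact K" "K \<subseteq> \<Omega>" "\<And>x. x \<notin> K \<Longrightarrow> f x = 0" "\<And>x. x \<notin> K \<Longrightarrow> d x = 0"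
  using assms C1_support[of f d] unfolding C1c_def by metis

lemma C1c_mono: "C1c U f d \<Longrightarrow> U \<subseteq> V \<Longrightarrow> C1c V f d"
  unfolding C1c_def by blast

lemma bounded_compact_support:
  fixes f :: "'a::euclidean_space \<Rightarrow> 'b::euclidean_space"
  assumes "continuous_on UNIV f" "compact K" "\<And>x. x \<notin> K \<Longrightarrow> f x = 0"
  obtains M where "M > 0" "\<And>x. norm (f x) \<le> M"
proof -
  have "bounded (f ` K)"
    using assms continuous_on_subset[OF assms(1), of K]
    by (intro compact_imp_bounded compact_continuous_image) auto
  then obtain M where "M > 0" "\<And>x. x \<in> K \<Longrightarrow> norm (f x) \<le> M"
    unfolding bounded_pos by auto
  then show ?thesis using that[of M] assms(3) by (metis norm_zero less_imp_le)
qed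

lemma integrable_compact_support:
  fixes f :: "'a::euclidean_space \<Rightarrow> 'b::euclidean_space"
  assumes "continuous_on UNIV f" "compact K" "\<And>x. x \<notin> K \<Longrightarrow> f x = 0"
  shows "integrable lborel f"
proof -
  have "integrable lborel (\<lambda>x. indicator K x *\<^sub>R f x)"
    using assms by (intro borel_integrable_compact) (auto intro: continuous_on_subset)
  moreover have "(\<lambda>x. indicator K x *\<^sub>R f x) = f"
    using assms(3) by (auto simp: indicator_def fun_eq_iff)
  ultimately show ?thesis by simp
qed

lemma uniform_compact_support:
  fixes f :: "'a::euclidean_space \<Rightarrow> 'b::euclidean_space"
  assumes c: "continuous_on UNIV f" and K: "compact K" "\<And>x. x \<notin> K \<Longrightarrow> f x = 0" and e: "e > 0"
  obtains \<delta> where "\<delta> > 0" "\<And>x y. norm (x - y) < \<delta> \<Longrightarrow> norm (f x - f y) < e"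
proof -
  obtain R where R: "R > 0" "\<And>x. x \<in> K \<Longrightarrow> norm x \<le> R"
    using compact_imp_bounded[OF K(1)] unfolding bounded_pos by auto
  have "uniformly_continuous_on (cball 0 (R+1)) f"
    using c continuous_on_subset by (intro compact_uniformly_continuous) auto
  then obtain d where d: "d > 0"
    "\<And>x y. x \<in> cball 0 (R+1) \<Longrightarrow> y \<in> cball 0 (R+1) \<Longrightarrow> dist x y < d \<Longrightarrow> dist (f x) (f y) < e"
    unfolding uniformly_continuous_on_def using e by metis
  have "norm (f x - f y) < e" if xy: "norm (x - y) < min d 1" for x y
  proof (cases "x \<in> K \<or> y \<in> K")
    case True
    then have "norm x \<le> R + 1 \<and> norm y \<le> R + 1"
      using R(2) xy norm_triangle_ineq2[of x y] norm_triangle_ineq2[of y x]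
      by (auto simp: norm_minus_commute) (smt (verit) R(2))+
    then show ?thesis using d(2)[of x y] xy by (auto simp: dist_norm)
  qed (use K(2) e in auto)
  then show ?thesis using that[of "min d 1"] d(1) by auto
qed

section \<open>Convolution with smooth kernels\<close>

definition conv :: "('a::euclidean_space \<Rightarrow> real) \<Rightarrow> ('a \<Rightarrow> 'b::euclidean_space) \<Rightarrow> 'a \<Rightarrow> 'b" where
  "conv \<rho> f x = (\<integral>y. \<rho> y *\<^sub>R f (x - y) \<partial>lborel)"

lemma lborel_integral_affine:
  fixes f :: "'a::euclidean_space \<Rightarrow> 'b::{banach, second_countable_topology}"
  assumes [measurable]: "f \<in> borel_measurable borel" and "c \<noteq> 0"
  shows "(\<integral>x. f x \<partial>lborel) = \<bar>c\<bar> ^ DIM('a) *\<^sub>R (\<integral>x. f (t + c *\<^sub>R x) \<partial>lborel)"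
  by (subst lborel_affine[OF \<open>c \<noteq> 0\<close>, of t])
     (simp add: integral_density integral_distr)

lemma lborel_nn_integral_affine:
  fixes f :: "'a::euclidean_space \<Rightarrow> ennreal"
  assumes [measurable]: "f \<in> borel_measurable borel" and "c \<noteq> 0"
  shows "(\<integral>\<^sup>+x. f x \<partial>lborel) = ennreal (\<bar>c\<bar> ^ DIM('a)) * (\<integral>\<^sup>+x. f (t + c *\<^sub>R x) \<partial>lborel)"
  by (subst lborel_affine[OF \<open>c \<noteq> 0\<close>, of t])
     (simp add: nn_integral_density nn_integral_distr nn_integral_cmult)

lemma conv_commute:
  fixes \<rho> f :: "'a::euclidean_space \<Rightarrow> real"
  assumes [measurable]: "\<rho> \<in> borel_measurable borel" "f \<in> borel_measurable borel"
  shows "conv \<rho> f x = conv f \<rho> x"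
  unfolding conv_def
  by (subst lborel_integral_affine[where c = "-1" and t = x]) (simp_all add: mult.commute)

lemma conv_integrable:
  fixes f :: "'a::euclidean_space \<Rightarrow> 'b::euclidean_space"
  assumes \<rho>: "integrable lborel \<rho>" and f: "f \<in> borel_measurable borel" "\<And>x. norm (f x) \<le> M"
  shows "integrable lborel (\<lambda>y. \<rho> y *\<^sub>R f (x - y))"
proof (rule Bochner_Integration.integrable_bound)
  show "integrable lborel (\<lambda>y. M * \<rho> y)" using \<rho> by simp
  show "(\<lambda>y. \<rho> y *\<^sub>R f (x - y)) \<in> borel_measurable lborel"
    using borel_measurable_integrable[OF \<rho>] f by measurable
  have "M \<ge> 0" using f(2) norm_ge_zero order_trans by blast
  then show "AE y in lborel. norm (\<rho> y *\<^sub>R f (x - y)) \<le> norm (M * \<rho> y)"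
    using f(2) by (auto simp: abs_mult mult.commute[of "\<bar>\<rho> _\<bar>"] intro!: mult_mono always_eventually)
qed

lemma conv_inner:
  fixes f :: "'a::euclidean_space \<Rightarrow> 'a"
  assumes "integrable lborel \<rho>" and "f \<in> borel_measurable borel" "\<And>x. norm (f x) \<le> M"
  shows "conv \<rho> f x \<bullet> v = conv \<rho> (\<lambda>x. f x \<bullet> v) x"
  unfolding conv_def using conv_integrable[OF assms]
  by (subst integral_inner_left[symmetric]) auto

lemma continuous_conv:
  fixes f :: "'a::euclidean_space \<Rightarrow> 'b::euclidean_space"
  assumes \<rho>: "integrable lborel \<rho>" and f: "continuous_on UNIV f" and K: "compact K" "\<And>x. x \<notin> K \<Longrightarrow> f x = 0"
  shows "continuous_on UNIV (conv \<rho> f)"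
proof -
  obtain M where M: "\<And>x. norm (f x) \<le> M" using bounded_compact_support[OF f K] by metis
  have fm: "f \<in> borel_measurable borel" using f by (rule borel_measurable_continuous_onI)
  note [measurable] = fm borel_measurable_integrable[OF \<rho>]
  show ?thesis
    unfolding continuous_on_sequentially comp_def
  proof (intro allI ballI impI)
    fix X :: "nat \<Rightarrow> 'a" and x
    assume X: "(\<forall>n. X n \<in> UNIV) \<and> X \<longlonglongrightarrow> x"
    show "(\<lambda>n. conv \<rho> f (X n)) \<longlonglongrightarrow> conv \<rho> f x"
      unfolding conv_def
    proof (rule integral_dominated_convergence[where w = "\<lambda>y. \<bar>\<rho> y\<bar> * M"])
      have "(\<lambda>n. f (X n - y)) \<longlonglongrightarrow> f (x - y)" for y
        using X by (intro continuous_on_tendsto_compose[OF f] tendsto_diff) auto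
      then show "AE y in lborel. (\<lambda>n. \<rho> y *\<^sub>R f (X n - y)) \<longlonglongrightarrow> \<rho> y *\<^sub>R f (x - y)"
        by (intro AE_I2 tendsto_scaleR tendsto_const)
      show "AE y in lborel. norm (\<rho> y *\<^sub>R f (X n - y)) \<le> \<bar>\<rho> y\<bar> * M" for n
        using M by (intro AE_I2) (simp add: mult_left_mono)
      show "integrable lborel (\<lambda>y. \<bar>\<rho> y\<bar> * M)" using \<rho> by simp
    qed measurable
  qed
qed

lemma GDERIV_conv:
  fixes f :: "'a::euclidean_space \<Rightarrow> real"
  assumes \<rho>: "integrable lborel \<rho>" and f: "C1 f d" and K: "compact K" "\<And>x. x \<notin> K \<Longrightarrow> f x = 0"
  shows "GDERIV (conv \<rho> f) x :> conv \<rho> d x"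
proof -
  have Kd: "\<And>x. x \<notin> K \<Longrightarrow> d x = 0" using C1_support[OF f K] by blast
  have cd: "continuous_on UNIV d" using f by (simp add: C1_def)
  note [measurable] = C1_measurable[OF f] borel_measurable_integrable[OF \<rho>]
  obtain M where M: "\<And>x. norm (f x) \<le> M" using bounded_compact_support[OF C1_continuous[OF f] K] by metis
  obtain M' where M': "\<And>x. norm (d x) \<le> M'" using bounded_compact_support[OF cd K(1) Kd] by metis
  note int = conv_integrable[OF \<rho> C1_measurable(1)[OF f] M]
  note intd = conv_integrable[OF \<rho> C1_measurable(2)[OF f] M']
  define I where "I = (\<integral>y. \<bar>\<rho> y\<bar> \<partial>lborel)"
  have I: "I \<ge> 0" unfolding I_def by simp
  have "\<exists>\<delta>>0. \<forall>x'. norm (x' - x) < \<delta> \<longrightarrow>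
      norm (conv \<rho> f x' - conv \<rho> f x - (x' - x) \<bullet> conv \<rho> d x) \<le> e * norm (x' - x)" if "e > 0" for e
  proof -
    have "e / (I + 1) > 0" using that I by auto
    from uniform_compact_support[OF cd K(1) Kd this] obtain \<delta> where
      \<delta>: "\<delta> > 0" "\<And>x y. norm (x - y) < \<delta> \<Longrightarrow> norm (d x - d y) < e / (I + 1)" by metis
    have "norm (conv \<rho> f x' - conv \<rho> f x - (x' - x) \<bullet> conv \<rho> d x) \<le> e * norm (x' - x)"
      if x': "norm (x' - x) < \<delta>" for x'
    proof -
      define h where "h = x' - x"
      have pt: "\<bar>\<rho> y * f (x' - y) - \<rho> y * f (x - y) - \<rho> y * (h \<bullet> d (x - y))\<bar> \<le> \<bar>\<rho> y\<bar> * (e / (I + 1) * norm h)" for y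
      proof -
        obtain t where t: "0 < t" "t < 1" "f ((x - y) + h) - f (x - y) = d ((x - y) + t *\<^sub>R h) \<bullet> h"
          using C1_mvt[OF f] by metis
        have "norm ((x - y) + t *\<^sub>R h - (x - y)) < \<delta>"
          using t x' mult_left_le_one_le[of "norm h" t] by (simp add: h_def)
        then have "norm (d ((x - y) + t *\<^sub>R h) - d (x - y)) < e / (I + 1)" by (rule \<delta>)
        moreover have "f (x' - y) - f (x - y) - h \<bullet> d (x - y) = (d ((x - y) + t *\<^sub>R h) - d (x - y)) \<bullet> h"
          using t(3) by (simp add: h_def inner_diff_left inner_commute algebra_simps)
        ultimately have "\<bar>f (x' - y) - f (x - y) - h \<bullet> d (x - y)\<bar> \<le> e / (I + 1) * norm h"
          using Cauchy_Schwarz_ineq2[of "d ((x - y) + t *\<^sub>R h) - d (x - y)" h]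
          by (smt (verit) mult_right_mono norm_ge_zero)
        then have "\<bar>\<rho> y\<bar> * \<bar>f (x' - y) - f (x - y) - h \<bullet> d (x - y)\<bar> \<le> \<bar>\<rho> y\<bar> * (e / (I + 1) * norm h)"
          by (intro mult_left_mono) auto
        then show ?thesis by (simp only: abs_mult[symmetric]) (simp add: algebra_simps)
      qed
      have i3: "integrable lborel (\<lambda>y. \<rho> y * (h \<bullet> d (x - y)))"
        using integrable_inner_left[OF intd[of x], of h] by (simp add: inner_commute)
      have "h \<bullet> conv \<rho> d x = (\<integral>y. \<rho> y * (h \<bullet> d (x - y)) \<partial>lborel)"
        unfolding conv_def using intd[of x] by (subst integral_inner_right[symmetric]) auto
      then have "norm (conv \<rho> f x' - conv \<rho> f x - (x' - x) \<bullet> conv \<rho> d x)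
        = \<bar>\<integral>y. \<rho> y * f (x' - y) - \<rho> y * f (x - y) - \<rho> y * (h \<bullet> d (x - y)) \<partial>lborel\<bar>"
        using int[of x'] int[of x] i3 unfolding conv_def h_def[symmetric] by simp
      also have "\<dots> \<le> (\<integral>y. \<bar>\<rho> y\<bar> * (e / (I + 1) * norm h) \<partial>lborel)"
        using int[of x'] int[of x] i3 \<rho> pt
        by (intro order_trans[OF integral_abs_bound] integral_mono) auto
      also have "\<dots> = I * (e / (I + 1) * norm h)" unfolding I_def by simp
      also have "\<dots> \<le> e * norm h" using I \<open>e > 0\<close>
        by (simp add: field_simps mult_left_mono)
      finally show ?thesis by (simp add: h_def)
    qed
    then show ?thesis using \<delta>(1) by blast
  qed
  then have "(conv \<rho> f has_derivative (\<lambda>h. h \<bullet> conv \<rho> d x)) (at x)"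
    unfolding has_derivative_at_alt by (auto intro: bounded_linear_inner_left)
  then show ?thesis unfolding gderiv_def .
qed

lemma C1_conv:
  assumes "integrable lborel \<rho>" and "C1 f d" and "compact K" "\<And>x. x \<notin> K \<Longrightarrow> f x = 0"
  shows "C1 (conv \<rho> f) (conv \<rho> d)"
  unfolding C1_def
  using GDERIV_conv[OF assms] C1_support[OF assms(2-4)] assms(2)
  by (auto simp: C1_def intro!: continuous_conv[OF assms(1) _ assms(3)])

section \<open>Smooth functions and mollification\<close>

lemma derivs_satisfy_D:
  "derivs_satisfy P (Suc k) f \<Longrightarrow> (\<And>x. GDERIV f x :> g x) \<Longrightarrow> derivs_satisfy P k (\<lambda>x. g x \<bullet> v)"
proof -
  assume 1: "derivs_satisfy P (Suc k) f" and 2: "\<And>x. GDERIV f x :> g x"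
  then obtain g' where g': "\<forall>x. GDERIV f x :> g' x" "\<forall>v. derivs_satisfy P k (\<lambda>x. g' x \<bullet> v)" by auto
  have "g' x = g x" for x using g'(1) 2[of x] gderiv_unique by blast
  then show ?thesis using g'(2) by simp
qed

lemma smoothD:
  assumes "smooth f"
  obtains g where "C1 f g" "\<And>v. smooth (\<lambda>x. g x \<bullet> v)"
proof -
  have "derivs_satisfy (continuous_on UNIV) (Suc 0) f" using assms unfolding smooth_def by blast
  then obtain g where g: "\<And>x. GDERIV f x :> g x" "\<And>v. continuous_on UNIV (\<lambda>x. g x \<bullet> v)"
    unfolding derivs_satisfy.simps by blast
  have "smooth (\<lambda>x. g x \<bullet> v)" for v
    using assms derivs_satisfy_D[OF _ g(1)] unfolding smooth_def by blast
  moreover have "continuous_on UNIV g"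
    using g(2) by (subst continuous_on_componentwise) blast
  then have "C1 f g" unfolding C1_def using g(1) by blast
  ultimately show ?thesis using that by blast
qed

lemma smooth_continuous: "smooth f \<Longrightarrow> continuous_on UNIV f"
  by (metis smoothD C1_continuous)

text \<open>Smoothness by coinduction: it suffices that a class of functions is stable under directional
  derivatives.\<close>

lemma smooth_coinduct:
  assumes "P f" and step: "\<And>f. P f \<Longrightarrow> continuous_on UNIV f \<and> (\<exists>g. (\<forall>x. GDERIV f x :> g x) \<and> (\<forall>v. P (\<lambda>x. g x \<bullet> v)))"
  shows "smooth f"
proof -
  have "derivs_satisfy (continuous_on UNIV) k f" if "P f" for k f
    using that
  proof (induction k arbitrary: f)
    case 0 then show ?case using step by simp
  next
    case (Suc k) then show ?case using step[OF Suc.prems] by auto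
  qed
  then show ?thesis using assms(1) unfolding smooth_def by blast
qed

inductive smooth_alg :: "('a::euclidean_space \<Rightarrow> real) \<Rightarrow> bool" where
  base: "smooth f \<Longrightarrow> smooth_alg f"
| add: "smooth_alg f \<Longrightarrow> smooth_alg g \<Longrightarrow> smooth_alg (\<lambda>x. f x + g x)"
| mult: "smooth_alg f \<Longrightarrow> smooth_alg g \<Longrightarrow> smooth_alg (\<lambda>x. f x * g x)"

text \<open>The algebra generated by the smooth functions is closed under directional derivatives
  by the Leibniz rule, so it consists of smooth functions.\<close>

lemma smooth_mult: assumes "smooth f" "smooth g" shows "smooth (\<lambda>x. f x * g x)"
proof (rule smooth_coinduct[where P = smooth_alg])
  show "smooth_alg (\<lambda>x. f x * g x)" using assms by (intro smooth_alg.intros)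
  fix h :: "'a \<Rightarrow> real" assume "smooth_alg h"
  then have "\<exists>g. C1 h g \<and> (\<forall>v. smooth_alg (\<lambda>x. g x \<bullet> v))"
  proof induction
    case (base f)
    then show ?case by (metis smoothD smooth_alg.base)
  next
    case (add f g)
    then obtain d e where "C1 f d" "C1 g e" "\<forall>v. smooth_alg (\<lambda>x. d x \<bullet> v)" "\<forall>v. smooth_alg (\<lambda>x. e x \<bullet> v)"
      by blast
    then show ?case
      by (intro exI[of _ "\<lambda>x. d x + e x"]) (auto intro: C1_add smooth_alg.add simp: inner_add_left)
  next
    case (mult f g)
    then obtain d e where "C1 f d" "C1 g e" "\<forall>v. smooth_alg (\<lambda>x. d x \<bullet> v)" "\<forall>v. smooth_alg (\<lambda>x. e x \<bullet> v)"
      by blast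
    then show ?case using mult
      by (intro exI[of _ "\<lambda>x. f x *\<^sub>R e x + g x *\<^sub>R d x"])
         (auto intro!: C1_mult smooth_alg.add smooth_alg.mult simp: inner_add_left)
  qed
  then show "continuous_on UNIV h \<and> (\<exists>g. (\<forall>x. GDERIV h x :> g x) \<and> (\<forall>v. smooth_alg (\<lambda>x. g x \<bullet> v)))"
    by (metis C1_continuous C1_def)
qed

lemma smooth_affine:
  assumes "smooth f" shows "smooth (\<lambda>x. k * f (b + c *\<^sub>R x))"
proof (rule smooth_coinduct[where P = "\<lambda>h. \<exists>k f. smooth f \<and> h = (\<lambda>x. k * f (b + c *\<^sub>R x))"])
  show "\<exists>k' f'. smooth f' \<and> (\<lambda>x. k * f (b + c *\<^sub>R x)) = (\<lambda>x. k' * f' (b + c *\<^sub>R x))" using assms by blast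
  fix h assume "\<exists>k f. smooth f \<and> h = (\<lambda>x. k * f (b + c *\<^sub>R x))"
  then obtain k f where f: "smooth f" "h = (\<lambda>x. k * f (b + c *\<^sub>R x))" by blast
  from smoothD[OF f(1)] obtain g where g: "C1 f g" "\<And>v. smooth (\<lambda>x. g x \<bullet> v)" by blast
  have "C1 h (\<lambda>x. k *\<^sub>R c *\<^sub>R g (b + c *\<^sub>R x))"
    using C1_mult[OF C1_const C1_affine[OF g(1)], of k b c] by (simp add: f(2))
  moreover have "(\<lambda>x. (k *\<^sub>R c *\<^sub>R g (b + c *\<^sub>R x)) \<bullet> v) = (\<lambda>x. (k * c) * (\<lambda>x. g x \<bullet> v) (b + c *\<^sub>R x))" for v
    by (simp add: fun_eq_iff)
  ultimately have "\<forall>v. \<exists>k' f'. smooth f' \<and> (\<lambda>x. (k *\<^sub>R c *\<^sub>R g (b + c *\<^sub>R x)) \<bullet> v) = (\<lambda>x. k' * f' (b + c *\<^sub>R x))"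
    using g(2) by blast
  moreover note h = \<open>C1 h (\<lambda>x. k *\<^sub>R c *\<^sub>R g (b + c *\<^sub>R x))\<close>
  ultimately show "continuous_on UNIV h \<and> (\<exists>g. (\<forall>x. GDERIV h x :> g x) \<and>
      (\<forall>v. \<exists>k f. smooth f \<and> (\<lambda>x. g x \<bullet> v) = (\<lambda>x. k * f (b + c *\<^sub>R x))))"
    using C1_continuous[OF h] h unfolding C1_def
    by (intro conjI exI[of _ "\<lambda>x. k *\<^sub>R c *\<^sub>R g (b + c *\<^sub>R x)"]) auto
qed

lemma smooth_conv:
  fixes f \<rho> :: "'a::euclidean_space \<Rightarrow> real"
  assumes f: "integrable lborel f" and \<rho>: "smooth \<rho>" and K: "compact K" "\<And>x. x \<notin> K \<Longrightarrow> \<rho> x = 0"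
  shows "smooth (conv f \<rho>)"
proof (rule smooth_coinduct[where P = "\<lambda>h. \<exists>\<rho>. smooth \<rho> \<and> (\<forall>x. x \<notin> K \<longrightarrow> \<rho> x = 0) \<and> h = conv f \<rho>"])
  show "\<exists>\<rho>'. smooth \<rho>' \<and> (\<forall>x. x \<notin> K \<longrightarrow> \<rho>' x = 0) \<and> conv f \<rho> = conv f \<rho>'" using assms by blast
  fix h assume "\<exists>\<rho>. smooth \<rho> \<and> (\<forall>x. x \<notin> K \<longrightarrow> \<rho> x = 0) \<and> h = conv f \<rho>"
  then obtain \<rho> where \<rho>: "smooth \<rho>" "\<And>x. x \<notin> K \<Longrightarrow> \<rho> x = 0" "h = conv f \<rho>" by blast
  from smoothD[OF \<rho>(1)] obtain g where g: "C1 \<rho> g" "\<And>v. smooth (\<lambda>x. g x \<bullet> v)" by blast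
  have g0: "\<And>x. x \<notin> K \<Longrightarrow> g x = 0" using C1_support[OF g(1) K(1) \<rho>(2)] by blast
  obtain M where M: "\<And>x. norm (g x) \<le> M"
    using bounded_compact_support[of g K] K(1) g0 g(1) unfolding C1_def by metis
  have "C1 h (conv f g)" using C1_conv[OF f g(1) K(1) \<rho>(2)] by (simp add: \<rho>(3))
  moreover have "(\<lambda>x. conv f g x \<bullet> v) = conv f (\<lambda>x. g x \<bullet> v)" for v
    using conv_inner[OF f C1_measurable(2)[OF g(1)] M] by (simp add: fun_eq_iff)
  moreover have "\<forall>x. x \<notin> K \<longrightarrow> g x \<bullet> v = 0" for v using g0 by simp
  ultimately show "continuous_on UNIV h \<and> (\<exists>g. (\<forall>x. GDERIV h x :> g x) \<and>
      (\<forall>v. \<exists>\<rho>. smooth \<rho> \<and> (\<forall>x. x \<notin> K \<longrightarrow> \<rho> x = 0) \<and> (\<lambda>x. g x \<bullet> v) = conv f \<rho>))"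
    using g(2) C1_continuous C1_def by blast
qed

lemma test_functionD:
  assumes "test_function \<Omega> \<psi>"
  shows "smooth \<psi>" "C1c \<Omega> \<psi> (grad \<psi>)"
proof -
  show 1: "smooth \<psi>" using assms by (simp add: test_function_def)
  then obtain g where g: "C1 \<psi> g" by (metis smoothD)
  then have "grad \<psi> = g" by (rule C1_grad)
  then show "C1c \<Omega> \<psi> (grad \<psi>)"
    unfolding C1c_def using assms g closure_subset[of "{x. \<psi> x \<noteq> 0}"]
    by (auto simp: test_function_def intro!: exI[of _ "closure {x. \<psi> x \<noteq> 0}"])
qed

lemma test_functionI:
  assumes "smooth \<psi>" "compact K" "K \<subseteq> \<Omega>" "\<And>x. x \<notin> K \<Longrightarrow> \<psi> x = 0"
  shows "test_function \<Omega> \<psi>"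
proof -
  have "closure {x. \<psi> x \<noteq> 0} \<subseteq> K"
    using assms by (intro closure_minimal) (auto intro: compact_imp_closed)
  moreover from this have "compact (closure {x. \<psi> x \<noteq> 0})"
    using assms(2) by (metis Int_absorb1 closed_closure compact_Int_closed)
  ultimately show ?thesis unfolding test_function_def using assms by blast
qed

text \<open>Rescalings of the square of a nonzero test function, normalized to integral 1.\<close>

lemma approximate_identity:
  fixes \<rho>0 :: "'a::euclidean_space \<Rightarrow> real"
  assumes "test_function U \<rho>0" and "\<rho>0 z \<noteq> 0"
  obtains \<rho> :: "nat \<Rightarrow> 'a \<Rightarrow> real" where
    "\<And>k. smooth (\<rho> k)" "\<And>k x. \<rho> k x \<ge> 0" "\<And>k. integrable lborel (\<rho> k)"
    "\<And>k. (\<integral>x. \<rho> k x \<partial>lborel) = 1" "\<And>k x. norm x > 1 / real (Suc k) \<Longrightarrow> \<rho> k x = 0"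
proof -
  define \<sigma> where "\<sigma> x = (\<rho>0 x)\<^sup>2" for x
  have sm: "smooth \<sigma>"
    using smooth_mult[of \<rho>0 \<rho>0] test_functionD(1)[OF assms(1)] by (simp add: \<sigma>_def[abs_def] power2_eq_square)
  obtain K where K: "compact K" "\<And>x. x \<notin> K \<Longrightarrow> \<rho>0 x = 0"
    using C1c_support[OF test_functionD(2)[OF assms(1)]] by metis
  have K\<sigma>: "\<And>x. x \<notin> K \<Longrightarrow> \<sigma> x = 0" using K by (simp add: \<sigma>_def)
  note cont = smooth_continuous[OF sm]
  have int: "integrable lborel \<sigma>" by (rule integrable_compact_support[OF cont K(1) K\<sigma>])
  have \<sigma>m [measurable]: "\<sigma> \<in> borel_measurable borel" using cont by (rule borel_measurable_continuous_onI)
  obtain R where R: "R > 0" "\<And>x. x \<in> K \<Longrightarrow> norm x \<le> R"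
    using compact_imp_bounded[OF K(1)] unfolding bounded_pos by auto
  define I where "I = (\<integral>x. \<sigma> x \<partial>lborel)"
  have "I \<noteq> 0"
  proof
    assume "I = 0"
    then have "AE x in lborel. \<sigma> x = 0"
      unfolding I_def using int by (subst (asm) integral_nonneg_eq_0_iff_AE) (auto simp: \<sigma>_def)
    then have "AE x \<in> UNIV in lebesgue. x \<in> {x. \<sigma> x = 0}"
      by (simp add: AE_completion)
    moreover have "closed {x. \<sigma> x = 0}" by (rule closed_Collect_eq[OF cont continuous_on_const])
    ultimately have "z \<in> {x. \<sigma> x = 0}" by (intro mem_closed_if_AE_lebesgue) auto
    then show False using assms(2) by (simp add: \<sigma>_def)
  qed
  moreover have "I \<ge> 0" unfolding I_def by (simp add: \<sigma>_def)
  ultimately have I: "I > 0" by simp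
  define c where "c k = R * real (Suc k)" for k
  have c: "c k > 0" for k using R by (simp add: c_def)
  define \<rho> where "\<rho> k x = (c k ^ DIM('a) / I) * \<sigma> (0 + c k *\<^sub>R x)" for k x
  have "smooth (\<rho> k)" for k unfolding \<rho>_def[abs_def] by (rule smooth_affine[OF sm])
  moreover have "\<rho> k x \<ge> 0" for k x using I c[of k] by (simp add: \<rho>_def \<sigma>_def)
  moreover have "\<rho> k x = 0" if "norm x > 1 / real (Suc k)" for k x
  proof -
    have "norm (c k *\<^sub>R x) = R * (real (Suc k) * norm x)"
      using R unfolding c_def norm_scaleR by (simp add: abs_mult)
    moreover have "real (Suc k) * norm x > 1" using that by (simp add: divide_less_eq mult.commute)
    ultimately have "norm (c k *\<^sub>R x) > R" using R(1) by (simp del: norm_scaleR)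
    then show ?thesis using R(2) K\<sigma> by (force simp: \<rho>_def)
  qed
  moreover from this have "integrable lborel (\<rho> k)" for k
    using smooth_continuous[OF \<open>smooth (\<rho> k)\<close>]
    by (intro integrable_compact_support[of _ "cball 0 (1 / real (Suc k))"]) auto
  moreover have "(\<integral>x. \<rho> k x \<partial>lborel) = 1" for k
  proof -
    have "I = c k ^ DIM('a) * (\<integral>x. \<sigma> (0 + c k *\<^sub>R x) \<partial>lborel)"
      using lborel_integral_affine[OF \<sigma>m, of "c k" 0] c[of k] unfolding I_def by simp
    then have "(\<integral>x. \<rho> k x \<partial>lborel) = I / I" unfolding \<rho>_def by simp
    then show ?thesis using I by simp
  qed
  ultimately show ?thesis using that by metis
qed

lemma conv_approx:
  fixes f :: "'a::euclidean_space \<Rightarrow> 'b::euclidean_space"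
  assumes \<rho>: "\<And>x. \<rho> x \<ge> 0" "integrable lborel \<rho>" "(\<integral>x. \<rho> x \<partial>lborel) = 1" "\<And>x. norm x > \<delta> \<Longrightarrow> \<rho> x = 0"
    and f: "f \<in> borel_measurable borel" "\<And>x. norm (f x) \<le> M"
    and osc: "\<And>x y. norm (x - y) \<le> \<delta> \<Longrightarrow> norm (f x - f y) \<le> e"
  shows "norm (conv \<rho> f x - f x) \<le> e"
proof -
  note int = conv_integrable[OF \<rho>(2) f]
  have "conv \<rho> f x - f x = (\<integral>y. \<rho> y *\<^sub>R f (x - y) - \<rho> y *\<^sub>R f x \<partial>lborel)"
    unfolding conv_def using int \<rho> by simp
  also have "norm \<dots> \<le> (\<integral>y. norm (\<rho> y *\<^sub>R f (x - y) - \<rho> y *\<^sub>R f x) \<partial>lborel)"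
    by (rule integral_norm_bound)
  also have "\<dots> \<le> (\<integral>y. \<rho> y * e \<partial>lborel)"
  proof (rule integral_mono)
    show "norm (\<rho> y *\<^sub>R f (x - y) - \<rho> y *\<^sub>R f x) \<le> \<rho> y * e" for y
    proof (cases "norm y > \<delta>")
      case False
      then have "norm (f (x - y) - f x) \<le> e" by (intro osc) simp
      then show ?thesis using \<rho>(1)[of y]
        by (simp only: scaleR_diff_right[symmetric] norm_scaleR) (intro mult_mono, auto)
    qed (simp add: \<rho>(4))
  qed (use int \<rho> in auto)
  also have "\<dots> = e" using \<rho> by simp
  finally show ?thesis .
qed

lemma compact_neighbourhood:
  fixes K :: "'a::euclidean_space set"
  assumes "compact K" "open U" "K \<subseteq> U"
  obtains \<delta> K' where "\<delta> > 0" "compact K'" "K' \<subseteq> U" "\<And>x y. x \<in> K \<Longrightarrow> norm (y - x) \<le> \<delta> \<Longrightarrow> y \<in> K'"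
proof -
  obtain \<delta> where \<delta>: "\<delta> > 0" "\<And>x. x \<in> K \<Longrightarrow> ball x \<delta> \<subseteq> U"
    using compact_subset_open_imp_ball_epsilon_subset[OF assms]
    by (metis UN_subset_iff)
  define K' where "K' = {x + y | x y. x \<in> K \<and> y \<in> cball 0 (\<delta>/2)}"
  have "compact K'" unfolding K'_def using assms(1) by (intro compact_sums) auto
  moreover have "K' \<subseteq> U" unfolding K'_def using \<delta> by (force simp: dist_norm subset_iff)
  moreover have "y \<in> K'" if "x \<in> K" "norm (y - x) \<le> \<delta>/2" for x y
    unfolding K'_def using that by (intro CollectI exI[of _ x] exI[of _ "y - x"]) auto
  ultimately show ?thesis using that[of "\<delta>/2" K'] \<delta>(1) by auto
qed

text \<open>Convolution with a kernel of small support enlarges the support only slightly, and the gradient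
  of the convolution is the convolution of the gradient.\<close>

lemma mollify:
  fixes f \<rho>0 :: "'a::euclidean_space \<Rightarrow> real"
  assumes \<rho>0: "test_function U \<rho>0" "\<rho>0 z \<noteq> 0"
    and f: "continuous_on UNIV f" and K: "compact K" "K \<subseteq> \<Omega>" "\<And>x. x \<notin> K \<Longrightarrow> f x = 0" and \<Omega>: "open \<Omega>"
  shows "\<exists>(\<psi> :: nat \<Rightarrow> 'a \<Rightarrow> real) K'. (\<forall>k. test_function \<Omega> (\<psi> k)) \<and> compact K' \<and> K' \<subseteq> \<Omega> \<and>
    (\<forall>k x. x \<notin> K' \<longrightarrow> \<psi> k x = 0) \<and> (\<forall>e>0. \<forall>\<^sub>F k in sequentially. \<forall>x. \<bar>\<psi> k x - f x\<bar> \<le> e) \<and>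
    (\<forall>e>0. \<forall>d. C1 f d \<longrightarrow> (\<forall>\<^sub>F k in sequentially. \<forall>x. norm (grad (\<psi> k) x - d x) \<le> e))"
proof -
  obtain \<rho> :: "nat \<Rightarrow> 'a \<Rightarrow> real" where \<rho>:
    "\<And>k. smooth (\<rho> k)" "\<And>k x. \<rho> k x \<ge> 0" "\<And>k. integrable lborel (\<rho> k)"
    "\<And>k. (\<integral>x. \<rho> k x \<partial>lborel) = 1" "\<And>k x. norm x > 1 / real (Suc k) \<Longrightarrow> \<rho> k x = 0"
    by (rule approximate_identity[OF \<rho>0]) blast
  obtain \<delta> K' where \<delta>: "\<delta> > 0" "compact K'" "K' \<subseteq> \<Omega>" "\<And>x y. x \<in> K \<Longrightarrow> norm (y - x) \<le> \<delta> \<Longrightarrow> y \<in> K'"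
    using compact_neighbourhood[OF K(1) \<Omega> K(2)] by metis
  have small: "\<forall>\<^sub>F k in sequentially. 1 / real (Suc k) < d" if "d > 0" for d :: real
    using LIMSEQ_inverse_real_of_nat that by (auto simp: inverse_eq_divide order_tendsto_iff)
  obtain N where N: "\<And>k. k \<ge> N \<Longrightarrow> 1 / real (Suc k) < \<delta>"
    using small[OF \<delta>(1)] unfolding eventually_sequentially by auto
  define \<psi> where "\<psi> k = conv (\<rho> (k + N)) f" for k
  have fm: "f \<in> borel_measurable borel" using f by (rule borel_measurable_continuous_onI)
  have \<rho>m: "\<rho> k \<in> borel_measurable borel" for k using \<rho>(3) borel_measurable_integrable by force
  have fint: "integrable lborel f" by (rule integrable_compact_support[OF f K(1,3)])
  have "smooth (\<psi> k)" for k
  proof -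
    have "\<psi> k = conv f (\<rho> (k + N))" unfolding \<psi>_def using conv_commute[OF \<rho>m fm] by blast
    moreover have "smooth (conv f (\<rho> (k + N)))"
      by (rule smooth_conv[OF fint \<rho>(1), of "cball 0 (1 / real (Suc (k + N)))"]) (auto simp: \<rho>(5))
    ultimately show ?thesis by simp
  qed
  moreover have supp: "\<psi> k x = 0" if "x \<notin> K'" for k x
  proof -
    have "\<rho> (k + N) y *\<^sub>R f (x - y) = 0" for y
    proof (cases "norm y > 1 / real (Suc (k + N))")
      case False
      then have "norm y \<le> \<delta>" using N[of "k + N"] by simp
      then have "x - y \<notin> K" using \<delta>(4)[of "x - y" x] that by auto
      then show ?thesis using K(3) by simp
    qed (simp add: \<rho>(5))
    then show ?thesis unfolding \<psi>_def conv_def by (simp only: integral_zero)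
  qed
  ultimately have "test_function \<Omega> (\<psi> k)" for k using \<delta>(2,3) test_functionI by blast
  have unif: "\<forall>\<^sub>F k in sequentially. \<forall>x. norm (conv (\<rho> (k + N)) g x - g x) \<le> e"
    if e: "e > 0" and g: "continuous_on UNIV g" and Kg: "\<And>x. x \<notin> K \<Longrightarrow> g x = 0" for g :: "'a \<Rightarrow> 'c::euclidean_space" and e
  proof -
    obtain \<eta> where \<eta>: "\<eta> > 0" "\<And>x y. norm (x - y) < \<eta> \<Longrightarrow> norm (g x - g y) < e"
      using uniform_compact_support[OF g K(1) Kg e] by metis
    obtain M where M: "\<And>x. norm (g x) \<le> M" using bounded_compact_support[OF g K(1) Kg] by metis
    have gm: "g \<in> borel_measurable borel" using g by (rule borel_measurable_continuous_onI)
    have "\<forall>\<^sub>F k in sequentially. 1 / real (Suc (k + N)) < \<eta>"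
      using small[OF \<eta>(1)] by (simp only: sequentially_offset eventually_sequentially_seg[of "\<lambda>k. 1 / real (Suc k) < \<eta>"])
    then show ?thesis
    proof eventually_elim
      case (elim k)
      have "norm (conv (\<rho> (k + N)) g x - g x) \<le> e" for x
        by (rule conv_approx[OF \<rho>(2,3,4,5) gm M]) (use \<eta>(2) elim in \<open>auto intro!: less_imp_le\<close>)
      then show ?case by blast
    qed
  qed
  have "\<forall>\<^sub>F k in sequentially. \<forall>x. \<bar>\<psi> k x - f x\<bar> \<le> e" if "e > 0" for e
    using unif[OF that f K(3)] by (simp add: \<psi>_def)
  moreover have "\<forall>\<^sub>F k in sequentially. \<forall>x. norm (grad (\<psi> k) x - d x) \<le> e" if e: "e > 0" and d: "C1 f d" for e d
  proof -
    have "grad (\<psi> k) = conv (\<rho> (k + N)) d" for k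
      unfolding \<psi>_def using C1_conv[OF \<rho>(3) d K(1,3)] by (rule C1_grad)
    moreover have "\<And>x. x \<notin> K \<Longrightarrow> d x = 0" using C1_support[OF d K(1,3)] by blast
    ultimately show ?thesis using unif[OF e, of d] d by (auto simp: C1_def)
  qed
  ultimately show ?thesis using \<open>\<And>k. test_function \<Omega> (\<psi> k)\<close> \<delta>(2,3) supp
    by (intro exI[of _ \<psi>] exI[of _ K']) blast
qed

section \<open>Integration by parts and uniqueness of weak gradients\<close>

text \<open>The convolution with the indicator of a large ball is constant near the origin, and its
  gradient there is the integral of \<open>d\<close>.\<close>

lemma integral_C1c_grad_zero:
  fixes f :: "'a::euclidean_space \<Rightarrow> real"
  assumes "C1c \<Omega> f d" shows "(\<integral>x. d x \<partial>lborel) = 0"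
proof -
  obtain K where K: "compact K" "\<And>x. x \<notin> K \<Longrightarrow> f x = 0" "\<And>x. x \<notin> K \<Longrightarrow> d x = 0"
    using C1c_support[OF assms] by metis
  have f: "C1 f d" using assms by (rule C1c_C1)
  obtain R where R: "\<And>x. x \<in> K \<Longrightarrow> norm x \<le> R" using compact_imp_bounded[OF K(1)] unfolding bounded_iff by blast
  define \<rho> where "\<rho> y = (indicator (cball 0 (R + 1)) y :: real)" for y :: 'a
  have \<rho>: "integrable lborel \<rho>" unfolding \<rho>_def[abs_def]
    using emeasure_bounded_finite[of "cball 0 (R + 1)"] by (intro integrable_real_indicator) auto
  have full: "\<rho> y *\<^sub>R h (x - y) = h (x - y)" if "\<And>x. x \<notin> K \<Longrightarrow> h x = 0" "x \<in> ball 0 1" for x y and h :: "'a \<Rightarrow> 'b::euclidean_space"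
  proof (cases "x - y \<in> K")
    case True
    have "norm y \<le> norm x + norm (x - y)" using norm_triangle_ineq4[of x "x - y"] by simp
    then show ?thesis using R[OF True] that(2) by (simp add: \<rho>_def)
  qed (simp add: that)
  have refl: "(\<integral>y. h (x - y) \<partial>lborel) = (\<integral>y. h y \<partial>lborel)" if "h \<in> borel_measurable borel" for x and h :: "'a \<Rightarrow> 'b::euclidean_space"
    using lborel_integral_affine[OF that, of "-1" x] by simp
  have g0: "GDERIV (conv \<rho> f) 0 :> conv \<rho> d 0" by (rule GDERIV_conv[OF \<rho> f K(1,2)])
  have near: "conv \<rho> f x = (\<integral>y. f y \<partial>lborel)" if "x \<in> ball 0 1" for x
  proof -
    have "(\<lambda>y. \<rho> y *\<^sub>R f (x - y)) = (\<lambda>y. f (x - y))" by (rule ext, rule full) (use K(2) that in auto)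
    then show ?thesis unfolding conv_def using refl[OF C1_measurable(1)[OF f], of x] by (simp only:)
  qed
  have d0: "conv \<rho> d 0 = (\<integral>y. d y \<partial>lborel)"
  proof -
    have "(\<lambda>y. \<rho> y *\<^sub>R d (0 - y)) = (\<lambda>y. d (0 - y))" by (rule ext, rule full) (use K(3) in auto)
    then show ?thesis unfolding conv_def using refl[OF C1_measurable(2)[OF f], of 0] by (simp only:)
  qed
  have "GDERIV (\<lambda>x. \<integral>y. f y \<partial>lborel) 0 :> (\<integral>y. d y \<partial>lborel)"
    by (rule GDERIV_cong_open[OF g0[unfolded d0] open_ball[of 0 1] _ near]) auto
  then show ?thesis by (rule gderiv_unique) (rule GDERIV_const)
qed

lemma integration_by_parts:
  assumes f: "C1c \<Omega> f d" and g: "C1 g e"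
  shows "(\<integral>x. f x *\<^sub>R e x \<partial>lborel) = - (\<integral>x. g x *\<^sub>R d x \<partial>lborel)"
proof -
  obtain K where K: "compact K" "K \<subseteq> \<Omega>" "\<And>x. x \<notin> K \<Longrightarrow> f x = 0" "\<And>x. x \<notin> K \<Longrightarrow> d x = 0"
    using C1c_support[OF f] by metis
  have "C1 (\<lambda>x. f x * g x) (\<lambda>x. f x *\<^sub>R e x + g x *\<^sub>R d x)" by (rule C1_mult[OF C1c_C1[OF f] g])
  then have "C1c \<Omega> (\<lambda>x. f x * g x) (\<lambda>x. f x *\<^sub>R e x + g x *\<^sub>R d x)"
    unfolding C1c_def using K by auto
  from integral_C1c_grad_zero[OF this] have "(\<integral>x. f x *\<^sub>R e x + g x *\<^sub>R d x \<partial>lborel) = 0" .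
  moreover have "integrable lborel (\<lambda>x. f x *\<^sub>R e x)" "integrable lborel (\<lambda>x. g x *\<^sub>R d x)"
    using K C1_continuous[OF C1c_C1[OF f]] C1_continuous[OF g] C1c_C1[OF f] g
    by (auto intro!: integrable_compact_support[of _ K] continuous_intros simp: C1_def)
  ultimately show ?thesis by (simp add: add_eq_0_iff2)
qed

lemma integrable_test_mult:
  fixes f g :: "'a::euclidean_space \<Rightarrow> real"
  assumes f: "continuous_on UNIV f" "\<And>x. x \<notin> K \<Longrightarrow> f x = 0" and K: "compact K"
    and g: "integrable lborel (\<lambda>x. indicator K x * g x)"
  shows "integrable lborel (\<lambda>x. f x * g x)"
proof -
  obtain M where M: "\<And>x. norm (f x) \<le> M" using bounded_compact_support[OF f(1) K f(2)] by metis
  have [measurable]: "f \<in> borel_measurable borel" using f(1) by (rule borel_measurable_continuous_onI)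
  have "integrable lborel (\<lambda>x. f x * (indicator K x * g x))"
  proof (rule Bochner_Integration.integrable_bound)
    show "integrable lborel (\<lambda>x. M * (indicator K x * g x))" using g by simp
    show "(\<lambda>x. f x * (indicator K x * g x)) \<in> borel_measurable lborel"
      using borel_measurable_integrable[OF g] by measurable
    have "norm (f x * (indicator K x * g x)) \<le> norm (M * (indicator K x * g x))" for x
      unfolding norm_mult using M[of x] by (intro mult_right_mono) auto
    then show "AE x in lborel. norm (f x * (indicator K x * g x)) \<le> norm (M * (indicator K x * g x))" by simp
  qed
  moreover have "(\<lambda>x. f x * (indicator K x * g x)) = (\<lambda>x. f x * g x)"
    using f(2) by (auto simp: indicator_def fun_eq_iff)
  ultimately show ?thesis by simp
qed

lemma integral_continuous_zero_of_test:
  fixes f g \<rho>0 :: "'a::euclidean_space \<Rightarrow> real"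
  assumes \<rho>0: "test_function U \<rho>0" "\<rho>0 z \<noteq> 0" and \<Omega>: "open \<Omega>"
    and g: "\<And>K. compact K \<Longrightarrow> K \<subseteq> \<Omega> \<Longrightarrow> integrable lborel (\<lambda>x. indicator K x * g x)"
    and zero: "\<And>\<psi>. test_function \<Omega> \<psi> \<Longrightarrow> (\<integral>x. \<psi> x * g x \<partial>lborel) = 0"
    and f: "continuous_on UNIV f" and K: "compact K" "K \<subseteq> \<Omega>" "\<And>x. x \<notin> K \<Longrightarrow> f x = 0"
  shows "(\<integral>x. f x * g x \<partial>lborel) = 0"
proof -
  from mollify[OF \<rho>0 f K \<Omega>] obtain \<psi> :: "nat \<Rightarrow> 'a \<Rightarrow> real" and K' where \<psi>': "\<forall>k. test_function \<Omega> (\<psi> k)" "compact K'" "K' \<subseteq> \<Omega>"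
    "\<forall>k x. x \<notin> K' \<longrightarrow> \<psi> k x = 0" "\<forall>e>0. \<forall>\<^sub>F k in sequentially. \<forall>x. \<bar>\<psi> k x - f x\<bar> \<le> e"
    by auto
  note \<psi> = \<psi>'(1)[rule_format] \<psi>'(2,3) \<psi>'(4)[rule_format]
  define L where "L = K \<union> K'"
  have L: "compact L" "L \<subseteq> \<Omega>" using K \<psi> by (auto simp: L_def)
  note gL = g[OF L]
  define I where "I = (\<integral>x. indicator L x * \<bar>g x\<bar> \<partial>lborel)"
  have gL': "integrable lborel (\<lambda>x. indicator L x * \<bar>g x\<bar>)"
    using integrable_abs[OF gL] by (simp add: abs_mult)
  have "\<bar>\<integral>x. f x * g x \<partial>lborel\<bar> \<le> e * I" if e: "e > 0" for e
  proof -
    obtain k where k: "\<And>x. \<bar>\<psi> k x - f x\<bar> \<le> e"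
      using eventually_happens'[OF sequentially_bot \<psi>'(5)[rule_format, OF e]] by auto
    have c: "continuous_on UNIV (\<psi> k)" by (rule smooth_continuous[OF test_functionD(1)[OF \<psi>(1)]])
    have i1: "integrable lborel (\<lambda>x. f x * g x)" using K by (intro integrable_test_mult[OF f _ L(1) gL]) (auto simp: L_def)
    have i2: "integrable lborel (\<lambda>x. \<psi> k x * g x)" using \<psi>(4) by (intro integrable_test_mult[OF c _ L(1) gL]) (auto simp: L_def)
    have pt: "\<bar>f x * g x - \<psi> k x * g x\<bar> \<le> e * (indicator L x * \<bar>g x\<bar>)" for x
    proof (cases "x \<in> L")
      case True
      have "\<bar>f x * g x - \<psi> k x * g x\<bar> = \<bar>\<psi> k x - f x\<bar> * \<bar>g x\<bar>"
        by (simp only: abs_mult[symmetric]) (simp add: algebra_simps abs_minus_commute)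
      also have "\<dots> \<le> e * \<bar>g x\<bar>" using k[of x] by (intro mult_right_mono) auto
      finally show ?thesis using True by simp
    qed (use K \<psi>(4) in \<open>auto simp: L_def\<close>)
    have "(\<integral>x. f x * g x \<partial>lborel) = (\<integral>x. f x * g x - \<psi> k x * g x \<partial>lborel)"
      using i1 i2 zero[OF \<psi>(1)] by simp
    also have "\<bar>\<dots>\<bar> \<le> (\<integral>x. e * (indicator L x * \<bar>g x\<bar>) \<partial>lborel)"
      using i1 i2 gL' pt by (intro order_trans[OF integral_abs_bound] integral_mono) auto
    finally show ?thesis by (simp add: I_def)
  qed
  note bd = this
  have "I \<ge> 0" unfolding I_def by (intro integral_nonneg_AE) auto
  have "\<bar>\<integral>x. f x * g x \<partial>lborel\<bar> \<le> 0 + e" if "e > 0" for e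
  proof -
    have "\<bar>\<integral>x. f x * g x \<partial>lborel\<bar> \<le> e / (I + 1) * I" using that \<open>I \<ge> 0\<close> by (intro bd) auto
    also have "\<dots> \<le> e" using that \<open>I \<ge> 0\<close> by (simp add: field_simps)
    finally show ?thesis by simp
  qed
  then show ?thesis using field_le_epsilon by (metis abs_le_zero_iff)
qed

text \<open>The fundamental lemma of the calculus of variations. Orthogonality to test functions passes to
  continuous functions of compact support, then to indicators of compact sets; inner regularity
  of Lebesgue measure shows that the sets where \<open>g\<close> has a strict sign are null.\<close>

lemma fundamental_lemma:
  fixes g \<rho>0 :: "'a::euclidean_space \<Rightarrow> real"
  assumes \<rho>0: "test_function U \<rho>0" "\<rho>0 z \<noteq> 0" and \<Omega>: "open \<Omega>" and gm [measurable]: "g \<in> borel_measurable borel"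
    and g: "\<And>K. compact K \<Longrightarrow> K \<subseteq> \<Omega> \<Longrightarrow> integrable lborel (\<lambda>x. indicator K x * g x)"
    and zero: "\<And>\<psi>. test_function \<Omega> \<psi> \<Longrightarrow> (\<integral>x. \<psi> x * g x \<partial>lborel) = 0"
  shows "AE x in lborel. x \<in> \<Omega> \<longrightarrow> g x = 0"
proof -
  have comp: "(\<integral>x. indicator K x * g x \<partial>lborel) = 0" if K: "compact K" "K \<subseteq> \<Omega>" for K
  proof (cases "K = {}")
    case False
    obtain \<delta> K' where \<delta>: "\<delta> > 0" "compact K'" "K' \<subseteq> \<Omega>" "\<And>x y. x \<in> K \<Longrightarrow> norm (y - x) \<le> \<delta> \<Longrightarrow> y \<in> K'"
      using compact_neighbourhood[OF K(1) \<Omega> K(2)] by metis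
    define f where "f j x = max 0 (1 - real j * infdist x K / \<delta>)" for j :: nat and x
    have "continuous_on UNIV (f j)" for j unfolding f_def[abs_def]
      using \<delta>(1) by (intro continuous_intros) auto
    have supp: "f j x = 0" if "x \<notin> K'" "j \<ge> 1" for j x
    proof -
      obtain y where "y \<in> K" "infdist x K = dist x y"
        using infdist_attains_inf[OF compact_imp_closed[OF K(1)] False] by metis
      then have "infdist x K > \<delta>" using \<delta>(4)[of y x] that by (force simp: dist_norm)
      moreover have "1 * infdist x K \<le> real j * infdist x K" using that by (intro mult_right_mono) (auto intro: infdist_nonneg)
      ultimately have "real j * infdist x K > \<delta>" by linarith
      then show ?thesis using \<delta>(1) by (simp add: f_def field_simps)
    qed
    have 0: "(\<integral>x. f (Suc j) x * g x \<partial>lborel) = 0" for j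
      by (rule integral_continuous_zero_of_test[OF \<rho>0 \<Omega> g zero \<open>continuous_on UNIV (f (Suc j))\<close> \<delta>(2,3)])
         (use supp in auto)
    have "(\<lambda>j. \<integral>x. f (Suc j) x * g x \<partial>lborel) \<longlonglongrightarrow> (\<integral>x. indicator K x * g x \<partial>lborel)"
    proof (rule integral_dominated_convergence[where w = "\<lambda>x. \<bar>indicator K' x * g x\<bar>"])
      show "integrable lborel (\<lambda>x. \<bar>indicator K' x * g x\<bar>)" using g[OF \<delta>(2,3)] by (rule integrable_abs)
      show "(\<lambda>x. f (Suc j) x * g x) \<in> borel_measurable lborel" for j
        using borel_measurable_continuous_onI[OF \<open>continuous_on UNIV (f (Suc j))\<close>] by simp
      show "(\<lambda>x. indicator K x * g x) \<in> borel_measurable lborel" using borel_compact[OF K(1)] by measurable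
      show "AE x in lborel. norm (f (Suc j) x * g x) \<le> \<bar>indicator K' x * g x\<bar>" for j
      proof (rule AE_I2)
        fix x :: 'a
        have "f (Suc j) x \<le> 1" "f (Suc j) x \<ge> 0" using \<delta>(1) by (auto simp: f_def infdist_nonneg)
        then show "norm (f (Suc j) x * g x) \<le> \<bar>indicator K' x * g x\<bar>"
          using supp[of x "Suc j"] by (auto simp: abs_mult mult_left_le_one_le indicator_def)
      qed
      have "(\<lambda>j. f (Suc j) x) \<longlonglongrightarrow> indicator K x" for x
      proof (cases "x \<in> K")
        case True
        then show ?thesis by (simp add: f_def)
      next
        case nK: False
        then have d: "infdist x K > 0" using K(1) False
          by (metis compact_imp_closed in_closed_iff_infdist_zero infdist_nonneg less_eq_real_def)
        obtain N where N: "real N > \<delta> / infdist x K" using reals_Archimedean2 by blast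
        have "f (Suc j) x = 0" if "j \<ge> N" for j
        proof -
          have "real N * infdist x K \<le> real (Suc j) * infdist x K" using that d by (intro mult_right_mono) auto
          moreover have "\<delta> < real N * infdist x K" using N d by (simp add: field_simps)
          ultimately have "real (Suc j) * infdist x K > \<delta>" by linarith
          then show ?thesis using \<delta>(1) by (simp only: f_def) (simp add: less_divide_eq max_def del: of_nat_Suc)
        qed
        then have "\<forall>\<^sub>F j in sequentially. f (Suc j) x = 0" by (auto simp: eventually_sequentially)
        then show ?thesis using nK by (simp add: tendsto_eventually)
      qed
      then show "AE x in lborel. (\<lambda>j. f (Suc j) x * g x) \<longlonglongrightarrow> indicator K x * g x"
        by (intro AE_I2 tendsto_intros)
    qed
    then show ?thesis using 0 by (simp add: LIMSEQ_const_iff)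
  qed simp
  have null: "E \<in> null_sets lborel"
    if E: "E \<in> sets borel" "E \<subseteq> \<Omega>" and s: "\<And>x. x \<in> E \<Longrightarrow> s * g x > 0" for E and s :: real
  proof -
    have "emeasure lborel E \<le> 0 + ennreal e" if e: "e > 0" for e
    proof -
      obtain T where T: "closed T" "T \<subseteq> E" "emeasure lebesgue (E - T) < ennreal e"
      proof -
        have "E \<in> sets lebesgue" using E(1) by simp
        then show ?thesis by (rule sets_lebesgue_inner_closed[OF _ e]) (rule that)
      qed
      have Tm: "T \<in> sets borel" using T(1) by simp
      have "T \<inter> cball 0 (real n) \<in> null_sets lborel" for n
      proof -
        define K where "K = T \<inter> cball 0 (real n)"
        have K: "compact K" "K \<subseteq> \<Omega>" using T E by (auto simp: K_def closed_Int_compact)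
        have Km [measurable]: "K \<in> sets borel" using K(1) by (rule borel_compact)
        have "integrable lborel (\<lambda>x. indicator K x * (s * g x))"
          using integrable_mult_right[OF g[OF K], of s] by (simp add: mult.left_commute)
        moreover have "(\<integral>x. indicator K x * (s * g x) \<partial>lborel) = 0"
        proof -
          have "(\<lambda>x. indicator K x * (s * g x)) = (\<lambda>x. s * (indicator K x * g x))" by (simp add: fun_eq_iff)
          then show ?thesis using comp[OF K] by simp
        qed
        moreover have "0 \<le> indicator K x * (s * g x)" for x
          using s[of x] T(2) by (auto simp: K_def indicator_def intro: less_imp_le)
        ultimately have "AE x in lborel. indicator K x * (s * g x) = 0"
          by (simp add: integral_nonneg_eq_0_iff_AE)
        then have "AE x in lborel. x \<notin> K"
        proof eventually_elim
          case (elim x)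
          show ?case
          proof
            assume "x \<in> K"
            then show False using elim s[of x] T(2) by (auto simp: K_def)
          qed
        qed
        then show ?thesis using Km unfolding K_def[symmetric] by (simp add: AE_iff_null_sets)
      qed
      then have "(\<Union>n. T \<inter> cball 0 (real n)) \<in> null_sets lborel" by blast
      moreover have "(\<Union>n. T \<inter> cball 0 (real n)) = T" using real_arch_simple by auto
      ultimately have "emeasure lborel T = 0" by auto
      moreover have "emeasure lborel (E - T) < ennreal e"
        using T(3) E Tm by (simp add: emeasure_completion main_part_sets)
      moreover have "emeasure lborel E \<le> emeasure lborel (E - T) + emeasure lborel T"
        using emeasure_subadditive[of "E - T" lborel T] E Tm T(2) by (simp add: Un_absorb2)
      ultimately show ?thesis by simp
    qed
    then have "emeasure lborel E \<le> 0" by (rule ennreal_le_epsilon)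
    then show ?thesis using E(1) by (simp add: null_sets_def)
  qed
  have [measurable]: "\<Omega> \<in> sets borel" using \<Omega> by simp
  have "{x \<in> \<Omega>. g x > 0} \<in> null_sets lborel" "{x \<in> \<Omega>. g x < 0} \<in> null_sets lborel"
    using null[of "{x \<in> \<Omega>. g x > 0}" 1] null[of "{x \<in> \<Omega>. g x < 0}" "-1"] by simp_all
  then have "AE x in lborel. x \<notin> {x \<in> \<Omega>. g x > 0}" "AE x in lborel. x \<notin> {x \<in> \<Omega>. g x < 0}"
    by (blast intro: AE_not_in)+
  then show ?thesis by eventually_elim auto
qed

section \<open>Convergence in the mean of order p\<close>

text \<open>The \<open>p\<close>-th power of the Lebesgue norm, with values in \<open>ennreal\<close> so
  that it can be estimated before it is known to be finite.\<close>

definition mass :: "real \<Rightarrow> ('a::euclidean_space \<Rightarrow> 'b::real_normed_vector) \<Rightarrow> ennreal" where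
  "mass p f = (\<integral>\<^sup>+x. ennreal (norm (f x) powr p) \<partial>lborel)"

lemma mass_mono:
  assumes "0 < p" "\<And>x. norm (f x) \<le> norm (g x)" shows "mass p f \<le> mass p g"
  unfolding mass_def using assms by (intro nn_integral_mono ennreal_leI powr_mono2) auto

lemma mass_scale:
  assumes "0 < p" "0 \<le> c" "f \<in> borel_measurable borel" "\<And>x. norm (g x) \<le> c * norm (f x)"
  shows "mass p g \<le> ennreal (c powr p) * mass p f"
proof -
  have "mass p g \<le> (\<integral>\<^sup>+x. ennreal (c powr p) * ennreal (norm (f x) powr p) \<partial>lborel)"
    unfolding mass_def
  proof (rule nn_integral_mono)
    fix x
    have "norm (g x) powr p \<le> (c * norm (f x)) powr p" using assms by (intro powr_mono2) auto
    also have "\<dots> = c powr p * norm (f x) powr p" using assms by (simp add: powr_mult)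
    finally show "ennreal (norm (g x) powr p) \<le> ennreal (c powr p) * ennreal (norm (f x) powr p)"
      by (simp add: ennreal_mult'[symmetric] ennreal_leI)
  qed
  also have "\<dots> = ennreal (c powr p) * mass p f" unfolding mass_def
    using assms(3) by (subst nn_integral_cmult) auto
  finally show ?thesis .
qed

lemma powr_sum_bound:
  fixes a b :: real assumes "0 < p" "0 \<le> a" "0 \<le> b"
  shows "(a + b) powr p \<le> 2 powr p * (a powr p + b powr p)"
proof -
  have "(a + b) powr p \<le> (2 * max a b) powr p" using assms by (intro powr_mono2) auto
  also have "\<dots> = 2 powr p * max a b powr p" using assms by (simp add: powr_mult)
  also have "max a b powr p \<le> a powr p + b powr p" by (simp add: max_def)
  finally show ?thesis by simp
qed

lemma mass_add:
  assumes "0 < p" "f \<in> borel_measurable borel" "g \<in> borel_measurable borel" "\<And>x. norm (h x) \<le> norm (f x) + norm (g x)"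
  shows "mass p h \<le> ennreal (2 powr p) * (mass p f + mass p g)"
proof -
  have "mass p h \<le> (\<integral>\<^sup>+x. ennreal (2 powr p) * (ennreal (norm (f x) powr p) + ennreal (norm (g x) powr p)) \<partial>lborel)"
    unfolding mass_def
  proof (rule nn_integral_mono)
    fix x
    have "norm (h x) powr p \<le> (norm (f x) + norm (g x)) powr p" using assms by (intro powr_mono2) auto
    also have "\<dots> \<le> 2 powr p * (norm (f x) powr p + norm (g x) powr p)" using assms by (intro powr_sum_bound) auto
    finally show "ennreal (norm (h x) powr p) \<le> ennreal (2 powr p) * (ennreal (norm (f x) powr p) + ennreal (norm (g x) powr p))"
      by (simp add: ennreal_mult'[symmetric] ennreal_plus[symmetric] ennreal_leI del: ennreal_plus)
  qed
  also have "\<dots> = ennreal (2 powr p) * (mass p f + mass p g)" unfolding mass_def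
    using assms(2,3) by (subst nn_integral_cmult) (auto simp: nn_integral_add)
  finally show ?thesis .
qed

lemma mass_integrable:
  assumes "f \<in> borel_measurable borel"
  shows "integrable lborel (\<lambda>x. norm (f x) powr p) \<longleftrightarrow> mass p f < \<infinity>"
  using assms unfolding integrable_iff_bounded mass_def by simp

lemma mass_eq_integral:
  assumes "f \<in> borel_measurable borel" "mass p f < \<infinity>"
  shows "mass p f = ennreal (\<integral>x. norm (f x) powr p \<partial>lborel)"
  using assms mass_integrable[of f p] unfolding mass_def by (subst nn_integral_eq_integral) auto

lemma mass_cong_AE:
  assumes "AE x in lborel. f x = g x" shows "mass p f = mass p g"
  unfolding mass_def using assms by (intro nn_integral_cong_AE) auto

lemma mass_bounded_support:
  fixes f :: "'a::euclidean_space \<Rightarrow> 'b::real_normed_vector"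
  assumes "f \<in> borel_measurable borel" "bounded \<Omega>" "\<And>x. x \<notin> \<Omega> \<Longrightarrow> f x = 0" "\<And>x. norm (f x) \<le> M" "0 < p"
  shows "mass p f < \<infinity>"
proof -
  obtain R where R: "\<And>x. x \<in> \<Omega> \<Longrightarrow> norm x \<le> R" using assms(2) bounded_iff by metis
  have M: "M \<ge> 0" using assms(4) norm_ge_zero order_trans by blast
  have "mass p f \<le> (\<integral>\<^sup>+x. ennreal (M powr p) * indicator (cball (0::'a) R) x \<partial>lborel)"
    unfolding mass_def
  proof (rule nn_integral_mono)
    fix x
    show "ennreal (norm (f x) powr p) \<le> ennreal (M powr p) * indicator (cball 0 R) x"
      using R[of x] assms(3)[of x] assms(4)[of x] assms(5) M
      by (cases "x \<in> \<Omega>") (auto intro!: ennreal_leI powr_mono2)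
  qed
  also have "\<dots> = ennreal (M powr p) * emeasure lborel (cball (0::'a) R)"
    by (simp add: nn_integral_cmult_indicator)
  also have "\<dots> < \<infinity>" using emeasure_bounded_finite[OF bounded_cball] by (auto simp: ennreal_mult_less_top)
  finally show ?thesis .
qed

lemma tendsto_0_ennreal_le:
  fixes a b :: "nat \<Rightarrow> ennreal"
  assumes "\<And>k. a k \<le> b k" "b \<longlonglongrightarrow> 0" shows "a \<longlonglongrightarrow> 0"
  using tendsto_const assms(2) by (rule tendsto_sandwich[rotated 2]) (use assms(1) in auto)

definition Lp_null :: "real \<Rightarrow> (nat \<Rightarrow> 'a::euclidean_space \<Rightarrow> 'b::euclidean_space) \<Rightarrow> bool" where
  "Lp_null p f \<longleftrightarrow> (\<forall>k. f k \<in> borel_measurable borel) \<and> (\<lambda>k. mass p (f k)) \<longlonglongrightarrow> 0"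

lemma Lp_null_bound:
  assumes "Lp_null p f" "0 < p" "0 \<le> c" "\<And>k. g k \<in> borel_measurable borel" "\<And>k x. norm (g k x) \<le> c * norm (f k x)"
  shows "Lp_null p g"
proof -
  have f: "\<And>k. f k \<in> borel_measurable borel" "(\<lambda>k. mass p (f k)) \<longlonglongrightarrow> 0" using assms(1) by (auto simp: Lp_null_def)
  have "(\<lambda>k. ennreal (c powr p) * mass p (f k)) \<longlonglongrightarrow> ennreal (c powr p) * 0"
    by (intro ennreal_tendsto_cmult f) auto
  then have "(\<lambda>k. mass p (g k)) \<longlonglongrightarrow> 0"
    by (intro tendsto_0_ennreal_le[OF mass_scale[OF assms(2,3) f(1) assms(5)]]) simp
  then show ?thesis using assms(4) by (simp add: Lp_null_def)
qed

lemma Lp_null_add_bound: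
  assumes f: "Lp_null p f" and g: "Lp_null p g" and p: "0 < p" and h: "\<And>k. h k \<in> borel_measurable borel"
    and b: "\<And>k x. norm (h k x) \<le> norm (f k x) + norm (g k x)"
  shows "Lp_null p h"
proof -
  have "(\<lambda>k. ennreal (2 powr p) * (mass p (f k) + mass p (g k))) \<longlonglongrightarrow> ennreal (2 powr p) * (0 + 0)"
    using f g by (intro ennreal_tendsto_cmult tendsto_add) (auto simp: Lp_null_def)
  then have lim: "(\<lambda>k. ennreal (2 powr p) * (mass p (f k) + mass p (g k))) \<longlonglongrightarrow> 0" by simp
  have "mass p (h k) \<le> ennreal (2 powr p) * (mass p (f k) + mass p (g k))" for k
    by (rule mass_add[OF p]) (use f g b in \<open>auto simp: Lp_null_def\<close>)
  then have "(\<lambda>k. mass p (h k)) \<longlonglongrightarrow> 0" using lim by (rule tendsto_0_ennreal_le)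
  then show ?thesis using h by (simp add: Lp_null_def)
qed

lemma Lp_null_add:
  assumes "Lp_null p f" "Lp_null p g" "0 < p" shows "Lp_null p (\<lambda>k x. f k x + g k x)"
  by (rule Lp_null_add_bound[OF assms]) (use assms in \<open>auto simp: Lp_null_def norm_triangle_ineq intro: borel_measurable_add\<close>)

lemma Lp_null_dominated:
  assumes "\<And>k. f k \<in> borel_measurable borel" "g \<in> borel_measurable borel" "mass p g < \<infinity>" "0 < p"
    and "\<And>k x. norm (f k x) \<le> norm (g x)" and "AE x in lborel. (\<lambda>k. f k x) \<longlonglongrightarrow> 0"
  shows "Lp_null p f"
proof -
  have "(\<lambda>k. mass p (f k)) \<longlonglongrightarrow> (\<integral>\<^sup>+x. 0 \<partial>(lborel::'a measure))"
    unfolding mass_def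
  proof (rule nn_integral_dominated_convergence[where w = "\<lambda>x. ennreal (norm (g x) powr p)"])
    show "AE x in lborel. ennreal (norm (f j x) powr p) \<le> ennreal (norm (g x) powr p)" for j
      using assms(4,5) by (intro AE_I2 ennreal_leI powr_mono2) auto
    show "AE x in lborel. (\<lambda>i. ennreal (norm (f i x) powr p)) \<longlonglongrightarrow> 0"
      using assms(6)
    proof eventually_elim
      case (elim x)
      have "(\<lambda>i. norm (f i x) powr p) \<longlonglongrightarrow> 0 powr p"
        using tendsto_norm_zero[OF elim] assms(4) by (intro tendsto_powr') auto
      then show ?case using tendsto_ennrealI by force
    qed
  qed (use assms in \<open>auto simp: mass_def\<close>)
  then show ?thesis using assms(1) by (simp add: Lp_null_def)
qed

lemma Lp_null_subseq: "Lp_null p f \<Longrightarrow> strict_mono r \<Longrightarrow> Lp_null p (\<lambda>k. f (r k))"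
  unfolding Lp_null_def using LIMSEQ_subseq_LIMSEQ[of "\<lambda>k. mass p (f k)" 0 r] by (auto simp: o_def)

lemma Lp_null_AE_subseq:
  assumes f: "Lp_null p f" and p: "0 < p"
  shows "\<exists>r :: nat \<Rightarrow> nat. strict_mono r \<and> (AE x in lborel. (\<lambda>k. f (r k) x) \<longlonglongrightarrow> 0)"
proof -
  have fm: "\<And>k. f k \<in> borel_measurable borel" and lim: "(\<lambda>k. mass p (f k)) \<longlonglongrightarrow> 0"
    using f by (auto simp: Lp_null_def)
  have "\<forall>\<^sub>F k in sequentially. mass p (f k) < 1" using lim by (rule order_tendstoD) simp
  then obtain N where N: "\<And>k. k \<ge> N \<Longrightarrow> mass p (f k) < 1" by (auto simp: eventually_sequentially)
  have fin: "mass p (f (k + N)) < \<infinity>" for k using N[of "k + N"] less_trans by fastforce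
  have "(\<lambda>k. mass p (f (k + N))) \<longlonglongrightarrow> 0" using lim by (rule LIMSEQ_ignore_initial_segment)
  then have "(\<lambda>k. ennreal (\<integral>x. norm (f (k + N) x) powr p \<partial>lborel)) \<longlonglongrightarrow> ennreal 0"
    using mass_eq_integral[OF fm fin] by simp
  then have "(\<lambda>k. \<integral>x. norm (norm (f (k + N) x) powr p) \<partial>lborel) \<longlonglongrightarrow> 0"
    by (subst (asm) tendsto_ennreal_iff) auto
  moreover have "integrable lborel (\<lambda>x. norm (f (k + N) x) powr p)" for k
    using mass_integrable[OF fm] fin by blast
  ultimately obtain r :: "nat \<Rightarrow> nat" where r: "strict_mono r"
      "AE x in lborel. (\<lambda>k. norm (f (r k + N) x) powr p) \<longlonglongrightarrow> 0"
    using tendsto_L1_AE_subseq[of lborel "\<lambda>k x. norm (f (k + N) x) powr p"] by auto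
  have "AE x in lborel. (\<lambda>k. f (r k + N) x) \<longlonglongrightarrow> 0"
    using r(2)
  proof eventually_elim
    case (elim x)
    have "(\<lambda>k. (norm (f (r k + N) x) powr p) powr (1/p)) \<longlonglongrightarrow> 0 powr (1/p)"
      using elim p by (intro tendsto_powr') auto
    then have "(\<lambda>k. norm (f (r k + N) x)) \<longlonglongrightarrow> 0" using p by (simp add: powr_powr)
    then show ?case by (rule tendsto_norm_zero_cancel)
  qed
  moreover have "strict_mono (\<lambda>k. r k + N)" using r(1) by (simp add: strict_mono_def)
  ultimately show ?thesis by blast
qed

section \<open>Functions vanishing at the boundary as limits of continuously differentiable ones\<close>

text \<open>A pair of a function and its weak gradient, both Borel functions on the whole space that vanish
  outside \<open>\<Omega>\<close>. Dilations, translations and chain rules act on such pairs through the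
  approximating sequence, which also converges almost everywhere so that Fatou's lemma transports
  integral inequalities.\<close>

definition approx_seq :: "real \<Rightarrow> 'a::euclidean_space set \<Rightarrow> ('a \<Rightarrow> real) \<Rightarrow> ('a \<Rightarrow> 'a) \<Rightarrow>
    (nat \<Rightarrow> 'a \<Rightarrow> real) \<Rightarrow> (nat \<Rightarrow> 'a \<Rightarrow> 'a) \<Rightarrow> bool" where
  "approx_seq p \<Omega> u g \<phi> d \<longleftrightarrow> (\<forall>k. C1c \<Omega> (\<phi> k) (d k)) \<and>
     Lp_null p (\<lambda>k x. \<phi> k x - u x) \<and> Lp_null p (\<lambda>k x. d k x - g x) \<and>
     (AE x in lborel. (\<lambda>k. \<phi> k x) \<longlonglongrightarrow> u x) \<and> (AE x in lborel. (\<lambda>k. d k x) \<longlonglongrightarrow> g x)"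

definition sobolev0 :: "real \<Rightarrow> 'a::euclidean_space set \<Rightarrow> ('a \<Rightarrow> real) \<Rightarrow> ('a \<Rightarrow> 'a) \<Rightarrow> bool" where
  "sobolev0 p \<Omega> u g \<longleftrightarrow> u \<in> borel_measurable borel \<and> g \<in> borel_measurable borel \<and>
     (\<forall>x. x \<notin> \<Omega> \<longrightarrow> u x = 0 \<and> g x = 0) \<and> mass p u < \<infinity> \<and> mass p g < \<infinity> \<and>
     (\<exists>\<phi> d. approx_seq p \<Omega> u g \<phi> d)"

lemma sobolev0D:
  assumes "sobolev0 p \<Omega> u g"
  shows "u \<in> borel_measurable borel" "g \<in> borel_measurable borel" "\<And>x. x \<notin> \<Omega> \<Longrightarrow> u x = 0"
    "\<And>x. x \<notin> \<Omega> \<Longrightarrow> g x = 0" "mass p u < \<infinity>" "mass p g < \<infinity>"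
  using assms by (auto simp: sobolev0_def)

lemma C1c_measurable:
  assumes "C1c \<Omega> f d" shows "f \<in> borel_measurable borel" "d \<in> borel_measurable borel"
  using C1_measurable[OF C1c_C1[OF assms]] by auto

lemma C1c_mass:
  assumes "C1c \<Omega> f d" "0 < p" shows "mass p f < \<infinity>" "mass p d < \<infinity>"
proof -
  obtain K where K: "compact K" "K \<subseteq> \<Omega>" "\<And>x. x \<notin> K \<Longrightarrow> f x = 0" "\<And>x. x \<notin> K \<Longrightarrow> d x = 0"
    using C1c_support[OF assms(1)] by metis
  have f: "C1 f d" using assms by (simp add: C1c_def)
  obtain M where M: "\<And>x. norm (f x) \<le> M"
    using bounded_compact_support[OF C1_continuous[OF f] K(1,3)] by metis
  obtain M' where M': "\<And>x. norm (d x) \<le> M'"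
    using bounded_compact_support[of d K] f K(1,4) unfolding C1_def by metis
  show "mass p f < \<infinity>"
    by (rule mass_bounded_support[OF C1_measurable(1)[OF f] compact_imp_bounded[OF K(1)] K(3) M assms(2)])
  show "mass p d < \<infinity>"
    by (rule mass_bounded_support[OF C1_measurable(2)[OF f] compact_imp_bounded[OF K(1)] K(4) M' assms(2)])
qed

lemma sobolev0I:
  assumes p: "0 < p" and u: "u \<in> borel_measurable borel" "g \<in> borel_measurable borel"
    "\<And>x. x \<notin> \<Omega> \<Longrightarrow> u x = 0" "\<And>x. x \<notin> \<Omega> \<Longrightarrow> g x = 0"
    and \<phi>: "\<And>k. C1c \<Omega> (\<phi> k) (d k)" and L: "Lp_null p (\<lambda>k x. \<phi> k x - u x)" "Lp_null p (\<lambda>k x. d k x - g x)"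
  shows "sobolev0 p \<Omega> u g"
proof -
  obtain r where r: "strict_mono r" "AE x in lborel. (\<lambda>k. \<phi> (r k) x - u x) \<longlonglongrightarrow> 0"
    using Lp_null_AE_subseq[OF L(1) p] by blast
  obtain s where s: "strict_mono s" "AE x in lborel. (\<lambda>k. d (r (s k)) x - g x) \<longlonglongrightarrow> 0"
    using Lp_null_AE_subseq[OF Lp_null_subseq[OF L(2) r(1)] p] by blast
  have rs: "strict_mono (\<lambda>k. r (s k))" using r(1) s(1) by (simp add: strict_mono_def)
  have "AE x in lborel. (\<lambda>k. \<phi> (r (s k)) x) \<longlonglongrightarrow> u x"
    using r(2)
  proof eventually_elim
    case (elim x)
    show ?case using LIMSEQ_subseq_LIMSEQ[OF elim s(1)] by (simp add: o_def LIM_zero_cancel)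
  qed
  moreover have "AE x in lborel. (\<lambda>k. d (r (s k)) x) \<longlonglongrightarrow> g x"
    using s(2) by eventually_elim (simp add: LIM_zero_cancel)
  ultimately have "approx_seq p \<Omega> u g (\<lambda>k. \<phi> (r (s k))) (\<lambda>k. d (r (s k)))"
    unfolding approx_seq_def using \<phi> Lp_null_subseq[OF L(1) rs] Lp_null_subseq[OF L(2) rs] by blast
  moreover have fin: "mass p v < \<infinity>" if v: "v \<in> borel_measurable borel" and w: "\<And>k. w k \<in> borel_measurable borel"
      "\<And>k. mass p (w k) < \<infinity>" "Lp_null p (\<lambda>k x. w k x - v x)" for v :: "'a \<Rightarrow> 'b::euclidean_space" and w
  proof -
    have "\<forall>\<^sub>F k in sequentially. mass p (\<lambda>x. w k x - v x) < 1"
      using w(3) unfolding Lp_null_def by (auto intro: order_tendstoD)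
    then obtain k where k: "mass p (\<lambda>x. w k x - v x) < 1" by (auto simp: eventually_sequentially)
    have "norm (v x) \<le> norm (w k x) + norm (w k x - v x)" for x
      by (metis norm_minus_commute norm_triangle_sub)
    then have "mass p v \<le> ennreal (2 powr p) * (mass p (w k) + mass p (\<lambda>x. w k x - v x))"
      using w(1) v p by (intro mass_add) auto
    also have "\<dots> < \<infinity>" using w(2)[of k] less_trans[OF k] by (auto simp: ennreal_mult_less_top)
    finally show ?thesis .
  qed
  moreover have "mass p u < \<infinity>"
    by (rule fin[OF u(1) _ _ L(1)]) (use C1c_mass[OF \<phi> p] C1c_measurable[OF \<phi>] in auto)
  moreover have "mass p g < \<infinity>"
    by (rule fin[OF u(2) _ _ L(2)]) (use C1c_mass[OF \<phi> p] C1c_measurable[OF \<phi>] in auto)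
  ultimately show ?thesis unfolding sobolev0_def using u by blast
qed

section \<open>Borel representatives and weak gradients\<close>

text \<open>Integrals of \<open>f\<close> over \<open>\<Omega>\<close> with respect to the completed measure become integrals of \<open>f'\<close>
  over the whole space, where translations, dilations and Fubini's theorem are available.\<close>

definition represents :: "'a::euclidean_space set \<Rightarrow> ('a \<Rightarrow> 'b::euclidean_space) \<Rightarrow> ('a \<Rightarrow> 'b) \<Rightarrow> bool" where
  "represents \<Omega> f f' \<longleftrightarrow> f' \<in> borel_measurable borel \<and> (\<forall>x. x \<notin> \<Omega> \<longrightarrow> f' x = 0) \<and>
     (AE x in lborel. x \<in> \<Omega> \<longrightarrow> f x = f' x)"

lemma lebesgue_measurable_AE:
  fixes f g :: "'a::euclidean_space \<Rightarrow> 'b::euclidean_space"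
  assumes f: "f \<in> borel_measurable lebesgue" and ae: "AE x in lebesgue. f x = g x"
  shows "g \<in> borel_measurable lebesgue"
proof (rule measurableI)
  fix A :: "'b set" assume "A \<in> sets borel"
  then have "f -` A \<inter> space lebesgue \<in> sets lebesgue" using f by (rule measurable_sets[rotated])
  then show "g -` A \<inter> space lebesgue \<in> sets lebesgue"
    by (rule completion.in_sets_AE[rotated]) (use ae in \<open>auto elim: eventually_mono\<close>)
qed simp

lemma represents_integral:
  assumes \<Omega>: "\<Omega> \<in> sets borel" and r: "represents \<Omega> f f'"
  shows "(\<integral>x. f x \<partial>lebesgue_on \<Omega>) = (\<integral>x. f' x \<partial>lborel)"
    and "integrable (lebesgue_on \<Omega>) f \<longleftrightarrow> integrable lborel f'"
    and "f \<in> borel_measurable (lebesgue_on \<Omega>)"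
proof -
  have f': "f' \<in> borel_measurable borel" using r by (simp add: represents_def)
  have f'l: "f' \<in> borel_measurable lebesgue" using f' by (intro measurable_completion) simp
  have "AE x in lborel. x \<in> \<Omega> \<longrightarrow> f x = f' x" using r by (simp add: represents_def)
  then have "AE x in lborel. f' x = indicator \<Omega> x *\<^sub>R f x"
    by eventually_elim (use r in \<open>auto simp: represents_def indicator_def\<close>)
  then have ae: "AE x in lebesgue. f' x = indicator \<Omega> x *\<^sub>R f x" by (rule AE_completion)
  note m = lebesgue_measurable_AE[OF f'l ae]
  have \<Omega>l: "\<Omega> \<inter> space lebesgue \<in> sets lebesgue" using \<Omega> by simp
  show "f \<in> borel_measurable (lebesgue_on \<Omega>)" using m borel_measurable_restrict_space_iff[OF \<Omega>l] by blast
  have "(\<integral>x. f x \<partial>lebesgue_on \<Omega>) = (\<integral>x. indicator \<Omega> x *\<^sub>R f x \<partial>lebesgue)"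
    by (rule integral_restrict_space[OF \<Omega>l])
  also have "\<dots> = (\<integral>x. f' x \<partial>lebesgue)" using m f'l ae by (intro integral_cong_AE) (auto elim: eventually_mono)
  also have "\<dots> = (\<integral>x. f' x \<partial>lborel)" using f' by (intro integral_completion) simp
  finally show "(\<integral>x. f x \<partial>lebesgue_on \<Omega>) = (\<integral>x. f' x \<partial>lborel)" .
  have "integrable (lebesgue_on \<Omega>) f \<longleftrightarrow> integrable lebesgue (\<lambda>x. indicator \<Omega> x *\<^sub>R f x)"
    by (rule integrable_restrict_space[OF \<Omega>l])
  also have "\<dots> \<longleftrightarrow> integrable lebesgue f'"
    using m f'l ae by (intro integrable_cong_AE) (auto elim: eventually_mono)
  also have "\<dots> \<longleftrightarrow> integrable lborel f'" using f' by (intro integrable_completion) simp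
  finally show "integrable (lebesgue_on \<Omega>) f \<longleftrightarrow> integrable lborel f'" .
qed

lemma represents_self:
  assumes "f \<in> borel_measurable borel" "\<Omega> \<in> sets borel"
  shows "represents \<Omega> f (\<lambda>x. indicator \<Omega> x *\<^sub>R f x)"
  using assms by (auto simp: represents_def)

lemma represents_borel:
  assumes "f \<in> borel_measurable borel" "\<And>x. x \<notin> \<Omega> \<Longrightarrow> f x = 0"
  shows "represents \<Omega> f f"
  using assms by (auto simp: represents_def)

lemma ex_represents:
  fixes f :: "'a::euclidean_space \<Rightarrow> 'b::euclidean_space"
  assumes \<Omega>: "\<Omega> \<in> sets borel" and f: "f \<in> borel_measurable (lebesgue_on \<Omega>)"
  shows "\<exists>f'. represents \<Omega> f f'"
proof -
  have \<Omega>l: "\<Omega> \<inter> space lebesgue \<in> sets lebesgue" using \<Omega> by simp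
  have m: "(\<lambda>x. indicator \<Omega> x *\<^sub>R f x) \<in> borel_measurable lebesgue"
    using f borel_measurable_restrict_space_iff[OF \<Omega>l] by blast
  have "\<exists>g. g \<in> borel_measurable lborel \<and> (AE x in lborel. (indicator \<Omega> x *\<^sub>R f x) \<bullet> b = g x)" for b
    using completion_ex_borel_measurable_real[of "\<lambda>x. (indicator \<Omega> x *\<^sub>R f x) \<bullet> b" lborel]
      borel_measurable_inner[OF m, of "\<lambda>_. b"] by auto
  then obtain g where g: "\<And>b. g b \<in> borel_measurable lborel" "\<And>b. AE x in lborel. (indicator \<Omega> x *\<^sub>R f x) \<bullet> b = g b x"
    by metis
  define f' where "f' x = indicator \<Omega> x *\<^sub>R (\<Sum>b\<in>Basis. g b x *\<^sub>R b)" for x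
  have "AE x in lborel. \<forall>b\<in>Basis. (indicator \<Omega> x *\<^sub>R f x) \<bullet> b = g b x"
    using g(2) by (subst AE_finite_all) auto
  then have "AE x in lborel. x \<in> \<Omega> \<longrightarrow> f x = f' x"
  proof eventually_elim
    case (elim x)
    show ?case
    proof
      assume "x \<in> \<Omega>"
      then have "\<forall>b\<in>Basis. f x \<bullet> b = g b x" using elim by simp
      then have "(\<Sum>b\<in>Basis. g b x *\<^sub>R b) = (\<Sum>b\<in>Basis. (f x \<bullet> b) *\<^sub>R b)" by (intro sum.cong) auto
      also have "\<dots> = f x" by (rule euclidean_representation)
      finally show "f x = f' x" using \<open>x \<in> \<Omega>\<close> by (simp add: f'_def)
    qed
  qed
  moreover have "f' \<in> borel_measurable borel" unfolding f'_def[abs_def] using g(1) \<Omega>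
    by (intro borel_measurable_scaleR borel_measurable_indicator borel_measurable_sum) auto
  ultimately show ?thesis unfolding represents_def by (intro exI[of _ f']) (auto simp: f'_def)
qed

lemma locally_integrable_represents:
  fixes g :: "'a::euclidean_space \<Rightarrow> 'b::euclidean_space"
  assumes \<Omega>: "open \<Omega>" and g: "locally_integrable \<Omega> g"
  shows "\<exists>g'. represents \<Omega> g g' \<and> (\<forall>K. compact K \<and> K \<subseteq> \<Omega> \<longrightarrow> integrable lborel (\<lambda>x. indicator K x *\<^sub>R g' x))"
proof -
  have gK: "integrable (lebesgue_on K) g" if "compact K" "K \<subseteq> \<Omega>" for K
    using g that by (simp add: locally_integrable_def)
  obtain C where C: "\<And>n. compact (C n)" "\<And>n. C n \<subseteq> \<Omega>" "\<And>n. C n \<subseteq> interior (C (Suc n))" "\<Union>(range C) = \<Omega>"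
    by (rule open_Union_compact_subsets[OF \<Omega>]) blast
  have inc: "C m \<subseteq> C n" if "m \<le> n" for m n
    using C(3) interior_subset by (intro lift_Suc_mono_le[OF _ that]) blast
  have meas: "(\<lambda>x. indicator (C n) x *\<^sub>R g x) \<in> borel_measurable lebesgue" for n
  proof -
    have "C n \<inter> space lebesgue \<in> sets lebesgue" using borel_compact[OF C(1)] by simp
    then show ?thesis
      using borel_measurable_integrable[OF gK[OF C(1,2)], of n] by (simp only: borel_measurable_restrict_space_iff)
  qed
  have "(\<lambda>n. indicator (C n) x *\<^sub>R g x) \<longlonglongrightarrow> indicator \<Omega> x *\<^sub>R g x" for x
  proof (cases "x \<in> \<Omega>")
    case True
    then obtain m where "x \<in> C m" using C(4) by blast
    then have "\<And>n. n \<ge> m \<Longrightarrow> x \<in> C n" using inc by blast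
    then have "\<forall>\<^sub>F n in sequentially. indicator (C n) x *\<^sub>R g x = g x"
      unfolding eventually_sequentially by (intro exI[of _ m]) auto
    then show ?thesis using True by (simp add: tendsto_eventually)
  next
    case False
    then have "\<And>n. x \<notin> C n" using C(2) by blast
    then show ?thesis using False by simp
  qed
  then have "(\<lambda>x. indicator \<Omega> x *\<^sub>R g x) \<in> borel_measurable lebesgue"
    by (intro borel_measurable_LIMSEQ_metric[OF meas]) auto
  moreover have \<Omega>b: "\<Omega> \<in> sets borel" using \<Omega> by simp
  ultimately have "g \<in> borel_measurable (lebesgue_on \<Omega>)"
    using borel_measurable_restrict_space_iff[of \<Omega> lebesgue g] by simp
  from ex_represents[OF \<Omega>b this] obtain g' where g': "represents \<Omega> g g'" by blast
  have "integrable lborel (\<lambda>x. indicator K x *\<^sub>R g' x)" if K: "compact K" "K \<subseteq> \<Omega>" for K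
  proof -
    have Kb: "K \<in> sets borel" using K(1) by (rule borel_compact)
    have "represents K g (\<lambda>x. indicator K x *\<^sub>R g' x)"
      using g' K Kb unfolding represents_def by (auto elim!: eventually_mono)
    then show ?thesis using represents_integral(2)[OF Kb] gK[OF K] by blast
  qed
  then show ?thesis using g' by blast
qed

text \<open>Weak gradients are unique by the fundamental lemma, so the choice made in the
  definition of the weak gradient is immaterial under integrals.\<close>

lemma weak_gradient_unique:
  fixes u \<rho>0 :: "'a::euclidean_space \<Rightarrow> real"
  assumes \<rho>0: "test_function U \<rho>0" "\<rho>0 z \<noteq> 0" and \<Omega>: "open \<Omega>"
    and g1: "has_weak_gradient \<Omega> u g1" and g2: "has_weak_gradient \<Omega> u g2"
  shows "AE x in lborel. x \<in> \<Omega> \<longrightarrow> g1 x = g2 x"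
proof -
  have \<Omega>b: "\<Omega> \<in> sets borel" using \<Omega> by simp
  obtain h1 where h1: "represents \<Omega> g1 h1" "\<And>K. compact K \<Longrightarrow> K \<subseteq> \<Omega> \<Longrightarrow> integrable lborel (\<lambda>x. indicator K x *\<^sub>R h1 x)"
    using locally_integrable_represents[OF \<Omega>] g1 unfolding has_weak_gradient_def by metis
  obtain h2 where h2: "represents \<Omega> g2 h2" "\<And>K. compact K \<Longrightarrow> K \<subseteq> \<Omega> \<Longrightarrow> integrable lborel (\<lambda>x. indicator K x *\<^sub>R h2 x)"
    using locally_integrable_represents[OF \<Omega>] g2 unfolding has_weak_gradient_def by metis
  have hm: "h1 \<in> borel_measurable borel" "h2 \<in> borel_measurable borel" using h1 h2 by (auto simp: represents_def)
  have main: "AE x in lborel. x \<in> \<Omega> \<longrightarrow> (h1 x - h2 x) \<bullet> b = 0" if b: "b \<in> Basis" for b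
  proof (rule fundamental_lemma[OF \<rho>0 \<Omega>])
    show "(\<lambda>x. (h1 x - h2 x) \<bullet> b) \<in> borel_measurable borel" using hm by simp
    fix K :: "'a set" assume K: "compact K" "K \<subseteq> \<Omega>"
    have "integrable lborel (\<lambda>x. (indicator K x *\<^sub>R h1 x - indicator K x *\<^sub>R h2 x) \<bullet> b)"
      using h1(2)[OF K] h2(2)[OF K] by simp
    then show "integrable lborel (\<lambda>x. indicator K x * ((h1 x - h2 x) \<bullet> b))"
      by (simp add: inner_diff_left right_diff_distrib)
  next
    fix \<psi> assume \<psi>: "test_function \<Omega> \<psi>"
    obtain K where K: "compact K" "K \<subseteq> \<Omega>" "\<And>x. x \<notin> K \<Longrightarrow> \<psi> x = 0"
      using C1c_support[OF test_functionD(2)[OF \<psi>]] by metis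
    have \<psi>m: "\<psi> \<in> borel_measurable borel" using C1c_measurable[OF test_functionD(2)[OF \<psi>]] by simp
    have r: "represents \<Omega> (\<lambda>x. \<psi> x *\<^sub>R g x) (\<lambda>x. \<psi> x *\<^sub>R h x)" if "represents \<Omega> g h" for g h :: "'a \<Rightarrow> 'a"
      using that \<psi>m unfolding represents_def by (auto elim: eventually_mono)
    have i: "integrable lborel (\<lambda>x. \<psi> x *\<^sub>R h x)"
      if h: "integrable lborel (\<lambda>x. indicator K x *\<^sub>R h x)" and hm: "h \<in> borel_measurable borel" for h :: "'a \<Rightarrow> 'a"
    proof -
      have "integrable lborel (\<lambda>x. \<psi> x * (h x \<bullet> c))" for c
      proof (rule integrable_test_mult[OF C1_continuous[OF C1c_C1[OF test_functionD(2)[OF \<psi>]]] K(3) K(1)])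
        show "integrable lborel (\<lambda>x. indicator K x * (h x \<bullet> c))"
          using integrable_inner_left[OF h, of c] by simp
      qed
      then have "integrable lborel (\<lambda>x. \<Sum>c\<in>Basis. (\<psi> x * (h x \<bullet> c)) *\<^sub>R c)" by simp
      moreover have "(\<Sum>c\<in>Basis. (\<psi> x * (h x \<bullet> c)) *\<^sub>R c) = \<psi> x *\<^sub>R h x" for x
        using euclidean_representation[of "\<psi> x *\<^sub>R h x"] by simp
      ultimately show ?thesis by simp
    qed
    note i1 = i[OF h1(2)[OF K(1,2)] hm(1)] and i2 = i[OF h2(2)[OF K(1,2)] hm(2)]
    have "(\<integral>x. \<psi> x *\<^sub>R g1 x \<partial>lebesgue_on \<Omega>) = (\<integral>x. \<psi> x *\<^sub>R g2 x \<partial>lebesgue_on \<Omega>)"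
      using g1 g2 \<psi> unfolding has_weak_gradient_def by (metis minus_equation_iff)
    then have "(\<integral>x. \<psi> x *\<^sub>R h1 x \<partial>lborel) = (\<integral>x. \<psi> x *\<^sub>R h2 x \<partial>lborel)"
      using represents_integral(1)[OF \<Omega>b r[OF h1(1)]] represents_integral(1)[OF \<Omega>b r[OF h2(1)]] by simp
    then have "(\<integral>x. (\<psi> x *\<^sub>R h1 x - \<psi> x *\<^sub>R h2 x) \<bullet> b \<partial>lborel) = 0"
      using i1 i2 by simp
    then show "(\<integral>x. \<psi> x * ((h1 x - h2 x) \<bullet> b) \<partial>lborel) = 0"
      by (simp add: inner_diff_left right_diff_distrib)
  qed
  have "AE x in lborel. \<forall>b\<in>Basis. x \<in> \<Omega> \<longrightarrow> (h1 x - h2 x) \<bullet> b = 0"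
    using main by (subst AE_finite_all) auto
  moreover have "AE x in lborel. x \<in> \<Omega> \<longrightarrow> g1 x = h1 x" "AE x in lborel. x \<in> \<Omega> \<longrightarrow> g2 x = h2 x"
    using h1(1) h2(1) by (auto simp: represents_def)
  ultimately show ?thesis
  proof eventually_elim
    case (elim x)
    show ?case
    proof
      assume x: "x \<in> \<Omega>"
      then have "h1 x - h2 x = 0" using elim(1) by (subst euclidean_eq_iff) auto
      then show "g1 x = g2 x" using elim x by simp
    qed
  qed
qed

section \<open>The Sobolev space as a space of pairs\<close>

text \<open>Mollification is uniform and stays in a fixed compact set, hence it converges in the mean,
  for the function and for its gradient.\<close>

lemma C1c_approx_test:
  fixes \<phi> \<rho>0 :: "'a::euclidean_space \<Rightarrow> real"
  assumes \<rho>0: "test_function U \<rho>0" "\<rho>0 z \<noteq> 0" and \<Omega>: "open \<Omega>" and \<phi>: "C1c \<Omega> \<phi> d" and p: "0 < p"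
  shows "\<exists>\<psi>. (\<forall>k. test_function \<Omega> (\<psi> k)) \<and> Lp_null p (\<lambda>k x. \<psi> k x - \<phi> x) \<and> Lp_null p (\<lambda>k x. grad (\<psi> k) x - d x)"
proof -
  obtain K where K: "compact K" "K \<subseteq> \<Omega>" "\<And>x. x \<notin> K \<Longrightarrow> \<phi> x = 0" "\<And>x. x \<notin> K \<Longrightarrow> d x = 0"
    using C1c_support[OF \<phi>] by metis
  note C = C1c_C1[OF \<phi>]
  from mollify[OF \<rho>0 C1_continuous[OF C] K(1-3) \<Omega>] obtain \<psi> :: "nat \<Rightarrow> 'a \<Rightarrow> real" and K' where
    \<psi>: "\<forall>k. test_function \<Omega> (\<psi> k)" "compact K'" "\<forall>k x. x \<notin> K' \<longrightarrow> \<psi> k x = 0"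
    "\<forall>e>0. \<forall>\<^sub>F k in sequentially. \<forall>x. \<bar>\<psi> k x - \<phi> x\<bar> \<le> e"
    "\<forall>e>0. \<forall>d. C1 \<phi> d \<longrightarrow> (\<forall>\<^sub>F k in sequentially. \<forall>x. norm (grad (\<psi> k) x - d x) \<le> e)"
    by auto
  have C\<psi>: "C1c \<Omega> (\<psi> k) (grad (\<psi> k))" for k using \<psi>(1) test_functionD(2) by blast
  have gs: "grad (\<psi> k) x = 0" if "x \<notin> K'" for k x
    using C1_support[OF C1c_C1[OF C\<psi>] \<psi>(2)] \<psi>(3) that by blast
  define A where "A = K \<union> K'"
  have A: "emeasure lborel A < \<infinity>" "A \<in> sets borel"
    unfolding A_def using emeasure_compact_finite[OF compact_Un[OF K(1) \<psi>(2)]]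
      borel_compact[OF compact_Un[OF K(1) \<psi>(2)]] by auto
  have null: "Lp_null p (\<lambda>k x. f k x - h x)"
    if f: "\<And>k. f k \<in> borel_measurable borel" "h \<in> borel_measurable borel"
      and z: "\<And>k x. x \<notin> A \<Longrightarrow> f k x = h x"
      and e: "\<And>e. e > 0 \<Longrightarrow> \<forall>\<^sub>F k in sequentially. \<forall>x. norm (f k x - h x) \<le> e"
    for f and h :: "'a \<Rightarrow> 'b::euclidean_space"
  proof -
    have fin: "emeasure lborel A = ennreal (measure lborel A)" using A by (simp add: emeasure_eq_ennreal_measure)
    have bound: "mass p (\<lambda>x. f k x - h x) \<le> ennreal (e powr p * measure lborel A)"
      if "\<forall>x. norm (f k x - h x) \<le> e" and "e > 0" for k e
    proof -
      have "mass p (\<lambda>x. f k x - h x) \<le> (\<integral>\<^sup>+x. ennreal (e powr p) * indicator A x \<partial>lborel)"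
        unfolding mass_def
      proof (rule nn_integral_mono)
        fix x
        show "ennreal (norm (f k x - h x) powr p) \<le> ennreal (e powr p) * indicator A x"
        proof (cases "x \<in> A")
          case True
          have "norm (f k x - h x) powr p \<le> e powr p" using that p by (intro powr_mono2) auto
          then show ?thesis using True by (simp add: ennreal_leI)
        qed (use z in auto)
      qed
      also have "\<dots> = ennreal (e powr p) * emeasure lborel A" using A by (simp add: nn_integral_cmult_indicator)
      also have "\<dots> = ennreal (e powr p * measure lborel A)" by (simp add: fin ennreal_mult')
      finally show ?thesis .
    qed
    have "(\<lambda>k. mass p (\<lambda>x. f k x - h x)) \<longlonglongrightarrow> 0"
    proof (rule order_tendstoI)
      fix a :: ennreal assume "0 < a"
      then obtain r :: real where r: "0 < r" "ennreal r < a"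
        using ennreal_rat_dense[of 0 a] by (metis ennreal_0 ennreal_less_zero_iff ennreal_neg leI order_less_irrefl)
      define m where "m = measure lborel A"
      have m: "m \<ge> 0" by (simp add: m_def)
      define e where "e = (r / (m + 1)) powr (1/p)"
      have e0: "e > 0" using r m by (simp add: e_def)
      have ep: "e powr p = r / (m + 1)" using p r m by (simp add: e_def powr_powr)
      have "e powr p * m \<le> r" unfolding ep using r m by (simp add: field_simps)
      then have "e powr p * measure lborel A \<le> r" by (simp add: m_def)
      then have er: "ennreal (e powr p * measure lborel A) < a" using r(2) by (meson ennreal_leI le_less_trans)
      show "\<forall>\<^sub>F k in sequentially. mass p (\<lambda>x. f k x - h x) < a"
        using e[OF e0] by eventually_elim (use bound[OF _ e0] er in \<open>blast intro: le_less_trans\<close>)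
    qed simp
    then show ?thesis using f by (simp add: Lp_null_def)
  qed
  have "Lp_null p (\<lambda>k x. \<psi> k x - \<phi> x)"
    by (rule null) (use C1c_measurable[OF C\<psi>] C1c_measurable[OF \<phi>] \<psi>(3,4) K in \<open>auto simp: A_def\<close>)
  moreover have "Lp_null p (\<lambda>k x. grad (\<psi> k) x - d x)"
    by (rule null) (use C1c_measurable[OF C\<psi>] C1c_measurable[OF \<phi>] \<psi>(5) C gs K in \<open>auto simp: A_def\<close>)
  ultimately show ?thesis using \<psi>(1) by blast
qed

lemma mass_1_le:
  fixes f :: "'a::euclidean_space \<Rightarrow> 'b::euclidean_space"
  assumes p: "1 \<le> p" and f: "f \<in> borel_measurable borel" "\<And>x. x \<notin> cball 0 R \<Longrightarrow> f x = 0" and e: "e > 0"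
  shows "mass 1 f \<le> ennreal (e * measure lborel (cball (0::'a) R)) + ennreal (e powr (1 - p)) * mass p f"
proof -
  have pt: "norm (f x) \<le> e * indicator (cball 0 R) x + e powr (1 - p) * norm (f x) powr p" for x
  proof (cases "norm (f x) \<le> e \<or> x \<notin> cball 0 R")
    case False
    then have n: "norm (f x) > e" by simp
    have "1 \<le> (norm (f x) / e) powr (p - 1)" using n e p by (intro ge_one_powr_ge_zero) auto
    then have "norm (f x) * 1 \<le> norm (f x) * (norm (f x) / e) powr (p - 1)" by (intro mult_left_mono) auto
    also have "\<dots> = e powr (1 - p) * norm (f x) powr p"
    proof -
      have "norm (f x) powr p = norm (f x) powr 1 * norm (f x) powr (p - 1)" using n e by (simp only: powr_add[symmetric]) simp
      moreover have "e powr (1 - p) = 1 / e powr (p - 1)" using powr_minus_divide[of e "p - 1"] by simp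
      ultimately show ?thesis using n e by (simp add: powr_divide)
    qed
    finally have "norm (f x) \<le> e powr (1 - p) * norm (f x) powr p" by simp
    moreover have "0 \<le> e * indicator (cball 0 R) x" using e by simp
    ultimately show ?thesis by linarith
  next
    case True
    then show ?thesis
      using f(2)[of x] e by (cases "x \<in> cball 0 R") (auto simp del: mem_cball intro: add_increasing2)
  qed
  have "mass 1 f \<le> (\<integral>\<^sup>+x. ennreal e * indicator (cball 0 R) x + ennreal (e powr (1 - p)) * ennreal (norm (f x) powr p) \<partial>lborel)"
    unfolding mass_def
  proof (rule nn_integral_mono)
    fix x
    have "ennreal (norm (f x) powr 1) \<le> ennreal (e * indicator (cball 0 R) x + e powr (1 - p) * norm (f x) powr p)"
      using pt[of x] by (intro ennreal_leI) simp
    also have "\<dots> = ennreal e * indicator (cball 0 R) x + ennreal (e powr (1 - p)) * ennreal (norm (f x) powr p)"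
      using e by (simp add: ennreal_plus ennreal_mult ennreal_indicator)
    finally show "ennreal (norm (f x) powr 1) \<le> \<dots>" .
  qed
  also have "\<dots> = ennreal e * emeasure lborel (cball (0::'a) R) + ennreal (e powr (1 - p)) * mass p f"
    unfolding mass_def using f(1) by (subst nn_integral_add)
      (auto intro!: borel_measurable_times_ennreal borel_measurable_indicator simp: nn_integral_cmult nn_integral_cmult_indicator)
  also have "emeasure lborel (cball (0::'a) R) = ennreal (measure lborel (cball (0::'a) R))"
    using emeasure_bounded_finite[OF bounded_cball, of "0::'a" R] by (intro emeasure_eq_ennreal_measure) simp
  finally show ?thesis using e by (simp add: ennreal_mult')
qed

lemma bounded_subset_cball0: "bounded \<Omega> \<Longrightarrow> \<exists>R>0. \<Omega> \<subseteq> cball (0::'a::real_normed_vector) R"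
  unfolding bounded_pos by (auto simp: subset_iff)

lemma integrable_of_mass:
  fixes f :: "'a::euclidean_space \<Rightarrow> 'b::euclidean_space"
  assumes p: "1 \<le> p" and f: "f \<in> borel_measurable borel" "\<And>x. x \<notin> \<Omega> \<Longrightarrow> f x = 0" "mass p f < \<infinity>" and "bounded \<Omega>"
  shows "integrable lborel f"
proof -
  obtain R where R: "\<Omega> \<subseteq> cball 0 R" using bounded_subset_cball0[OF assms(5)] by blast
  have "mass 1 f \<le> ennreal (1 * measure lborel (cball (0::'a) R)) + ennreal (1 powr (1 - p)) * mass p f"
    by (rule mass_1_le[OF p f(1)]) (use f(2) R in blast, simp)
  also have "\<dots> < \<infinity>" using f(3) by (simp add: ennreal_mult_less_top)
  finally show ?thesis using f(1) unfolding integrable_iff_bounded mass_def by simp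
qed

lemma Lp_null_L1:
  assumes p: "1 \<le> p" and f: "Lp_null p f" "\<And>k x. x \<notin> \<Omega> \<Longrightarrow> f k x = 0" and b: "bounded \<Omega>"
  shows "Lp_null 1 f"
proof -
  obtain R where R: "\<Omega> \<subseteq> cball 0 R" using bounded_subset_cball0[OF b] by blast
  have fm: "f k \<in> borel_measurable borel" for k using f(1) by (simp add: Lp_null_def)
  define V where "V = measure lborel (cball (0::'a) R)"
  have "(\<lambda>k. mass 1 (f k)) \<longlonglongrightarrow> 0"
  proof (rule order_tendstoI)
    fix a :: ennreal assume "0 < a"
    then obtain r :: real where r: "0 < r" "ennreal r < a"
      using ennreal_rat_dense[of 0 a] by (metis ennreal_0 ennreal_less_zero_iff ennreal_neg leI order_less_irrefl)
    define e where "e = r / (2 * (V + 1))"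
    have V: "V \<ge> 0" by (simp add: V_def)
    have e: "e > 0" using r V by (simp add: e_def)
    have eV: "e * V \<le> r / 2"
    proof -
      have "e * V \<le> e * (V + 1)" using e by simp
      also have "\<dots> = r / 2" using V by (simp add: e_def field_simps)
      finally show ?thesis .
    qed
    have "(\<lambda>k. ennreal (e powr (1 - p)) * mass p (f k)) \<longlonglongrightarrow> ennreal (e powr (1 - p)) * 0"
      using f(1) by (intro ennreal_tendsto_cmult) (auto simp: Lp_null_def)
    then have "\<forall>\<^sub>F k in sequentially. ennreal (e powr (1 - p)) * mass p (f k) < ennreal (r / 2)"
      using r(1) by (intro order_tendstoD(2)[of _ 0]) auto
    then show "\<forall>\<^sub>F k in sequentially. mass 1 (f k) < a"
    proof eventually_elim
      case (elim k)
      have "mass 1 (f k) \<le> ennreal (e * V) + ennreal (e powr (1 - p)) * mass p (f k)"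
        unfolding V_def by (rule mass_1_le[OF p fm _ e]) (use f(2) R in blast)
      also have "\<dots> \<le> ennreal (r / 2) + ennreal (r / 2)"
        using elim eV by (intro add_mono ennreal_leI) auto
      also have "\<dots> = ennreal r" using r by (simp add: ennreal_plus[symmetric] del: ennreal_plus)
      finally show ?case using r(2) by (rule le_less_trans)
    qed
  qed simp
  then show ?thesis using fm by (simp add: Lp_null_def)
qed

lemma integral_tendsto_L1:
  fixes F :: "nat \<Rightarrow> 'a::euclidean_space \<Rightarrow> 'b::euclidean_space"
  assumes "Lp_null 1 (\<lambda>k x. F k x - G x)" "\<And>k. integrable lborel (F k)" "integrable lborel G"
  shows "(\<lambda>k. \<integral>x. F k x \<partial>lborel) \<longlonglongrightarrow> (\<integral>x. G x \<partial>lborel)"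
  using assms by (intro tendsto_L1_int) (auto simp: Lp_null_def mass_def)

text \<open>Integration by parts holds along the approximating sequence, and both sides converge because
  on a bounded set convergence in the mean of order \<open>p\<close> implies convergence in the mean of
  order 1.\<close>

lemma sobolev0_weak_gradient:
  fixes u :: "'a::euclidean_space \<Rightarrow> real"
  assumes s: "sobolev0 p \<Omega> u g" and p: "1 \<le> p" and \<Omega>: "open \<Omega>" "bounded \<Omega>"
  shows "has_weak_gradient \<Omega> u g"
proof -
  have \<Omega>b: "\<Omega> \<in> sets borel" using \<Omega> by simp
  note sD = sobolev0D[OF s]
  have iu: "integrable lborel u" and ig: "integrable lborel g"
    using integrable_of_mass[OF p sD(1,3,5) \<Omega>(2)] integrable_of_mass[OF p sD(2,4,6) \<Omega>(2)] by auto
  have loc: "locally_integrable \<Omega> f" if "integrable lborel f" for f :: "'a \<Rightarrow> 'b::euclidean_space"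
    unfolding locally_integrable_def
  proof (intro allI impI)
    fix K assume "compact K \<and> K \<subseteq> \<Omega>"
    then have K: "K \<in> sets borel" by (simp add: borel_compact)
    have "integrable lborel (\<lambda>x. indicator K x *\<^sub>R f x)" using that K by (intro integrable_mult_indicator) auto
    then show "integrable (lebesgue_on K) f"
      using represents_integral(2)[OF K represents_self[OF _ K], of f] borel_measurable_integrable[OF that] by simp
  qed
  obtain \<phi> d where ap: "approx_seq p \<Omega> u g \<phi> d" using s unfolding sobolev0_def by blast
  then have \<phi>: "\<And>k. C1c \<Omega> (\<phi> k) (d k)" and L: "Lp_null p (\<lambda>k x. \<phi> k x - u x)" "Lp_null p (\<lambda>k x. d k x - g x)"
    by (auto simp: approx_seq_def)
  have z: "\<phi> k x = 0" "d k x = 0" if "x \<notin> \<Omega>" for k x using C1c_support[OF \<phi>] that by (metis subsetD)+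
  have L1: "Lp_null 1 (\<lambda>k x. \<phi> k x - u x)" "Lp_null 1 (\<lambda>k x. d k x - g x)"
    by (rule Lp_null_L1[OF p L(1) _ \<Omega>(2)], use z sD in simp) (rule Lp_null_L1[OF p L(2) _ \<Omega>(2)], use z sD in simp)
  have i\<phi>: "integrable lborel (\<phi> k)" "integrable lborel (d k)" for k
    using integrable_of_mass[OF p C1c_measurable(1)[OF \<phi>] z(1) C1c_mass(1)[OF \<phi>] \<Omega>(2)]
      integrable_of_mass[OF p C1c_measurable(2)[OF \<phi>] z(2) C1c_mass(2)[OF \<phi>] \<Omega>(2)] p by auto
  have eq: "(\<integral>x. u x *\<^sub>R grad \<psi> x \<partial>lborel) = - (\<integral>x. \<psi> x *\<^sub>R g x \<partial>lborel)" if \<psi>: "test_function \<Omega> \<psi>" for \<psi>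
  proof -
    note C = test_functionD(2)[OF \<psi>]
    note Cm[measurable] = C1c_measurable(1)[OF C] C1c_measurable(2)[OF C]
    obtain K where K: "compact K" "K \<subseteq> \<Omega>" "\<And>x. x \<notin> K \<Longrightarrow> \<psi> x = 0" "\<And>x. x \<notin> K \<Longrightarrow> grad \<psi> x = 0"
      using C1c_support[OF C] by metis
    obtain M where M: "M > 0" "\<And>x. norm (\<psi> x) \<le> M"
      using bounded_compact_support[OF C1_continuous[OF C1c_C1[OF C]] K(1,3)] by metis
    obtain M' where M': "M' > 0" "\<And>x. norm (grad \<psi> x) \<le> M'"
      using bounded_compact_support[of "grad \<psi>" K] C1c_C1[OF C] K(1,4) unfolding C1_def by metis
    have i1: "integrable lborel (\<lambda>x. f x *\<^sub>R grad \<psi> x)" if f: "integrable lborel f" for f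
    proof (rule Bochner_Integration.integrable_bound)
      show "integrable lborel (\<lambda>x. M' * f x)" using f by simp
      show "(\<lambda>x. f x *\<^sub>R grad \<psi> x) \<in> borel_measurable lborel" using borel_measurable_integrable[OF f] by simp
      have "\<bar>f x\<bar> * norm (grad \<psi> x) \<le> M' * \<bar>f x\<bar>" for x
        using mult_left_mono[OF M'(2)[of x], of "\<bar>f x\<bar>"] by (simp add: mult.commute)
      then show "AE x in lborel. norm (f x *\<^sub>R grad \<psi> x) \<le> norm (M' * f x)"
        using M'(1) by (simp add: abs_mult)
    qed
    have i2: "integrable lborel (\<lambda>x. \<psi> x *\<^sub>R f x)" if f: "integrable lborel f" for f :: "'a \<Rightarrow> 'a"
    proof (rule Bochner_Integration.integrable_bound)
      show "integrable lborel (\<lambda>x. M *\<^sub>R f x)" using f by simp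
      show "(\<lambda>x. \<psi> x *\<^sub>R f x) \<in> borel_measurable lborel" using borel_measurable_integrable[OF f] by simp
      have "\<bar>\<psi> x\<bar> * norm (f x) \<le> M * norm (f x)" for x
        using mult_right_mono[OF M(2)[of x], of "norm (f x)"] by simp
      then show "AE x in lborel. norm (\<psi> x *\<^sub>R f x) \<le> norm (M *\<^sub>R f x)"
        using M(1) by simp
    qed
    have 1: "(\<lambda>k. \<integral>x. \<phi> k x *\<^sub>R grad \<psi> x \<partial>lborel) \<longlonglongrightarrow> (\<integral>x. u x *\<^sub>R grad \<psi> x \<partial>lborel)"
    proof (rule integral_tendsto_L1[OF Lp_null_bound[OF L1(1), where c = M']])
      show "norm (\<phi> k x *\<^sub>R grad \<psi> x - u x *\<^sub>R grad \<psi> x) \<le> M' * norm (\<phi> k x - u x)" for k x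
        using mult_left_mono[OF M'(2)[of x], of "\<bar>\<phi> k x - u x\<bar>"]
        by (simp add: scaleR_diff_left[symmetric] mult.commute)
      show "(\<lambda>x. \<phi> k x *\<^sub>R grad \<psi> x - u x *\<^sub>R grad \<psi> x) \<in> borel_measurable borel" for k
        using C1c_measurable[OF \<phi>[of k]] sD(1) by simp
    qed (use M' i1 iu i\<phi> in auto)
    have 2: "(\<lambda>k. \<integral>x. \<psi> x *\<^sub>R d k x \<partial>lborel) \<longlonglongrightarrow> (\<integral>x. \<psi> x *\<^sub>R g x \<partial>lborel)"
    proof (rule integral_tendsto_L1[OF Lp_null_bound[OF L1(2), where c = M]])
      show "norm (\<psi> x *\<^sub>R d k x - \<psi> x *\<^sub>R g x) \<le> M * norm (d k x - g x)" for k x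
        using mult_right_mono[OF M(2)[of x], of "norm (d k x - g x)"]
        by (simp add: scaleR_diff_right[symmetric])
      show "(\<lambda>x. \<psi> x *\<^sub>R d k x - \<psi> x *\<^sub>R g x) \<in> borel_measurable borel" for k
        using C1c_measurable[OF \<phi>[of k]] sD(2) by simp
    qed (use M i2 ig i\<phi> in auto)
    have 3: "(\<integral>x. \<phi> k x *\<^sub>R grad \<psi> x \<partial>lborel) = - (\<integral>x. \<psi> x *\<^sub>R d k x \<partial>lborel)" for k
      by (rule integration_by_parts[OF \<phi> C1c_C1[OF C]])
    show ?thesis using LIMSEQ_unique[OF 1[unfolded 3] tendsto_minus[OF 2]] .
  qed
  have "(\<integral>x. u x *\<^sub>R grad \<psi> x \<partial>lebesgue_on \<Omega>) = - (\<integral>x. \<psi> x *\<^sub>R g x \<partial>lebesgue_on \<Omega>)" if \<psi>: "test_function \<Omega> \<psi>" for \<psi>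
  proof -
    note Cm = C1c_measurable[OF test_functionD(2)[OF \<psi>]]
    have m: "(\<lambda>x. u x *\<^sub>R grad \<psi> x) \<in> borel_measurable borel" "(\<lambda>x. \<psi> x *\<^sub>R g x) \<in> borel_measurable borel"
      using Cm sD(1,2) by (auto intro: borel_measurable_scaleR)
    have r: "represents \<Omega> (\<lambda>x. u x *\<^sub>R grad \<psi> x) (\<lambda>x. u x *\<^sub>R grad \<psi> x)" "represents \<Omega> (\<lambda>x. \<psi> x *\<^sub>R g x) (\<lambda>x. \<psi> x *\<^sub>R g x)"
      by (rule represents_borel[OF m(1)], simp add: sD(3)) (rule represents_borel[OF m(2)], simp add: sD(4))
    show ?thesis using eq[OF \<psi>] by (simp only: represents_integral(1)[OF \<Omega>b r(1)] represents_integral(1)[OF \<Omega>b r(2)])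
  qed
  then show ?thesis unfolding has_weak_gradient_def using loc[OF iu] loc[OF ig] by blast
qed

lemma Lp_norm_represents:
  assumes \<Omega>: "\<Omega> \<in> sets borel" and r: "represents \<Omega> f f'" and p: "0 < p"
  shows "in_Lp p \<Omega> f \<longleftrightarrow> mass p f' < \<infinity>"
    and "mass p f' < \<infinity> \<Longrightarrow> Lp_norm p \<Omega> f = enn2real (mass p f') powr (1 / p)"
proof -
  have f': "f' \<in> borel_measurable borel" using r by (simp add: represents_def)
  have r2: "represents \<Omega> (\<lambda>x. norm (f x) powr p) (\<lambda>x. norm (f' x) powr p)"
    using r p unfolding represents_def by (auto elim: eventually_mono)
  show "in_Lp p \<Omega> f \<longleftrightarrow> mass p f' < \<infinity>"
    unfolding in_Lp_def using represents_integral(3)[OF \<Omega> r] represents_integral(2)[OF \<Omega> r2] mass_integrable[OF f', of p] by simp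
  assume "mass p f' < \<infinity>"
  then show "Lp_norm p \<Omega> f = enn2real (mass p f') powr (1 / p)"
    unfolding Lp_norm_def represents_integral(1)[OF \<Omega> r2] using mass_eq_integral[OF f', of p] by simp
qed

lemma represents_diff:
  fixes f :: "'a::euclidean_space \<Rightarrow> 'b::euclidean_space"
  assumes "represents \<Omega> f f'" "represents \<Omega> g g'" shows "represents \<Omega> (\<lambda>x. f x - g x) (\<lambda>x. f' x - g' x)"
  using assms unfolding represents_def by (auto elim: eventually_elim2)

lemma Lp_norm_tendsto_0_iff:
  fixes f f' :: "nat \<Rightarrow> 'a::euclidean_space \<Rightarrow> 'b::euclidean_space"
  assumes \<Omega>: "\<Omega> \<in> sets borel" and r: "\<And>k. represents \<Omega> (f k) (f' k)" and p: "0 < p" and fin: "\<And>k. mass p (f' k) < \<infinity>"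
  shows "(\<lambda>k. Lp_norm p \<Omega> (f k)) \<longlonglongrightarrow> 0 \<longleftrightarrow> Lp_null p f'"
proof -
  define I where "I k = enn2real (mass p (f' k))" for k
  have I: "I k \<ge> 0" "mass p (f' k) = ennreal (I k)" for k using fin by (auto simp: I_def)
  have "(\<lambda>k. Lp_norm p \<Omega> (f k)) = (\<lambda>k. I k powr (1 / p))"
    using Lp_norm_represents(2)[OF \<Omega> r p fin] by (simp add: I_def)
  moreover have "(\<lambda>k. I k powr (1 / p)) \<longlonglongrightarrow> 0 \<longleftrightarrow> I \<longlonglongrightarrow> 0"
  proof
    assume "(\<lambda>k. I k powr (1 / p)) \<longlonglongrightarrow> 0"
    then have "(\<lambda>k. (I k powr (1 / p)) powr p) \<longlonglongrightarrow> 0 powr p" using p by (intro tendsto_powr') auto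
    then show "I \<longlonglongrightarrow> 0" using p I by (simp add: powr_powr)
  next
    assume "I \<longlonglongrightarrow> 0"
    then have "(\<lambda>k. I k powr (1 / p)) \<longlonglongrightarrow> 0 powr (1 / p)" using p I by (intro tendsto_powr') auto
    then show "(\<lambda>k. I k powr (1 / p)) \<longlonglongrightarrow> 0" by simp
  qed
  moreover have "I \<longlonglongrightarrow> 0 \<longleftrightarrow> (\<lambda>k. mass p (f' k)) \<longlonglongrightarrow> 0"
    unfolding I(2) ennreal_0[symmetric] by (subst tendsto_ennreal_iff) (auto simp: I)
  ultimately show ?thesis using r by (simp add: Lp_null_def represents_def)
qed

text \<open>The approximating functions are merely continuously differentiable; mollifying the
  \<open>k\<close>-th one up to an error \<open>1/k\<close> yields the test functions that the definition
  of the space asks for.\<close>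

theorem sobolev0_in_W0:
  fixes v \<rho>0 :: "'a::euclidean_space \<Rightarrow> real"
  assumes \<rho>0: "test_function U \<rho>0" "\<rho>0 z \<noteq> 0" and s: "sobolev0 p \<Omega> v h" and p: "1 \<le> p"
    and \<Omega>: "open \<Omega>" "bounded \<Omega>"
  shows "v \<in> W0 p \<Omega>" "represents \<Omega> (weak_grad \<Omega> v) h"
proof -
  have \<Omega>b: "\<Omega> \<in> sets borel" using \<Omega> by simp
  have p0: "0 < p" using p by simp
  note sD = sobolev0D[OF s]
  note wg = sobolev0_weak_gradient[OF s p \<Omega>]
  have rv: "represents \<Omega> v v" and rh: "represents \<Omega> h h" using sD by (auto intro: represents_borel)
  have "has_weak_gradient \<Omega> v (weak_grad \<Omega> v)" unfolding weak_grad_def using someI[of "has_weak_gradient \<Omega> v", OF wg] .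
  from weak_gradient_unique[OF \<rho>0 \<Omega>(1) this wg] show "represents \<Omega> (weak_grad \<Omega> v) h"
    using sD by (auto simp: represents_def)
  obtain \<phi> d where ap: "approx_seq p \<Omega> v h \<phi> d" using s unfolding sobolev0_def by blast
  then have \<phi>: "\<And>k. C1c \<Omega> (\<phi> k) (d k)" and L: "Lp_null p (\<lambda>k x. \<phi> k x - v x)" "Lp_null p (\<lambda>k x. d k x - h x)"
    by (auto simp: approx_seq_def)
  have "\<exists>\<psi>. test_function \<Omega> \<psi> \<and> mass p (\<lambda>x. \<psi> x - \<phi> k x) < ennreal (1 / real (Suc k))
      \<and> mass p (\<lambda>x. grad \<psi> x - d k x) < ennreal (1 / real (Suc k))" for k
  proof -
    from C1c_approx_test[OF \<rho>0 \<Omega>(1) \<phi> p0] obtain \<psi> where \<psi>: "\<forall>j. test_function \<Omega> (\<psi> j)"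
      "Lp_null p (\<lambda>j x. \<psi> j x - \<phi> k x)" "Lp_null p (\<lambda>j x. grad (\<psi> j) x - d k x)" by blast
    have e: "0 < ennreal (1 / real (Suc k))" by simp
    have "\<forall>\<^sub>F j in sequentially. mass p (\<lambda>x. \<psi> j x - \<phi> k x) < ennreal (1 / real (Suc k))"
      using \<psi>(2) e unfolding Lp_null_def by (intro order_tendstoD(2)) auto
    moreover have "\<forall>\<^sub>F j in sequentially. mass p (\<lambda>x. grad (\<psi> j) x - d k x) < ennreal (1 / real (Suc k))"
      using \<psi>(3) e unfolding Lp_null_def by (intro order_tendstoD(2)) auto
    ultimately have "\<forall>\<^sub>F j in sequentially. mass p (\<lambda>x. \<psi> j x - \<phi> k x) < ennreal (1 / real (Suc k)) \<and>
      mass p (\<lambda>x. grad (\<psi> j) x - d k x) < ennreal (1 / real (Suc k))" by (rule eventually_conj)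
    from eventually_happens'[OF sequentially_bot this] show ?thesis using \<psi>(1) by blast
  qed
  then obtain \<psi> where \<psi>: "\<And>k. test_function \<Omega> (\<psi> k)"
    "\<And>k. mass p (\<lambda>x. \<psi> k x - \<phi> k x) < ennreal (1 / real (Suc k))"
    "\<And>k. mass p (\<lambda>x. grad (\<psi> k) x - d k x) < ennreal (1 / real (Suc k))" by metis
  have C: "C1c \<Omega> (\<psi> k) (grad (\<psi> k))" for k by (rule test_functionD(2)[OF \<psi>(1)])
  have lim: "(\<lambda>k. ennreal (1 / real (Suc k))) \<longlonglongrightarrow> 0"
    using tendsto_ennrealI[OF LIMSEQ_inverse_real_of_nat] by (simp add: inverse_eq_divide)
  have 1: "Lp_null p (\<lambda>k x. \<psi> k x - \<phi> k x)" "Lp_null p (\<lambda>k x. grad (\<psi> k) x - d k x)"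
    unfolding Lp_null_def
    using C1c_measurable[OF C] C1c_measurable[OF \<phi>] tendsto_0_ennreal_le[OF less_imp_le[OF \<psi>(2)] lim]
      tendsto_0_ennreal_le[OF less_imp_le[OF \<psi>(3)] lim] by auto
  have 2: "Lp_null p (\<lambda>k x. \<psi> k x - v x)" "Lp_null p (\<lambda>k x. grad (\<psi> k) x - h x)"
    using Lp_null_add[OF 1(1) L(1) p0] Lp_null_add[OF 1(2) L(2) p0] by simp_all
  have z: "\<psi> k x = 0" "grad (\<psi> k) x = 0" if "x \<notin> \<Omega>" for k x using C1c_support[OF C] that by (metis subsetD)+
  have r: "represents \<Omega> (\<psi> k) (\<psi> k)" "represents \<Omega> (grad (\<psi> k)) (grad (\<psi> k))" for k
    using z C1c_measurable[OF C] by (auto intro: represents_borel)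
  have fin1: "mass p (\<lambda>x. \<psi> k x - v x) < \<infinity>" for k
    by (rule le_less_trans[OF mass_add[OF p0 C1c_measurable(1)[OF C] sD(1) norm_triangle_ineq4]])
       (use C1c_mass[OF C p0] sD in \<open>auto simp: ennreal_mult_less_top\<close>)
  have fin2: "mass p (\<lambda>x. grad (\<psi> k) x - h x) < \<infinity>" for k
    by (rule le_less_trans[OF mass_add[OF p0 C1c_measurable(2)[OF C] sD(2) norm_triangle_ineq4]])
       (use C1c_mass[OF C p0] sD in \<open>auto simp: ennreal_mult_less_top\<close>)
  have 3: "(\<lambda>k. Lp_norm p \<Omega> (\<lambda>x. \<psi> k x - v x)) \<longlonglongrightarrow> 0"
    using Lp_norm_tendsto_0_iff[OF \<Omega>b represents_diff[OF r(1) rv] p0 fin1] 2 by simp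
  have 4: "(\<lambda>k. Lp_norm p \<Omega> (\<lambda>x. grad (\<psi> k) x - h x)) \<longlonglongrightarrow> 0"
    using Lp_norm_tendsto_0_iff[OF \<Omega>b represents_diff[OF r(2) rh] p0 fin2] 2 by simp
  have "in_Lp p \<Omega> v" "in_Lp p \<Omega> h"
    using Lp_norm_represents(1)[OF \<Omega>b rv p0] Lp_norm_represents(1)[OF \<Omega>b rh p0] sD by auto
  then show "v \<in> W0 p \<Omega>" unfolding W0_def using wg 3 4 \<psi>(1) by blast
qed

theorem W0_sobolev0:
  fixes u \<rho>0 :: "'a::euclidean_space \<Rightarrow> real"
  assumes \<rho>0: "test_function U \<rho>0" "\<rho>0 z \<noteq> 0" and u: "u \<in> W0 p \<Omega>" and p: "1 \<le> p"
    and \<Omega>: "open \<Omega>" "bounded \<Omega>"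
  shows "\<exists>v h. sobolev0 p \<Omega> v h \<and> represents \<Omega> u v \<and> represents \<Omega> (weak_grad \<Omega> u) h"
proof -
  have \<Omega>b: "\<Omega> \<in> sets borel" using \<Omega> by simp
  have p0: "0 < p" using p by simp
  from u obtain g \<phi> where g: "in_Lp p \<Omega> u" "has_weak_gradient \<Omega> u g" "in_Lp p \<Omega> g" and \<phi>: "\<And>k. test_function \<Omega> (\<phi> k)"
    and lim: "(\<lambda>k. Lp_norm p \<Omega> (\<lambda>x. \<phi> k x - u x)) \<longlonglongrightarrow> 0" "(\<lambda>k. Lp_norm p \<Omega> (\<lambda>x. grad (\<phi> k) x - g x)) \<longlonglongrightarrow> 0"
    unfolding W0_def by blast
  obtain v where v: "represents \<Omega> u v" using ex_represents[OF \<Omega>b, of u] g(1) by (auto simp: in_Lp_def)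
  obtain h where h: "represents \<Omega> g h" using ex_represents[OF \<Omega>b, of g] g(3) by (auto simp: in_Lp_def)
  have vm: "v \<in> borel_measurable borel" "h \<in> borel_measurable borel" "\<And>x. x \<notin> \<Omega> \<Longrightarrow> v x = 0" "\<And>x. x \<notin> \<Omega> \<Longrightarrow> h x = 0"
    using v h by (auto simp: represents_def)
  have fin: "mass p v < \<infinity>" "mass p h < \<infinity>"
    using Lp_norm_represents(1)[OF \<Omega>b v p0] Lp_norm_represents(1)[OF \<Omega>b h p0] g by auto
  have C: "C1c \<Omega> (\<phi> k) (grad (\<phi> k))" for k by (rule test_functionD(2)[OF \<phi>])
  have zz: "\<phi> k x = 0" "grad (\<phi> k) x = 0" if "x \<notin> \<Omega>" for k x using C1c_support[OF C] that by (metis subsetD)+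
  have r: "represents \<Omega> (\<phi> k) (\<phi> k)" "represents \<Omega> (grad (\<phi> k)) (grad (\<phi> k))" for k
    using zz C1c_measurable[OF C] by (auto intro: represents_borel)
  have fin1: "mass p (\<lambda>x. \<phi> k x - v x) < \<infinity>" for k
    by (rule le_less_trans[OF mass_add[OF p0 C1c_measurable(1)[OF C] vm(1) norm_triangle_ineq4]])
       (use C1c_mass[OF C p0] fin in \<open>auto simp: ennreal_mult_less_top\<close>)
  have fin2: "mass p (\<lambda>x. grad (\<phi> k) x - h x) < \<infinity>" for k
    by (rule le_less_trans[OF mass_add[OF p0 C1c_measurable(2)[OF C] vm(2) norm_triangle_ineq4]])
       (use C1c_mass[OF C p0] fin in \<open>auto simp: ennreal_mult_less_top\<close>)
  have "Lp_null p (\<lambda>k x. \<phi> k x - v x)"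
    using Lp_norm_tendsto_0_iff[OF \<Omega>b represents_diff[OF r(1) v] p0 fin1] lim by simp
  moreover have "Lp_null p (\<lambda>k x. grad (\<phi> k) x - h x)"
    using Lp_norm_tendsto_0_iff[OF \<Omega>b represents_diff[OF r(2) h] p0 fin2] lim by simp
  ultimately have "sobolev0 p \<Omega> v h" by (intro sobolev0I[OF p0 vm C])
  moreover have "has_weak_gradient \<Omega> u (weak_grad \<Omega> u)" unfolding weak_grad_def using someI[of "has_weak_gradient \<Omega> u", OF g(2)] .
  from weak_gradient_unique[OF \<rho>0 \<Omega>(1) this g(2)] have "AE x in lborel. x \<in> \<Omega> \<longrightarrow> weak_grad \<Omega> u x = g x" .
  then have "represents \<Omega> (weak_grad \<Omega> u) h" using h unfolding represents_def by (auto elim: eventually_elim2)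
  ultimately show ?thesis using v by blast
qed

section \<open>Operations on the Sobolev space\<close>

lemma lipschitz_of_deriv:
  fixes F :: "real \<Rightarrow> real"
  assumes "\<And>s. (F has_real_derivative F' s) (at s)" "\<And>s. \<bar>F' s\<bar> \<le> M"
  shows "\<bar>F a - F b\<bar> \<le> M * \<bar>a - b\<bar>"
  using field_differentiable_bound[of UNIV F F' M b a] assms
  by (simp add: has_field_derivative_at_within abs_minus_commute)

text \<open>Product and chain rule. The approximating sequence is transformed in the same way; the bound
  on \<open>F'\<close> makes all terms converge except the one with \<open>F' (\<phi> k) - F' u\<close>,
  which is handled by dominated convergence.\<close>

lemma sobolev0_mult_compose:
  fixes u \<zeta> :: "'a::euclidean_space \<Rightarrow> real"
  assumes s: "sobolev0 p \<Omega> u g" and p: "0 < p"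
    and F: "\<And>s. (F has_real_derivative F' s) (at s)" "continuous_on UNIV F'" "\<And>s. \<bar>F' s\<bar> \<le> M"
    and \<zeta>: "C1 \<zeta> e" "\<And>x. \<bar>\<zeta> x\<bar> \<le> A" "\<And>x. norm (e x) \<le> A'"
    and or: "F 0 = 0 \<or> C1c \<Omega> \<zeta> e"
  shows "sobolev0 p \<Omega> (\<lambda>x. \<zeta> x * F (u x)) (\<lambda>x. \<zeta> x *\<^sub>R F' (u x) *\<^sub>R g x + F (u x) *\<^sub>R e x)"
proof -
  note sD = sobolev0D[OF s]
  obtain \<phi> d where ap: "approx_seq p \<Omega> u g \<phi> d" using s unfolding sobolev0_def by blast
  then have \<phi>: "\<And>k. C1c \<Omega> (\<phi> k) (d k)" and L: "Lp_null p (\<lambda>k x. \<phi> k x - u x)" "Lp_null p (\<lambda>k x. d k x - g x)"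
    and ae: "AE x in lborel. (\<lambda>k. \<phi> k x) \<longlonglongrightarrow> u x"
    by (auto simp: approx_seq_def)
  have M: "M \<ge> 0" using F(3) abs_ge_zero order_trans by blast
  have A: "A \<ge> 0" "A' \<ge> 0" using \<zeta> abs_ge_zero norm_ge_zero order_trans by blast+
  have "isCont F s" for s using F(1) DERIV_isCont by blast
  then have Fc: "continuous_on UNIV F" by (simp add: continuous_at_imp_continuous_on)
  have Fm[measurable]: "F \<in> borel_measurable borel" "F' \<in> borel_measurable borel"
    using Fc F(2) by (auto intro: borel_measurable_continuous_onI)
  have um[measurable]: "u \<in> borel_measurable borel" "g \<in> borel_measurable borel" using sD by auto
  have \<zeta>m[measurable]: "\<zeta> \<in> borel_measurable borel" "e \<in> borel_measurable borel" using C1_measurable[OF \<zeta>(1)] by auto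
  have \<phi>m[measurable]: "\<phi> k \<in> borel_measurable borel" "d k \<in> borel_measurable borel" for k using C1c_measurable[OF \<phi>] by auto
  note lip = lipschitz_of_deriv[of F F', OF F(1,3)]
  show ?thesis
  proof (rule sobolev0I[OF p])
    show "(\<lambda>x. \<zeta> x * F (u x)) \<in> borel_measurable borel" by measurable
    show "(\<lambda>x. \<zeta> x *\<^sub>R F' (u x) *\<^sub>R g x + F (u x) *\<^sub>R e x) \<in> borel_measurable borel" by measurable
    show "C1c \<Omega> (\<lambda>x. \<zeta> x * F (\<phi> k x)) (\<lambda>x. \<zeta> x *\<^sub>R F' (\<phi> k x) *\<^sub>R d k x + F (\<phi> k x) *\<^sub>R e x)" for k
    proof -
      have "C1 (\<lambda>x. \<zeta> x * F (\<phi> k x)) (\<lambda>x. \<zeta> x *\<^sub>R F' (\<phi> k x) *\<^sub>R d k x + F (\<phi> k x) *\<^sub>R e x)"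
        by (rule C1_mult[OF \<zeta>(1) C1_compose[OF C1c_C1[OF \<phi>] F(1,2)]])
      moreover obtain K where "compact K" "K \<subseteq> \<Omega>" "\<And>x. x \<notin> K \<Longrightarrow> \<phi> k x = 0"
        using C1c_support[OF \<phi>] by metis
      ultimately show ?thesis using or unfolding C1c_def by auto
    qed
    have z: "F 0 = 0 \<or> (\<zeta> x = 0 \<and> e x = 0)" if "x \<notin> \<Omega>" for x
      using or C1c_support[of \<Omega> \<zeta> e] that by (metis subsetD)
    show "\<zeta> x * F (u x) = 0" if "x \<notin> \<Omega>" for x using z[OF that] sD(3)[OF that] by auto
    show "\<zeta> x *\<^sub>R F' (u x) *\<^sub>R g x + F (u x) *\<^sub>R e x = 0" if "x \<notin> \<Omega>" for x
      using z[OF that] sD(3,4)[OF that] by auto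
    show "Lp_null p (\<lambda>k x. \<zeta> x * F (\<phi> k x) - \<zeta> x * F (u x))"
    proof (rule Lp_null_bound[OF L(1) p, of "A * M"])
      show "norm (\<zeta> x * F (\<phi> k x) - \<zeta> x * F (u x)) \<le> A * M * norm (\<phi> k x - u x)" for k x
      proof -
        have "\<bar>\<zeta> x\<bar> * \<bar>F (\<phi> k x) - F (u x)\<bar> \<le> A * (M * \<bar>\<phi> k x - u x\<bar>)"
          using lip \<zeta>(2) A by (intro mult_mono) auto
        then show ?thesis by (simp add: right_diff_distrib[symmetric] abs_mult mult.assoc)
      qed
    qed (use A M in auto)
    have "Lp_null p (\<lambda>k x. \<zeta> x *\<^sub>R F' (\<phi> k x) *\<^sub>R (d k x - g x))"
    proof (rule Lp_null_bound[OF L(2) p, of "A * M"])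
      show "norm (\<zeta> x *\<^sub>R F' (\<phi> k x) *\<^sub>R (d k x - g x)) \<le> A * M * norm (d k x - g x)" for k x
      proof -
        have "\<bar>\<zeta> x\<bar> * \<bar>F' (\<phi> k x)\<bar> \<le> A * M" using F(3) \<zeta>(2) A by (intro mult_mono) auto
        then have "\<bar>\<zeta> x\<bar> * \<bar>F' (\<phi> k x)\<bar> * norm (d k x - g x) \<le> A * M * norm (d k x - g x)"
          by (intro mult_right_mono) auto
        then show ?thesis by (simp add: mult.assoc abs_mult)
      qed
    qed (use A M in auto)
    moreover have "Lp_null p (\<lambda>k x. (F (\<phi> k x) - F (u x)) *\<^sub>R e x)"
    proof (rule Lp_null_bound[OF L(1) p, of "M * A'"])
      show "norm ((F (\<phi> k x) - F (u x)) *\<^sub>R e x) \<le> M * A' * norm (\<phi> k x - u x)" for k x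
      proof -
        have "\<bar>F (\<phi> k x) - F (u x)\<bar> * norm (e x) \<le> (M * \<bar>\<phi> k x - u x\<bar>) * A'"
          using lip \<zeta>(3) M by (intro mult_mono) auto
        then show ?thesis by (simp add: mult_ac)
      qed
    qed (use A M in auto)
    moreover have "Lp_null p (\<lambda>k x. (\<zeta> x * (F' (\<phi> k x) - F' (u x))) *\<^sub>R g x)"
    proof (rule Lp_null_dominated[where g = "\<lambda>x. (A * (2 * M)) *\<^sub>R g x"])
      have "mass p (\<lambda>x. (A * (2 * M)) *\<^sub>R g x) \<le> ennreal ((A * (2 * M)) powr p) * mass p g"
        using A M by (intro mass_scale[OF p _ um(2)]) auto
      then show "mass p (\<lambda>x. (A * (2 * M)) *\<^sub>R g x) < \<infinity>"
        using sD(6) by (auto simp: ennreal_mult_less_top intro: le_less_trans)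
      show "norm ((\<zeta> x * (F' (\<phi> k x) - F' (u x))) *\<^sub>R g x) \<le> norm ((A * (2 * M)) *\<^sub>R g x)" for k x
      proof -
        have "\<bar>F' (\<phi> k x) - F' (u x)\<bar> \<le> 2 * M" using F(3)[of "\<phi> k x"] F(3)[of "u x"] by linarith
        then have "\<bar>\<zeta> x\<bar> * \<bar>F' (\<phi> k x) - F' (u x)\<bar> \<le> A * (2 * M)" using \<zeta>(2) A by (intro mult_mono) auto
        moreover have "\<bar>A * (2 * M)\<bar> = A * (2 * M)" using A M by simp
        ultimately show ?thesis by (simp only: norm_scaleR abs_mult) (intro mult_right_mono, auto)
      qed
      show "AE x in lborel. (\<lambda>k. (\<zeta> x * (F' (\<phi> k x) - F' (u x))) *\<^sub>R g x) \<longlonglongrightarrow> 0"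
        using ae
      proof eventually_elim
        case (elim x)
        have "(\<lambda>k. F' (\<phi> k x)) \<longlonglongrightarrow> F' (u x)"
          using continuous_on_tendsto_compose[OF F(2) elim] by simp
        then have "(\<lambda>k. (\<zeta> x * (F' (\<phi> k x) - F' (u x))) *\<^sub>R g x) \<longlonglongrightarrow> (\<zeta> x * (F' (u x) - F' (u x))) *\<^sub>R g x"
          by (intro tendsto_intros)
        then show ?case by simp
      qed
    qed (use p in auto)
    ultimately have "Lp_null p (\<lambda>k x. (\<zeta> x *\<^sub>R F' (\<phi> k x) *\<^sub>R (d k x - g x) + (F (\<phi> k x) - F (u x)) *\<^sub>R e x)
        + (\<zeta> x * (F' (\<phi> k x) - F' (u x))) *\<^sub>R g x)"
      by (intro Lp_null_add p)
    moreover have "(\<zeta> x *\<^sub>R F' (\<phi> k x) *\<^sub>R (d k x - g x) + (F (\<phi> k x) - F (u x)) *\<^sub>R e x)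
        + (\<zeta> x * (F' (\<phi> k x) - F' (u x))) *\<^sub>R g x =
      (\<zeta> x *\<^sub>R F' (\<phi> k x) *\<^sub>R d k x + F (\<phi> k x) *\<^sub>R e x) - (\<zeta> x *\<^sub>R F' (u x) *\<^sub>R g x + F (u x) *\<^sub>R e x)" for k x
      by (simp add: algebra_simps)
    ultimately show "Lp_null p (\<lambda>k x. (\<zeta> x *\<^sub>R F' (\<phi> k x) *\<^sub>R d k x + F (\<phi> k x) *\<^sub>R e x) -
        (\<zeta> x *\<^sub>R F' (u x) *\<^sub>R g x + F (u x) *\<^sub>R e x))" by simp
  qed
qed

lemma sobolev0_compose:
  fixes u :: "'a::euclidean_space \<Rightarrow> real"
  assumes s: "sobolev0 p \<Omega> u g" and p: "0 < p"
    and F: "\<And>s. (F has_real_derivative F' s) (at s)" "continuous_on UNIV F'" "\<And>s. \<bar>F' s\<bar> \<le> M" "F 0 = 0"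
  shows "sobolev0 p \<Omega> (\<lambda>x. F (u x)) (\<lambda>x. F' (u x) *\<^sub>R g x)"
  using sobolev0_mult_compose[OF s p F(1-3) C1_const, of 1 1 0] F(4) by simp

lemma sobolev0_diff:
  fixes u :: "'a::euclidean_space \<Rightarrow> real"
  assumes s: "sobolev0 p \<Omega> u g" and t: "sobolev0 p \<Omega> v h" and p: "0 < p"
  shows "sobolev0 p \<Omega> (\<lambda>x. v x - u x) (\<lambda>x. h x - g x)"
proof -
  note sD = sobolev0D[OF s] and tD = sobolev0D[OF t]
  obtain \<phi> d where "approx_seq p \<Omega> u g \<phi> d" using s unfolding sobolev0_def by blast
  then have \<phi>: "\<And>k. C1c \<Omega> (\<phi> k) (d k)" and L: "Lp_null p (\<lambda>k x. \<phi> k x - u x)" "Lp_null p (\<lambda>k x. d k x - g x)"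
    by (auto simp: approx_seq_def)
  obtain \<psi> f where "approx_seq p \<Omega> v h \<psi> f" using t unfolding sobolev0_def by blast
  then have \<psi>: "\<And>k. C1c \<Omega> (\<psi> k) (f k)" and L': "Lp_null p (\<lambda>k x. \<psi> k x - v x)" "Lp_null p (\<lambda>k x. f k x - h x)"
    by (auto simp: approx_seq_def)
  show ?thesis
  proof (rule sobolev0I[OF p])
    show "C1c \<Omega> (\<lambda>x. \<psi> k x - \<phi> k x) (\<lambda>x. f k x - d k x)" for k
    proof -
      obtain K where K: "compact K" "K \<subseteq> \<Omega>" "\<And>x. x \<notin> K \<Longrightarrow> \<phi> k x = 0"
        using C1c_support[OF \<phi>] by metis
      obtain K' where K': "compact K'" "K' \<subseteq> \<Omega>" "\<And>x. x \<notin> K' \<Longrightarrow> \<psi> k x = 0"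
        using C1c_support[OF \<psi>] by metis
      have "\<psi> k x - \<phi> k x = 0" if "x \<notin> K \<union> K'" for x using K(3)[of x] K'(3)[of x] that by simp
      then show ?thesis unfolding C1c_def
        using C1_diff[OF C1c_C1[OF \<psi>] C1c_C1[OF \<phi>]] compact_Un[OF K(1) K'(1)] Un_least[OF K(2) K'(2)]
        by blast
    qed
    have "norm ((a - b) - (c - d)) \<le> norm (a - c) + norm (b - d)" for a b c d :: "'z::real_normed_vector"
      using norm_triangle_ineq4[of "a - c" "b - d"] by (simp add: algebra_simps)
    note tri = this
    show "Lp_null p (\<lambda>k x. \<psi> k x - \<phi> k x - (v x - u x))"
      by (rule Lp_null_add_bound[OF L'(1) L(1) p _ tri])
         (use C1c_measurable[OF \<phi>] C1c_measurable[OF \<psi>] sD tD in \<open>auto intro!: borel_measurable_diff\<close>)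
    show "Lp_null p (\<lambda>k x. f k x - d k x - (h x - g x))"
      by (rule Lp_null_add_bound[OF L'(2) L(2) p _ tri])
         (use C1c_measurable[OF \<phi>] C1c_measurable[OF \<psi>] sD tD in \<open>auto intro!: borel_measurable_diff\<close>)
  qed (use sD tD in auto)
qed

lemma mass_affine:
  fixes f :: "'a::euclidean_space \<Rightarrow> 'b::euclidean_space"
  assumes "f \<in> borel_measurable borel" "c > 0"
  shows "mass p (\<lambda>x. f (b + c *\<^sub>R x)) = ennreal (1 / c ^ DIM('a)) * mass p f"
proof -
  have "ennreal (1 / c ^ DIM('a)) * mass p f =
      ennreal (1 / c ^ DIM('a)) * (ennreal (\<bar>c\<bar> ^ DIM('a)) * mass p (\<lambda>x. f (b + c *\<^sub>R x)))"
    unfolding mass_def using assms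
    by (subst lborel_nn_integral_affine[of _ c b]) auto
  also have "\<dots> = ennreal ((1 / c ^ DIM('a)) * c ^ DIM('a)) * mass p (\<lambda>x. f (b + c *\<^sub>R x))"
    using assms by (simp add: mult.assoc[symmetric] ennreal_mult'[symmetric])
  finally show ?thesis using assms by simp
qed

text \<open>Dilating a function about the centre of a star-shaped domain by a factor \<open>t \<ge> 1\<close> contracts its
  support towards the centre, so the dilated function still vanishes at the boundary and is
  an admissible test function.\<close>

lemma sobolev0_dilate:
  fixes u :: "'a::euclidean_space \<Rightarrow> real"
  assumes s: "sobolev0 p \<Omega> u g" and p: "0 < p" and star: "\<And>x. x \<in> \<Omega> \<Longrightarrow> closed_segment a x \<subseteq> \<Omega>" and t: "t \<ge> 1"
  shows "sobolev0 p \<Omega> (\<lambda>x. u ((1 - t) *\<^sub>R a + t *\<^sub>R x)) (\<lambda>x. t *\<^sub>R g ((1 - t) *\<^sub>R a + t *\<^sub>R x))"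
proof -
  define b where "b = (1 - t) *\<^sub>R a"
  note sD = sobolev0D[OF s]
  obtain \<phi> d where "approx_seq p \<Omega> u g \<phi> d" using s unfolding sobolev0_def by blast
  then have \<phi>: "\<And>k. C1c \<Omega> (\<phi> k) (d k)" and L: "Lp_null p (\<lambda>k x. \<phi> k x - u x)" "Lp_null p (\<lambda>k x. d k x - g x)"
    by (auto simp: approx_seq_def)
  have inv: "x = (1 - 1/t) *\<^sub>R a + (1/t) *\<^sub>R (b + t *\<^sub>R x)" for x
    using t by (simp add: b_def algebra_simps)
  have shrink: "x \<in> \<Omega>" if "b + t *\<^sub>R x \<in> \<Omega>" for x
  proof -
    have "x \<in> closed_segment a (b + t *\<^sub>R x)"
      unfolding closed_segment_def using inv[of x] t by (auto intro!: exI[of _ "1/t"])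
    then show ?thesis using star[OF that] by blast
  qed
  have null: "Lp_null p (\<lambda>k x. f k (b + t *\<^sub>R x))" if f: "Lp_null p f" for f :: "nat \<Rightarrow> 'a \<Rightarrow> 'b::euclidean_space"
  proof -
    have fm: "f k \<in> borel_measurable borel" for k using f by (simp add: Lp_null_def)
    have "(\<lambda>k. ennreal (1 / t ^ DIM('a)) * mass p (f k)) \<longlonglongrightarrow> ennreal (1 / t ^ DIM('a)) * 0"
      using f by (intro ennreal_tendsto_cmult) (auto simp: Lp_null_def)
    then have "(\<lambda>k. mass p (\<lambda>x. f k (b + t *\<^sub>R x))) \<longlonglongrightarrow> 0"
      using t by (simp add: mass_affine[OF fm])
    then show ?thesis unfolding Lp_null_def using fm by auto
  qed
  show ?thesis unfolding b_def[symmetric]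
  proof (rule sobolev0I[OF p])
    show "u (b + t *\<^sub>R x) = 0" "t *\<^sub>R g (b + t *\<^sub>R x) = 0" if "x \<notin> \<Omega>" for x
      using sD(3,4) shrink that by auto
    show "C1c \<Omega> (\<lambda>x. \<phi> k (b + t *\<^sub>R x)) (\<lambda>x. t *\<^sub>R d k (b + t *\<^sub>R x))" for k
    proof -
      obtain K where K: "compact K" "K \<subseteq> \<Omega>" "\<And>x. x \<notin> K \<Longrightarrow> \<phi> k x = 0"
        using C1c_support[OF \<phi>] by metis
      define K' where "K' = (\<lambda>y. (1 - 1/t) *\<^sub>R a + (1/t) *\<^sub>R y) ` K"
      have "compact K'" unfolding K'_def using K(1) by (intro compact_continuous_image continuous_intros)
      moreover have "K' \<subseteq> \<Omega>"
      proof
        fix x assume "x \<in> K'"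
        then obtain y where y: "y \<in> K" "x = (1 - 1/t) *\<^sub>R a + (1/t) *\<^sub>R y" by (auto simp: K'_def)
        then have "x \<in> closed_segment a y" unfolding closed_segment_def using t by (auto intro!: exI[of _ "1/t"])
        then show "x \<in> \<Omega>" using star y K(2) by blast
      qed
      moreover have "\<phi> k (b + t *\<^sub>R x) = 0" if "x \<notin> K'" for x
        using that inv[of x] K(3) unfolding K'_def by (metis imageI)
      ultimately show ?thesis unfolding C1c_def using C1_affine[OF C1c_C1[OF \<phi>]] by blast
    qed
    show "Lp_null p (\<lambda>k x. \<phi> k (b + t *\<^sub>R x) - u (b + t *\<^sub>R x))" using null[OF L(1)] .
    show "Lp_null p (\<lambda>k x. t *\<^sub>R d k (b + t *\<^sub>R x) - t *\<^sub>R g (b + t *\<^sub>R x))"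
      by (rule Lp_null_bound[OF null[OF L(2)] p, of t])
         (use t sD C1c_measurable[OF \<phi>] in \<open>auto simp: scaleR_diff_right[symmetric]\<close>)
  qed (use sD in auto)
qed

section \<open>Integral inequalities from the fundamental theorem of calculus along segments\<close>

text \<open>With \<open>r = p - 1\<close>, one \<open>p\<close>-th of the derivative of
  \<open>\<bar>s\<bar> powr p\<close>.\<close>

definition signed_powr :: "real \<Rightarrow> real \<Rightarrow> real" where
  "signed_powr r s = \<bar>s\<bar> powr r * sgn s"

lemma abs_signed_powr: "\<bar>signed_powr r s\<bar> = \<bar>s\<bar> powr r"
  by (cases "s = 0") (auto simp: signed_powr_def abs_mult)

lemma signed_powr_mult_self: "signed_powr (p - 1) s * s = \<bar>s\<bar> powr p"
proof (cases "s = 0")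
  case False
  have "\<bar>s\<bar> powr p = \<bar>s\<bar> powr (p - 1) * \<bar>s\<bar> powr 1" by (simp only: powr_add[symmetric]) simp
  then show ?thesis using False by (simp add: signed_powr_def sgn_if)
qed (simp add: signed_powr_def)

lemma powr_young:
  fixes a b :: real
  assumes "1 < p" "0 \<le> a" "0 \<le> b" shows "a powr (p - 1) * b \<le> (1 - 1/p) * a powr p + b powr p / p"
proof -
  define q where "q = p / (p - 1)"
  have q: "q > 1" "1/q + 1/p = 1" using assms by (auto simp: q_def field_simps)
  have "(a powr (p - 1)) * b \<le> (a powr (p - 1)) powr q / q + b powr p / p"
    using q assms by (intro Youngs_inequality) auto
  also have "(a powr (p - 1)) powr q = a powr p" using assms by (simp add: powr_powr q_def)
  also have "a powr p / q = (1/q) * a powr p" by simp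
  also have "1/q = 1 - 1/p" using q(2) by linarith
  finally show ?thesis .
qed

text \<open>The tangent line inequality for \<open>\<bar>s\<bar> powr p\<close>: Young's inequality bounds the linear term.\<close>

lemma powr_tangent:
  assumes p: "1 < p" shows "\<bar>a\<bar> powr p + p * signed_powr (p - 1) a * (b - a) \<le> \<bar>b\<bar> powr p"
proof -
  have "signed_powr (p - 1) a * b \<le> \<bar>a\<bar> powr (p - 1) * \<bar>b\<bar>"
    using abs_ge_self[of "signed_powr (p - 1) a * b"] by (simp add: abs_mult abs_signed_powr)
  also have "\<dots> \<le> (1 - 1/p) * \<bar>a\<bar> powr p + \<bar>b\<bar> powr p / p" using p by (intro powr_young) auto
  finally have "p * (signed_powr (p - 1) a * b) \<le> p * ((1 - 1/p) * \<bar>a\<bar> powr p + \<bar>b\<bar> powr p / p)"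
    using p by simp
  also have "\<dots> = (p - 1) * \<bar>a\<bar> powr p + \<bar>b\<bar> powr p" using p by (simp add: field_simps)
  finally show ?thesis
    using signed_powr_mult_self[of p a] by (simp add: right_diff_distrib left_diff_distrib mult.assoc)
qed

text \<open>Jensen's inequality for the integral of the derivative along a segment; the tangent to the
  power at the mean value integrates to the claim.\<close>

lemma segment_inequality:
  fixes f :: "'a::euclidean_space \<Rightarrow> real"
  assumes f: "C1 f d" and p: "1 < p"
  shows "ennreal (\<bar>f y - f x\<bar> powr p) \<le>
    (\<integral>\<^sup>+s. indicator {0..1} s * ennreal (\<bar>d (x + s *\<^sub>R (y - x)) \<bullet> (y - x)\<bar> powr p) \<partial>lborel)"
proof -
  define h where "h s = d (x + s *\<^sub>R (y - x)) \<bullet> (y - x)" for s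
  have "continuous_on UNIV d" using f by (simp add: C1_def)
  then have "continuous_on UNIV (\<lambda>s. d (x + s *\<^sub>R (y - x)))"
    by (rule continuous_on_compose2) (auto intro!: continuous_intros)
  then have hc: "continuous_on UNIV h" unfolding h_def[abs_def] by (intro continuous_on_inner continuous_on_const)
  have hm[measurable]: "h \<in> borel_measurable borel" using hc by (rule borel_measurable_continuous_onI)
  define m where "m = f y - f x"
  have "has_bochner_integral lborel (\<lambda>s. h s * indicator {0..1} s) (f (x + 1 *\<^sub>R (y - x)) - f (x + 0 *\<^sub>R (y - x)))"
    using C1_line[OF f, of x "y - x" _ UNIV] hc
    by (intro has_bochner_integral_FTC_Icc_real) (auto simp: h_def continuous_on_eq_continuous_at)
  then have hI: "integrable lborel (\<lambda>s. h s * indicator {0..1} s)" "(\<integral>s. h s * indicator {0..1} s \<partial>lborel) = m"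
    by (auto simp: has_bochner_integral_iff m_def)
  have oneI: "integrable lborel (indicator {0..1::real} :: real \<Rightarrow> real)" by simp
  have one: "(\<integral>s. indicator {0..1::real} s \<partial>lborel) = (1::real)" by simp
  have "continuous_on UNIV (\<lambda>s. \<bar>h s\<bar> powr p)"
    using hc p by (intro continuous_on_powr' continuous_intros) auto
  then have pI: "integrable lborel (\<lambda>s. indicator {0..1} s *\<^sub>R (\<bar>h s\<bar> powr p))"
    by (intro borel_integrable_compact) (auto intro: continuous_on_subset)
  define T where "T s = indicator {0..1} s * (\<bar>m\<bar> powr p) + p * signed_powr (p - 1) m * (h s * indicator {0..1} s - m * indicator {0..1} s)" for s :: real
  have "(\<integral>s. T s \<partial>lborel) = \<bar>m\<bar> powr p"
    unfolding T_def using hI oneI one by simp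
  moreover have "(\<integral>s. T s \<partial>lborel) \<le> (\<integral>s. indicator {0..1} s *\<^sub>R (\<bar>h s\<bar> powr p) \<partial>lborel)"
  proof (rule integral_mono)
    show "integrable lborel T" unfolding T_def using hI oneI by simp
    show "T s \<le> indicator {0..1} s *\<^sub>R (\<bar>h s\<bar> powr p)" for s
      using powr_tangent[OF p, of m "h s"] by (simp add: T_def indicator_def)
  qed (rule pI)
  ultimately have "ennreal (\<bar>m\<bar> powr p) \<le> ennreal (\<integral>s. indicator {0..1} s *\<^sub>R (\<bar>h s\<bar> powr p) \<partial>lborel)"
    by (simp add: ennreal_leI)
  also have "\<dots> = (\<integral>\<^sup>+s. ennreal (indicator {0..1} s *\<^sub>R (\<bar>h s\<bar> powr p)) \<partial>lborel)"
    using pI by (intro nn_integral_eq_integral[symmetric]) auto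
  also have "\<dots> = (\<integral>\<^sup>+s. indicator {0..1} s * ennreal (\<bar>h s\<bar> powr p) \<partial>lborel)"
    by (intro nn_integral_cong) (auto simp: indicator_def)
  finally show ?thesis by (simp add: h_def m_def)
qed

lemma translation_estimate:
  fixes f :: "'a::euclidean_space \<Rightarrow> real"
  assumes f: "C1 f d" and p: "1 < p"
  shows "mass p (\<lambda>x. f (x + h) - f x) \<le> mass p (\<lambda>x. d x \<bullet> h)"
proof -
  have dm[measurable]: "d \<in> borel_measurable borel" by (rule C1_measurable(2)[OF f])
  have "mass p (\<lambda>x. f (x + h) - f x) \<le>
      (\<integral>\<^sup>+x. (\<integral>\<^sup>+s. indicator {0..1} s * ennreal (\<bar>d (x + s *\<^sub>R h) \<bullet> h\<bar> powr p) \<partial>lborel) \<partial>lborel)"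
    unfolding mass_def
  proof (rule nn_integral_mono)
    fix x
    show "ennreal (norm (f (x + h) - f x) powr p) \<le>
        (\<integral>\<^sup>+s. indicator {0..1} s * ennreal (\<bar>d (x + s *\<^sub>R h) \<bullet> h\<bar> powr p) \<partial>lborel)"
      using segment_inequality[OF f p, of "x + h" x] by simp
  qed
  also have "\<dots> = (\<integral>\<^sup>+s. (\<integral>\<^sup>+x. indicator {0..1} s * ennreal (\<bar>d (x + s *\<^sub>R h) \<bullet> h\<bar> powr p) \<partial>lborel) \<partial>(lborel::real measure))"
    by (rule lborel_pair.Fubini') measurable
  also have "\<dots> = (\<integral>\<^sup>+s. indicator {0..1} s * mass p (\<lambda>x. d x \<bullet> h) \<partial>(lborel::real measure))"
  proof (rule nn_integral_cong)
    fix s :: real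
    have "mass p (\<lambda>x. d x \<bullet> h) = (\<integral>\<^sup>+x. ennreal (norm (d (s *\<^sub>R h + 1 *\<^sub>R x) \<bullet> h) powr p) \<partial>lborel)"
      unfolding mass_def by (subst lborel_nn_integral_affine[of _ 1 "s *\<^sub>R h"]) auto
    then show "(\<integral>\<^sup>+x. indicator {0..1} s * ennreal (\<bar>d (x + s *\<^sub>R h) \<bullet> h\<bar> powr p) \<partial>lborel) =
        indicator {0..1} s * mass p (\<lambda>x. d x \<bullet> h)"
      by (subst nn_integral_cmult) (auto simp: add.commute)
  qed
  also have "\<dots> = mass p (\<lambda>x. d x \<bullet> h)" by (simp add: nn_integral_multc)
  finally show ?thesis .
qed

lemma mass_inner_le:
  fixes g :: "'a::euclidean_space \<Rightarrow> 'a"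
  assumes "0 < p" "g \<in> borel_measurable borel"
  shows "mass p (\<lambda>x. g x \<bullet> h) \<le> ennreal (norm h powr p) * mass p g"
proof (rule mass_scale[OF assms(1) norm_ge_zero assms(2)])
  show "norm (g x \<bullet> h) \<le> norm h * norm (g x)" for x
    using Cauchy_Schwarz_ineq2[of "g x" h] by (simp add: mult.commute)
qed

text \<open>Translating a function off its own support shows that the derivative in a single direction
  already controls the function.\<close>

lemma directional_poincare_C1c:
  fixes f :: "'a::euclidean_space \<Rightarrow> real"
  assumes f: "C1c (cball a R) f d" and p: "1 < p" and h: "norm h > 2 * R"
  shows "mass p f \<le> mass p (\<lambda>x. d x \<bullet> h)"
proof -
  have z: "f x = 0 \<or> f (x + h) = 0" for x
  proof (rule ccontr)
    assume "\<not> (f x = 0 \<or> f (x + h) = 0)"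
    then have "x \<in> cball a R" "x + h \<in> cball a R" using C1c_support[OF f] by (metis subsetD)+
    then have "norm (x + h - x) \<le> R + R" using dist_triangle2[of "x + h" x a] by (auto simp: dist_norm norm_minus_commute)
    then show False using h by simp
  qed
  have "mass p f \<le> mass p (\<lambda>x. f (x + h) - f x)"
    unfolding mass_def
  proof (rule nn_integral_mono)
    fix x
    show "ennreal (norm (f x) powr p) \<le> ennreal (norm (f (x + h) - f x) powr p)"
      using z[of x] by (cases "f x = 0") auto
  qed
  also have "\<dots> \<le> mass p (\<lambda>x. d x \<bullet> h)" by (rule translation_estimate[OF C1c_C1[OF f] p])
  finally show ?thesis .
qed

text \<open>The dilation moves the points of the ball \<open>cball a R\<close> by at most \<open>(t - 1)
  R\<close>, and the points in between are dilations with factors at least 1, which do not increase the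
  mass of the gradient.\<close>

lemma dilation_estimate_C1c:
  fixes f :: "'a::euclidean_space \<Rightarrow> real"
  assumes f: "C1c (cball a R) f d" and p: "1 < p" and t: "1 \<le> t" and R: "0 \<le> R"
  shows "mass p (\<lambda>x. f ((1 - t) *\<^sub>R a + t *\<^sub>R x) - f x) \<le> ennreal (((t - 1) * R) powr p) * mass p d"
proof -
  have C: "C1 f d" using f by (rule C1c_C1)
  have dm[measurable]: "d \<in> borel_measurable borel" by (rule C1_measurable(2)[OF C])
  define T where "T s = 1 + s * (t - 1)" for s :: real
  have inner: "(\<integral>\<^sup>+s. indicator {0..1} s * ennreal (\<bar>d (x + s *\<^sub>R (t - 1) *\<^sub>R (x - a)) \<bullet> ((t - 1) *\<^sub>R (x - a))\<bar> powr p) \<partial>lborel)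
      \<le> (\<integral>\<^sup>+s. indicator {0..1} s * (ennreal (((t - 1) * R) powr p) * ennreal (norm (d ((1 - T s) *\<^sub>R a + T s *\<^sub>R x)) powr p)) \<partial>lborel)" for x
  proof (rule nn_integral_mono)
    fix s :: real
    define y where "y = (1 - T s) *\<^sub>R a + T s *\<^sub>R x"
    have y: "x + s *\<^sub>R (t - 1) *\<^sub>R (x - a) = y" by (simp add: y_def T_def algebra_simps)
    have "\<bar>d y \<bullet> ((t - 1) *\<^sub>R (x - a))\<bar> \<le> ((t - 1) * R) * norm (d y)" if s: "s \<in> {0..1}"
    proof (cases "d y = 0")
      case False
      then have "y \<in> cball a R" using C1c_support[OF f] by (metis subsetD)
      moreover have "y - a = T s *\<^sub>R (x - a)" by (simp add: y_def algebra_simps)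
      moreover have T1: "T s \<ge> 1" using s t by (simp add: T_def)
      ultimately have "T s * norm (x - a) \<le> R"
        by (metis abs_of_nonneg dist_norm mem_cball norm_minus_commute norm_scaleR order_trans zero_le_one)
      moreover have "1 * norm (x - a) \<le> T s * norm (x - a)" using T1 by (intro mult_right_mono) auto
      ultimately have n: "norm (x - a) \<le> R" by simp
      have "\<bar>d y \<bullet> ((t - 1) *\<^sub>R (x - a))\<bar> \<le> norm (d y) * norm ((t - 1) *\<^sub>R (x - a))" by (rule Cauchy_Schwarz_ineq2)
      also have "\<dots> \<le> norm (d y) * ((t - 1) * R)" using n t by (intro mult_left_mono) (auto intro: mult_left_mono)
      finally show ?thesis by (simp add: mult.commute)
    qed simp
    then have "\<bar>d y \<bullet> ((t - 1) *\<^sub>R (x - a))\<bar> powr p \<le> ((t - 1) * R) powr p * norm (d y) powr p" if "s \<in> {0..1}"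
      using that p t R powr_mono2[of p "\<bar>d y \<bullet> ((t - 1) *\<^sub>R (x - a))\<bar>" "((t - 1) * R) * norm (d y)"]
      by (simp add: powr_mult)
    then show "indicator {0..1} s * ennreal (\<bar>d (x + s *\<^sub>R (t - 1) *\<^sub>R (x - a)) \<bullet> ((t - 1) *\<^sub>R (x - a))\<bar> powr p) \<le>
        indicator {0..1} s * (ennreal (((t - 1) * R) powr p) * ennreal (norm (d ((1 - T s) *\<^sub>R a + T s *\<^sub>R x)) powr p))"
      unfolding y y_def[symmetric] by (cases "s \<in> {0..1}") (auto simp: ennreal_mult'[symmetric] intro!: ennreal_leI)
  qed
  have seg: "x + (t - 1) *\<^sub>R (x - a) = (1 - t) *\<^sub>R a + t *\<^sub>R x" for x by (simp add: algebra_simps)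
  have "mass p (\<lambda>x. f ((1 - t) *\<^sub>R a + t *\<^sub>R x) - f x) \<le>
    (\<integral>\<^sup>+x. (\<integral>\<^sup>+s. indicator {0..1} s * (ennreal (((t - 1) * R) powr p) * ennreal (norm (d ((1 - T s) *\<^sub>R a + T s *\<^sub>R x)) powr p)) \<partial>lborel) \<partial>lborel)"
    unfolding mass_def
  proof (rule nn_integral_mono)
    fix x
    show "ennreal (norm (f ((1 - t) *\<^sub>R a + t *\<^sub>R x) - f x) powr p) \<le>
      (\<integral>\<^sup>+s. indicator {0..1} s * (ennreal (((t - 1) * R) powr p) * ennreal (norm (d ((1 - T s) *\<^sub>R a + T s *\<^sub>R x)) powr p)) \<partial>lborel)"
      using order_trans[OF segment_inequality[OF C p, of "x + (t - 1) *\<^sub>R (x - a)" x, unfolded add_diff_cancel_left'] inner]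
      by (simp add: seg)
  qed
  also have "\<dots> = (\<integral>\<^sup>+s. (\<integral>\<^sup>+x. indicator {0..1} s * (ennreal (((t - 1) * R) powr p) * ennreal (norm (d ((1 - T s) *\<^sub>R a + T s *\<^sub>R x)) powr p)) \<partial>lborel) \<partial>(lborel::real measure))"
    unfolding T_def by (rule lborel_pair.Fubini') measurable
  also have "\<dots> \<le> (\<integral>\<^sup>+s. indicator {0..1} s * (ennreal (((t - 1) * R) powr p) * mass p d) \<partial>(lborel::real measure))"
  proof (rule nn_integral_mono)
    fix s :: real
    show "(\<integral>\<^sup>+x. indicator {0..1} s * (ennreal (((t - 1) * R) powr p) * ennreal (norm (d ((1 - T s) *\<^sub>R a + T s *\<^sub>R x)) powr p)) \<partial>lborel)
        \<le> indicator {0..1} s * (ennreal (((t - 1) * R) powr p) * mass p d)"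
    proof (cases "s \<in> {0..1}")
      case True
      then have T1: "T s \<ge> 1" using t by (simp add: T_def)
      have "(\<integral>\<^sup>+x. ennreal (((t - 1) * R) powr p) * ennreal (norm (d ((1 - T s) *\<^sub>R a + T s *\<^sub>R x)) powr p) \<partial>lborel)
        = ennreal (((t - 1) * R) powr p) * mass p (\<lambda>x. d ((1 - T s) *\<^sub>R a + T s *\<^sub>R x))"
        unfolding mass_def by (subst nn_integral_cmult) auto
      also have "mass p (\<lambda>x. d ((1 - T s) *\<^sub>R a + T s *\<^sub>R x)) = ennreal (1 / T s ^ DIM('a)) * mass p d"
        using T1 by (intro mass_affine) auto
      also have "\<dots> \<le> 1 * mass p d"
        using T1 by (intro mult_right_mono) (auto simp: one_le_power divide_le_eq_1)
      finally show ?thesis using True by (simp add: mult_left_mono)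
    qed simp
  qed
  also have "\<dots> = ennreal (((t - 1) * R) powr p) * mass p d" by (simp add: nn_integral_multc)
  finally show ?thesis .
qed

text \<open>Inequalities pass from continuously differentiable functions to the Sobolev space: the left-hand
  side by Fatou's lemma, the right-hand side by convergence in the mean, at the price of the
  harmless factor \<open>2 powr p\<close>.\<close>

lemma mass_limit:
  fixes w :: "nat \<Rightarrow> 'd::euclidean_space \<Rightarrow> 'b::euclidean_space" and v :: "nat \<Rightarrow> 'a::euclidean_space \<Rightarrow> 'c::euclidean_space"
  assumes p: "0 < p" and q: "0 < q" and w: "\<And>k. w k \<in> borel_measurable borel" "w0 \<in> borel_measurable borel" "AE x in lborel. (\<lambda>k. w k x) \<longlonglongrightarrow> w0 x"
    and v: "\<And>k. v k \<in> borel_measurable borel" "v0 \<in> borel_measurable borel" "Lp_null p (\<lambda>k x. v k x - v0 x)"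
    and bound: "\<And>k D. D > 0 \<Longrightarrow> mass p (v k) \<le> ennreal D \<Longrightarrow> mass q (w k) \<le> ennreal (B D)"
    and D0: "mass p v0 = ennreal D0" "D0 \<ge> 0" and B: "(B \<longlongrightarrow> B (2 powr p * D0)) (at_right (2 powr p * D0))"
  shows "mass q w0 \<le> ennreal (B (2 powr p * D0))"
proof -
  have ge: "mass q w0 \<le> ennreal (B D)" if D: "D > 2 powr p * D0" for D
  proof -
    have Dpos: "D > 0" using D D0(2) by (meson le_less_trans mult_nonneg_nonneg powr_ge_zero)
    have "(\<lambda>k. ennreal (2 powr p) * (mass p (\<lambda>x. v k x - v0 x) + mass p v0)) \<longlonglongrightarrow> ennreal (2 powr p) * (0 + mass p v0)"
      using v(3) by (intro ennreal_tendsto_cmult tendsto_add) (auto simp: Lp_null_def)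
    moreover have "ennreal (2 powr p) * (0 + mass p v0) < ennreal D"
      using D D0 by (simp add: ennreal_mult'[symmetric] ennreal_lessI Dpos)
    ultimately have "\<forall>\<^sub>F k in sequentially. ennreal (2 powr p) * (mass p (\<lambda>x. v k x - v0 x) + mass p v0) < ennreal D"
      by (rule order_tendstoD(2))
    then have ev: "\<forall>\<^sub>F k in sequentially. mass q (w k) \<le> ennreal (B D)"
    proof eventually_elim
      case (elim k)
      have "mass p (v k) \<le> ennreal (2 powr p) * (mass p (\<lambda>x. v k x - v0 x) + mass p v0)"
        by (rule mass_add[OF p]) (use v in \<open>auto intro: norm_triangle_sub simp: add.commute\<close>)
      then show ?case using elim Dpos by (intro bound) auto
    qed
    have "mass q w0 = (\<integral>\<^sup>+x. liminf (\<lambda>k. ennreal (norm (w k x) powr q)) \<partial>lborel)"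
      unfolding mass_def
    proof (rule nn_integral_cong_AE, use w(3) in eventually_elim)
      case (elim x)
      have "(\<lambda>k. norm (w k x) powr q) \<longlonglongrightarrow> norm (w0 x) powr q"
        using elim q by (intro tendsto_powr' tendsto_norm) auto
      then have "(\<lambda>k. ennreal (norm (w k x) powr q)) \<longlonglongrightarrow> ennreal (norm (w0 x) powr q)" by (rule tendsto_ennrealI)
      then show ?case using lim_imp_Liminf[OF sequentially_bot] by metis
    qed
    also have "\<dots> \<le> liminf (\<lambda>k. mass q (w k))"
      unfolding mass_def using w by (intro nn_integral_liminf) auto
    also have "\<dots> \<le> ennreal (B D)" using ev by (intro Liminf_le) auto
    finally show ?thesis .
  qed
  have "((\<lambda>D. ennreal (B D)) \<longlongrightarrow> ennreal (B (2 powr p * D0))) (at_right (2 powr p * D0))"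
    by (rule tendsto_ennrealI[OF B])
  moreover have "\<forall>\<^sub>F D in at_right (2 powr p * D0). mass q w0 \<le> ennreal (B D)"
    using ge by (auto simp: eventually_at_right_field intro!: exI[of _ "2 powr p * D0 + 1"])
  ultimately show ?thesis by (rule tendsto_lowerbound) simp
qed

lemma mass_real: "mass p f < \<infinity> \<Longrightarrow> mass p f = ennreal (enn2real (mass p f))"
  by simp

lemma directional_poincare:
  fixes u :: "'a::euclidean_space \<Rightarrow> real"
  assumes s: "sobolev0 p \<Omega> u g" and p: "1 < p" and b: "\<Omega> \<subseteq> cball a R" and h: "norm h > 2 * R"
  shows "mass p u \<le> ennreal (2 powr p) * mass p (\<lambda>x. g x \<bullet> h)"
proof -
  note sD = sobolev0D[OF s]
  obtain \<phi> d where "approx_seq p \<Omega> u g \<phi> d" using s unfolding sobolev0_def by blast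
  then have \<phi>: "\<And>k. C1c \<Omega> (\<phi> k) (d k)" and L: "Lp_null p (\<lambda>k x. \<phi> k x - u x)" "Lp_null p (\<lambda>k x. d k x - g x)"
    and ae: "AE x in lborel. (\<lambda>k. \<phi> k x) \<longlonglongrightarrow> u x"
    by (auto simp: approx_seq_def)
  have p0: "0 < p" using p by simp
  have fin: "mass p (\<lambda>x. g x \<bullet> h) < \<infinity>"
    using mass_inner_le[OF p0 sD(2), of h] sD(6) by (auto simp: ennreal_mult_less_top intro: le_less_trans)
  have L': "Lp_null p (\<lambda>k x. d k x \<bullet> h - g x \<bullet> h)"
    by (rule Lp_null_bound[OF L(2) p0, of "norm h"])
       (use C1c_measurable[OF \<phi>] sD in \<open>auto simp: inner_diff_left[symmetric] Cauchy_Schwarz_ineq2 mult.commute[of "norm h"]\<close>)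
  have "mass p u \<le> ennreal ((2 powr p * enn2real (mass p (\<lambda>x. g x \<bullet> h))))"
  proof (rule mass_limit[OF p0 p0 _ sD(1) ae _ _ L' _ mass_real[OF fin], where B = "\<lambda>D. D"])
    show "mass p (\<phi> k) \<le> ennreal D" if "mass p (\<lambda>x. d k x \<bullet> h) \<le> ennreal D" for k D
      using directional_poincare_C1c[OF C1c_mono[OF \<phi> b] p h] that order_trans by blast
  qed (use C1c_measurable[OF \<phi>] sD in \<open>auto intro: tendsto_ident_at\<close>)
  also have "\<dots> = ennreal (2 powr p) * mass p (\<lambda>x. g x \<bullet> h)"
    using fin by (simp add: ennreal_mult)
  finally show ?thesis .
qed

lemma dilation_estimate:
  fixes u :: "'a::euclidean_space \<Rightarrow> real"
  assumes s: "sobolev0 p \<Omega> u g" and p: "1 < p" and b: "\<Omega> \<subseteq> cball a R" and t: "1 \<le> t" and R: "0 \<le> R"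
  shows "mass p (\<lambda>x. u ((1 - t) *\<^sub>R a + t *\<^sub>R x) - u x) \<le> ennreal (((t - 1) * R) powr p) * (ennreal (2 powr p) * mass p g)"
proof -
  note sD = sobolev0D[OF s]
  obtain \<phi> d where "approx_seq p \<Omega> u g \<phi> d" using s unfolding sobolev0_def by blast
  then have \<phi>: "\<And>k. C1c \<Omega> (\<phi> k) (d k)" and L: "Lp_null p (\<lambda>k x. \<phi> k x - u x)" "Lp_null p (\<lambda>k x. d k x - g x)"
    and ae: "AE x in lborel. (\<lambda>k. \<phi> k x) \<longlonglongrightarrow> u x"
    by (auto simp: approx_seq_def)
  have p0: "0 < p" using p by simp
  define c where "c = ((t - 1) * R) powr p"
  define b where "b = (1 - t) *\<^sub>R a"
  have T: "(lborel :: 'a measure) = density (distr lborel borel (\<lambda>x. b + t *\<^sub>R x)) (\<lambda>_. \<bar>t\<bar> ^ DIM('a))"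
    using t by (intro lborel_affine) simp
  have "AE x in density (distr lborel borel (\<lambda>x. b + t *\<^sub>R x)) (\<lambda>_. \<bar>t\<bar> ^ DIM('a)). (\<lambda>k. \<phi> k x) \<longlonglongrightarrow> u x"
    using ae by (subst T[symmetric])
  then have "AE x in distr lborel borel (\<lambda>x. b + t *\<^sub>R x). (\<lambda>k. \<phi> k x) \<longlonglongrightarrow> u x"
    using t by (subst (asm) AE_density) auto
  then have ae2: "AE x in lborel. (\<lambda>k. \<phi> k (b + t *\<^sub>R x)) \<longlonglongrightarrow> u (b + t *\<^sub>R x)"
    by (rule AE_distrD[rotated]) simp
  have ae3: "AE x in lborel. (\<lambda>k. \<phi> k (b + t *\<^sub>R x) - \<phi> k x) \<longlonglongrightarrow> u (b + t *\<^sub>R x) - u x"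
    using ae ae2 by eventually_elim (rule tendsto_diff)
  have mm: "(\<lambda>x. f (b + t *\<^sub>R x) - f x) \<in> borel_measurable borel" if "f \<in> borel_measurable borel" for f :: "'a \<Rightarrow> real"
    using that by measurable
  have "mass p (\<lambda>x. u (b + t *\<^sub>R x) - u x) \<le> ennreal (c * (2 powr p * enn2real (mass p g)))"
  proof (rule mass_limit[OF p0 p0 mm[OF C1c_measurable(1)[OF \<phi>]] mm[OF sD(1)] ae3 C1c_measurable(2)[OF \<phi>] sD(2) L(2) _ mass_real[OF sD(6)], where B = "\<lambda>D. c * D"])
    show "mass p (\<lambda>x. \<phi> k (b + t *\<^sub>R x) - \<phi> k x) \<le> ennreal (c * D)" if "mass p (d k) \<le> ennreal D" for k D
    proof -
      have "mass p (\<lambda>x. \<phi> k (b + t *\<^sub>R x) - \<phi> k x) \<le> ennreal c * mass p (d k)"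
        unfolding b_def c_def by (rule dilation_estimate_C1c[OF C1c_mono[OF \<phi> assms(3)] p t R])
      also have "\<dots> \<le> ennreal c * ennreal D" using that by (intro mult_left_mono) auto
      finally show ?thesis by (simp add: ennreal_mult' c_def)
    qed
  qed (auto intro!: tendsto_intros)
  also have "\<dots> = ennreal c * (ennreal (2 powr p) * mass p g)"
    using sD(6) by (simp add: ennreal_mult c_def)
  finally show ?thesis unfolding b_def c_def .
qed

lemma borel_fst_snd:
  "(fst :: 'a::second_countable_topology \<times> 'b::second_countable_topology \<Rightarrow> 'a) \<in> borel \<rightarrow>\<^sub>M borel"
  "(snd :: 'a::second_countable_topology \<times> 'b::second_countable_topology \<Rightarrow> 'b) \<in> borel \<rightarrow>\<^sub>M borel"
  by (auto simp: borel_prod[symmetric])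

lemma ball_poincare_C1:
  fixes f :: "'a::euclidean_space \<Rightarrow> real"
  assumes f: "C1 f d" and p: "1 < p" and \<rho>: "0 < \<rho>" and Z: "Z \<in> sets borel" "Z \<subseteq> ball y \<rho>"
  shows "mass p (\<lambda>w. indicator Z (fst w) * indicator (ball y \<rho>) (snd w) * (f (snd w) - f (fst w))) \<le>
    ennreal ((2 * \<rho>) powr p * (measure lborel (ball y \<rho>) * 2 ^ DIM('a))) * mass p (\<lambda>x. indicator (ball y \<rho>) x *\<^sub>R d x)"
proof -
  define B where "B = ball y \<rho>"
  have Bm[measurable]: "B \<in> sets borel" by (simp add: B_def)
  have dm[measurable]: "d \<in> borel_measurable borel" by (rule C1_measurable(2)[OF f])
  define H where "H x = (ennreal (norm (indicator B x *\<^sub>R d x) powr p))" for x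
  have Hm[measurable]: "H \<in> borel_measurable borel" unfolding H_def[abs_def] by measurable
  define c where "c = ennreal ((2 * \<rho>) powr p)"
  define G where "G w s = indicator {0..1} s * (indicator B (fst w) * indicator B (snd w) * (c * H ((1 - s) *\<^sub>R fst w + s *\<^sub>R snd w)))" for w :: "'a \<times> 'a" and s :: real
  note fs[measurable] = borel_fst_snd[where 'a = 'a and 'b = 'a]
  have fs2[measurable]: "(\<lambda>x. fst (fst x)) \<in> (borel :: ('a \<times> 'a) measure) \<Otimes>\<^sub>M (borel :: real measure) \<rightarrow>\<^sub>M borel"
     "(\<lambda>x. snd (fst x)) \<in> (borel :: ('a \<times> 'a) measure) \<Otimes>\<^sub>M (borel :: real measure) \<rightarrow>\<^sub>M borel"
    by (rule measurable_compose[OF measurable_fst fs(1)], rule measurable_compose[OF measurable_fst fs(2)])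
  have Gm: "(\<lambda>(w, s). G w s) \<in> borel_measurable (borel \<Otimes>\<^sub>M borel)"
    unfolding G_def by measurable
  have Gm2[measurable]: "(\<lambda>w. G w s) \<in> borel_measurable borel" for s
    unfolding G_def by measurable
  have V: "emeasure lborel B = ennreal (measure lborel B)"
    using emeasure_bounded_finite[of B] by (intro emeasure_eq_ennreal_measure) (simp add: B_def)
  have cv: "(1 - s) *\<^sub>R z + s *\<^sub>R x \<in> B" if "z \<in> B" "x \<in> B" "s \<in> {0..1}" for s z x
    using that convexD_alt[OF convex_ball, of z y \<rho> x s] by (auto simp: B_def)
  have pt: "ennreal (norm (indicator Z (fst w) * indicator B (snd w) * (f (snd w) - f (fst w))) powr p) \<le> (\<integral>\<^sup>+s. G w s \<partial>lborel)" for w :: "'a \<times> 'a"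
  proof (cases "fst w \<in> Z \<and> snd w \<in> B")
    case True
    define z x where "z = fst w" and "x = snd w"
    have zx: "z \<in> B" "x \<in> B" using True Z(2) by (auto simp: z_def x_def B_def)
    have "norm (x - z) \<le> norm (x - y) + norm (z - y)" using norm_triangle_ineq4[of "x - y" "z - y"] by simp
    then have n: "norm (x - z) \<le> 2 * \<rho>" using zx by (simp add: B_def dist_norm norm_minus_commute)
    have "ennreal (\<bar>f x - f z\<bar> powr p) \<le> (\<integral>\<^sup>+s. indicator {0..1} s * ennreal (\<bar>d (z + s *\<^sub>R (x - z)) \<bullet> (x - z)\<bar> powr p) \<partial>lborel)"
      by (rule segment_inequality[OF f p])
    also have "\<dots> \<le> (\<integral>\<^sup>+s. G w s \<partial>lborel)"
    proof (rule nn_integral_mono)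
      fix s :: real
      show "indicator {0..1} s * ennreal (\<bar>d (z + s *\<^sub>R (x - z)) \<bullet> (x - z)\<bar> powr p) \<le> G w s"
      proof (cases "s \<in> {0..1}")
        case True
        define v where "v = (1 - s) *\<^sub>R z + s *\<^sub>R x"
        have v: "z + s *\<^sub>R (x - z) = v" by (simp add: v_def algebra_simps)
        have "v \<in> B" using cv zx True by (simp add: v_def)
        have "\<bar>d v \<bullet> (x - z)\<bar> \<le> norm (d v) * norm (x - z)" by (rule Cauchy_Schwarz_ineq2)
        also have "\<dots> \<le> norm (d v) * (2 * \<rho>)" using n by (intro mult_left_mono) auto
        finally have "\<bar>d v \<bullet> (x - z)\<bar> powr p \<le> (2 * \<rho> * norm (d v)) powr p"
          using p by (intro powr_mono2) (auto simp: mult_ac)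
        also have "\<dots> = (2 * \<rho>) powr p * norm (d v) powr p" using \<rho> by (simp add: powr_mult)
        finally have "ennreal (\<bar>d v \<bullet> (x - z)\<bar> powr p) \<le> c * H v"
          using \<open>v \<in> B\<close> by (simp add: H_def c_def ennreal_mult'[symmetric] ennreal_leI)
        then show ?thesis using True zx unfolding v G_def by (simp add: v_def z_def[symmetric] x_def[symmetric])
      qed simp
    qed
    finally show ?thesis using True by (simp add: z_def x_def)
  qed auto
  have "mass p (\<lambda>w. indicator Z (fst w) * indicator B (snd w) * (f (snd w) - f (fst w))) \<le> (\<integral>\<^sup>+w. (\<integral>\<^sup>+s. G w s \<partial>lborel) \<partial>(lborel :: ('a \<times> 'a) measure))"
    unfolding mass_def by (rule nn_integral_mono) (rule pt)
  also have "\<dots> = (\<integral>\<^sup>+s. (\<integral>\<^sup>+w. G w s \<partial>(lborel :: ('a \<times> 'a) measure)) \<partial>lborel)"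
    by (rule lborel_pair.Fubini'[symmetric]) (use Gm in simp)
  also have "\<dots> \<le> (\<integral>\<^sup>+s. indicator {0..1} s * (c * (ennreal (measure lborel B * 2 ^ DIM('a)) * mass p (\<lambda>x. indicator B x *\<^sub>R d x))) \<partial>(lborel :: real measure))"
  proof (rule nn_integral_mono)
    fix s :: real
    have half: "(\<integral>\<^sup>+z. (\<integral>\<^sup>+x. indicator B z * indicator B x * (c * H (r *\<^sub>R z + t *\<^sub>R x)) \<partial>lborel) \<partial>lborel) \<le>
        c * (ennreal (measure lborel B * 2 ^ DIM('a)) * mass p (\<lambda>x. indicator B x *\<^sub>R d x))"
      if t: "1/2 \<le> t" for r t :: real
    proof -
      have "(\<integral>\<^sup>+x. indicator B z * indicator B x * (c * H (r *\<^sub>R z + t *\<^sub>R x)) \<partial>lborel) \<le>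
          indicator B z * (c * (ennreal (2 ^ DIM('a)) * mass p (\<lambda>x. indicator B x *\<^sub>R d x)))" for z
      proof -
        have "(\<integral>\<^sup>+x. indicator B z * indicator B x * (c * H (r *\<^sub>R z + t *\<^sub>R x)) \<partial>lborel) \<le>
            (\<integral>\<^sup>+x. indicator B z * (c * H (r *\<^sub>R z + t *\<^sub>R x)) \<partial>lborel)"
          by (intro nn_integral_mono) (auto simp: indicator_def)
        also have "\<dots> = indicator B z * (c * (\<integral>\<^sup>+x. H (r *\<^sub>R z + t *\<^sub>R x) \<partial>lborel))"
          by (simp add: nn_integral_cmult)
        also have "(\<integral>\<^sup>+x. H (r *\<^sub>R z + t *\<^sub>R x) \<partial>lborel) = mass p (\<lambda>x. (\<lambda>x. indicator B x *\<^sub>R d x) (r *\<^sub>R z + t *\<^sub>R x))"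
          unfolding mass_def H_def ..
        also have "\<dots> = ennreal (1 / t ^ DIM('a)) * mass p (\<lambda>x. indicator B x *\<^sub>R d x)"
          using t by (intro mass_affine) auto
        also have "ennreal (1 / t ^ DIM('a)) \<le> ennreal (2 ^ DIM('a))"
        proof (rule ennreal_leI)
          have "(1/2) ^ DIM('a) \<le> t ^ DIM('a)" using t by (intro power_mono) auto
          then show "1 / t ^ DIM('a) \<le> 2 ^ DIM('a)" using t by (simp add: field_simps power_one_over)
        qed
        finally show ?thesis by (simp add: mult_left_mono mult_right_mono)
      qed
      then have "(\<integral>\<^sup>+z. (\<integral>\<^sup>+x. indicator B z * indicator B x * (c * H (r *\<^sub>R z + t *\<^sub>R x)) \<partial>lborel) \<partial>lborel) \<le>
          (\<integral>\<^sup>+z. indicator B z * (c * (ennreal (2 ^ DIM('a)) * mass p (\<lambda>x. indicator B x *\<^sub>R d x))) \<partial>lborel)"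
        by (rule nn_integral_mono)
      also have "\<dots> = ennreal (measure lborel B) * (c * (ennreal (2 ^ DIM('a)) * mass p (\<lambda>x. indicator B x *\<^sub>R d x)))"
        by (simp add: nn_integral_multc V)
      finally show ?thesis by (simp add: ennreal_mult' mult_ac)
    qed
    show "(\<integral>\<^sup>+w. G w s \<partial>(lborel :: ('a \<times> 'a) measure)) \<le> indicator {0..1} s * (c * (ennreal (measure lborel B * 2 ^ DIM('a)) * mass p (\<lambda>x. indicator B x *\<^sub>R d x)))"
    proof (cases "s \<in> {0..1}")
      case True
      define G' where "G' z x = indicator B z * indicator B x * (c * H ((1 - s) *\<^sub>R z + s *\<^sub>R x))" for z x
      have Gs: "G w s = (\<lambda>(z, x). G' z x) w" for w using True by (simp add: G_def G'_def split_beta)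
      have G'm: "(\<lambda>(z, x). G' z x) \<in> borel_measurable (lborel \<Otimes>\<^sub>M lborel)" unfolding G'_def by measurable
      have e1: "(\<integral>\<^sup>+w. G w s \<partial>(lborel :: ('a \<times> 'a) measure)) = (\<integral>\<^sup>+z. (\<integral>\<^sup>+x. G' z x \<partial>lborel) \<partial>lborel)"
        unfolding Gs lborel_prod[symmetric] using lborel.nn_integral_fst[OF G'm] by simp
      show ?thesis
      proof (cases "1/2 \<le> s")
        case True
        then show ?thesis unfolding e1 G'_def using half[of s "1 - s"] \<open>s \<in> {0..1}\<close> by simp
      next
        case False
        have "(\<integral>\<^sup>+z. (\<integral>\<^sup>+x. G' z x \<partial>lborel) \<partial>lborel) = (\<integral>\<^sup>+x. (\<integral>\<^sup>+z. G' z x \<partial>lborel) \<partial>lborel)"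
          using lborel_pair.Fubini'[OF G'm] by simp
        also have "\<dots> \<le> c * (ennreal (measure lborel B * 2 ^ DIM('a)) * mass p (\<lambda>x. indicator B x *\<^sub>R d x))"
          unfolding G'_def using half[of "1 - s" s] False by (simp add: add.commute mult.commute[of "indicator B _" "indicator B _"])
        finally show ?thesis unfolding e1 using \<open>s \<in> {0..1}\<close> by simp
      qed
    qed (simp add: G_def)
  qed
  also have "\<dots> = c * (ennreal (measure lborel B * 2 ^ DIM('a)) * mass p (\<lambda>x. indicator B x *\<^sub>R d x))"
    by (simp add: nn_integral_multc)
  finally show ?thesis unfolding B_def[symmetric] c_def by (simp add: ennreal_mult' mult.assoc)
qed

text \<open>The Poincare inequality on a ball for functions vanishing on a set of positive measure: average
  the difference quotient bound over all pairs of a point of the zero set and a point of the ball.\<close>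

lemma ball_poincare:
  fixes v :: "'a::euclidean_space \<Rightarrow> real"
  assumes s: "sobolev0 p \<Omega> v h" and p: "1 < p" and \<rho>: "0 < \<rho>" and Z: "Z \<in> sets borel" "Z \<subseteq> ball y \<rho>" "\<And>z. z \<in> Z \<Longrightarrow> v z = 0"
  shows "emeasure lborel Z * mass p (\<lambda>x. indicator (ball y \<rho>) x * v x) \<le>
    ennreal ((2 * \<rho>) powr p * (measure lborel (ball y \<rho>) * 2 ^ DIM('a)) * 2 powr p) * mass p (\<lambda>x. indicator (ball y \<rho>) x *\<^sub>R h x)"
proof -
  note sD = sobolev0D[OF s]
  obtain \<phi> d where "approx_seq p \<Omega> v h \<phi> d" using s unfolding sobolev0_def by blast
  then have \<phi>: "\<And>k. C1c \<Omega> (\<phi> k) (d k)" and L: "Lp_null p (\<lambda>k x. \<phi> k x - v x)" "Lp_null p (\<lambda>k x. d k x - h x)"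
    and ae: "AE x in lborel. (\<lambda>k. \<phi> k x) \<longlonglongrightarrow> v x"
    by (auto simp: approx_seq_def)
  have p0: "0 < p" using p by simp
  define B where "B = ball y \<rho>"
  have Bm[measurable]: "B \<in> sets borel" by (simp add: B_def)
  have Zm[measurable]: "Z \<in> sets borel" by (rule Z)
  define c where "c = (2 * \<rho>) powr p * (measure lborel B * 2 ^ DIM('a))"
  have c: "c \<ge> 0" by (simp add: c_def)
  have vm[measurable]: "v \<in> borel_measurable borel" "h \<in> borel_measurable borel" using sD by auto
  have \<phi>m[measurable]: "\<phi> k \<in> borel_measurable borel" "d k \<in> borel_measurable borel" for k using C1c_measurable[OF \<phi>] by auto
  define X where "X f w = indicator Z (fst w) * indicator B (snd w) * (f (snd w) - f (fst w))" for f :: "'a \<Rightarrow> real" and w :: "'a \<times> 'a"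
  have Xm: "X f \<in> borel_measurable borel" if [measurable]: "f \<in> borel_measurable borel" for f
  proof -
    note fs[measurable] = borel_fst_snd[where 'a = 'a and 'b = 'a]
    show ?thesis unfolding X_def[abs_def] by measurable
  qed
  have hB: "mass p (\<lambda>x. indicator B x *\<^sub>R h x) < \<infinity>"
    by (rule le_less_trans[OF mass_mono[OF p0] sD(6)]) (auto simp: indicator_def)
  have LB: "Lp_null p (\<lambda>k x. indicator B x *\<^sub>R d k x - indicator B x *\<^sub>R h x)"
    by (rule Lp_null_bound[OF L(2) p0, of 1]) (auto simp: indicator_def)
  have aeX: "AE w in lborel. (\<lambda>k. X (\<phi> k) w) \<longlonglongrightarrow> X v w"
  proof -
    have "AE w in lborel \<Otimes>\<^sub>M lborel. (\<lambda>k. \<phi> k (fst w)) \<longlonglongrightarrow> v (fst w) \<and> (\<lambda>k. \<phi> k (snd w)) \<longlonglongrightarrow> v (snd w)"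
    proof (rule lborel_pair.AE_pair_measure)
      show "{w \<in> space (lborel \<Otimes>\<^sub>M lborel). (\<lambda>k. \<phi> k (fst w)) \<longlonglongrightarrow> v (fst w) \<and> (\<lambda>k. \<phi> k (snd w)) \<longlonglongrightarrow> v (snd w)} \<in> sets (lborel \<Otimes>\<^sub>M lborel)"
        by measurable
      show "AE x in lborel. AE z in lborel. (\<lambda>k. \<phi> k (fst (x, z))) \<longlonglongrightarrow> v (fst (x, z)) \<and> (\<lambda>k. \<phi> k (snd (x, z))) \<longlonglongrightarrow> v (snd (x, z))"
        using ae
      proof eventually_elim
        case (elim x)
        show ?case using ae by eventually_elim (use elim in simp)
      qed
    qed
    then have "AE w in lborel. (\<lambda>k. \<phi> k (fst w)) \<longlonglongrightarrow> v (fst w) \<and> (\<lambda>k. \<phi> k (snd w)) \<longlonglongrightarrow> v (snd w)"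
      unfolding lborel_prod .
    then show ?thesis by eventually_elim (auto simp: X_def intro!: tendsto_intros)
  qed
  have "mass p (X v) \<le> ennreal (c * (2 powr p * enn2real (mass p (\<lambda>x. indicator B x *\<^sub>R h x))))"
  proof (rule mass_limit[OF p0 p0 Xm[OF \<phi>m(1)] Xm[OF vm(1)] aeX _ _ LB _ mass_real[OF hB], where B = "\<lambda>D. c * D"])
    show "mass p (X (\<phi> k)) \<le> ennreal (c * D)" if D: "mass p (\<lambda>x. indicator B x *\<^sub>R d k x) \<le> ennreal D" for k D
    proof -
      have "mass p (X (\<phi> k)) \<le> ennreal c * mass p (\<lambda>x. indicator B x *\<^sub>R d k x)"
        unfolding X_def B_def c_def by (rule ball_poincare_C1[OF C1c_C1[OF \<phi>] p \<rho> Z(1,2)])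
      also have "\<dots> \<le> ennreal c * ennreal D" using D by (intro mult_left_mono) auto
      finally show ?thesis using c by (simp add: ennreal_mult')
    qed
  qed (auto intro!: tendsto_intros)
  also have "\<dots> = ennreal (c * 2 powr p) * mass p (\<lambda>x. indicator B x *\<^sub>R h x)"
    using hB c by (simp add: ennreal_mult mult.assoc)
  also have "mass p (X v) = (\<integral>\<^sup>+z. (\<integral>\<^sup>+x. indicator Z z * ennreal (norm (indicator B x * v x) powr p) \<partial>lborel) \<partial>lborel)"
  proof -
    have eq: "ennreal (norm (X v w) powr p) = (case w of (z, x) \<Rightarrow> indicator Z z * ennreal (norm (indicator B x * v x) powr p))" for w
      using Z(3) by (auto simp: X_def indicator_def split_beta)
    have m: "(\<lambda>(z, x). indicator Z z * ennreal (norm (indicator B x * v x) powr p)) \<in> borel_measurable (lborel \<Otimes>\<^sub>M lborel)"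
      by measurable
    show ?thesis unfolding mass_def eq lborel_prod[symmetric] using lborel.nn_integral_fst[OF m] by simp
  qed
  also have "\<dots> = emeasure lborel Z * mass p (\<lambda>x. indicator B x * v x)"
    unfolding mass_def by (simp add: nn_integral_cmult nn_integral_multc)
  finally show ?thesis unfolding B_def c_def .
qed

section \<open>The Sobolev inequality\<close>

text \<open>Continuation beyond the left end point by the tangent keeps a function continuously differentiable.\<close>

lemma C1_extension:
  fixes f f' :: "real \<Rightarrow> real"
  assumes f: "\<And>s. 0 \<le> s \<Longrightarrow> (f has_real_derivative f' s) (at s)"
  shows "((\<lambda>s. f (max 0 s) + f' 0 * min 0 s) has_real_derivative f' (max 0 s)) (at s)"
proof -
  consider "s < 0" | "s = 0" | "s > 0" by linarith
  then show ?thesis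
  proof cases
    case 1
    have "((\<lambda>s. f 0 + f' 0 * s) has_real_derivative f' (max 0 s)) (at s)" using 1 by (auto intro!: derivative_eq_intros)
    then show ?thesis by (rule has_field_derivative_transform_within_open[where S = "{..<0}"]) (use 1 in auto)
  next
    case 3
    have "(f has_real_derivative f' (max 0 s)) (at s)" using f[of s] 3 by simp
    then show ?thesis by (rule has_field_derivative_transform_within_open[where S = "{0<..}"]) (use 3 in auto)
  next
    case 2
    have "(f has_derivative (\<lambda>h. f' 0 * h)) (at 0)" using f[of 0] by (simp add: has_field_derivative_def)
    then have D: "\<And>e. e > 0 \<Longrightarrow> \<exists>\<delta>>0. \<forall>y. norm (y - 0) < \<delta> \<longrightarrow> norm (f y - f 0 - f' 0 * (y - 0)) \<le> e * norm (y - 0)"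
      unfolding has_derivative_at_alt by blast
    have "((\<lambda>s. f (max 0 s) + f' 0 * min 0 s) has_derivative (\<lambda>h. f' 0 * h)) (at 0)"
      unfolding has_derivative_at_alt
    proof (intro conjI allI impI bounded_linear_mult_right)
      fix e :: real assume "0 < e"
      then obtain \<delta> where \<delta>: "\<delta> > 0" "\<And>y. \<bar>y\<bar> < \<delta> \<Longrightarrow> \<bar>f y - f 0 - f' 0 * y\<bar> \<le> e * \<bar>y\<bar>" using D[of e] by auto
      have "norm (f (max 0 y) + f' 0 * min 0 y - (f (max 0 0) + f' 0 * min 0 0) - f' 0 * (y - 0)) \<le> e * norm (y - 0)" if "norm (y - 0) < \<delta>" for y
      proof -
        have eq: "f (max 0 y) + f' 0 * min 0 y - (f (max 0 0) + f' 0 * min 0 0) - f' 0 * (y - 0) = f (max 0 y) - f 0 - f' 0 * max 0 y"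
          by (cases "y \<ge> 0") auto
        have "\<bar>f (max 0 y) - f 0 - f' 0 * max 0 y\<bar> \<le> e * \<bar>max 0 y\<bar>" using that by (intro \<delta>(2)) (auto simp: max_def)
        moreover have "e * \<bar>max 0 y\<bar> \<le> e * \<bar>y\<bar>" using \<open>0 < e\<close> by (intro mult_left_mono) (auto simp: max_def)
        ultimately show ?thesis unfolding eq real_norm_def by simp
      qed
      then show "\<exists>d>0. \<forall>y. norm (y - 0) < d \<longrightarrow> norm (f (max 0 y) + f' 0 * min 0 y - (f (max 0 0) + f' 0 * min 0 0) - f' 0 * (y - 0)) \<le> e * norm (y - 0)"
        using \<delta>(1) by blast
    qed
    then show ?thesis unfolding 2 by (simp add: has_field_derivative_def)
  qed
qed

lemma pos_part_square_deriv: "((\<lambda>x::real. (max 0 x)\<^sup>2) has_real_derivative 2 * max 0 x) (at x)"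
proof -
  have "((\<lambda>x. x\<^sup>2) has_real_derivative 2 * s) (at s)" for s :: real by (auto intro!: derivative_eq_intros)
  from C1_extension[OF this, of x] show ?thesis by simp
qed

text \<open>A quadratic spline rising from 0 to 1 on the unit interval.\<close>

definition ramp :: "real \<Rightarrow> real" where
  "ramp s = 2 * (max 0 s)\<^sup>2 - 4 * (max 0 (s - 1/2))\<^sup>2 + 2 * (max 0 (s - 1))\<^sup>2"

definition ramp' :: "real \<Rightarrow> real" where
  "ramp' s = 4 * max 0 s - 8 * max 0 (s - 1/2) + 4 * max 0 (s - 1)"

lemma ramp_deriv: "(ramp has_real_derivative ramp' s) (at s)"
proof -
  have sh: "((\<lambda>x. (max 0 (x - c))\<^sup>2) has_real_derivative 2 * max 0 (s - c)) (at s)" for c :: real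
  proof -
    have "((\<lambda>x. x - c) has_real_derivative 1) (at s)" by (auto intro!: derivative_eq_intros)
    from DERIV_chain2[where f = "\<lambda>x. (max 0 x)\<^sup>2" and g = "\<lambda>x. x - c", OF pos_part_square_deriv this]
    show ?thesis by simp
  qed
  show ?thesis unfolding ramp_def[abs_def] ramp'_def
    using DERIV_add[OF DERIV_diff[OF DERIV_cmult[OF sh[of 0], of 2] DERIV_cmult[OF sh[of "1/2"], of 4]] DERIV_cmult[OF sh[of 1], of 2]]
    by simp
qed

lemma ramp'_cont: "continuous_on UNIV ramp'"
  unfolding ramp'_def[abs_def] by (intro continuous_intros)

lemma C1_ramp:
  assumes f: "C1 f d"
  shows "C1 (\<lambda>x. ramp (\<alpha> * f x + \<beta>)) (\<lambda>x. (ramp' (\<alpha> * f x + \<beta>) * \<alpha>) *\<^sub>R d x)"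
proof (rule C1_compose[OF f, of "\<lambda>s. ramp (\<alpha> * s + \<beta>)"])
  fix s
  have "((\<lambda>s. \<alpha> * s + \<beta>) has_real_derivative \<alpha>) (at s)" by (auto intro!: derivative_eq_intros)
  from DERIV_chain2[where f = ramp and g = "\<lambda>s. \<alpha> * s + \<beta>", OF ramp_deriv this]
  show "((\<lambda>s. ramp (\<alpha> * s + \<beta>)) has_real_derivative ramp' (\<alpha> * s + \<beta>) * \<alpha>) (at s)" .
  show "continuous_on UNIV (\<lambda>s. ramp' (\<alpha> * s + \<beta>) * \<alpha>)"
    by (intro continuous_intros continuous_on_compose2[OF ramp'_cont]) auto
qed

lemma ramp_values: "s \<le> 0 \<Longrightarrow> ramp s = 0" "1 \<le> s \<Longrightarrow> ramp s = 1"
  by (auto simp: ramp_def max_def power2_eq_square algebra_simps)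

lemma ramp'_bounds: "\<bar>ramp' s\<bar> \<le> 2" "s \<le> 0 \<Longrightarrow> ramp' s = 0" "1 \<le> s \<Longrightarrow> ramp' s = 0" "0 \<le> ramp' s"
  by (auto simp: ramp'_def max_def abs_if)

lemma ramp_bounds: "0 \<le> ramp s" "ramp s \<le> 1"
proof -
  have "mono ramp"
    by (rule monoI) (rule DERIV_nonneg_imp_nondecreasing, assumption, use ramp_deriv ramp'_bounds(4) in blast)
  then have "ramp (min s 0) \<le> ramp s" "ramp s \<le> ramp (max s 1)" by (simp_all add: monoD)
  then show "0 \<le> ramp s" "ramp s \<le> 1" using ramp_values by (simp_all add: max_def min_def split: if_splits)
qed

text \<open>Comparing a function equal to 1 on \<open>E\<close> with its translates by vectors of a ball twice as large as
  its support: at least half of the translates of a point of \<open>E\<close> leave the support. This is a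
  capacity estimate that carries the dimension into the Sobolev exponent.\<close>

lemma level_estimate:
  fixes g :: "'a::euclidean_space \<Rightarrow> real"
  assumes g: "C1 g e" and p: "1 < p" and A: "A \<in> sets borel" "emeasure lborel A = ennreal \<alpha>" "\<alpha> \<ge> 0" "\<And>x. x \<notin> A \<Longrightarrow> g x = 0"
    and E: "E \<in> sets borel" "\<And>x. x \<in> E \<Longrightarrow> g x = 1" and M: "mass p e \<le> ennreal M" "M \<ge> 0"
  shows "emeasure lborel E \<le> ennreal (2 * (2 / unit_ball_vol (real DIM('a))) powr (p / real DIM('a)) * \<alpha> powr (p / real DIM('a)) * M)"
proof (cases "\<alpha> = 0")
  case True
  have "E \<subseteq> A" using E(2) A(4) by force
  then have "emeasure lborel E \<le> emeasure lborel A" using A(1) by (intro emeasure_mono) auto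
  then show ?thesis using A(2) True by simp
next
  case False
  then have \<alpha>: "\<alpha> > 0" using A(3) by simp
  define n where "n = real DIM('a)"
  have n: "n > 0" by (simp add: n_def)
  define \<omega> where "\<omega> = unit_ball_vol n"
  have \<omega>: "\<omega> > 0" using n by (simp add: \<omega>_def)
  \<comment> \<open>the radius of a ball of volume \<open>2 * \<alpha>\<close>\<close>
  define r where "r = (2 * \<alpha> / \<omega>) powr (1 / n)"
  have r: "r > 0" using \<alpha> \<omega> by (simp add: r_def)
  have rn: "r ^ DIM('a) = 2 * \<alpha> / \<omega>"
    using r n \<alpha> \<omega> by (simp add: r_def powr_powr n_def flip: powr_realpow)
  define B where "B = ball (0::'a) r"
  have Bm[measurable]: "B \<in> sets borel" by (simp add: B_def)
  have Am[measurable]: "A \<in> sets borel" and Em[measurable]: "E \<in> sets borel" by fact+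
  have gm[measurable]: "g \<in> borel_measurable borel" by (rule C1_measurable(1)[OF g])
  have em[measurable]: "e \<in> borel_measurable borel" by (rule C1_measurable(2)[OF g])
  have VB: "emeasure lborel B = ennreal (2 * \<alpha>)"
    unfolding B_def using r rn \<omega> by (subst emeasure_ball) (auto simp: \<omega>_def n_def)
  have fib: "ennreal \<alpha> \<le> (\<integral>\<^sup>+h. indicator B h * ennreal (\<bar>g (x + h) - g x\<bar> powr p) \<partial>lborel)" if x: "x \<in> E" for x
  proof -
    define A' where "A' = {h. x + h \<in> A}"
    have A'm[measurable]: "A' \<in> sets borel" unfolding A'_def by measurable
    have "emeasure lborel A = (\<integral>\<^sup>+h. indicator A h \<partial>lborel)" by simp
    also have "\<dots> = (\<integral>\<^sup>+h. indicator A (x + 1 *\<^sub>R h) \<partial>lborel)"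
      by (subst lborel_nn_integral_affine[of _ 1 x]) auto
    also have "\<dots> = (\<integral>\<^sup>+h. indicator A' h \<partial>lborel)" by (simp add: A'_def indicator_def)
    also have "\<dots> = emeasure lborel A'" by simp
    finally have "emeasure lborel A' = ennreal \<alpha>" using A(2) by simp
    moreover have "emeasure lborel B \<le> emeasure lborel (A' \<union> (B - A'))" by (intro emeasure_mono) auto
    moreover have "emeasure lborel (A' \<union> (B - A')) \<le> emeasure lborel A' + emeasure lborel (B - A')"
      by (intro emeasure_subadditive) auto
    ultimately have "ennreal (2 * \<alpha>) \<le> ennreal \<alpha> + emeasure lborel (B - A')" using VB by simp
    then have "ennreal \<alpha> + ennreal \<alpha> \<le> ennreal \<alpha> + emeasure lborel (B - A')"
      using \<alpha> by (simp add: ennreal_plus[symmetric] del: ennreal_plus)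
    then have "ennreal \<alpha> \<le> emeasure lborel (B - A')" by (simp add: ennreal_add_left_cancel_le)
    also have "\<dots> = (\<integral>\<^sup>+h. indicator (B - A') h \<partial>lborel)" by simp
    also have "\<dots> \<le> (\<integral>\<^sup>+h. indicator B h * ennreal (\<bar>g (x + h) - g x\<bar> powr p) \<partial>lborel)"
      using A(4) E(2)[OF x] by (intro nn_integral_mono) (auto simp: indicator_def A'_def)
    finally show ?thesis .
  qed
  have "ennreal \<alpha> * emeasure lborel E = (\<integral>\<^sup>+x. ennreal \<alpha> * indicator E x \<partial>lborel)"
    by (simp add: nn_integral_cmult_indicator)
  also have "\<dots> \<le> (\<integral>\<^sup>+x. (\<integral>\<^sup>+h. indicator B h * ennreal (\<bar>g (x + h) - g x\<bar> powr p) \<partial>lborel) \<partial>lborel)"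
    using fib by (intro nn_integral_mono) (auto simp: indicator_def)
  also have "\<dots> = (\<integral>\<^sup>+h. (\<integral>\<^sup>+x. indicator B h * ennreal (\<bar>g (x + h) - g x\<bar> powr p) \<partial>lborel) \<partial>lborel)"
    by (rule lborel_pair.Fubini'[symmetric]) measurable
  also have "\<dots> \<le> (\<integral>\<^sup>+h. indicator B h * ennreal (r powr p * M) \<partial>lborel)"
  proof (rule nn_integral_mono)
    fix h :: 'a
    show "(\<integral>\<^sup>+x. indicator B h * ennreal (\<bar>g (x + h) - g x\<bar> powr p) \<partial>lborel) \<le> indicator B h * ennreal (r powr p * M)"
    proof (cases "h \<in> B")
      case True
      have "(\<integral>\<^sup>+x. ennreal (\<bar>g (x + h) - g x\<bar> powr p) \<partial>lborel) \<le> mass p (\<lambda>x. e x \<bullet> h)"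
        using translation_estimate[OF g p, of h] by (simp add: mass_def)
      also have "\<dots> \<le> ennreal (norm h powr p) * mass p e" using p by (intro mass_inner_le) auto
      also have "\<dots> \<le> ennreal (r powr p) * ennreal M"
        using True p M by (intro mult_mono ennreal_leI powr_mono2) (auto simp: B_def)
      finally show ?thesis using True by (simp add: ennreal_mult')
    qed simp
  qed
  also have "\<dots> = ennreal (2 * \<alpha>) * ennreal (r powr p * M)" by (simp add: nn_integral_multc VB)
  also have "\<dots> = ennreal \<alpha> * ennreal (2 * (r powr p * M))"
    using \<alpha> M by (simp add: ennreal_mult[symmetric] mult_ac)
  finally have "emeasure lborel E \<le> ennreal (2 * (r powr p * M))"
    using \<alpha> by (simp add: ennreal_mult_le_mult_iff)
  also have "r powr p = (2 / \<omega>) powr (p / n) * \<alpha> powr (p / n)"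
    using \<alpha> \<omega> by (simp add: r_def powr_powr powr_mult[symmetric])
  finally show ?thesis by (simp add: \<omega>_def n_def mult_ac)
qed

text \<open>If the second term dominates, a power of \<open>S\<close> can be cancelled.\<close>

lemma self_improving_bound:
  fixes S b K \<theta> :: real
  assumes "0 \<le> S" "0 \<le> b" "0 \<le> K" "0 < \<theta>" "\<theta> < 1" "S \<le> b + K * S powr \<theta>"
  shows "S \<le> 2 * b + (2 * K) powr (1 / (1 - \<theta>))"
proof (cases "S \<le> 2 * b \<or> S = 0")
  case False
  then have "S > 0" "S > 2 * b" using assms by auto
  then have "S \<le> 2 * K * S powr \<theta>" using assms by linarith
  moreover have "S = S powr (1 - \<theta>) * S powr \<theta>" using \<open>S > 0\<close> by (simp add: powr_add[symmetric])
  ultimately have "S powr (1 - \<theta>) * S powr \<theta> \<le> 2 * K * S powr \<theta>" by simp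
  then have "S powr (1 - \<theta>) \<le> 2 * K" using \<open>S > 0\<close> by simp
  then have "(S powr (1 - \<theta>)) powr (1 / (1 - \<theta>)) \<le> (2 * K) powr (1 / (1 - \<theta>))"
    using assms by (intro powr_mono2) auto
  then show ?thesis using \<open>S > 0\<close> assms by (simp add: powr_powr)
next
  case True
  have "0 \<le> (2 * K) powr (1 / (1 - \<theta>))" by simp
  then show ?thesis using True assms by linarith
qed

text \<open>Sobolev's inequality by truncation: the level estimate for the pieces of \<open>f\<close>
  between consecutive dyadic levels bounds each level set by a power of the preceding one times the
  energy of the piece. Summation gives a bound for the sum \<open>S\<close> over the levels in terms of a
  power of \<open>S\<close> itself. The smallest level \<open>\<epsilon>\<close> is sent to zero.\<close>

lemma sobolev_C1c:
  fixes f :: "'a::euclidean_space \<Rightarrow> real"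
  defines "n \<equiv> real DIM('a)"
  assumes f: "C1c \<Omega> f d" and p: "1 < p" "p < n" and q: "q = n * p / (n - p)"
    and D: "mass p d \<le> ennreal D" "D \<ge> 0"
  shows "mass q (\<lambda>x. max 0 (f x)) \<le>
    ennreal (2 powr q * (2 * (2 powr q * (2 * (2 / unit_ball_vol n) powr (p / n)) * 2 powr p)) powr (q / p) * D powr (q / p))"
proof -
  have n: "n > 0" using p by simp
  have q0: "q > p" "q > 0" using p n by (auto simp: q field_simps)
  have qp: "q * (p / n) = q - p" using p n by (simp add: q field_simps)
  have qp': "1 / (1 - p / n) = q / p" using p n by (simp add: q field_simps)
  define c0 where "c0 = 2 * (2 / unit_ball_vol n) powr (p / n)"
  define K where "K = 2 powr q * c0 * 2 powr p"
  have c0: "c0 \<ge> 0" and K0: "K \<ge> 0" by (auto simp: c0_def K_def)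
  note C = C1c_C1[OF f]
  have fm[measurable]: "f \<in> borel_measurable borel" and dm[measurable]: "d \<in> borel_measurable borel"
    using C1_measurable[OF C] by auto
  obtain Q where Q: "compact Q" "\<And>x. x \<notin> Q \<Longrightarrow> f x = 0" using C1c_support[OF f] by metis
  obtain N0 where N0: "N0 > 0" "\<And>x. norm (f x) \<le> N0" using bounded_compact_support[OF C1_continuous[OF C] Q] by metis
  have dfin: "mass p d < \<infinity>" using D by (auto intro: le_less_trans)
  have dint: "integrable lborel (\<lambda>x. norm (d x) powr p)" using mass_integrable[OF dm] dfin by blast
  have dI: "(\<integral>x. norm (d x) powr p \<partial>lborel) \<le> D"
    using D mass_eq_integral[OF dm dfin] by simp
  have QV: "emeasure lborel Q < \<infinity>" "Q \<in> sets borel" using emeasure_compact_finite[OF Q(1)] borel_compact[OF Q(1)] by auto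
  define V where "V = measure lborel Q"
  have V0: "V \<ge> 0" by (simp add: V_def)
  define I where "I = (\<integral>x. (max 0 (f x)) powr q \<partial>lborel)"
  have Iint: "integrable lborel (\<lambda>x. (max 0 (f x)) powr q)"
    using Q C1_continuous[OF C] q0
    by (intro integrable_compact_support[of _ Q] continuous_on_powr' continuous_intros) auto
  have main: "I \<le> 2 powr q * (2 * (\<epsilon> powr q * V) + (2 * (K * D)) powr (q / p)) + \<epsilon> powr q * V" if \<epsilon>: "\<epsilon> > 0" for \<epsilon>
  proof -
    define l where "l k = \<epsilon> * 2 ^ k" for k :: nat
    have l: "l k > 0" "l (Suc k) = 2 * l k" for k using \<epsilon> by (auto simp: l_def)
    have lmono: "l j \<le> l k" if "j \<le> k" for j k using that \<epsilon> by (auto simp: l_def power_increasing)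
    obtain N where N: "N0 \<le> l N"
    proof -
      obtain N where "N0 / \<epsilon> < 2 ^ N" using real_arch_pow[of 2] by auto
      then have "N0 \<le> l N" using \<epsilon> by (simp add: l_def field_simps)
      then show ?thesis by (rule that)
    qed
    define A where "A k = {x. f x > l k}" for k
    have Am[measurable]: "A k \<in> sets borel" for k unfolding A_def by measurable
    have AQ: "A k \<subseteq> Q" for k using Q(2) l(1)[of k] by (force simp: A_def)
    have Afin: "emeasure lborel (A k) < \<infinity>" for k
      using emeasure_mono[OF AQ[of k], of lborel] QV by (auto intro: le_less_trans)
    define \<alpha> where "\<alpha> k = measure lborel (A k)" for k
    have \<alpha>: "emeasure lborel (A k) = ennreal (\<alpha> k)" "\<alpha> k \<ge> 0" for k
      using Afin[of k] unfolding \<alpha>_def by (subst emeasure_eq_ennreal_measure) auto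
    have \<alpha>V: "\<alpha> k \<le> V" for k
      unfolding \<alpha>_def V_def using AQ QV by (intro measure_mono_fmeasurable) (auto simp: fmeasurable_def)
    define R where "R k = A k - A (Suc k)" for k
    have Rm[measurable]: "R k \<in> sets borel" for k unfolding R_def by measurable
    define E where "E k = (\<integral>x. indicator (R k) x *\<^sub>R (norm (d x) powr p) \<partial>lborel)" for k
    have Eint: "integrable lborel (\<lambda>x. indicator (R k) x *\<^sub>R (norm (d x) powr p))" for k
      using dint by (intro integrable_mult_indicator) auto
    have E0: "E k \<ge> 0" for k unfolding E_def by (intro integral_nonneg_AE) auto
    have Rdisj: "(\<Sum>k<N. indicator (R k) x) \<le> (1::real)" for x
    proof -
      have "(\<Sum>k<N. indicator (R k) x) = (\<Sum>k<N. indicator (A k) x - indicator (A (Suc k)) x :: real)"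
      proof (rule sum.cong)
        fix k
        have "A (Suc k) \<subseteq> A k" using lmono[of k "Suc k"] by (auto simp: A_def)
        then show "indicator (R k) x = (indicator (A k) x - indicator (A (Suc k)) x :: real)"
          by (auto simp: R_def indicator_def)
      qed simp
      also have "\<dots> = indicator (A 0) x - indicator (A N) x"
        by (induction N) auto
      finally show ?thesis by (simp add: indicator_def)
    qed
    have Esum: "(\<Sum>k<N. E k) \<le> D"
    proof -
      have "(\<Sum>k<N. E k) = (\<integral>x. (\<Sum>k<N. indicator (R k) x *\<^sub>R (norm (d x) powr p)) \<partial>lborel)"
        unfolding E_def by (rule Bochner_Integration.integral_sum[symmetric]) (rule Eint)
      also have "\<dots> \<le> (\<integral>x. norm (d x) powr p \<partial>lborel)"
      proof (rule integral_mono)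
        show "(\<Sum>k<N. indicator (R k) x *\<^sub>R (norm (d x) powr p)) \<le> norm (d x) powr p" for x
          using mult_right_mono[OF Rdisj[of x], of "norm (d x) powr p"]
          unfolding real_scaleR_def sum_distrib_right[symmetric] by simp
        show "integrable lborel (\<lambda>x. \<Sum>k<N. indicator (R k) x *\<^sub>R (norm (d x) powr p))"
          by (rule Bochner_Integration.integrable_sum) (rule Eint)
      qed (rule dint)
      finally show ?thesis using dI by simp
    qed
    define b where "b k = l k powr q * \<alpha> k" for k
    have b0: "b k \<ge> 0" for k using \<alpha> by (simp add: b_def)
    have step: "b (Suc k) \<le> K * b k powr (p / n) * E k" for k
    proof -
      define F where "F s = ramp ((s - l k) / l k)" for s
      define F' where "F' s = ramp' ((s - l k) / l k) / l k" for s
      have g: "C1 (\<lambda>x. F (f x)) (\<lambda>x. F' (f x) *\<^sub>R d x)"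
        using C1_ramp[OF C, of "1 / l k" "-1"] l(1)[of k] by (simp add: F_def F'_def diff_divide_distrib)
      have F'z: "F' (f x) = 0" if "x \<notin> R k" for x
      proof (cases "f x \<le> l k")
        case True
        then have "(f x - l k) / l k \<le> 0" using l(1)[of k] by (simp add: divide_le_0_iff)
        then show ?thesis using ramp'_bounds(2) by (simp add: F'_def)
      next
        case False
        then have "f x > l (Suc k)" using that by (auto simp: R_def A_def)
        then have "1 \<le> (f x - l k) / l k" using l by simp
        then show ?thesis using ramp'_bounds(3) by (simp add: F'_def)
      qed
      have ms: "mass p (\<lambda>x. F' (f x) *\<^sub>R d x) \<le> ennreal ((2 / l k) powr p * E k)"
      proof -
        have "mass p (\<lambda>x. F' (f x) *\<^sub>R d x) \<le> ennreal ((2 / l k) powr p) * mass p (\<lambda>x. indicator (R k) x *\<^sub>R d x)"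
        proof (rule mass_scale)
          show "norm (F' (f x) *\<^sub>R d x) \<le> (2 / l k) * norm (indicator (R k) x *\<^sub>R d x)" for x
          proof (cases "x \<in> R k")
            case True
            have "\<bar>F' (f x)\<bar> \<le> 2 / l k" using ramp'_bounds(1) l(1)[of k] by (simp add: F'_def divide_right_mono)
            then have "\<bar>F' (f x)\<bar> * norm (d x) \<le> (2 / l k) * norm (d x)" by (intro mult_right_mono) auto
            then show ?thesis using True by simp
          qed (simp add: F'z)
        qed (use p l(1)[of k] in auto)
        also have "mass p (\<lambda>x. indicator (R k) x *\<^sub>R d x) = ennreal (E k)"
        proof -
          have eq: "norm (indicator (R k) x *\<^sub>R d x) powr p = indicator (R k) x *\<^sub>R (norm (d x) powr p)" for x
            by (simp add: indicator_def)
          show ?thesis unfolding mass_def eq E_def using Eint by (intro nn_integral_eq_integral) auto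
        qed
        finally show ?thesis by (simp add: ennreal_mult')
      qed
      have "emeasure lborel (A (Suc k)) \<le> ennreal (c0 * \<alpha> k powr (p / n) * ((2 / l k) powr p * E k))"
        unfolding c0_def n_def
      proof (rule level_estimate[OF g p(1) _ \<alpha>(1) \<alpha>(2) _ _ _ ms])
        show "F (f x) = 0" if "x \<notin> A k" for x
        proof -
          have "(f x - l k) / l k \<le> 0" using that l(1)[of k] by (simp add: A_def divide_le_0_iff)
          then show ?thesis using ramp_values(1) by (simp add: F_def)
        qed
        show "F (f x) = 1" if "x \<in> A (Suc k)" for x
        proof -
          have "1 \<le> (f x - l k) / l k" using that l(1)[of k] l(2)[of k] by (simp add: A_def)
          then show ?thesis using ramp_values(2) by (simp add: F_def)
        qed
      qed (use E0 in auto)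
      then have "\<alpha> (Suc k) \<le> c0 * \<alpha> k powr (p / n) * ((2 / l k) powr p * E k)"
        unfolding \<alpha>(1) using E0 c0 by simp
      then have "b (Suc k) \<le> (2 * l k) powr q * (c0 * \<alpha> k powr (p / n) * ((2 / l k) powr p * E k))"
        unfolding b_def l(2) by (intro mult_left_mono) auto
      also have "\<dots> = K * (l k powr q * l k powr (- p)) * \<alpha> k powr (p / n) * E k"
        using l(1)[of k] by (simp add: K_def powr_mult powr_divide powr_minus_divide)
      also have "l k powr q * l k powr (- p) = (l k powr q) powr (p / n)"
        using l(1)[of k] qp by (simp add: powr_add[symmetric] powr_powr)
      also have "K * (l k powr q) powr (p / n) * \<alpha> k powr (p / n) * E k = K * b k powr (p / n) * E k"
        using \<alpha> by (simp add: b_def powr_mult)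
      finally show ?thesis .
    qed
    define S where "S = (\<Sum>k<N. b k)"
    have S0: "S \<ge> 0" unfolding S_def using b0 by (intro sum_nonneg)
    have bS: "b k \<le> S" if "k < N" for k unfolding S_def using that b0 by (intro member_le_sum) auto
    have "S \<le> b 0 + K * D * S powr (p / n)"
    proof -
      have "S \<le> (\<Sum>k<Suc N. b k)" unfolding S_def using b0 by simp
      also have "\<dots> = b 0 + (\<Sum>k<N. b (Suc k))" by (rule sum.lessThan_Suc_shift)
      also have "(\<Sum>k<N. b (Suc k)) \<le> (\<Sum>k<N. K * S powr (p / n) * E k)"
      proof (rule sum_mono)
        fix k assume "k \<in> {..<N}"
        then have "b k powr (p / n) \<le> S powr (p / n)" using bS b0 p n by (intro powr_mono2) auto
        then have "K * b k powr (p / n) * E k \<le> K * S powr (p / n) * E k"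
          using K0 E0 by (intro mult_right_mono mult_left_mono) auto
        then show "b (Suc k) \<le> K * S powr (p / n) * E k" using step[of k] by simp
      qed
      also have "\<dots> = K * S powr (p / n) * (\<Sum>k<N. E k)" by (simp add: sum_distrib_left)
      also have "\<dots> \<le> K * S powr (p / n) * D" using K0 Esum by (intro mult_left_mono) auto
      finally show ?thesis by (simp add: mult_ac)
    qed
    then have "S \<le> 2 * b 0 + (2 * (K * D)) powr (1 / (1 - p / n))"
      using S0 b0 K0 D p n by (intro self_improving_bound) auto
    moreover have "b 0 \<le> \<epsilon> powr q * V" using \<alpha>V[of 0] by (simp add: b_def l_def mult_left_mono)
    ultimately have SS: "S \<le> 2 * (\<epsilon> powr q * V) + (2 * (K * D)) powr (q / p)" by (simp add: qp')
    have "I \<le> (\<integral>x. (\<Sum>k<N. l (Suc k) powr q * indicator (A k) x) + \<epsilon> powr q * indicator Q x \<partial>lborel)"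
      unfolding I_def
    proof (rule integral_mono[OF Iint])
      show "integrable lborel (\<lambda>x. (\<Sum>k<N. l (Suc k) powr q * indicator (A k) x) + \<epsilon> powr q * indicator Q x)"
        using Afin QV by (intro Bochner_Integration.integrable_add Bochner_Integration.integrable_sum integrable_mult_right integrable_real_indicator) auto
      fix x
      have s0: "0 \<le> (\<Sum>k<N. l (Suc k) powr q * indicator (A k) x)" by (intro sum_nonneg) auto
      show "(max 0 (f x)) powr q \<le> (\<Sum>k<N. l (Suc k) powr q * indicator (A k) x) + \<epsilon> powr q * indicator Q x"
      proof (cases "f x > \<epsilon>")
        case False
        then have "(max 0 (f x)) powr q \<le> \<epsilon> powr q * indicator Q x"
          using Q(2)[of x] \<epsilon> q0 by (cases "x \<in> Q") (auto intro!: powr_mono2)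
        then show ?thesis using s0 by linarith
      next
        case True
        have ex: "\<exists>k<N. l k < f x \<and> f x \<le> l (Suc k)"
        proof (rule ccontr)
          assume no: "\<not> (\<exists>k<N. l k < f x \<and> f x \<le> l (Suc k))"
          have "l k < f x" if "k \<le> N" for k using that
          proof (induction k)
            case 0 then show ?case using True by (simp add: l_def)
          next
            case (Suc k) then show ?case using no by force
          qed
          then show False using N N0(2)[of x] by force
        qed
        then obtain k where k: "k < N" "l k < f x" "f x \<le> l (Suc k)" by blast
        have "(max 0 (f x)) powr q \<le> l (Suc k) powr q * indicator (A k) x"
          using k q0 l(1)[of k] by (auto simp: A_def intro!: powr_mono2)
        also have "\<dots> \<le> (\<Sum>k<N. l (Suc k) powr q * indicator (A k) x)"
          using k(1) by (intro member_le_sum[of k "{..<N}" "\<lambda>k. l (Suc k) powr q * indicator (A k) x"]) auto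
        finally show ?thesis by (simp add: add_increasing2)
      qed
    qed
    also have "\<dots> = (\<Sum>k<N. l (Suc k) powr q * \<alpha> k) + \<epsilon> powr q * V"
    proof -
      have i: "integrable lborel (\<lambda>x. l (Suc k) powr q * indicator (A k) x)" for k
        using Afin by (intro integrable_mult_right integrable_real_indicator) auto
      have i2: "integrable lborel (\<lambda>x. \<epsilon> powr q * indicator Q x)"
        using QV by (intro integrable_mult_right integrable_real_indicator) auto
      have i3: "integrable lborel (\<lambda>x. (\<Sum>k<N. l (Suc k) powr q * indicator (A k) x))"
        by (rule Bochner_Integration.integrable_sum) (rule i)
      have "(\<integral>x. (\<Sum>k<N. l (Suc k) powr q * indicator (A k) x) + \<epsilon> powr q * indicator Q x \<partial>lborel)
         = (\<Sum>k<N. (\<integral>x. l (Suc k) powr q * indicator (A k) x \<partial>lborel)) + (\<integral>x. \<epsilon> powr q * indicator Q x \<partial>lborel)"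
        by (subst Bochner_Integration.integral_add[OF i3 i2]) (subst Bochner_Integration.integral_sum[OF i], rule refl)
      then show ?thesis by (simp add: \<alpha>_def V_def)
    qed
    also have "(\<Sum>k<N. l (Suc k) powr q * \<alpha> k) = 2 powr q * S"
      unfolding S_def sum_distrib_left using l by (intro sum.cong) (auto simp: b_def powr_mult less_imp_le)
    also have "2 powr q * S \<le> 2 powr q * (2 * (\<epsilon> powr q * V) + (2 * (K * D)) powr (q / p))"
      using SS by (intro mult_left_mono) auto
    finally show ?thesis by simp
  qed
  have "((\<lambda>\<epsilon>. 2 powr q * (2 * (\<epsilon> powr q * V) + (2 * (K * D)) powr (q / p)) + \<epsilon> powr q * V) \<longlongrightarrow>
      2 powr q * (2 * (0 powr q * V) + (2 * (K * D)) powr (q / p)) + 0 powr q * V) (at_right 0)"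
    using q0 by (intro tendsto_intros tendsto_powr' tendsto_ident_at) (auto simp: eventually_at_right_less eventually_at_filter)
  moreover have "\<forall>\<^sub>F \<epsilon> in at_right 0. I \<le> 2 powr q * (2 * (\<epsilon> powr q * V) + (2 * (K * D)) powr (q / p)) + \<epsilon> powr q * V"
    using main by (auto simp: eventually_at_right_field intro!: exI[of _ 1])
  ultimately have "I \<le> 2 powr q * (2 * (0 powr q * V) + (2 * (K * D)) powr (q / p)) + 0 powr q * V"
    by (rule tendsto_lowerbound) simp
  then have "I \<le> 2 powr q * (2 * K) powr (q / p) * D powr (q / p)"
    using K0 D by (simp add: powr_mult mult.assoc[symmetric])
  moreover have "mass q (\<lambda>x. max 0 (f x)) = ennreal I"
    unfolding mass_def I_def using Iint by (simp add: nn_integral_eq_integral)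
  ultimately show ?thesis by (simp add: ennreal_leI K_def c0_def)
qed

text \<open>In the limit of the approximating sequence the positive parts become \<open>u\<close> itself.\<close>

theorem sobolev_inequality:
  fixes u :: "'a::euclidean_space \<Rightarrow> real"
  defines "n \<equiv> real DIM('a)"
  assumes p: "1 < p" "p < n" and q: "q = n * p / (n - p)"
  shows "\<exists>C>0. \<forall>\<Omega> (u :: 'a \<Rightarrow> real) g. sobolev0 p \<Omega> u g \<and> (\<forall>x. 0 \<le> u x) \<longrightarrow>
    mass q u \<le> ennreal (C * enn2real (mass p g) powr (q / p))"
proof -
  have n: "n > 0" using p by simp
  have q0: "q > 0" "q / p > 0" using p n by (auto simp: q field_simps)
  have p0: "0 < p" using p by simp
  define c where "c = 2 powr q * (2 * (2 powr q * (2 * (2 / unit_ball_vol n) powr (p / n)) * 2 powr p)) powr (q / p)"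
  have c: "c > 0" unfolding c_def using unit_ball_vol_pos[OF less_imp_le[OF n]] by (intro mult_pos_pos) auto
  have "mass q u \<le> ennreal (c * (2 powr p) powr (q / p) * enn2real (mass p g) powr (q / p))"
    if s: "sobolev0 p \<Omega> u g" and nn: "\<And>x. 0 \<le> u x" for \<Omega> g and u :: "'a \<Rightarrow> real"
  proof -
    note sD = sobolev0D[OF s]
    obtain \<phi> d where "approx_seq p \<Omega> u g \<phi> d" using s unfolding sobolev0_def by blast
    then have \<phi>: "\<And>k. C1c \<Omega> (\<phi> k) (d k)" and L: "Lp_null p (\<lambda>k x. \<phi> k x - u x)" "Lp_null p (\<lambda>k x. d k x - g x)"
      and ae: "AE x in lborel. (\<lambda>k. \<phi> k x) \<longlonglongrightarrow> u x"
      by (auto simp: approx_seq_def)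
    have ae2: "AE x in lborel. (\<lambda>k. max 0 (\<phi> k x)) \<longlonglongrightarrow> u x"
      using ae
    proof eventually_elim
      case (elim x)
      have "(\<lambda>k. max 0 (\<phi> k x)) \<longlonglongrightarrow> max 0 (u x)" using elim by (intro tendsto_max tendsto_const)
      then show ?case using nn[of x] by simp
    qed
    have m: "(\<lambda>x. max 0 (\<phi> k x)) \<in> borel_measurable borel" for k
      using C1c_measurable(1)[OF \<phi>] by measurable
    have "mass q u \<le> ennreal (c * (2 powr p * enn2real (mass p g)) powr (q / p))"
    proof (rule mass_limit[OF p0 q0(1) m sD(1) ae2 C1c_measurable(2)[OF \<phi>] sD(2) L(2) _ mass_real[OF sD(6)], where B = "\<lambda>D. c * D powr (q / p)"])
      show "mass q (\<lambda>x. max 0 (\<phi> k x)) \<le> ennreal (c * D powr (q / p))" if "D > 0" "mass p (d k) \<le> ennreal D" for k D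
        unfolding c_def n_def using sobolev_C1c[OF \<phi> p(1) _ _ that(2)] p q that(1) by (simp add: n_def)
      show "((\<lambda>D. c * D powr (q / p)) \<longlongrightarrow> c * (2 powr p * enn2real (mass p g)) powr (q / p)) (at_right (2 powr p * enn2real (mass p g)))"
      proof (intro tendsto_intros tendsto_powr' tendsto_ident_at)
        have "0 \<le> 2 powr p * enn2real (mass p g)" by simp
        then show "2 powr p * enn2real (mass p g) \<noteq> 0 \<or> 0 < q / p \<and> (\<forall>\<^sub>F x in at_right (2 powr p * enn2real (mass p g)). 0 \<le> x)"
          using q0 by (auto simp: eventually_at_filter)
      qed
    qed simp
    then show ?thesis by (simp add: powr_mult mult.assoc)
  qed
  moreover have "c * (2 powr p) powr (q / p) > 0" using c by simp
  ultimately show ?thesis by blast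
qed

section \<open>Norms given by averages over the sphere\<close>

lemma signed_powr_alt: "signed_powr r s = (max 0 s) powr r - (max 0 (- s)) powr r"
  by (auto simp: signed_powr_def max_def sgn_if)

lemma continuous_signed_powr: "0 < r \<Longrightarrow> continuous_on UNIV (signed_powr r)"
  unfolding signed_powr_alt[abs_def] by (intro continuous_intros continuous_on_powr') auto

lemma measurable_signed_powr [measurable]: "signed_powr r \<in> borel_measurable borel"
  unfolding signed_powr_alt[abs_def] by measurable

text \<open>For a finite measure on the unit sphere that charges every direction, the \<open>p\<close>-th power of the
  norm \<open>(\<integral>\<bar>\<xi> \<bullet> \<zeta>\<bar>\<^sup>p)\<close>, and one \<open>p\<close>-th of its gradient.\<close>

definition avg_norm :: "'a::euclidean_space measure \<Rightarrow> real \<Rightarrow> 'a \<Rightarrow> real" where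
  "avg_norm \<mu> p \<zeta> = (\<integral>\<xi>. \<bar>\<xi> \<bullet> \<zeta>\<bar> powr p \<partial>\<mu>)"

definition avg_flux :: "'a::euclidean_space measure \<Rightarrow> real \<Rightarrow> 'a \<Rightarrow> 'a" where
  "avg_flux \<mu> p \<zeta> = (\<integral>\<xi>. signed_powr (p - 1) (\<xi> \<bullet> \<zeta>) *\<^sub>R \<xi> \<partial>\<mu>)"

locale directional_average =
  fixes \<mu> :: "'a::euclidean_space measure" and p c :: real
  assumes fin: "finite_measure \<mu>" and id_meas: "(\<lambda>\<xi>. \<xi>) \<in> \<mu> \<rightarrow>\<^sub>M borel"
    and unit: "\<And>\<xi>. \<xi> \<in> space \<mu> \<Longrightarrow> norm \<xi> = 1" and p: "1 < p"
    and c: "0 < c" and lower: "\<And>\<zeta>. c * norm \<zeta> powr p \<le> avg_norm \<mu> p \<zeta>"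
begin

abbreviation "N \<equiv> avg_norm \<mu> p"
abbreviation "a \<equiv> avg_flux \<mu> p"
abbreviation "m \<equiv> measure \<mu> (space \<mu>)"

lemma inner_le: "\<xi> \<in> space \<mu> \<Longrightarrow> \<bar>\<xi> \<bullet> \<zeta>\<bar> \<le> norm \<zeta>"
  using Cauchy_Schwarz_ineq2[of \<xi> \<zeta>] unit[of \<xi>] by simp

lemma inner_meas [measurable]: "(\<lambda>\<xi>. \<xi> \<bullet> \<zeta>) \<in> borel_measurable \<mu>"
  using id_meas by measurable

lemma int_N: "integrable \<mu> (\<lambda>\<xi>. \<bar>\<xi> \<bullet> \<zeta>\<bar> powr p)"
  using inner_le[of _ \<zeta>] p
  by (intro finite_measure.integrable_const_bound[OF fin, of _ "norm \<zeta> powr p"]) (auto intro!: powr_mono2 AE_I2)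

lemma int_a: "integrable \<mu> (\<lambda>\<xi>. signed_powr (p - 1) (\<xi> \<bullet> \<zeta>) *\<^sub>R \<xi>)"
proof (rule finite_measure.integrable_const_bound[OF fin, of _ "norm \<zeta> powr (p - 1)"])
  show "AE \<xi> in \<mu>. norm (signed_powr (p - 1) (\<xi> \<bullet> \<zeta>) *\<^sub>R \<xi>) \<le> norm \<zeta> powr (p - 1)"
    using inner_le[of _ \<zeta>] p by (intro AE_I2) (auto simp: abs_signed_powr unit intro!: powr_mono2)
  show "(\<lambda>\<xi>. signed_powr (p - 1) (\<xi> \<bullet> \<zeta>) *\<^sub>R \<xi>) \<in> borel_measurable \<mu>"
    using id_meas inner_meas by (intro borel_measurable_scaleR) measurable
qed

lemma a_inner: "a \<zeta> \<bullet> \<eta> = (\<integral>\<xi>. signed_powr (p - 1) (\<xi> \<bullet> \<zeta>) * (\<xi> \<bullet> \<eta>) \<partial>\<mu>)"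
  unfolding avg_flux_def using int_a by (subst integral_inner_left[symmetric]) auto

lemma int_ai: "integrable \<mu> (\<lambda>\<xi>. signed_powr (p - 1) (\<xi> \<bullet> \<zeta>) * (\<xi> \<bullet> \<eta>))"
  using integrable_inner_left[OF int_a[of \<zeta>], of \<eta>] by simp

lemma a_self: "a \<zeta> \<bullet> \<zeta> = N \<zeta>"
  unfolding a_inner avg_norm_def by (simp add: signed_powr_mult_self)

lemma a_zero: "a 0 = 0" "N 0 = 0"
  using p by (simp_all add: avg_flux_def avg_norm_def signed_powr_def)

lemma N_nonneg: "0 \<le> N \<zeta>"
  unfolding avg_norm_def by (intro integral_nonneg_AE) auto

lemma N_upper: "N \<zeta> \<le> m * norm \<zeta> powr p"
proof -
  have "N \<zeta> \<le> (\<integral>\<xi>. norm \<zeta> powr p \<partial>\<mu>)"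
    unfolding avg_norm_def using inner_le[of _ \<zeta>] p
    by (intro integral_mono int_N finite_measure.integrable_const[OF fin] powr_mono2) auto
  then show ?thesis by simp
qed

lemma a_bound: "norm (a \<zeta>) \<le> m * norm \<zeta> powr (p - 1)"
proof -
  have "norm (a \<zeta>) \<le> (\<integral>\<xi>. norm (signed_powr (p - 1) (\<xi> \<bullet> \<zeta>) *\<^sub>R \<xi>) \<partial>\<mu>)"
    unfolding avg_flux_def by (rule integral_norm_bound)
  also have "\<dots> \<le> (\<integral>\<xi>. norm \<zeta> powr (p - 1) \<partial>\<mu>)"
    using inner_le[of _ \<zeta>] p
    by (intro integral_mono integrable_norm int_a finite_measure.integrable_const[OF fin])
      (auto simp: abs_signed_powr unit intro!: powr_mono2)
  finally show ?thesis by simp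
qed

text \<open>Integrating the scalar tangent inequality over all directions shows that the flux is a
  subgradient of the convex function \<open>N / p\<close>.\<close>

lemma bregman: "N \<zeta> + p * (a \<zeta> \<bullet> (\<eta> - \<zeta>)) \<le> N \<eta>"
proof -
  have "N \<zeta> + p * (a \<zeta> \<bullet> (\<eta> - \<zeta>)) = (\<integral>\<xi>. \<bar>\<xi> \<bullet> \<zeta>\<bar> powr p + p * (signed_powr (p - 1) (\<xi> \<bullet> \<zeta>) * (\<xi> \<bullet> (\<eta> - \<zeta>))) \<partial>\<mu>)"
    unfolding a_inner avg_norm_def using int_N int_ai by simp
  also have "\<dots> \<le> N \<eta>"
    unfolding avg_norm_def
  proof (rule integral_mono)
    show "\<bar>\<xi> \<bullet> \<zeta>\<bar> powr p + p * (signed_powr (p - 1) (\<xi> \<bullet> \<zeta>) * (\<xi> \<bullet> (\<eta> - \<zeta>))) \<le> \<bar>\<xi> \<bullet> \<eta>\<bar> powr p" for \<xi>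
      using powr_tangent[OF p, of "\<xi> \<bullet> \<zeta>" "\<xi> \<bullet> \<eta>"] by (simp add: inner_diff_right mult.assoc)
  qed (use int_N int_ai in auto)
  finally show ?thesis .
qed

lemma a_continuous: "continuous_on UNIV a"
proof -
  have "isCont a \<zeta>" for \<zeta>
    unfolding continuous_at_sequentially
  proof (intro allI impI)
    fix z :: "nat \<Rightarrow> 'a" assume z: "z \<longlonglongrightarrow> \<zeta>"
    then obtain R where R: "\<And>k. norm (z k) \<le> R"
      using convergent_imp_bounded by (metis bounded_iff rangeI)
    have "(\<lambda>k. \<integral>\<xi>. signed_powr (p - 1) (\<xi> \<bullet> z k) *\<^sub>R \<xi> \<partial>\<mu>) \<longlonglongrightarrow> (\<integral>\<xi>. signed_powr (p - 1) (\<xi> \<bullet> \<zeta>) *\<^sub>R \<xi> \<partial>\<mu>)"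
    proof (rule integral_dominated_convergence[where w = "\<lambda>_. R powr (p - 1)"])
      show "AE \<xi> in \<mu>. (\<lambda>k. signed_powr (p - 1) (\<xi> \<bullet> z k) *\<^sub>R \<xi>) \<longlonglongrightarrow> signed_powr (p - 1) (\<xi> \<bullet> \<zeta>) *\<^sub>R \<xi>"
      proof (rule AE_I2)
        fix \<xi>
        have lim: "(\<lambda>k. \<xi> \<bullet> z k) \<longlonglongrightarrow> \<xi> \<bullet> \<zeta>" using z by (intro tendsto_intros)
        have cs: "continuous_on UNIV (signed_powr (p - 1))" using p by (intro continuous_signed_powr) simp
        have "(\<lambda>k. signed_powr (p - 1) (\<xi> \<bullet> z k)) \<longlonglongrightarrow> signed_powr (p - 1) (\<xi> \<bullet> \<zeta>)"
          using continuous_on_tendsto_compose[OF cs lim] by simp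
        then show "(\<lambda>k. signed_powr (p - 1) (\<xi> \<bullet> z k) *\<^sub>R \<xi>) \<longlonglongrightarrow> signed_powr (p - 1) (\<xi> \<bullet> \<zeta>) *\<^sub>R \<xi>"
          by (intro tendsto_intros)
      qed
      show "AE \<xi> in \<mu>. norm (signed_powr (p - 1) (\<xi> \<bullet> z k) *\<^sub>R \<xi>) \<le> R powr (p - 1)" for k
        using order_trans[OF inner_le R] p by (intro AE_I2) (auto simp: abs_signed_powr unit intro!: powr_mono2)
    qed (use int_a finite_measure.integrable_const[OF fin] in \<open>auto dest: borel_measurable_integrable\<close>)
    then show "(a \<circ> z) \<longlonglongrightarrow> a \<zeta>" by (simp add: avg_flux_def o_def)
  qed
  then show ?thesis by (simp add: continuous_at_imp_continuous_on)
qed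

lemma GDERIV_N: "GDERIV N \<zeta> :> p *\<^sub>R a \<zeta>"
proof -
  have "isCont a \<zeta>" using a_continuous by (simp add: continuous_on_eq_continuous_at)
  have "\<exists>\<delta>>0. \<forall>\<eta>. norm (\<eta> - \<zeta>) < \<delta> \<longrightarrow> norm (N \<eta> - N \<zeta> - (\<eta> - \<zeta>) \<bullet> (p *\<^sub>R a \<zeta>)) \<le> e * norm (\<eta> - \<zeta>)" if e: "e > 0" for e
  proof -
    have "e / p > 0" using e p by simp
    then obtain \<delta> where \<delta>: "\<delta> > 0" "\<And>\<eta>. dist \<eta> \<zeta> < \<delta> \<Longrightarrow> dist (a \<eta>) (a \<zeta>) < e / p"
      using \<open>isCont a \<zeta>\<close> unfolding continuous_at_eps_delta by blast
    have "norm (N \<eta> - N \<zeta> - (\<eta> - \<zeta>) \<bullet> (p *\<^sub>R a \<zeta>)) \<le> e * norm (\<eta> - \<zeta>)" if "norm (\<eta> - \<zeta>) < \<delta>" for \<eta>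
    proof -
      have 1: "0 \<le> N \<eta> - N \<zeta> - p * (a \<zeta> \<bullet> (\<eta> - \<zeta>))" using bregman[of \<zeta> \<eta>] by simp
      have 2: "N \<eta> - N \<zeta> - p * (a \<zeta> \<bullet> (\<eta> - \<zeta>)) \<le> p * ((a \<eta> - a \<zeta>) \<bullet> (\<eta> - \<zeta>))"
        using bregman[of \<eta> \<zeta>] by (simp add: inner_diff_left inner_diff_right algebra_simps)
      have "(a \<eta> - a \<zeta>) \<bullet> (\<eta> - \<zeta>) \<le> norm (a \<eta> - a \<zeta>) * norm (\<eta> - \<zeta>)" by (rule norm_cauchy_schwarz)
      also have "\<dots> \<le> e / p * norm (\<eta> - \<zeta>)"
        using \<delta>(2)[of \<eta>] that by (intro mult_right_mono) (auto simp: dist_norm)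
      finally have "p * ((a \<eta> - a \<zeta>) \<bullet> (\<eta> - \<zeta>)) \<le> p * (e / p * norm (\<eta> - \<zeta>))"
        using p by (intro mult_left_mono) auto
      also have "\<dots> = e * norm (\<eta> - \<zeta>)" using p by simp
      finally show ?thesis using 1 2 by (simp add: inner_commute)
    qed
    then show ?thesis using \<delta>(1) by blast
  qed
  then show ?thesis unfolding gderiv_def has_derivative_at_alt using bounded_linear_inner_left by blast
qed

lemma N_measurable [measurable]: "N \<in> borel_measurable borel"
proof -
  have "continuous_on UNIV N" using GDERIV_isCont[OF GDERIV_N] by (simp add: continuous_at_imp_continuous_on)
  then show ?thesis by (rule borel_measurable_continuous_onI)
qed

lemma a_measurable [measurable]: "a \<in> borel_measurable borel"
  using a_continuous by (rule borel_measurable_continuous_onI)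

text \<open>The flux of the norm \<open>N powr (1 / p)\<close>: the chain rule cancels the powers of \<open>N\<close>.\<close>

lemma flux_of_norm:
  assumes "\<zeta> \<noteq> 0"
  shows "(N \<zeta> powr (1 / p)) powr (p - 1) *\<^sub>R grad (\<lambda>\<zeta>. N \<zeta> powr (1 / p)) \<zeta> = a \<zeta>"
proof -
  have "c * norm \<zeta> powr p > 0" using c assms by simp
  then have N: "N \<zeta> > 0" using lower[of \<zeta>] by simp
  have "((\<lambda>s. s powr (1 / p)) has_real_derivative (1 / p) * N \<zeta> powr (1 / p - 1)) (at (N \<zeta>))"
    using N by (rule has_real_derivative_powr)
  from GDERIV_DERIV_compose[OF GDERIV_N this]
  have "grad (\<lambda>\<zeta>. N \<zeta> powr (1 / p)) \<zeta> = ((1 / p) * N \<zeta> powr (1 / p - 1)) *\<^sub>R (p *\<^sub>R a \<zeta>)" by (rule grad_eq)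
  then have "(N \<zeta> powr (1 / p)) powr (p - 1) *\<^sub>R grad (\<lambda>\<zeta>. N \<zeta> powr (1 / p)) \<zeta> =
      (N \<zeta> powr (1 / p * (p - 1)) * N \<zeta> powr (1 / p - 1)) *\<^sub>R a \<zeta>"
    using p by (simp add: powr_powr)
  also have "N \<zeta> powr (1 / p * (p - 1)) * N \<zeta> powr (1 / p - 1) = N \<zeta> powr (1 / p * (p - 1) + (1 / p - 1))"
    by (simp only: powr_add)
  also have "1 / p * (p - 1) + (1 / p - 1) = 0" using p by (simp add: field_simps)
  finally show ?thesis using N by simp
qed

end

section \<open>The affine flux\<close>

lemma sphere_measure_basic:
  fixes T :: "'a::euclidean_space itself"
  shows "space (sphere_measure :: 'a measure) = sphere 0 1"
    "sets (sphere_measure :: 'a measure) = sets (restrict_space borel (sphere 0 1))"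
  by (auto simp: sphere_measure_def space_restrict_space)

lemma sphere_measure_id: "(\<lambda>\<xi>. \<xi>) \<in> (sphere_measure :: 'a::euclidean_space measure) \<rightarrow>\<^sub>M borel"
  unfolding measurable_cong_sets[OF sphere_measure_basic(2) refl] by (rule measurable_restrict_space1) simp

lemma sphere_measure_borel:
  assumes "f \<in> borel_measurable borel" shows "f \<in> borel_measurable (sphere_measure :: 'a::euclidean_space measure)"
  using measurable_compose[OF sphere_measure_id assms] .

lemma nn_integral_sphere:
  fixes f :: "'a::euclidean_space \<Rightarrow> ennreal"
  assumes f: "f \<in> borel_measurable sphere_measure"
  shows "(\<integral>\<^sup>+\<xi>. f \<xi> \<partial>sphere_measure) = (\<integral>\<^sup>+x. ennreal (real DIM('a)) * f (x /\<^sub>R norm x) * indicator (ball 0 1 - {0}) x \<partial>lborel)"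
proof -
  let ?M = "restrict_space lborel (ball (0::'a) 1 - {0})"
  have T: "(\<lambda>x::'a. x /\<^sub>R norm x) \<in> ?M \<rightarrow>\<^sub>M restrict_space borel (sphere 0 1)"
    by (intro measurable_restrict_space2 measurable_restrict_space1) (auto simp: space_restrict_space)
  have f': "f \<in> borel_measurable (restrict_space borel (sphere 0 1))"
    using f measurable_cong_sets[OF sphere_measure_basic(2) refl] by blast
  have fT: "(\<lambda>x. f (x /\<^sub>R norm x)) \<in> borel_measurable ?M" by (rule measurable_compose[OF T f'])
  have "(\<integral>\<^sup>+\<xi>. f \<xi> \<partial>sphere_measure) = (\<integral>\<^sup>+x. f (x /\<^sub>R norm x) \<partial>density ?M (\<lambda>_. ennreal (real DIM('a))))"
    unfolding sphere_measure_def using T f' by (subst nn_integral_distr) auto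
  also have "\<dots> = (\<integral>\<^sup>+x. ennreal (real DIM('a)) * f (x /\<^sub>R norm x) \<partial>?M)"
    using fT by (subst nn_integral_density) auto
  also have "\<dots> = (\<integral>\<^sup>+x. ennreal (real DIM('a)) * f (x /\<^sub>R norm x) * indicator (ball 0 1 - {0}) x \<partial>lborel)"
    by (subst nn_integral_restrict_space) auto
  finally show ?thesis .
qed

lemma sphere_measure_total:
  "0 < emeasure (sphere_measure :: 'a::euclidean_space measure) (sphere 0 1)"
  "emeasure (sphere_measure :: 'a::euclidean_space measure) (sphere 0 1) < \<infinity>"
proof -
  let ?\<sigma> = "sphere_measure :: 'a measure"
  have "emeasure ?\<sigma> (sphere 0 1) = (\<integral>\<^sup>+\<xi>. 1 \<partial>?\<sigma>)" using sphere_measure_basic(1)[where 'a = 'a] by simp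
  also have "\<dots> = (\<integral>\<^sup>+x. ennreal (real DIM('a)) * indicator (ball 0 1 - {0}) x \<partial>(lborel :: 'a measure))"
    by (subst nn_integral_sphere) auto
  also have "\<dots> = ennreal (real DIM('a)) * emeasure lborel (ball (0::'a) 1 - {0})"
    by (subst nn_integral_cmult_indicator) auto
  also have "emeasure lborel (ball (0::'a) 1 - {0}) = emeasure lborel (ball (0::'a) 1)"
    by (subst emeasure_Diff) auto
  also have "\<dots> = ennreal (unit_ball_vol (real DIM('a)))" by (subst emeasure_ball) auto
  finally have "emeasure ?\<sigma> (sphere 0 1) = ennreal (real DIM('a) * unit_ball_vol (real DIM('a)))"
    by (simp add: ennreal_mult')
  then show "0 < emeasure ?\<sigma> (sphere 0 1)" "emeasure ?\<sigma> (sphere 0 1) < \<infinity>" by auto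
qed

text \<open>No direction is neglected by the surface measure: the cone of half-angle 60 degrees around
  \<open>\<zeta>\<close> contains a ball of radius 1/4.\<close>

lemma sphere_average_lower:
  assumes p: "0 < p"
  shows "\<exists>c>0. \<forall>\<zeta>::'a::euclidean_space. ennreal (c * norm \<zeta> powr p) \<le> (\<integral>\<^sup>+\<xi>. ennreal (\<bar>\<xi> \<bullet> \<zeta>\<bar> powr p) \<partial>sphere_measure)"
proof -
  define v where "v = real DIM('a) * (unit_ball_vol (real DIM('a)) * (1/4) ^ DIM('a)) * (1/2) powr p"
  have v: "v > 0" by (simp add: v_def)
  have "ennreal (v * norm \<zeta> powr p) \<le> (\<integral>\<^sup>+\<xi>. ennreal (\<bar>\<xi> \<bullet> \<zeta>\<bar> powr p) \<partial>sphere_measure)" for \<zeta> :: 'a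
  proof (cases "\<zeta> = 0")
    case False
    define e where "e = \<zeta> /\<^sub>R norm \<zeta>"
    have e: "norm e = 1" "\<zeta> = norm \<zeta> *\<^sub>R e" using False by (auto simp: e_def)
    define B where "B = ball ((3/4) *\<^sub>R e) (1/4)"
    have pt: "ennreal (real DIM('a)) * ennreal (((1/2) * norm \<zeta>) powr p) * indicator B x \<le>
        ennreal (real DIM('a)) * ennreal (\<bar>(x /\<^sub>R norm x) \<bullet> \<zeta>\<bar> powr p) * indicator (ball 0 1 - {0}) x" for x
    proof (cases "x \<in> B")
      case True
      define y where "y = x - (3/4) *\<^sub>R e"
      have y: "norm y < 1/4" using True by (simp add: B_def y_def dist_norm norm_minus_commute)
      have x: "x = (3/4) *\<^sub>R e + y" by (simp add: y_def)
      have "norm x \<le> 3/4 + norm y" unfolding x using norm_triangle_ineq[of "(3/4) *\<^sub>R e" y] e by simp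
      then have n1: "norm x < 1" using y by simp
      have "\<bar>y \<bullet> e\<bar> \<le> norm y * norm e" by (rule Cauchy_Schwarz_ineq2)
      moreover have "x \<bullet> e = 3/4 + y \<bullet> e" unfolding x using e by (simp add: inner_add_left dot_square_norm)
      ultimately have xe: "x \<bullet> e \<ge> 1/2" using y e by simp
      then have x0: "x \<noteq> 0" by auto
      have "1/2 * norm x \<le> x \<bullet> e" using xe n1 by simp
      then have "1/2 \<le> (x /\<^sub>R norm x) \<bullet> e" using x0 by (simp add: field_simps)
      then have "norm \<zeta> * (1/2) \<le> norm \<zeta> * ((x /\<^sub>R norm x) \<bullet> e)" by (intro mult_left_mono) auto
      also have "\<dots> = (x /\<^sub>R norm x) \<bullet> \<zeta>" by (metis e(2) inner_scaleR_right)
      finally have "(1/2) * norm \<zeta> \<le> \<bar>(x /\<^sub>R norm x) \<bullet> \<zeta>\<bar>" by simp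
      then have "((1/2) * norm \<zeta>) powr p \<le> \<bar>(x /\<^sub>R norm x) \<bullet> \<zeta>\<bar> powr p" using p by (intro powr_mono2) auto
      then show ?thesis using True x0 n1 by (simp add: mult_left_mono ennreal_leI)
    qed simp
    have "ennreal (v * norm \<zeta> powr p) = ennreal (real DIM('a)) * ennreal (((1/2) * norm \<zeta>) powr p) * emeasure lborel B"
      unfolding B_def v_def by (subst emeasure_ball) (auto simp: powr_mult powr_divide ennreal_mult'[symmetric] mult_ac)
    also have "\<dots> = (\<integral>\<^sup>+x. ennreal (real DIM('a)) * ennreal (((1/2) * norm \<zeta>) powr p) * indicator B x \<partial>lborel)"
      by (subst nn_integral_cmult_indicator) (auto simp: B_def)
    also have "\<dots> \<le> (\<integral>\<^sup>+x. ennreal (real DIM('a)) * ennreal (\<bar>(x /\<^sub>R norm x) \<bullet> \<zeta>\<bar> powr p) * indicator (ball 0 1 - {0}) x \<partial>lborel)"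
      by (intro nn_integral_mono pt)
    also have "\<dots> = (\<integral>\<^sup>+\<xi>. ennreal (\<bar>\<xi> \<bullet> \<zeta>\<bar> powr p) \<partial>sphere_measure)"
      by (rule nn_integral_sphere[symmetric]) (rule sphere_measure_borel, measurable)
    finally show ?thesis .
  qed simp
  then show ?thesis using v by blast
qed

lemma inverse_ennreal_powr_antimono:
  assumes "0 < x" "x \<le> y" "0 \<le> r"
  shows "inverse (ennreal (y powr r)) \<le> inverse (ennreal (x powr r))"
proof -
  have "x powr r \<le> y powr r" using assms by (intro powr_mono2) auto
  then show ?thesis using assms by (simp add: inverse_ennreal ennreal_leI)
qed

text \<open>For a fixed nontrivial function the affine flux is the flux of a fixed norm: the weight on the
  sphere is bounded above, and bounded below by the directional Poincare inequality.\<close>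

theorem affine_flux_structure:
  fixes u :: "'a::euclidean_space \<Rightarrow> real"
  assumes s: "sobolev0 p \<Omega> v g" and rg: "represents \<Omega> (weak_grad \<Omega> u) g" and p: "1 < p" and \<Omega>: "open \<Omega>" "bounded \<Omega>"
    and nz: "\<not> (AE x in lborel. v x = 0)"
  shows "\<exists>\<mu> c. directional_average \<mu> p c \<and> (\<forall>\<zeta>. affine_flux p \<Omega> u \<zeta> = avg_flux \<mu> p \<zeta>)"
proof -
  note sD = sobolev0D[OF s]
  have \<Omega>b: "\<Omega> \<in> sets borel" using \<Omega> by simp
  have p0: "0 < p" using p by simp
  have gm[measurable]: "g \<in> borel_measurable borel" by (rule sD(2))
  define n where "n = real DIM('a)"
  have n: "n \<ge> 1" by (simp add: n_def Suc_leI DIM_positive)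
  let ?S = "sphere (0::'a) 1" and ?\<sigma> = "sphere_measure :: 'a measure"
  define w where "w \<xi> = (\<integral>x. \<bar>g x \<bullet> \<xi>\<bar> powr p \<partial>lborel)" for \<xi>
  have dir: "dir_integral p \<Omega> u = w"
  proof
    fix \<xi>
    have "represents \<Omega> (\<lambda>x. \<bar>weak_grad \<Omega> u x \<bullet> \<xi>\<bar> powr p) (\<lambda>x. \<bar>g x \<bullet> \<xi>\<bar> powr p)"
      using rg p unfolding represents_def by (auto elim: eventually_mono)
    from represents_integral(1)[OF \<Omega>b this] show "dir_integral p \<Omega> u \<xi> = w \<xi>"
      by (simp add: dir_integral_def w_def)
  qed
  have wm[measurable]: "w \<in> borel_measurable borel" unfolding w_def[abs_def]
    by (rule lborel.borel_measurable_lebesgue_integral) measurable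
  have massfin: "mass p (\<lambda>x. g x \<bullet> \<xi>) < \<infinity>" for \<xi>
    using mass_inner_le[OF p0 gm, of \<xi>] sD(6) by (auto simp: ennreal_mult_less_top intro: le_less_trans)
  have w: "mass p (\<lambda>x. g x \<bullet> \<xi>) = ennreal (w \<xi>)" "0 \<le> w \<xi>" for \<xi>
    using mass_eq_integral[OF _ massfin, of \<xi>] by (auto simp: w_def)
  define G where "G = enn2real (mass p g)"
  have G: "mass p g = ennreal G" "G \<ge> 0" using sD(6) by (auto simp: G_def)
  have wup: "w \<xi> \<le> G" if "\<xi> \<in> ?S" for \<xi>
    using mass_inner_le[OF p0 gm, of \<xi>] that w G by simp
  obtain R where R: "R > 0" "\<Omega> \<subseteq> cball 0 R" using bounded_subset_cball0[OF \<Omega>(2)] by blast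
  define L where "L = 2 * R + 1"
  have L: "L > 0" "L > 2 * R" using R by (auto simp: L_def)
  define W where "W = enn2real (mass p v)"
  have W: "mass p v = ennreal W" "W \<ge> 0" using sD(5) by (auto simp: W_def)
  have "W > 0"
  proof (rule ccontr)
    assume "\<not> W > 0"
    then have "mass p v = 0" using W by simp
    then have "AE x in lborel. ennreal (norm (v x) powr p) = 0"
      unfolding mass_def using sD(1) by (subst (asm) nn_integral_0_iff_AE) auto
    then have "AE x in lborel. v x = 0" by eventually_elim simp
    then show False using nz by blast
  qed
  define \<kappa> where "\<kappa> = W / (2 powr p * L powr p)"
  have \<kappa>: "\<kappa> > 0" using \<open>W > 0\<close> L by (simp add: \<kappa>_def)
  have wlow: "\<kappa> \<le> w \<xi>" if \<xi>: "\<xi> \<in> ?S" for \<xi>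
  proof -
    have "mass p v \<le> ennreal (2 powr p) * mass p (\<lambda>x. g x \<bullet> (L *\<^sub>R \<xi>))"
      using \<xi> L by (intro directional_poincare[OF s p R(2)]) auto
    also have "w (L *\<^sub>R \<xi>) = L powr p * w \<xi>"
      unfolding w_def using L by (simp add: abs_mult powr_mult)
    then have "mass p (\<lambda>x. g x \<bullet> (L *\<^sub>R \<xi>)) = ennreal (L powr p * w \<xi>)" using w(1)[of "L *\<^sub>R \<xi>"] by simp
    finally have "ennreal W \<le> ennreal (2 powr p * (L powr p * w \<xi>))" using W by (simp add: ennreal_mult')
    then have "W \<le> 2 powr p * (L powr p * w \<xi>)" using w(2) by (simp add: ennreal_le_iff)
    then show ?thesis using L by (simp add: \<kappa>_def field_simps)
  qed
  obtain \<xi>0 :: 'a where "\<xi>0 \<in> ?S" using vector_choose_size[of 1] by (metis dist_0_norm mem_sphere zero_le_one)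
  then have "\<kappa> \<le> G" using wlow wup order_trans by blast
  then have G0: "G > 0" using \<kappa> by simp
  have ac: "affine_const DIM('a) p > 0"
  proof -
    have "unit_ball_vol (n + p - 2) > 0" "unit_ball_vol n > 0" "unit_ball_vol (p - 1) > 0"
      using n p by (intro unit_ball_vol_pos, simp)+
    moreover from this have "n * unit_ball_vol n * unit_ball_vol (p - 1) > 0" "n * unit_ball_vol n > 0" using n by simp_all
    ultimately show ?thesis unfolding affine_const_def n_def[symmetric]
      by (intro mult_pos_pos iffD2[OF powr_gt_zero]) auto
  qed
  have ae: "affine_energy p \<Omega> u > 0"
  proof -
    define J where "J = (\<integral>\<^sup>+\<xi>. inverse (ennreal (w \<xi> powr (n / p))) \<partial>?\<sigma>)"
    have lo: "inverse (ennreal (G powr (n / p))) * emeasure ?\<sigma> ?S \<le> J"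
    proof -
      have "inverse (ennreal (G powr (n / p))) * emeasure ?\<sigma> ?S = (\<integral>\<^sup>+\<xi>. inverse (ennreal (G powr (n / p))) \<partial>?\<sigma>)"
        using sphere_measure_basic(1)[where 'a = 'a] by simp
      also have "\<dots> \<le> J" unfolding J_def using wup less_le_trans[OF \<kappa> wlow] n p0 sphere_measure_basic(1)[where 'a = 'a]
        by (intro nn_integral_mono inverse_ennreal_powr_antimono) auto
      finally show ?thesis .
    qed
    have up: "J \<le> inverse (ennreal (\<kappa> powr (n / p))) * emeasure ?\<sigma> ?S"
    proof -
      have "J \<le> (\<integral>\<^sup>+\<xi>. inverse (ennreal (\<kappa> powr (n / p))) \<partial>?\<sigma>)"
        unfolding J_def using wlow \<kappa> n p0 sphere_measure_basic(1)[where 'a = 'a]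
        by (intro nn_integral_mono inverse_ennreal_powr_antimono) auto
      then show ?thesis using sphere_measure_basic(1)[where 'a = 'a] by simp
    qed
    have "inverse (ennreal (G powr (n / p))) * emeasure ?\<sigma> ?S > 0"
      using sphere_measure_total(1)[where 'a = 'a] by (simp add: ennreal_zero_less_mult_iff ennreal_inverse_positive)
    then have J0: "J > 0" using lo by (rule less_le_trans)
    have "inverse (ennreal (\<kappa> powr (n / p))) * emeasure ?\<sigma> ?S < \<infinity>"
      using sphere_measure_total(2)[where 'a = 'a] \<kappa> by (simp add: ennreal_mult_less_top inverse_ennreal)
    then have J1: "J < \<infinity>" using up le_less_trans by blast
    have "inverse J > 0" using J1 by (simp add: ennreal_inverse_positive)
    moreover have "inverse J \<noteq> top" using J0 by (simp del: infinity_ennreal_def)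
    then have "inverse J < \<infinity>" by (simp add: less_top[symmetric])
    ultimately have "enn2real (inverse J) > 0" by (simp add: enn2real_positive_iff)
    then show ?thesis unfolding affine_energy_def dir using ac by (simp add: J_def n_def)
  qed
  define K where "K = affine_const DIM('a) p powr (- n) * affine_energy p \<Omega> u powr (n + p)"
  have K: "K > 0" using ac ae by (simp add: K_def)
  define r where "r = (n + p) / p"
  have r: "r > 0" using n p by (simp add: r_def)
  define k where "k \<xi> = K * w \<xi> powr (- r)" for \<xi>
  have km[measurable]: "k \<in> borel_measurable borel" unfolding k_def[abs_def] by measurable
  have k0: "0 \<le> k \<xi>" for \<xi> using K by (simp add: k_def)
  have kup: "k \<xi> \<le> K * \<kappa> powr (- r)" if "\<xi> \<in> ?S" for \<xi>
    unfolding k_def using K r wlow[OF that] \<kappa> by (intro mult_left_mono powr_mono2') auto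
  have klow: "K * G powr (- r) \<le> k \<xi>" if "\<xi> \<in> ?S" for \<xi>
    unfolding k_def using K r wup[OF that] wlow[OF that] \<kappa> by (intro mult_left_mono powr_mono2') auto
  define \<mu> where "\<mu> = density ?\<sigma> (\<lambda>\<xi>. ennreal (k \<xi>))"
  have ks: "k \<in> borel_measurable ?\<sigma>" by (rule sphere_measure_borel[OF km])
  have Hpow: "affine_H_pow p \<Omega> u \<zeta> = avg_norm \<mu> p \<zeta>" for \<zeta>
  proof -
    have im: "(\<lambda>\<xi>. \<bar>\<xi> \<bullet> \<zeta>\<bar> powr p) \<in> borel_measurable ?\<sigma>" by (rule sphere_measure_borel) measurable
    have "affine_H_pow p \<Omega> u \<zeta> = K * (\<integral>\<xi>. w \<xi> powr (- r) * \<bar>\<xi> \<bullet> \<zeta>\<bar> powr p \<partial>?\<sigma>)"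
    proof -
      have re: "- (n + p) / p = - r" using p by (simp add: r_def field_simps)
      show ?thesis unfolding affine_H_pow_def dir n_def[symmetric] re K_def ..
    qed
    also have "\<dots> = (\<integral>\<xi>. k \<xi> *\<^sub>R (\<bar>\<xi> \<bullet> \<zeta>\<bar> powr p) \<partial>?\<sigma>)" by (simp add: k_def mult.assoc)
    also have "\<dots> = avg_norm \<mu> p \<zeta>"
      unfolding avg_norm_def \<mu>_def using ks im k0 by (subst integral_density) auto
    finally show ?thesis .
  qed
  obtain c where c: "c > 0" "\<And>\<zeta>::'a. ennreal (c * norm \<zeta> powr p) \<le> (\<integral>\<^sup>+\<xi>. ennreal (\<bar>\<xi> \<bullet> \<zeta>\<bar> powr p) \<partial>sphere_measure)"
    using sphere_average_lower[OF p0] by metis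
  define c' where "c' = K * G powr (- r) * c"
  have fin: "finite_measure \<mu>"
  proof (rule finite_measureI)
    have "emeasure \<mu> (space \<mu>) = (\<integral>\<^sup>+\<xi>. ennreal (k \<xi>) \<partial>?\<sigma>)"
      unfolding \<mu>_def using ks by (subst emeasure_density) (auto intro!: nn_integral_cong)
    also have "\<dots> \<le> (\<integral>\<^sup>+\<xi>. ennreal (K * \<kappa> powr (- r)) \<partial>?\<sigma>)"
      using kup sphere_measure_basic(1)[where 'a = 'a] by (intro nn_integral_mono ennreal_leI) auto
    also have "\<dots> < \<infinity>" using sphere_measure_total(2)[where 'a = 'a] sphere_measure_basic(1)[where 'a = 'a]
      by (simp add: ennreal_mult_less_top)
    finally show "emeasure \<mu> (space \<mu>) \<noteq> \<infinity>" by simp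
  qed
  have idm: "(\<lambda>\<xi>. \<xi>) \<in> \<mu> \<rightarrow>\<^sub>M borel" unfolding \<mu>_def using sphere_measure_id by simp
  have un: "norm \<xi> = 1" if "\<xi> \<in> space \<mu>" for \<xi> using that sphere_measure_basic(1)[where 'a = 'a] by (simp add: \<mu>_def)
  have low: "c' * norm \<zeta> powr p \<le> avg_norm \<mu> p \<zeta>" for \<zeta>
  proof -
    have im[measurable]: "(\<lambda>\<xi>. \<bar>\<xi> \<bullet> \<zeta>\<bar> powr p) \<in> borel_measurable ?\<sigma>" by (rule sphere_measure_borel) measurable
    have im': "(\<lambda>\<xi>. \<bar>\<xi> \<bullet> \<zeta>\<bar> powr p) \<in> borel_measurable \<mu>" using im by (simp add: \<mu>_def)
    have "norm (\<xi> \<bullet> \<zeta>) \<le> norm \<zeta>" if "\<xi> \<in> space \<mu>" for \<xi>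
      using Cauchy_Schwarz_ineq2[of \<xi> \<zeta>] un[OF that] by simp
    then have int: "integrable \<mu> (\<lambda>\<xi>. \<bar>\<xi> \<bullet> \<zeta>\<bar> powr p)" using p0 im'
      by (intro finite_measure.integrable_const_bound[OF fin, of _ "norm \<zeta> powr p"]) (auto intro!: AE_I2 powr_mono2)
    have "ennreal (c' * norm \<zeta> powr p) = ennreal (K * G powr (- r)) * ennreal (c * norm \<zeta> powr p)"
      using K c by (simp add: c'_def ennreal_mult'[symmetric] mult.assoc)
    also have "\<dots> \<le> ennreal (K * G powr (- r)) * (\<integral>\<^sup>+\<xi>. ennreal (\<bar>\<xi> \<bullet> \<zeta>\<bar> powr p) \<partial>?\<sigma>)"
      by (intro mult_left_mono c(2)) auto
    also have "\<dots> = (\<integral>\<^sup>+\<xi>. ennreal (K * G powr (- r)) * ennreal (\<bar>\<xi> \<bullet> \<zeta>\<bar> powr p) \<partial>?\<sigma>)"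
      by (subst nn_integral_cmult) auto
    also have "\<dots> \<le> (\<integral>\<^sup>+\<xi>. ennreal (k \<xi>) * ennreal (\<bar>\<xi> \<bullet> \<zeta>\<bar> powr p) \<partial>?\<sigma>)"
      using klow sphere_measure_basic(1)[where 'a = 'a] by (intro nn_integral_mono mult_right_mono ennreal_leI) auto
    also have "\<dots> = (\<integral>\<^sup>+\<xi>. ennreal (\<bar>\<xi> \<bullet> \<zeta>\<bar> powr p) \<partial>\<mu>)"
      unfolding \<mu>_def using ks by (subst nn_integral_density) auto
    also have "\<dots> = ennreal (avg_norm \<mu> p \<zeta>)"
      unfolding avg_norm_def using int by (intro nn_integral_eq_integral) auto
    finally show ?thesis
      by (subst (asm) ennreal_le_iff) (auto simp: avg_norm_def intro: integral_nonneg_AE)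
  qed
  have c': "c' > 0" using K G0 c by (simp add: c'_def)
  have DA: "directional_average \<mu> p c'"
    by (rule directional_average.intro[OF fin idm un p c' low])
  have "affine_flux p \<Omega> u \<zeta> = avg_flux \<mu> p \<zeta>" for \<zeta>
  proof (cases "\<zeta> = 0")
    case True
    then show ?thesis using directional_average.a_zero(1)[OF DA] by (simp add: affine_flux_def)
  next
    case False
    have "affine_H p \<Omega> u = (\<lambda>\<zeta>. avg_norm \<mu> p \<zeta> powr (1 / p))" by (simp add: affine_H_def Hpow fun_eq_iff)
    then show ?thesis using directional_average.flux_of_norm[OF DA False] False by (simp add: affine_flux_def)
  qed
  then show ?thesis using DA by blast
qed

section \<open>Higher integrability\<close>

text \<open>A smooth substitute for \<open>min k x\<close> on the positive axis; the functions \<open>x * (soft_min k x) powr t\<close>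
  grow linearly, and their derivatives are comparable with \<open>(soft_min k x) powr t\<close>.\<close>

definition soft_min :: "real \<Rightarrow> real \<Rightarrow> real" where
  "soft_min k x = k * max 0 x / (k + max 0 x)"

definition trunc :: "real \<Rightarrow> real \<Rightarrow> real \<Rightarrow> real" where
  "trunc k t x = x * soft_min k x powr t"

definition trunc' :: "real \<Rightarrow> real \<Rightarrow> real \<Rightarrow> real" where
  "trunc' k t x = soft_min k x powr t * (1 + t * k / (k + max 0 x))"

lemma soft_min_bounds:
  assumes "0 < k" shows "0 \<le> soft_min k x" "soft_min k x \<le> k" "soft_min k x \<le> max 0 x"
proof -
  have p: "k + max 0 x > 0" using assms by (simp add: add_pos_nonneg)
  show "0 \<le> soft_min k x" using assms p by (simp add: soft_min_def)
  show "soft_min k x \<le> k" unfolding soft_min_def using assms p by (simp add: divide_le_eq mult_left_mono)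
  have "k * max 0 x \<le> max 0 x * (k + max 0 x)" by (simp add: algebra_simps)
  then show "soft_min k x \<le> max 0 x" unfolding soft_min_def using p by (simp add: divide_le_eq)
qed

lemma soft_min_cont: "0 < k \<Longrightarrow> continuous_on UNIV (soft_min k)"
  unfolding soft_min_def[abs_def]
  by (intro continuous_intros) (auto simp: add_pos_nonneg dest: less_imp_neq)

lemma soft_min_powr_cont: "0 < k \<Longrightarrow> 0 < t \<Longrightarrow> continuous_on UNIV (\<lambda>x. soft_min k x powr t)"
  using soft_min_bounds(1) by (intro continuous_on_powr' soft_min_cont continuous_intros) auto

lemma trunc_deriv:
  assumes k: "0 < k" and t: "0 < t"
  shows "(trunc k t has_real_derivative trunc' k t x) (at x)"
proof -
  consider "x < 0" | "x = 0" | "x > 0" by linarith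
  then show ?thesis
  proof cases
    case 1
    have "((\<lambda>x. 0) has_real_derivative trunc' k t x) (at x)"
      using 1 by (auto simp: trunc'_def soft_min_def intro!: derivative_eq_intros)
    then show ?thesis
      by (rule has_field_derivative_transform_within_open[where S = "{..<0}"]) (use 1 in \<open>auto simp: trunc_def soft_min_def\<close>)
  next
    case 2
    have "isCont (\<lambda>h. soft_min k h powr t) 0"
      using soft_min_powr_cont[OF k t] by (simp add: continuous_on_eq_continuous_at)
    then have "(\<lambda>h. soft_min k h powr t) \<midarrow>0\<rightarrow> 0" unfolding isCont_def by (simp add: soft_min_def)
    then have "(\<lambda>h. (trunc k t (0 + h) - trunc k t 0) / h) \<midarrow>0\<rightarrow> 0"
      by (rule Lim_transform_eventually) (auto simp: trunc_def eventually_at_filter)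
    then show ?thesis unfolding 2 by (simp add: DERIV_def trunc'_def soft_min_def)
  next
    case 3
    define y where "y = k * x / (k + x)"
    have y: "y > 0" using k 3 by (simp add: y_def)
    have d: "((\<lambda>x. k * x / (k + x)) has_real_derivative k * k / (k + x)\<^sup>2) (at x)"
      using k 3 by (auto intro!: derivative_eq_intros simp: power2_eq_square field_simps)
    have "((\<lambda>x. (k * x / (k + x)) powr t) has_real_derivative (t * y powr (t - 1)) * (k * k / (k + x)\<^sup>2)) (at x)"
      using DERIV_chain2[where f = "\<lambda>z. z powr t" and g = "\<lambda>x. k * x / (k + x)", OF has_real_derivative_powr[OF y, unfolded y_def] d]
      unfolding y_def .
    from DERIV_mult[OF DERIV_ident this]
    have "((\<lambda>x. x * (k * x / (k + x)) powr t) has_real_derivative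
       1 * y powr t + (t * y powr (t - 1)) * (k * k / (k + x)\<^sup>2) * x) (at x)" by (simp add: y_def)
    also have "1 * y powr t + (t * y powr (t - 1)) * (k * k / (k + x)\<^sup>2) * x = trunc' k t x"
    proof -
      have "y powr (t - 1) = y powr t / y" using y by (simp add: powr_diff)
      moreover have "(k * k / (k + x)\<^sup>2) * x / y = k / (k + x)"
      proof -
        have "k + x \<noteq> 0" using k 3 by simp
        then show ?thesis using k 3 by (simp add: y_def power2_eq_square)
      qed
      moreover have "(t * (y powr t / y)) * (k * k / (k + x)\<^sup>2) * x = y powr t * (t * ((k * k / (k + x)\<^sup>2) * x / y))" by (simp add: mult_ac)
      ultimately have "(t * y powr (t - 1)) * (k * k / (k + x)\<^sup>2) * x = y powr t * (t * (k / (k + x)))" by simp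
      then show ?thesis using 3 by (simp add: trunc'_def soft_min_def y_def algebra_simps)
    qed
    finally show ?thesis
      by (rule has_field_derivative_transform_within_open[where S = "{0<..}"]) (use 3 in \<open>auto simp: trunc_def soft_min_def\<close>)
  qed
qed

lemma trunc'_cont: "0 < k \<Longrightarrow> 0 < t \<Longrightarrow> continuous_on UNIV (trunc' k t)"
  unfolding trunc'_def[abs_def]
  by (intro continuous_intros soft_min_powr_cont) (auto simp: add_pos_nonneg dest: less_imp_neq)

lemma trunc'_bounds:
  assumes k: "0 < k" and t: "0 < t"
  shows "soft_min k x powr t \<le> trunc' k t x" "trunc' k t x \<le> (1 + t) * soft_min k x powr t" "\<bar>trunc' k t x\<bar> \<le> (1 + t) * k powr t"
proof -
  define z where "z = t * k / (k + max 0 x)"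
  have p: "k + max 0 x > 0" using k by (simp add: add_pos_nonneg)
  have z: "0 \<le> z" "z \<le> t" using k t p by (auto simp: z_def divide_le_eq algebra_simps)
  have s: "0 \<le> soft_min k x powr t" by simp
  show 1: "soft_min k x powr t \<le> trunc' k t x"
    using mult_left_mono[of 1 "1 + z" "soft_min k x powr t"] z s by (simp add: trunc'_def z_def)
  show 2: "trunc' k t x \<le> (1 + t) * soft_min k x powr t"
    using mult_left_mono[of "1 + z" "1 + t" "soft_min k x powr t"] z s by (simp add: trunc'_def z_def mult.commute)
  have "soft_min k x powr t \<le> k powr t" using soft_min_bounds[OF k] t by (intro powr_mono2) auto
  then have "(1 + t) * soft_min k x powr t \<le> (1 + t) * k powr t" using t by (intro mult_left_mono) auto
  then show "\<bar>trunc' k t x\<bar> \<le> (1 + t) * k powr t" using 1 2 s by linarith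
qed

lemma holder_bound:
  fixes F H :: "'a \<Rightarrow> real"
  assumes int: "integrable M F" "integrable M H" and nn: "\<And>x. 0 \<le> F x" "\<And>x. 0 \<le> H x"
    and ab: "0 < \<alpha>" "0 < \<beta>" "\<alpha> + \<beta> = 1" and A: "0 < A" "(\<integral>x. F x \<partial>M) \<le> A" and B: "0 < B" "(\<integral>x. H x \<partial>M) \<le> B"
  shows "integrable M (\<lambda>x. F x powr \<alpha> * H x powr \<beta>)" "(\<integral>x. F x powr \<alpha> * H x powr \<beta> \<partial>M) \<le> A powr \<alpha> * B powr \<beta>"
proof -
  have meas[measurable]: "F \<in> borel_measurable M" "H \<in> borel_measurable M" using int by auto
  define R where "R x = (A powr \<alpha> * B powr \<beta>) * (\<alpha> * (F x / A) + \<beta> * (H x / B))" for x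
  have pt: "F x powr \<alpha> * H x powr \<beta> \<le> R x" for x
  proof -
    have "(F x / A) powr \<alpha> * (H x / B) powr \<beta> \<le> \<alpha> * (F x / A) + \<beta> * (H x / B)"
    proof (cases "F x = 0 \<or> H x = 0")
      case False
      then show ?thesis using nn[of x] A B ab by (intro Youngs_inequality_0) (auto simp: less_le)
    next
      case True
      then have "(F x / A) powr \<alpha> * (H x / B) powr \<beta> = 0" by auto
      also have "0 \<le> \<alpha> * (F x / A) + \<beta> * (H x / B)" using nn[of x] A B ab by simp
      finally show ?thesis .
    qed
    then have "(A powr \<alpha> * B powr \<beta>) * ((F x / A) powr \<alpha> * (H x / B) powr \<beta>) \<le> R x"
      unfolding R_def by (intro mult_left_mono) auto
    also have "(A powr \<alpha> * B powr \<beta>) * ((F x / A) powr \<alpha> * (H x / B) powr \<beta>) = F x powr \<alpha> * H x powr \<beta>"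
      using A B nn[of x] by (simp add: powr_divide)
    finally show ?thesis .
  qed
  have Rint: "integrable M R" unfolding R_def[abs_def] using int by simp
  show I: "integrable M (\<lambda>x. F x powr \<alpha> * H x powr \<beta>)"
    using order_trans[OF pt abs_ge_self] by (intro Bochner_Integration.integrable_bound[OF Rint]) auto
  have "(\<integral>x. F x powr \<alpha> * H x powr \<beta> \<partial>M) \<le> (\<integral>x. R x \<partial>M)" using I Rint pt by (intro integral_mono) auto
  also have "\<dots> = (A powr \<alpha> * B powr \<beta>) * (\<alpha> * ((\<integral>x. F x \<partial>M) / A) + \<beta> * ((\<integral>x. H x \<partial>M) / B))"
    unfolding R_def using int by simp
  also have "\<dots> \<le> (A powr \<alpha> * B powr \<beta>) * (\<alpha> * 1 + \<beta> * 1)"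
    using A B ab by (intro mult_left_mono add_mono) auto
  finally show "(\<integral>x. F x powr \<alpha> * H x powr \<beta> \<partial>M) \<le> A powr \<alpha> * B powr \<beta>" using ab by simp
qed

text \<open>The weak form of the equation for a fixed norm, in terms of Borel representatives.\<close>

locale critical_problem = directional_average \<mu> p c
  for \<mu> :: "'a::euclidean_space measure" and p c :: real +
  fixes \<Omega> :: "'a set" and v :: "'a \<Rightarrow> real" and g :: "'a \<Rightarrow> 'a" and q lam :: real
  assumes open_dom: "open \<Omega>" and bounded_dom: "bounded \<Omega>" and sob: "sobolev0 p \<Omega> v g"
    and v_nonneg: "\<And>x. 0 \<le> v x" and p_less: "p < real DIM('a)"
    and q_def: "q = real DIM('a) * p / (real DIM('a) - p)" and lam: "lam \<le> 0"
    and weak: "\<And>\<phi> h. sobolev0 p \<Omega> \<phi> h \<Longrightarrow>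
      (\<integral>x. avg_flux \<mu> p (g x) \<bullet> h x \<partial>lborel) = (\<integral>x. v x powr (q - 1) * \<phi> x \<partial>lborel) + lam * (\<integral>x. v x powr (p - 1) * \<phi> x \<partial>lborel)"
begin

lemma vm [measurable]: "v \<in> borel_measurable borel" and gm [measurable]: "g \<in> borel_measurable borel"
  using sobolev0D[OF sob] by auto

lemma p0: "0 < p" using p by simp

lemma pq: "p < q"
proof -
  have "p * (real DIM('a) - p) < real DIM('a) * p" using p by (simp add: algebra_simps)
  then show ?thesis using p_less by (simp add: q_def less_divide_eq)
qed

lemma mass_v: "mass r v = (\<integral>\<^sup>+x. ennreal (v x powr r) \<partial>lborel)"
  using v_nonneg by (simp add: mass_def)

lemma integrable_v: "integrable lborel (\<lambda>x. v x powr r) \<longleftrightarrow> mass r v < \<infinity>"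
  using mass_integrable[OF vm, of r] v_nonneg by simp

lemma v_Lq: "mass q v < \<infinity>"
proof -
  obtain C where "mass q v \<le> ennreal (C * enn2real (mass p g) powr (q / p))"
    using sobolev_inequality[OF p p_less q_def] sob v_nonneg by blast
  then show ?thesis using le_less_trans by fastforce
qed

lemma g_int: "integrable lborel (\<lambda>x. norm (g x) powr p)"
  using mass_integrable[OF gm, of p] sobolev0D(6)[OF sob] by blast

lemma Ng_int: "integrable lborel (\<lambda>x. N (g x))"
proof (rule Bochner_Integration.integrable_bound[of _ "\<lambda>x. m * norm (g x) powr p"])
  show "integrable lborel (\<lambda>x. m * norm (g x) powr p)" using g_int by simp
  show "AE x in lborel. norm (N (g x)) \<le> norm (m * norm (g x) powr p)"
    using N_upper N_nonneg by (intro AE_I2) (simp add: abs_mult)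
qed measurable

lemma tail_small:
  assumes "e > 0" shows "\<exists>M>0. (\<integral>x. indicator {x. v x > M} x *\<^sub>R v x powr q \<partial>lborel) < e"
proof -
  have int: "integrable lborel (\<lambda>x. v x powr q)" using v_Lq integrable_v by blast
  have "(\<lambda>k::nat. \<integral>x. indicator {x. v x > real k} x *\<^sub>R v x powr q \<partial>lborel) \<longlonglongrightarrow> (\<integral>x. 0 \<partial>(lborel :: 'a measure))"
  proof (rule integral_dominated_convergence[where w = "\<lambda>x. v x powr q"])
    show "AE x in lborel. (\<lambda>k::nat. indicator {x. v x > real k} x *\<^sub>R v x powr q) \<longlonglongrightarrow> 0"
    proof (rule AE_I2)
      fix x
      obtain K :: nat where "v x < real K" using reals_Archimedean2 by blast
      then have "\<forall>\<^sub>F k::nat in sequentially. indicator {x. v x > real k} x *\<^sub>R v x powr q = 0"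
        by (auto simp: eventually_sequentially indicator_def intro!: exI[of _ K])
      then show "(\<lambda>k::nat. indicator {x. v x > real k} x *\<^sub>R v x powr q) \<longlonglongrightarrow> 0" by (rule tendsto_eventually)
    qed
  qed (use int in \<open>auto simp: indicator_def\<close>)
  then have "\<forall>\<^sub>F k::nat in sequentially. (\<integral>x. indicator {x. v x > real k} x *\<^sub>R v x powr q \<partial>lborel) < e"
    using assms by (intro order_tendstoD(2)) auto
  then have "\<forall>\<^sub>F k::nat in sequentially. (\<integral>x. indicator {x. v x > real k} x *\<^sub>R v x powr q \<partial>lborel) < e \<and> k > 0"
    using eventually_gt_at_top by (rule eventually_conj)
  then obtain k :: nat where "k > 0" "(\<integral>x. indicator {x. v x > real k} x *\<^sub>R v x powr q \<partial>lborel) < e"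
    by (auto simp: eventually_sequentially)
  then show ?thesis by (intro exI[of _ "real k"]) auto
qed

text \<open>The estimate behind one step of the iteration, uniformly in the truncation: testing with
  \<open>v * (soft_min k v) powr (p s)\<close> and absorbing the part where \<open>v\<close> is large, which is small in
  the critical Lebesgue space.\<close>

lemma moser_uniform:
  assumes s: "0 < s" and r: "mass (p * (1 + s)) v < \<infinity>"
  shows "\<exists>C. \<forall>k>0. mass q (\<lambda>x. trunc k s (v x)) \<le> ennreal C"
proof -
  obtain Cs where Cs: "Cs > 0" "\<And>w h. sobolev0 p \<Omega> w h \<Longrightarrow> (\<And>x. 0 \<le> w x) \<Longrightarrow> mass q w \<le> ennreal (Cs * enn2real (mass p h) powr (q / p))"
    using sobolev_inequality[OF p p_less q_def] by metis
  have q0: "q > 0" using pq p by simp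
  have pp: "q / p > 0" "p / q > 0" "p / q < 1" using pq p by auto
  define A where "A = Cs powr (p / q) * ((1 + s) powr p / c)"
  have A: "A > 0" using Cs c s by (simp add: A_def)
  \<comment> \<open>a tail this small contributes at most half of the left-hand side\<close>
  define \<theta> where "\<theta> = (1 / (2 * A)) powr (q / (q - p))"
  have \<theta>: "\<theta> > 0" "A * \<theta> powr ((q - p) / q) = 1 / 2" using A pq q0 by (auto simp: \<theta>_def powr_powr)
  obtain M where M: "M > 0" "(\<integral>x. indicator {x. v x > M} x *\<^sub>R v x powr q \<partial>lborel) < \<theta>"
    using tail_small[OF \<theta>(1)] by blast
  define J where "J = (\<integral>x. v x powr (p * (1 + s)) \<partial>lborel)"
  have Jint: "integrable lborel (\<lambda>x. v x powr (p * (1 + s)))" using r integrable_v by blast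
  have J0: "J \<ge> 0" by (simp add: J_def)
  have qint: "integrable lborel (\<lambda>x. v x powr q)" using v_Lq integrable_v by blast
  have bound: "mass q (\<lambda>x. trunc k s (v x)) \<le> ennreal ((2 * A * (M powr (q - p) * J)) powr (q / p))" if k: "k > 0" for k
  proof -
    have ps: "0 < p * s" using s p by simp
    define F where "F = trunc k (p * s)"
    define G where "G = trunc k s"
    define w where "w x = soft_min k (v x)" for x
    have w0: "0 \<le> w x" "w x \<le> v x" "w x \<le> k" for x
      using soft_min_bounds[OF k, of "v x"] v_nonneg[of x] by (auto simp: w_def)
    have wm[measurable]: "w \<in> borel_measurable borel" unfolding w_def[abs_def] soft_min_def by measurable
    have Fv: "F (v x) = v x * w x powr (p * s)" and Gv: "G (v x) = v x * w x powr s" for x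
      by (auto simp: F_def G_def trunc_def w_def)
    have F'm[measurable]: "(\<lambda>x. trunc' k t (v x)) \<in> borel_measurable borel" for t
      unfolding trunc'_def soft_min_def by measurable
    have G0: "0 \<le> G (v x)" for x using v_nonneg w0 by (simp add: Gv)
    have sF: "sobolev0 p \<Omega> (\<lambda>x. F (v x)) (\<lambda>x. trunc' k (p * s) (v x) *\<^sub>R g x)"
      unfolding F_def by (rule sobolev0_compose[OF sob p0 trunc_deriv[OF k ps] trunc'_cont[OF k ps] trunc'_bounds(3)[OF k ps]]) (simp add: trunc_def)
    have sG: "sobolev0 p \<Omega> (\<lambda>x. G (v x)) (\<lambda>x. trunc' k s (v x) *\<^sub>R g x)"
      unfolding G_def by (rule sobolev0_compose[OF sob p0 trunc_deriv[OF k s] trunc'_cont[OF k s] trunc'_bounds(3)[OF k s]]) (simp add: trunc_def)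
    have eq1: "v x powr (q - 1) * F (v x) = v x powr (q - p) * G (v x) powr p" for x
    proof (cases "v x = 0")
      case False
      then have v: "v x > 0" using v_nonneg[of x] by simp
      have "v x powr (q - 1) * v x = v x powr q" using v powr_add[of "v x" "q - 1" 1] by simp
      moreover have "v x powr (q - p) * v x powr p = v x powr q" using v by (simp add: powr_add[symmetric])
      ultimately show ?thesis using v w0[of x] by (simp add: Fv Gv powr_mult powr_powr mult.assoc[symmetric] mult.commute[of s p])
    qed (simp add: Fv Gv)
    define X where "X = (\<integral>x. v x powr (q - p) * G (v x) powr p \<partial>lborel)"
    define Y where "Y = enn2real (mass q (\<lambda>x. G (v x)))"
    have Gle: "G (v x) \<le> k powr s * v x" for x
      using mult_left_mono[OF powr_mono2[of s "w x" k] v_nonneg[of x]] w0[of x] s by (simp add: Gv mult.commute)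
    have Gm[measurable]: "(\<lambda>x. G (v x)) \<in> borel_measurable borel" by (simp add: Gv[abs_def])
    have Gfin: "mass q (\<lambda>x. G (v x)) < \<infinity>"
      by (rule le_less_trans[OF mass_scale[of q "k powr s" v]])
         (use v_Lq q0 Gle G0 v_nonneg in \<open>auto simp: ennreal_mult_less_top\<close>)
    have Yint: "integrable lborel (\<lambda>x. G (v x) powr q)" "Y = (\<integral>x. G (v x) powr q \<partial>lborel)"
      using mass_integrable[OF Gm, of q] mass_eq_integral[OF Gm, of q] Gfin G0 by (auto simp: Y_def)
    have Y0: "Y \<ge> 0" by (simp add: Y_def)
    have GP: "G (v x) powr p \<le> v x powr (p * (1 + s))" for x
    proof -
      have "w x powr s \<le> v x powr s" using w0[of x] s by (intro powr_mono2) auto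
      then have "G (v x) \<le> v x * v x powr s" using v_nonneg by (simp add: Gv mult_left_mono)
      also have "\<dots> = v x powr (1 + s)" using v_nonneg[of x] by (simp add: powr_add)
      finally have "G (v x) powr p \<le> (v x powr (1 + s)) powr p" using G0 p0 by (intro powr_mono2) auto
      then show ?thesis by (simp add: powr_powr mult.commute)
    qed
    show ?thesis
    proof (cases "Y = 0")
      case True
      then have "mass q (\<lambda>x. G (v x)) = 0" using Gfin by (auto simp: Y_def enn2real_eq_0_iff)
      then show ?thesis by (simp add: G_def)
    next
      case False
      then have Ypos: "Y > 0" using Y0 by simp
      define H1 where "H1 x = indicator {x. v x > M} x *\<^sub>R v x powr q" for x
      have H1int: "integrable lborel H1" unfolding H1_def[abs_def] using qint by (intro integrable_mult_indicator) auto
      have \<alpha>\<beta>: "0 < (q - p) / q" "0 < p / q" "(q - p) / q + p / q = 1" using pq q0 p0 by (auto simp: field_simps)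
      have H10: "0 \<le> H1 x" for x by (simp add: H1_def)
      have H1le: "(\<integral>x. H1 x \<partial>lborel) \<le> \<theta>" using M(2) by (simp add: H1_def)
      note hol = holder_bound[OF H1int Yint(1) H10 _ \<alpha>\<beta> \<theta>(1) H1le Ypos eq_refl[OF Yint(2)[symmetric]], simplified]
      have H1p: "H1 x powr ((q - p) / q) * (G (v x) powr q) powr (p / q) = indicator {x. v x > M} x * (v x powr (q - p) * G (v x) powr p)" for x
        using q0 by (simp add: H1_def powr_powr indicator_def)
      have hint: "integrable lborel (\<lambda>x. indicator {x. v x > M} x * (v x powr (q - p) * G (v x) powr p))"
        and hle: "(\<integral>x. indicator {x. v x > M} x * (v x powr (q - p) * G (v x) powr p) \<partial>lborel) \<le> \<theta> powr ((q - p) / q) * Y powr (p / q)"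
        using hol unfolding H1p by auto
      have split: "v x powr (q - p) * G (v x) powr p \<le> M powr (q - p) * v x powr (p * (1 + s)) + indicator {x. v x > M} x * (v x powr (q - p) * G (v x) powr p)" for x
      proof (cases "v x > M")
        case False
        then have "v x powr (q - p) \<le> M powr (q - p)" using v_nonneg[of x] pq by (intro powr_mono2) auto
        then show ?thesis using mult_mono[OF _ GP[of x], of "v x powr (q - p)" "M powr (q - p)"] False by simp
      qed simp
      have Xle: "X \<le> M powr (q - p) * J + \<theta> powr ((q - p) / q) * Y powr (p / q)"
      proof -
        have "X \<le> (\<integral>x. M powr (q - p) * v x powr (p * (1 + s)) + indicator {x. v x > M} x * (v x powr (q - p) * G (v x) powr p) \<partial>lborel)"
          unfolding X_def
        proof (rule integral_mono)
          show i: "integrable lborel (\<lambda>x. M powr (q - p) * v x powr (p * (1 + s)) + indicator {x. v x > M} x * (v x powr (q - p) * G (v x) powr p))"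
            using Jint hint by simp
          show "integrable lborel (\<lambda>x. v x powr (q - p) * G (v x) powr p)"
            by (rule Bochner_Integration.integrable_bound[OF i]) (use split in \<open>auto intro!: AE_I2 order_trans[OF _ abs_ge_self]\<close>)
        qed (rule split)
        also have "\<dots> = M powr (q - p) * J + (\<integral>x. indicator {x. v x > M} x * (v x powr (q - p) * G (v x) powr p) \<partial>lborel)"
          using Jint hint by (simp add: J_def)
        finally show ?thesis using hle by simp
      qed
      have test: "(\<integral>x. trunc' k (p * s) (v x) * N (g x) \<partial>lborel) \<le> X"
      proof -
        have "(\<integral>x. trunc' k (p * s) (v x) * N (g x) \<partial>lborel) = (\<integral>x. a (g x) \<bullet> (trunc' k (p * s) (v x) *\<^sub>R g x) \<partial>lborel)"
          by (simp add: a_self)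
        also have "\<dots> = X + lam * (\<integral>x. v x powr (p - 1) * F (v x) \<partial>lborel)"
          unfolding weak[OF sF] X_def eq1 ..
        also have "\<dots> \<le> X"
        proof -
          have "0 \<le> (\<integral>x. v x powr (p - 1) * F (v x) \<partial>lborel)"
            using v_nonneg w0 by (intro integral_nonneg_AE AE_I2) (simp add: Fv)
          then show ?thesis using lam by (simp add: mult_nonpos_nonneg)
        qed
        finally show ?thesis .
      qed
      define D where "D = enn2real (mass p (\<lambda>x. trunc' k s (v x) *\<^sub>R g x))"
      have Dle: "D \<le> (1 + s) powr p / c * X"
      proof -
        have b: "\<bar>trunc' k (p * s) (v x)\<bar> \<le> (1 + p * s) * k powr (p * s)" for x by (rule trunc'_bounds(3)[OF k ps])
        have int1: "integrable lborel (\<lambda>x. trunc' k (p * s) (v x) * N (g x))"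
        proof (rule Bochner_Integration.integrable_bound[of _ "\<lambda>x. ((1 + p * s) * k powr (p * s)) * N (g x)"])
          show "AE x in lborel. norm (trunc' k (p * s) (v x) * N (g x)) \<le> norm (((1 + p * s) * k powr (p * s)) * N (g x))"
          proof (rule AE_I2)
            fix x
            have "\<bar>trunc' k (p * s) (v x)\<bar> * N (g x) \<le> ((1 + p * s) * k powr (p * s)) * N (g x)"
              using b N_nonneg by (intro mult_right_mono) auto
            then show "norm (trunc' k (p * s) (v x) * N (g x)) \<le> norm (((1 + p * s) * k powr (p * s)) * N (g x))"
              using N_nonneg[of "g x"] ps by (simp add: abs_mult)
          qed
        qed (use Ng_int in auto)
        have pt: "norm (trunc' k s (v x) *\<^sub>R g x) powr p \<le> (1 + s) powr p / c * (trunc' k (p * s) (v x) * N (g x))" for x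
        proof -
          have "0 \<le> trunc' k s (v x)" using trunc'_bounds(1)[OF k s, of "v x"] by (rule order_trans[rotated]) simp
          then have "norm (trunc' k s (v x) *\<^sub>R g x) powr p = trunc' k s (v x) powr p * norm (g x) powr p" by (simp add: powr_mult)
          also have "trunc' k s (v x) powr p \<le> ((1 + s) * w x powr s) powr p"
            using \<open>0 \<le> trunc' k s (v x)\<close> trunc'_bounds(2)[OF k s, of "v x"] p0 by (intro powr_mono2) (auto simp: w_def)
          also have "\<dots> = (1 + s) powr p * w x powr (p * s)" using s w0 by (simp add: powr_mult powr_powr mult.commute)
          also have "\<dots> \<le> (1 + s) powr p * trunc' k (p * s) (v x)"
            using trunc'_bounds(1)[OF k ps, of "v x"] by (intro mult_left_mono) (auto simp: w_def)
          finally have 1: "norm (trunc' k s (v x) *\<^sub>R g x) powr p \<le> (1 + s) powr p * trunc' k (p * s) (v x) * norm (g x) powr p"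
            by (simp add: mult_right_mono)
          have F'0: "0 \<le> trunc' k (p * s) (v x)" using trunc'_bounds(1)[OF k ps, of "v x"] by (rule order_trans[rotated]) simp
          have "norm (g x) powr p \<le> N (g x) / c" using lower[of "g x"] c by (simp add: field_simps)
          then have "(1 + s) powr p * trunc' k (p * s) (v x) * norm (g x) powr p \<le> (1 + s) powr p * trunc' k (p * s) (v x) * (N (g x) / c)"
            using F'0 by (intro mult_left_mono) auto
          then show ?thesis using 1 by simp
        qed
        note sGm = sobolev0D(2,6)[OF sG]
        have "D = (\<integral>x. norm (trunc' k s (v x) *\<^sub>R g x) powr p \<partial>lborel)"
          unfolding D_def mass_eq_integral[OF sGm] by simp
        also have "\<dots> \<le> (\<integral>x. (1 + s) powr p / c * (trunc' k (p * s) (v x) * N (g x)) \<partial>lborel)"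
          using pt int1 mass_integrable[OF sGm(1), of p] sGm(2) by (intro integral_mono) auto
        also have "\<dots> = (1 + s) powr p / c * (\<integral>x. trunc' k (p * s) (v x) * N (g x) \<partial>lborel)" by simp
        also have "\<dots> \<le> (1 + s) powr p / c * X" using test c by (intro mult_left_mono) auto
        finally show ?thesis .
      qed
      have D0: "D \<ge> 0" by (simp add: D_def)
      have "ennreal Y \<le> ennreal (Cs * D powr (q / p))"
        using Cs(2)[OF sG G0] Gfin by (simp add: Y_def D_def)
      then have "Y \<le> Cs * D powr (q / p)" using Cs(1) by (simp add: ennreal_le_iff)
      then have "Y powr (p / q) \<le> (Cs * D powr (q / p)) powr (p / q)" using Y0 pp by (intro powr_mono2) auto
      also have "\<dots> = Cs powr (p / q) * D" using Cs(1) D0 p0 q0 by (simp add: powr_mult powr_powr)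
      also have "\<dots> \<le> Cs powr (p / q) * ((1 + s) powr p / c * X)" using Dle by (intro mult_left_mono) auto
      also have "\<dots> = A * X" by (simp add: A_def)
      also have "\<dots> \<le> A * (M powr (q - p) * J + \<theta> powr ((q - p) / q) * Y powr (p / q))" using Xle A by (intro mult_left_mono) auto
      also have "\<dots> = A * (M powr (q - p) * J) + (A * \<theta> powr ((q - p) / q)) * Y powr (p / q)" by (simp add: algebra_simps)
      finally have "Y powr (p / q) \<le> 2 * A * (M powr (q - p) * J)" unfolding \<theta>(2) by simp
      then have "(Y powr (p / q)) powr (q / p) \<le> (2 * A * (M powr (q - p) * J)) powr (q / p)"
        using pp by (intro powr_mono2) auto
      then have "Y \<le> (2 * A * (M powr (q - p) * J)) powr (q / p)" using Y0 p0 q0 by (simp add: powr_powr)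
      then have "ennreal Y \<le> ennreal ((2 * A * (M powr (q - p) * J)) powr (q / p))" by (rule ennreal_leI)
      moreover have "mass q (\<lambda>x. G (v x)) = ennreal Y" using mass_real[OF Gfin] by (simp only: Y_def)
      ultimately show ?thesis by (simp only: G_def)
    qed
  qed
  then show ?thesis by blast
qed

text \<open>The truncations tend to \<open>v\<close> to the power \<open>1 + s\<close>, so Fatou's lemma
  removes them.\<close>

lemma moser_step:
  assumes s: "0 < s" and r: "mass (p * (1 + s)) v < \<infinity>"
  shows "mass (q * (1 + s)) v < \<infinity>"
proof -
  obtain C where C: "\<And>k. k > 0 \<Longrightarrow> mass q (\<lambda>x. trunc k s (v x)) \<le> ennreal C" using moser_uniform[OF assms] by blast
  have q0: "q > 0" using pq p by simp
  have tm: "(\<lambda>x. trunc k s (v x)) \<in> borel_measurable borel" for k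
    unfolding trunc_def soft_min_def by measurable
  have lim: "(\<lambda>k::nat. ennreal (norm (trunc (real (Suc k)) s (v x)) powr q)) \<longlonglongrightarrow> ennreal (v x powr (q * (1 + s)))" for x
  proof -
    have "(\<lambda>k::nat. v x / (1 + v x / real (Suc k))) \<longlonglongrightarrow> v x / (1 + v x * 0)"
      using tendsto_mult[OF tendsto_const[of "v x"] LIMSEQ_inverse_real_of_nat]
      by (intro tendsto_intros) (auto simp: divide_inverse)
    moreover have "soft_min (real (Suc k)) (v x) = v x / (1 + v x / real (Suc k))" for k
      using v_nonneg[of x] by (simp add: soft_min_def field_simps add_pos_nonneg del: of_nat_Suc)
    ultimately have "(\<lambda>k. soft_min (real (Suc k)) (v x)) \<longlonglongrightarrow> v x" by simp
    then have "(\<lambda>k. (v x * soft_min (real (Suc k)) (v x) powr s)) \<longlonglongrightarrow> v x * v x powr s"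
      using s soft_min_bounds(1) by (intro tendsto_intros tendsto_powr') auto
    then have "(\<lambda>k. norm (trunc (real (Suc k)) s (v x)) powr q) \<longlonglongrightarrow> norm (v x * v x powr s) powr q"
      unfolding trunc_def using q0 by (intro tendsto_powr' tendsto_norm) auto
    moreover have "norm (v x * v x powr s) powr q = v x powr (q * (1 + s))"
      using v_nonneg[of x] by (simp add: powr_mult powr_powr powr_add[symmetric] algebra_simps)
    ultimately show ?thesis using tendsto_ennrealI by metis
  qed
  have "mass (q * (1 + s)) v = (\<integral>\<^sup>+x. liminf (\<lambda>k. ennreal (norm (trunc (real (Suc k)) s (v x)) powr q)) \<partial>lborel)"
    unfolding mass_v using lim_imp_Liminf[OF sequentially_bot lim] by simp
  also have "\<dots> \<le> liminf (\<lambda>k. mass q (\<lambda>x. trunc (real (Suc k)) s (v x)))"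
    unfolding mass_def using tm by (intro nn_integral_liminf) measurable
  also have "\<dots> \<le> ennreal C" by (intro Liminf_le always_eventually allI C) auto
  finally show ?thesis by (rule le_less_trans) simp
qed

lemma mass_interpolate:
  assumes "mass r v < \<infinity>" "p \<le> t" "t \<le> r" shows "mass t v < \<infinity>"
proof -
  have "mass t v \<le> (\<integral>\<^sup>+x. ennreal (v x powr p) + ennreal (v x powr r) \<partial>lborel)"
    unfolding mass_v
  proof (rule nn_integral_mono)
    fix x
    have "v x powr t \<le> v x powr p + v x powr r"
    proof (cases "v x \<le> 1")
      case True
      then have "v x powr t \<le> v x powr p" using v_nonneg[of x] assms by (intro powr_mono') auto
      then show ?thesis by (simp add: add_increasing2)
    next
      case False
      then have "v x powr t \<le> v x powr r" using assms by (intro powr_mono) auto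
      then show ?thesis by (simp add: add_increasing)
    qed
    then show "ennreal (v x powr t) \<le> ennreal (v x powr p) + ennreal (v x powr r)"
      by (simp add: ennreal_plus[symmetric] ennreal_leI del: ennreal_plus)
  qed
  also have "\<dots> = mass p v + mass r v" unfolding mass_v by (simp add: nn_integral_add)
  also have "\<dots> < \<infinity>" using assms sobolev0D(5)[OF sob] by simp
  finally show ?thesis .
qed

text \<open>Each step multiplies the exponent by \<open>q / p > 1\<close>, starting from the Sobolev
  exponent.\<close>

theorem all_powers_integrable:
  assumes "p \<le> r" shows "mass r v < \<infinity>"
proof -
  have qp: "q / p > 1" using pq p0 by simp
  have iter: "mass (q * (q / p) ^ j) v < \<infinity>" for j :: nat
  proof (induction j)
    case 0 then show ?case using v_Lq by simp
  next
    case (Suc j)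
    define s where "s = (q / p) ^ Suc j - 1"
    have "(q / p) ^ Suc j > 1" using qp by (rule one_less_power) simp
    then have s: "0 < s" by (simp add: s_def)
    have "p * (1 + s) = q * (q / p) ^ j" using p0 by (simp add: s_def)
    then show ?case using moser_step[OF s] Suc by (simp add: s_def)
  qed
  obtain j where "r / q < (q / p) ^ j" using real_arch_pow[OF qp] by blast
  then have "r \<le> q * (q / p) ^ j" using pq p0 by (simp add: field_simps)
  then show ?thesis using mass_interpolate[OF iter assms] by blast
qed

end

section \<open>The dilation inequality\<close>

lemma powr_diff_le:
  fixes x y :: real
  assumes "0 \<le> x" "0 \<le> y" "1 \<le> r" shows "\<bar>x - y\<bar> powr r \<le> \<bar>x powr r - y powr r\<bar>"
proof -
  have super: "s powr r + t powr r \<le> (s + t) powr r" if st: "0 \<le> s" "0 \<le> t" for s t :: real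
  proof (cases "s = 0 \<or> t = 0")
    case False
    have split: "z powr r = z * z powr (r - 1)" if "z > 0" for z :: real using that powr_add[of z 1 "r - 1"] by simp
    have "s powr (r - 1) \<le> (s + t) powr (r - 1)" "t powr (r - 1) \<le> (s + t) powr (r - 1)"
      using st assms(3) by (auto intro!: powr_mono2)
    then have "s * s powr (r - 1) + t * t powr (r - 1) \<le> s * (s + t) powr (r - 1) + t * (s + t) powr (r - 1)"
      using st by (intro add_mono mult_left_mono) auto
    then show ?thesis using split[of s] split[of t] split[of "s + t"] st False by (simp add: distrib_right)
  qed auto
  show ?thesis using super[of "x - y" y] super[of "y - x" x] assms by (cases "y \<le> x") auto
qed

context critical_problem
begin

definition dil :: "'a \<Rightarrow> real \<Rightarrow> 'a \<Rightarrow> 'a" where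
  "dil b t x = (1 - t) *\<^sub>R b + t *\<^sub>R x"

lemma dil_meas [measurable]: "dil b t \<in> borel \<rightarrow>\<^sub>M borel"
  unfolding dil_def[abs_def] by measurable

lemma integral_dil:
  fixes f :: "'a \<Rightarrow> real"
  assumes f: "integrable lborel f" and t: "t > 0"
  shows "integrable lborel (\<lambda>x. f (dil b t x))" "(\<integral>x. f (dil b t x) \<partial>lborel) = (\<integral>x. f x \<partial>lborel) / t ^ DIM('a)"
proof -
  have fm[measurable]: "f \<in> borel_measurable borel" using f by auto
  have "mass 1 f < \<infinity>" using f mass_integrable[OF fm, of 1] by simp
  then have "mass 1 (\<lambda>x. f (dil b t x)) < \<infinity>"
    unfolding dil_def using mass_affine[OF fm t, of 1 "(1 - t) *\<^sub>R b"] by (simp add: ennreal_mult_less_top)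
  then show "integrable lborel (\<lambda>x. f (dil b t x))"
    unfolding integrable_iff_bounded mass_def by simp
  show "(\<integral>x. f (dil b t x) \<partial>lborel) = (\<integral>x. f x \<partial>lborel) / t ^ DIM('a)"
    using lborel_integral_affine[OF fm, of t "(1 - t) *\<^sub>R b"] t unfolding dil_def by simp
qed

lemma N_homogeneous: "0 \<le> t \<Longrightarrow> N (t *\<^sub>R \<zeta>) = t powr p * N \<zeta>"
  unfolding avg_norm_def by (simp add: abs_mult powr_mult)

abbreviation "vt b t \<equiv> (\<lambda>x. v (dil b t x))"

definition Q where "Q = (\<integral>x. v x powr q \<partial>lborel)"
definition L where "L = (\<integral>x. v x powr p \<partial>lborel)"
text \<open>By convexity of the power, \<open>\<integral>v powr (q - 1) * (vt b t - v)\<close> falls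
  short of the increment of \<open>\<integral>v powr q / q\<close> by at most this amount.\<close>

definition defect where "defect b t = (\<integral>x. (vt b t x powr (q - 1) - v x powr (q - 1)) * (vt b t x - v x) \<partial>lborel)"

lemma int_powr: "p \<le> r \<Longrightarrow> integrable lborel (\<lambda>x. v x powr r)"
  using all_powers_integrable integrable_v by blast

lemma conj_exponent: "p \<le> (q - 1) * (p / (p - 1))" "1 < p / (p - 1)" "1 - 1/p > 0"
proof -
  have "p * (p - 1) \<le> (q - 1) * p" using pq p by (simp add: mult.commute)
  then show "p \<le> (q - 1) * (p / (p - 1))" using p by (simp add: le_divide_eq)
  show "1 < p / (p - 1)" "1 - 1/p > 0" using p by auto
qed

lemma young_product:
  fixes s t :: real assumes "0 \<le> s" "0 \<le> t" shows "s * t \<le> s powr (p / (p - 1)) + t powr p"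
proof -
  have e: "1 / (p / (p - 1)) + 1 / p = 1" using p by (simp add: field_simps)
  have "s * t \<le> s powr (p / (p - 1)) / (p / (p - 1)) + t powr p / p"
    using Youngs_inequality[OF conj_exponent(2) p e assms] .
  moreover have frac: "z / c \<le> z" if "1 < c" "0 \<le> z" for z c :: real
    using divide_left_mono[of 1 c z] that by simp
  from frac[OF conj_exponent(2), of "s powr (p / (p - 1))"]
  have "s powr (p / (p - 1)) / (p / (p - 1)) \<le> s powr (p / (p - 1))" by simp
  moreover have "t powr p / p \<le> t powr p" using frac[OF p, of "t powr p"] by simp
  ultimately show ?thesis by linarith
qed

lemma product_integrable:
  fixes f h :: "'a \<Rightarrow> real"
  assumes [measurable]: "f \<in> borel_measurable borel" "h \<in> borel_measurable borel"
    and "integrable lborel (\<lambda>x. \<bar>f x\<bar> powr (p / (p - 1)))" "integrable lborel (\<lambda>x. \<bar>h x\<bar> powr p)"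
  shows "integrable lborel (\<lambda>x. f x * h x)"
proof (rule Bochner_Integration.integrable_bound[of _ "\<lambda>x. \<bar>f x\<bar> powr (p / (p - 1)) + \<bar>h x\<bar> powr p"])
  show "AE x in lborel. norm (f x * h x) \<le> norm (\<bar>f x\<bar> powr (p / (p - 1)) + \<bar>h x\<bar> powr p)"
    using young_product[of "\<bar>f _\<bar>" "\<bar>h _\<bar>"] by (intro AE_I2) (simp add: abs_mult)
qed (use assms in auto)

lemma flux_integrable:
  assumes h: "h \<in> borel_measurable borel" "mass p h < \<infinity>"
  shows "integrable lborel (\<lambda>x. a (g x) \<bullet> h x)"
proof (rule Bochner_Integration.integrable_bound[of _ "\<lambda>x. m * (norm (g x) powr p + norm (h x) powr p)"])
  show "integrable lborel (\<lambda>x. m * (norm (g x) powr p + norm (h x) powr p))"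
    using g_int mass_integrable[OF h(1), of p] h(2) by simp
  show "(\<lambda>x. a (g x) \<bullet> h x) \<in> borel_measurable lborel" using h(1) by measurable
  show "AE x in lborel. norm (a (g x) \<bullet> h x) \<le> norm (m * (norm (g x) powr p + norm (h x) powr p))"
  proof (rule AE_I2)
    fix x
    have "norm (a (g x) \<bullet> h x) \<le> norm (a (g x)) * norm (h x)" using Cauchy_Schwarz_ineq2 by auto
    also have "\<dots> \<le> (m * norm (g x) powr (p - 1)) * norm (h x)" by (intro mult_right_mono a_bound) auto
    also have "\<dots> \<le> m * (norm (g x) powr p + norm (h x) powr p)"
    proof -
      have "norm (g x) powr (p - 1) * norm (h x) \<le> (norm (g x) powr (p - 1)) powr (p / (p - 1)) + norm (h x) powr p"
        by (intro young_product) auto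
      then have "norm (g x) powr (p - 1) * norm (h x) \<le> norm (g x) powr p + norm (h x) powr p"
        using p by (simp add: powr_powr)
      then have "m * (norm (g x) powr (p - 1) * norm (h x)) \<le> m * (norm (g x) powr p + norm (h x) powr p)"
        by (intro mult_left_mono) auto
      then show ?thesis by (simp add: mult.assoc)
    qed
    finally show "norm (a (g x) \<bullet> h x) \<le> norm (m * (norm (g x) powr p + norm (h x) powr p))"
      by (rule order_trans) simp
  qed
qed

lemma mult_powr_minus_1: "0 \<le> s \<Longrightarrow> s powr (r - 1) * s = s powr (r :: real)"
  using powr_add[of s "r - 1" 1] by (cases "s = 0") auto

lemma energy_identity: "(\<integral>x. N (g x) \<partial>lborel) = Q + lam * L"
  using weak[OF sob] by (simp add: a_self mult_powr_minus_1[OF v_nonneg] Q_def L_def)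

text \<open>A weak form of the Pohozaev identity. The dilated function is an admissible test function, and
  convexity of the energy compares the two Dirichlet energies, which differ by a power of \<open>t\<close>.
  On the region that the dilation throws out of the domain the dilated gradient vanishes, and
  the convexity inequality has a surplus there.\<close>

lemma dilation_inequality:
  assumes star: "\<And>x. x \<in> \<Omega> \<Longrightarrow> closed_segment b x \<subseteq> \<Omega>" and t: "t \<ge> 1"
  shows "(p - 1) * (\<integral>x. indicator {x. dil b t x \<notin> \<Omega>} x * N (g x) \<partial>lborel) \<le>
    (t powr p / t ^ DIM('a) - 1) * (Q + lam * L) - (p / q) * (1 / t ^ DIM('a) - 1) * Q - lam * (1 / t ^ DIM('a) - 1) * L + p * defect b t"
    and "integrable lborel (\<lambda>x. (vt b t x powr (q - 1) - v x powr (q - 1)) * (vt b t x - v x))"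
proof -
  have t0: "t > 0" using t by simp
  have q0: "q > 1" using pq p by simp
  have \<Omega>m[measurable]: "\<Omega> \<in> sets borel" using open_dom by simp
  define S where "S = {x. dil b t x \<notin> \<Omega>}"
  have Sm[measurable]: "S \<in> sets borel" unfolding S_def by measurable
  define gt where "gt x = t *\<^sub>R g (dil b t x)" for x
  have gtm[measurable]: "gt \<in> borel_measurable borel" unfolding gt_def[abs_def] by measurable
  have st: "sobolev0 p \<Omega> (vt b t) gt"
    unfolding gt_def dil_def by (rule sobolev0_dilate[OF sob p0 star t])
  have sd: "sobolev0 p \<Omega> (\<lambda>x. vt b t x - v x) (\<lambda>x. gt x - g x)" by (rule sobolev0_diff[OF sob st p0])
  note ip = int_powr integral_dil(1)[OF int_powr t0]
  have Ngt: "integrable lborel (\<lambda>x. N (gt x))" "(\<integral>x. N (gt x) \<partial>lborel) = t powr p / t ^ DIM('a) * (Q + lam * L)"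
    using integral_dil[OF Ng_int t0, of b] t0 by (simp_all add: gt_def N_homogeneous energy_identity)
  have SN: "integrable lborel (\<lambda>x. indicator S x * N (g x))"
    using integrable_mult_indicator[OF _ Ng_int, of S] by simp
  have fi: "integrable lborel (\<lambda>x. a (g x) \<bullet> (gt x - g x))"
    using sobolev0D[OF sd] by (intro flux_integrable) auto
  have pt: "N (g x) + p * (a (g x) \<bullet> (gt x - g x)) + (p - 1) * (indicator S x * N (g x)) \<le> N (gt x)" for x
  proof (cases "x \<in> S")
    case True
    then have "gt x = 0" using sobolev0D(4)[OF sob] by (simp add: S_def gt_def)
    then show ?thesis using True a_zero(2) by (simp add: a_self algebra_simps)
  next
    case False
    then show ?thesis using bregman[of "g x" "gt x"] by simp
  qed
  have "(\<integral>x. N (g x) + p * (a (g x) \<bullet> (gt x - g x)) + (p - 1) * (indicator S x * N (g x)) \<partial>lborel) \<le> (\<integral>x. N (gt x) \<partial>lborel)"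
    using pt Ng_int fi SN Ngt by (intro integral_mono) auto
  then have 1: "(Q + lam * L) + p * (\<integral>x. a (g x) \<bullet> (gt x - g x) \<partial>lborel) + (p - 1) * (\<integral>x. indicator S x * N (g x) \<partial>lborel)
      \<le> t powr p / t ^ DIM('a) * (Q + lam * L)"
    using Ng_int fi SN by (simp add: Ngt(2) energy_identity)
  have vtm[measurable]: "vt b t \<in> borel_measurable borel" by measurable
  have vt0: "0 \<le> vt b t x" for x by (rule v_nonneg)
  have prod: "integrable lborel (\<lambda>x. f1 x powr (r - 1) * f2 x)"
    if [measurable]: "f1 \<in> borel_measurable borel" "f2 \<in> borel_measurable borel"
      and nn: "\<And>x. 0 \<le> f1 x" "\<And>x. 0 \<le> f2 x"
      and f1: "\<And>r. p \<le> r \<Longrightarrow> integrable lborel (\<lambda>x. f1 x powr r)" and f2: "\<And>r. p \<le> r \<Longrightarrow> integrable lborel (\<lambda>x. f2 x powr r)"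
      and r: "p \<le> r" for f1 f2 :: "'a \<Rightarrow> real" and r
  proof (rule product_integrable)
    have "p * (p - 1) \<le> (r - 1) * p" using r p by (simp add: mult.commute)
    then have "p \<le> (r - 1) * (p / (p - 1))" using p by (simp add: le_divide_eq)
    then show "integrable lborel (\<lambda>x. \<bar>f1 x powr (r - 1)\<bar> powr (p / (p - 1)))" using f1 by (simp add: powr_powr)
    show "integrable lborel (\<lambda>x. \<bar>f2 x\<bar> powr p)" using f2[of p] nn by simp
  qed measurable
  note pr = prod[OF vm vm v_nonneg v_nonneg ip(1) ip(1)] prod[OF vm vtm v_nonneg vt0 ip(1) ip(2)]
    prod[OF vtm vm vt0 v_nonneg ip(2) ip(1)] prod[OF vtm vtm vt0 vt0 ip(2) ip(2)]
  show di: "integrable lborel (\<lambda>x. (vt b t x powr (q - 1) - v x powr (q - 1)) * (vt b t x - v x))"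
    using pr[of q] pq by (simp add: algebra_simps)
  have fin: "(1 / t ^ DIM('a) - 1) * Q / q - defect b t \<le> (\<integral>x. v x powr (q - 1) * (vt b t x - v x) \<partial>lborel)"
  proof -
    have "(\<integral>x. (vt b t x powr q - v x powr q) / q - (vt b t x powr (q - 1) - v x powr (q - 1)) * (vt b t x - v x) \<partial>lborel)
       \<le> (\<integral>x. v x powr (q - 1) * (vt b t x - v x) \<partial>lborel)"
    proof (rule integral_mono)
      show "integrable lborel (\<lambda>x. (vt b t x powr q - v x powr q) / q - (vt b t x powr (q - 1) - v x powr (q - 1)) * (vt b t x - v x))"
        using ip[of q] pq di by simp
      show "integrable lborel (\<lambda>x. v x powr (q - 1) * (vt b t x - v x))" using pr[of q] pq by (simp add: algebra_simps)
      fix x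
      have "vt b t x powr q + q * (vt b t x powr (q - 1) * (v x - vt b t x)) \<le> v x powr q"
        using powr_tangent[OF q0, of "vt b t x" "v x"] vt0[of x] v_nonneg[of x]
        by (cases "vt b t x = 0") (auto simp: signed_powr_def sgn_if mult.assoc)
      then have "vt b t x powr q - v x powr q \<le> q * (vt b t x powr (q - 1) * (vt b t x - v x))" by (simp add: algebra_simps)
      then have "(vt b t x powr q - v x powr q) / q \<le> vt b t x powr (q - 1) * (vt b t x - v x)"
        using q0 by (simp add: pos_divide_le_eq mult.commute)
      then show "(vt b t x powr q - v x powr q) / q - (vt b t x powr (q - 1) - v x powr (q - 1)) * (vt b t x - v x) \<le> v x powr (q - 1) * (vt b t x - v x)"
        by (simp add: algebra_simps)
    qed
    moreover have "(\<integral>x. (vt b t x powr q - v x powr q) / q - (vt b t x powr (q - 1) - v x powr (q - 1)) * (vt b t x - v x) \<partial>lborel)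
       = (1 / t ^ DIM('a) - 1) * Q / q - defect b t"
    proof -
      have i1: "integrable lborel (\<lambda>x. (vt b t x powr q - v x powr q) / q)" using ip[of q] pq by simp
      have "(\<integral>x. (vt b t x powr q - v x powr q) / q \<partial>lborel) = (Q / t ^ DIM('a) - Q) / q"
        using ip[of q] pq integral_dil(2)[OF int_powr t0, of q b] by (simp add: Q_def)
      then show ?thesis unfolding Bochner_Integration.integral_diff[OF i1 di] defect_def[symmetric]
        by (simp add: left_diff_distrib)
    qed
    ultimately show ?thesis by simp
  qed
  have lt: "lam * ((1 / t ^ DIM('a) - 1) * L / p) \<le> lam * (\<integral>x. v x powr (p - 1) * (vt b t x - v x) \<partial>lborel)"
  proof -
    have "(\<integral>x. v x powr (p - 1) * (vt b t x - v x) \<partial>lborel) \<le> (\<integral>x. (vt b t x powr p - v x powr p) / p \<partial>lborel)"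
    proof (rule integral_mono)
      show "integrable lborel (\<lambda>x. v x powr (p - 1) * (vt b t x - v x))" using pr[of p] by (simp add: algebra_simps)
      show "integrable lborel (\<lambda>x. (vt b t x powr p - v x powr p) / p)" using ip[of p] by simp
      fix x
      have "v x powr p + p * (v x powr (p - 1) * (vt b t x - v x)) \<le> vt b t x powr p"
        using powr_tangent[OF p, of "v x" "vt b t x"] vt0[of x] v_nonneg[of x]
        by (cases "v x = 0") (auto simp: signed_powr_def sgn_if mult.assoc)
      then have "p * (v x powr (p - 1) * (vt b t x - v x)) \<le> vt b t x powr p - v x powr p" by simp
      then show "v x powr (p - 1) * (vt b t x - v x) \<le> (vt b t x powr p - v x powr p) / p"
        using p0 by (simp add: pos_le_divide_eq mult.commute)
    qed
    also have "\<dots> = (1 / t ^ DIM('a) - 1) * L / p"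
      using ip[of p] integral_dil(2)[OF int_powr t0, of p b] by (simp add: L_def algebra_simps diff_divide_distrib)
    finally show ?thesis using lam by (rule mult_left_mono_neg)
  qed
  have "(\<integral>x. a (g x) \<bullet> (gt x - g x) \<partial>lborel) \<ge> (1 / t ^ DIM('a) - 1) * Q / q - defect b t + lam * ((1 / t ^ DIM('a) - 1) * L / p)"
    unfolding weak[OF sd] using fin lt by simp
  then have "p * (\<integral>x. a (g x) \<bullet> (gt x - g x) \<partial>lborel) \<ge> p * ((1 / t ^ DIM('a) - 1) * Q / q - defect b t + lam * ((1 / t ^ DIM('a) - 1) * L / p))"
    using p by (intro mult_left_mono) auto
  also have "p * ((1 / t ^ DIM('a) - 1) * Q / q - defect b t + lam * ((1 / t ^ DIM('a) - 1) * L / p)) =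
      (p / q) * (1 / t ^ DIM('a) - 1) * Q - p * defect b t + lam * (1 / t ^ DIM('a) - 1) * L"
  proof -
    have "p * (z * Q / q - D + lam * (z * L / p)) = (p / q) * z * Q - p * D + lam * z * L" for z D
      using p by (simp add: distrib_left right_diff_distrib)
    then show ?thesis .
  qed
  finally show "(p - 1) * (\<integral>x. indicator {x. dil b t x \<notin> \<Omega>} x * N (g x) \<partial>lborel) \<le>
    (t powr p / t ^ DIM('a) - 1) * (Q + lam * L) - (p / q) * (1 / t ^ DIM('a) - 1) * Q - lam * (1 / t ^ DIM('a) - 1) * L + p * defect b t"
    using 1 by (simp add: S_def[symmetric] algebra_simps)
qed

end

context critical_problem
begin

text \<open>The integral of the dilated power is at most that of the original one, so convergence almost
  everywhere improves to convergence in the mean.\<close>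

lemma scheffe_dilation:
  assumes t: "\<And>j::nat. t j \<ge> 1" and ae: "AE x in lborel. (\<lambda>j. vt b (t j) x) \<longlonglongrightarrow> v x" and r: "p \<le> r"
  shows "(\<lambda>j. \<integral>x. \<bar>vt b (t j) x powr r - v x powr r\<bar> \<partial>lborel) \<longlonglongrightarrow> 0"
proof -
  have r0: "r > 0" using r p by simp
  have tp: "t j > 0" for j using t[of j] by simp
  note i = int_powr[OF r] integral_dil[OF int_powr[OF r] tp]
  have "(\<lambda>j. \<integral>\<^sup>+x. ennreal (norm (vt b (t j) x powr r - v x powr r)) \<partial>lborel) \<longlonglongrightarrow> 0"
  proof (rule Scheffe_lemma1)
    show "AE x in lborel. (\<lambda>j. vt b (t j) x powr r) \<longlonglongrightarrow> v x powr r"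
      using ae
    proof eventually_elim
      case (elim x)
      then show ?case using r0 v_nonneg by (intro tendsto_powr') auto
    qed
    have nn: "(\<integral>\<^sup>+x. ennreal (norm (f x powr r)) \<partial>lborel) = ennreal (\<integral>x. f x powr r \<partial>lborel)"
      if "integrable lborel (\<lambda>x. f x powr r)" for f :: "'a \<Rightarrow> real"
      using that by (simp add: nn_integral_eq_integral)
    show "limsup (\<lambda>j. \<integral>\<^sup>+x. ennreal (norm (vt b (t j) x powr r)) \<partial>lborel) \<le> (\<integral>\<^sup>+x. ennreal (norm (v x powr r)) \<partial>lborel)"
      unfolding nn[OF i(2)] nn[OF i(1)]
    proof (rule Limsup_bounded, rule always_eventually, rule allI, rule ennreal_leI)
      fix j
      have "(\<integral>x. v x powr r \<partial>lborel) / t j ^ DIM('a) \<le> (\<integral>x. v x powr r \<partial>lborel) / 1"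
        using t[of j] by (intro divide_left_mono) (auto simp: one_le_power)
      then show "(\<integral>x. vt b (t j) x powr r \<partial>lborel) \<le> (\<integral>x. v x powr r \<partial>lborel)" by (simp add: i(3))
    qed
  qed (use i in auto)
  moreover have "(\<integral>\<^sup>+x. ennreal (norm (vt b (t j) x powr r - v x powr r)) \<partial>lborel) = ennreal (\<integral>x. \<bar>vt b (t j) x powr r - v x powr r\<bar> \<partial>lborel)" for j
    using i by (subst nn_integral_eq_integral) auto
  ultimately have "(\<lambda>j. ennreal (\<integral>x. \<bar>vt b (t j) x powr r - v x powr r\<bar> \<partial>lborel)) \<longlonglongrightarrow> ennreal 0" by simp
  then show ?thesis by (subst (asm) tendsto_ennreal_iff) auto
qed

text \<open>Higher integrability makes the convexity defect of the right-hand side negligible: it is a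
  product of a quantity of order \<open>t - 1\<close> and one that tends to zero by continuity of
  dilations in Lebesgue spaces.\<close>

lemma defect_negligible:
  assumes R: "\<Omega> \<subseteq> cball b R" "0 \<le> R"
  shows "\<exists>t :: nat \<Rightarrow> real. (\<forall>j. t j > 1) \<and> t \<longlonglongrightarrow> 1 \<and> (\<lambda>j. defect b (t j) / (t j - 1)) \<longlonglongrightarrow> 0"
proof -
  define \<tau> where "\<tau> j = 1 + 1 / real (Suc j)" for j
  have \<tau>: "\<tau> j > 1" for j by (simp add: \<tau>_def)
  have \<tau>1: "\<tau> \<longlonglongrightarrow> 1" unfolding \<tau>_def[abs_def]
    using tendsto_add[OF tendsto_const[of 1] LIMSEQ_inverse_real_of_nat] by (simp add: inverse_eq_divide)
  define G where "G = 2 powr p * enn2real (mass p g)"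
  have G0: "G \<ge> 0" by (simp add: G_def)
  have mb: "mass p (\<lambda>x. vt b t x - v x) \<le> ennreal (((t - 1) * R) powr p * G)" if "t \<ge> 1" for t
    using dilation_estimate[OF sob p R(1) that R(2)] sobolev0D(6)[OF sob]
    unfolding dil_def G_def by (simp add: ennreal_mult')
  have "Lp_null p (\<lambda>j x. vt b (\<tau> j) x - v x)"
  proof -
    have "(\<lambda>j. ennreal (((\<tau> j - 1) * R) powr p * G)) \<longlonglongrightarrow> ennreal (((1 - 1) * R) powr p * G)"
      using \<tau> p0 R(2) by (intro tendsto_ennrealI tendsto_mult tendsto_powr' tendsto_diff \<tau>1 tendsto_const) (auto simp: less_imp_le)
    then have "(\<lambda>j. ennreal (((\<tau> j - 1) * R) powr p * G)) \<longlonglongrightarrow> 0" by simp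
    then have "(\<lambda>j. mass p (\<lambda>x. vt b (\<tau> j) x - v x)) \<longlonglongrightarrow> 0"
      by (rule tendsto_0_ennreal_le[rotated]) (rule mb[OF less_imp_le[OF \<tau>]])
    then show ?thesis by (simp add: Lp_null_def)
  qed
  from Lp_null_AE_subseq[OF this p0] obtain s :: "nat \<Rightarrow> nat" where s: "strict_mono s"
    "AE x in lborel. (\<lambda>j. vt b (\<tau> (s j)) x - v x) \<longlonglongrightarrow> 0" by blast
  define t where "t j = \<tau> (s j)" for j
  have t: "t j > 1" for j using \<tau> by (simp add: t_def)
  have t1: "t \<longlonglongrightarrow> 1" unfolding t_def using LIMSEQ_subseq_LIMSEQ[OF \<tau>1 s(1)] by (simp add: o_def)
  have ae: "AE x in lborel. (\<lambda>j. vt b (t j) x) \<longlonglongrightarrow> v x"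
    using s(2) by eventually_elim (simp add: t_def LIM_zero_cancel)
  define p' where "p' = p / (p - 1)"
  have p': "p' > 1" using conj_exponent by (simp add: p'_def)
  have \<sigma>: "p \<le> (q - 1) * p'" using conj_exponent by (simp add: p'_def)
  define B where "B j = (\<integral>x. \<bar>vt b (t j) x powr ((q - 1) * p') - v x powr ((q - 1) * p')\<bar> \<partial>lborel)" for j
  have B: "B \<longlonglongrightarrow> 0" unfolding B_def using scheffe_dilation[OF less_imp_le[OF t] ae \<sigma>] .
  have B0: "B j \<ge> 0" for j unfolding B_def by (intro integral_nonneg_AE) auto
  \<comment> \<open>the summand 1 keeps the bound positive\<close>
  define K where "K = R powr p * G + 1"
  have K: "K > 0" using G0 by (simp add: K_def add_nonneg_pos)
  have bound: "\<bar>defect b (t j) / (t j - 1)\<bar> \<le> (B j + 1 / real (Suc j)) powr (1 - 1/p) * K powr (1/p)" for j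
  proof -
    have tj: "t j > 1" "t j > 0" "t j \<ge> 1" using t[of j] by auto
    have vtm[measurable]: "vt b (t j) \<in> borel_measurable borel" by measurable
    define D1 where "D1 x = \<bar>vt b (t j) x powr (q - 1) - v x powr (q - 1)\<bar>" for x
    define D2 where "D2 x = \<bar>vt b (t j) x - v x\<bar> / (t j - 1)" for x
    have D0: "D1 x \<ge> 0" "D2 x \<ge> 0" for x using tj by (auto simp: D1_def D2_def)
    have D1m[measurable]: "D1 \<in> borel_measurable borel" and D2m[measurable]: "D2 \<in> borel_measurable borel"
      unfolding D1_def[abs_def] D2_def[abs_def] by measurable
    have iB: "integrable lborel (\<lambda>x. \<bar>vt b (t j) x powr ((q - 1) * p') - v x powr ((q - 1) * p')\<bar>)"
      using int_powr[OF \<sigma>] integral_dil(1)[OF int_powr[OF \<sigma>] tj(2)] by simp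
    have D1le: "D1 x powr p' \<le> \<bar>vt b (t j) x powr ((q - 1) * p') - v x powr ((q - 1) * p')\<bar>" for x
      using powr_diff_le[of "vt b (t j) x powr (q - 1)" "v x powr (q - 1)" p'] p' by (simp add: D1_def powr_powr)
    have i1: "integrable lborel (\<lambda>x. D1 x powr p')"
      by (rule Bochner_Integration.integrable_bound[OF iB]) (use D1le in auto)
    have I1: "(\<integral>x. D1 x powr p' \<partial>lborel) \<le> B j + 1 / real (Suc j)"
    proof -
      have "(\<integral>x. D1 x powr p' \<partial>lborel) \<le> B j" unfolding B_def using i1 iB D1le by (intro integral_mono) auto
      then show ?thesis by (rule add_increasing2[rotated]) simp
    qed
    have m2: "mass p D2 \<le> ennreal (R powr p * G)"
    proof -
      have "mass p D2 \<le> ennreal ((1 / (t j - 1)) powr p) * mass p (\<lambda>x. vt b (t j) x - v x)"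
        using tj p0 by (intro mass_scale) (auto simp: D2_def)
      also have "\<dots> \<le> ennreal ((1 / (t j - 1)) powr p) * ennreal (((t j - 1) * R) powr p * G)"
        by (intro mult_left_mono mb[OF tj(3)]) auto
      also have "\<dots> = ennreal (((1 / (t j - 1)) powr p * ((t j - 1) * R) powr p) * G)"
        by (simp add: ennreal_mult'[symmetric] mult.assoc)
      also have "(1 / (t j - 1)) powr p * ((t j - 1) * R) powr p = R powr p"
        using tj R(2) by (simp add: powr_mult[symmetric])
      finally show ?thesis .
    qed
    then have f2: "mass p D2 < \<infinity>" by (rule le_less_trans) simp
    have i2: "integrable lborel (\<lambda>x. D2 x powr p)" using mass_integrable[OF D2m, of p] f2 D0 by simp
    have "ennreal (\<integral>x. D2 x powr p \<partial>lborel) \<le> ennreal (R powr p * G)"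
      using m2 mass_eq_integral[OF D2m f2] D0 by simp
    then have I2: "(\<integral>x. D2 x powr p \<partial>lborel) \<le> K" using G0 by (simp add: K_def ennreal_le_iff)
    have e: "0 < 1 - 1/p" "0 < 1/p" "1 - 1/p + 1/p = 1" using conj_exponent(3) p0 by auto
    have A: "0 < B j + 1 / real (Suc j)" using B0[of j] by (intro add_nonneg_pos) auto
    note hol = holder_bound[OF i1 i2 powr_ge_zero powr_ge_zero e A I1 K I2]
    have eq: "(D1 x powr p') powr (1 - 1/p) * (D2 x powr p) powr (1/p) = D1 x * D2 x" for x
    proof -
      have "p' * (1 - 1/p) = 1" using p by (simp add: p'_def field_simps)
      then show ?thesis using D0[of x] p0 by (simp add: powr_powr)
    qed
    have "defect b (t j) / (t j - 1) = (\<integral>x. ((vt b (t j) x powr (q - 1) - v x powr (q - 1)) * (vt b (t j) x - v x)) / (t j - 1) \<partial>lborel)"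
      unfolding defect_def by simp
    then have "\<bar>defect b (t j) / (t j - 1)\<bar> \<le> (\<integral>x. \<bar>((vt b (t j) x powr (q - 1) - v x powr (q - 1)) * (vt b (t j) x - v x)) / (t j - 1)\<bar> \<partial>lborel)"
      by (simp only: integral_abs_bound)
    also have "\<dots> = (\<integral>x. (D1 x powr p') powr (1 - 1/p) * (D2 x powr p) powr (1/p) \<partial>lborel)"
    proof (rule arg_cong[where f = "integral\<^sup>L lborel"], rule ext)
      fix x
      have "\<bar>((vt b (t j) x powr (q - 1) - v x powr (q - 1)) * (vt b (t j) x - v x)) / (t j - 1)\<bar> = D1 x * D2 x"
        using tj(1) by (simp only: D1_def D2_def abs_mult abs_divide times_divide_eq_right abs_of_pos diff_gt_0_iff_gt)
      then show "\<bar>((vt b (t j) x powr (q - 1) - v x powr (q - 1)) * (vt b (t j) x - v x)) / (t j - 1)\<bar> = (D1 x powr p') powr (1 - 1/p) * (D2 x powr p) powr (1/p)"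
        by (simp only: eq)
    qed
    also have "\<dots> \<le> (B j + 1 / real (Suc j)) powr (1 - 1/p) * K powr (1/p)" by (rule hol(2))
    finally show ?thesis .
  qed
  have "(\<lambda>j. (B j + 1 / real (Suc j)) powr (1 - 1/p) * K powr (1/p)) \<longlonglongrightarrow> (0 + 0) powr (1 - 1/p) * K powr (1/p)"
    using LIMSEQ_inverse_real_of_nat B0 conj_exponent(3)
    by (intro tendsto_mult tendsto_const tendsto_powr' tendsto_add B) (auto simp: inverse_eq_divide)
  then have lim: "(\<lambda>j. (B j + 1 / real (Suc j)) powr (1 - 1/p) * K powr (1/p)) \<longlonglongrightarrow> 0" by simp
  have "(\<lambda>j. defect b (t j) / (t j - 1)) \<longlonglongrightarrow> 0"
    by (rule Lim_null_comparison[OF _ lim]) (use bound in \<open>auto intro!: always_eventually\<close>)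
  then show ?thesis using t t1 by blast
qed

lemma powr_quotient_limit:
  fixes r :: real
  assumes t: "\<And>j::nat. t j > 1" "t \<longlonglongrightarrow> 1"
  shows "(\<lambda>j. (t j powr r - 1) / (t j - 1)) \<longlonglongrightarrow> r"
proof -
  have "((\<lambda>z. z powr r) has_real_derivative r * 1 powr (r - 1)) (at 1)" by (rule has_real_derivative_powr) simp
  then have "((\<lambda>z. (z powr r - 1 powr r) / (z - 1)) \<longlongrightarrow> r) (at 1)" by (simp add: has_field_derivative_iff)
  moreover have "filterlim t (at 1) sequentially"
  proof (rule filterlim_atI[OF t(2)])
    show "\<forall>\<^sub>F j in sequentially. t j \<noteq> 1" using t(1) by (auto intro!: always_eventually simp: less_imp_neq[THEN not_sym])
  qed
  ultimately show ?thesis using filterlim_compose[of "\<lambda>z. (z powr r - 1 powr r) / (z - 1)"] by simp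
qed

text \<open>In the critical case all terms of the dilation inequality of first order in \<open>t - 1\<close> cancel except
  \<open>lam * L\<close>. So \<open>lam < 0\<close> is impossible, and for \<open>lam = 0\<close> the energy in the boundary layer
  removed by the dilation is of smaller order than the width of the layer.\<close>

theorem boundary_energy_negligible:
  assumes star: "\<And>x. x \<in> \<Omega> \<Longrightarrow> closed_segment b x \<subseteq> \<Omega>" and R: "\<Omega> \<subseteq> cball b R" "0 \<le> R"
    and nz: "\<not> (AE x in lborel. v x = 0)"
  shows "lam = 0" "\<exists>t :: nat \<Rightarrow> real. (\<forall>j. t j > 1) \<and> t \<longlonglongrightarrow> 1 \<and>
    (\<lambda>j. (\<integral>x. indicator {x. dil b (t j) x \<notin> \<Omega>} x * N (g x) \<partial>lborel) / (t j - 1)) \<longlonglongrightarrow> 0"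
proof -
  obtain t :: "nat \<Rightarrow> real" where t: "\<And>j. t j > 1" "t \<longlonglongrightarrow> 1" "(\<lambda>j. defect b (t j) / (t j - 1)) \<longlonglongrightarrow> 0"
    using defect_negligible[OF R] by blast
  define n where "n = real DIM('a)"
  have tn: "1 / t j ^ DIM('a) = t j powr (- n)" "t j powr p / t j ^ DIM('a) = t j powr (p - n)" for j
    using t(1)[of j] by (simp_all add: n_def powr_minus powr_diff powr_realpow inverse_eq_divide)
  define E where "E j = (\<integral>x. indicator {x. dil b (t j) x \<notin> \<Omega>} x * N (g x) \<partial>lborel)" for j
  have E0: "E j \<ge> 0" for j unfolding E_def using N_nonneg by (intro integral_nonneg_AE) auto
  define Rh where "Rh j = (t j powr (p - n) - 1) / (t j - 1) * (Q + lam * L) - (p / q) * ((t j powr (- n) - 1) / (t j - 1)) * Q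
      - lam * ((t j powr (- n) - 1) / (t j - 1)) * L + p * (defect b (t j) / (t j - 1))" for j
  have le: "(p - 1) * (E j / (t j - 1)) \<le> Rh j" for j
  proof -
    define d where "d = t j - 1"
    have d: "d > 0" using t(1)[of j] by (simp add: d_def)
    have "(p - 1) * E j \<le> (t j powr (p - n) - 1) * (Q + lam * L) - (p / q) * (t j powr (- n) - 1) * Q - lam * (t j powr (- n) - 1) * L + p * defect b (t j)"
      using dilation_inequality(1)[OF star less_imp_le[OF t(1)], of j] unfolding tn E_def .
    then have "((p - 1) * E j) / d \<le> ((t j powr (p - n) - 1) * (Q + lam * L) - (p / q) * (t j powr (- n) - 1) * Q - lam * (t j powr (- n) - 1) * L + p * defect b (t j)) / d"
      using d by (intro divide_right_mono) auto
    also have "\<dots> = Rh j"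
    proof -
      have "(X * A - k * Y * B - l * Y * C + r * D) / d = X / d * A - k * (Y / d) * B - l * (Y / d) * C + r * (D / d)"
        for X Y A B C D k l r :: real by (simp add: add_divide_distrib diff_divide_distrib)
      then show ?thesis unfolding Rh_def d_def[symmetric] .
    qed
    finally show ?thesis by (simp add: d_def)
  qed
  have lim: "Rh \<longlonglongrightarrow> (p - n) * (Q + lam * L) - (p / q) * (- n) * Q - lam * (- n) * L + p * 0"
    unfolding Rh_def[abs_def] by (intro tendsto_intros powr_quotient_limit t)
  have "n - p > 0" using p_less by (simp add: n_def)
  then have "(p / q) * n = n - p" using p p_less by (simp add: q_def n_def)
  then have "(p - n) * (Q + lam * L) + ((p / q) * n) * Q + lam * n * L = p * (lam * L)"
    by (simp only:) (simp add: algebra_simps)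
  then have "(p - n) * (Q + lam * L) - (p / q) * (- n) * Q - lam * (- n) * L + p * 0 = p * (lam * L)"
    by simp
  with lim have lim': "Rh \<longlonglongrightarrow> p * (lam * L)" by simp
  have Rh0: "0 \<le> Rh j" for j using order_trans[OF _ le[of j], of 0] E0[of j] t(1)[of j] p by simp
  have "0 \<le> p * (lam * L)" by (rule LIMSEQ_le_const[OF lim']) (use Rh0 in blast)
  then have lL: "0 \<le> lam * L" using p0 by (simp add: zero_le_mult_iff)
  have "L > 0"
  proof (rule ccontr)
    assume "\<not> L > 0"
    moreover have "L \<ge> 0" by (simp add: L_def)
    ultimately have "L = 0" by simp
    then have "AE x in lborel. v x powr p = 0"
      unfolding L_def using int_powr[OF order_refl] by (subst (asm) integral_nonneg_eq_0_iff_AE) auto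
    then have "AE x in lborel. v x = 0" by eventually_elim simp
    then show False using nz by blast
  qed
  then have "0 \<le> lam" using lL by (simp add: zero_le_mult_iff)
  then show l0: "lam = 0" using lam by simp
  have up: "(\<lambda>j. Rh j / (p - 1)) \<longlonglongrightarrow> 0" using tendsto_divide[OF lim' tendsto_const[of "p - 1"]] l0 p by simp
  have "(\<lambda>j. E j / (t j - 1)) \<longlonglongrightarrow> 0"
  proof (rule tendsto_sandwich[OF _ _ tendsto_const up])
    show "\<forall>\<^sub>F j in sequentially. 0 \<le> E j / (t j - 1)" using E0 t(1) by (intro always_eventually allI divide_nonneg_nonneg) (auto simp: less_imp_le)
    show "\<forall>\<^sub>F j in sequentially. E j / (t j - 1) \<le> Rh j / (p - 1)"
      using le p by (intro always_eventually allI) (simp add: pos_le_divide_eq mult.commute)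
  qed
  then show "\<exists>t :: nat \<Rightarrow> real. (\<forall>j. t j > 1) \<and> t \<longlonglongrightarrow> 1 \<and>
    (\<lambda>j. (\<integral>x. indicator {x. dil b (t j) x \<notin> \<Omega>} x * N (g x) \<partial>lborel) / (t j - 1)) \<longlonglongrightarrow> 0"
    using t(1,2) unfolding E_def by blast
qed

end

section \<open>Boundary geometry\<close>

lemma derivs_satisfy_C1:
  fixes f :: "'a::euclidean_space \<Rightarrow> real"
  assumes "derivs_satisfy P 2 f"
  shows "\<exists>d. C1 f d"
proof -
  have "derivs_satisfy P (Suc (Suc 0)) f" using assms by (simp add: numeral_2_eq_2)
  then have "\<exists>d. (\<forall>x. GDERIV f x :> d x) \<and> (\<forall>w. \<exists>g. \<forall>x. GDERIV (\<lambda>x. d x \<bullet> w) x :> g x)"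
    unfolding derivs_satisfy.simps by blast
  then obtain d where d: "\<And>x. GDERIV f x :> d x" "\<And>w. \<exists>g. \<forall>x. GDERIV (\<lambda>x. d x \<bullet> w) x :> g x" by blast
  have "continuous_on UNIV (\<lambda>x. d x \<bullet> w)" for w
  proof -
    obtain g where g: "\<forall>x. GDERIV (\<lambda>x. d x \<bullet> w) x :> g x" using d(2) by blast
    then show ?thesis by (intro continuous_at_imp_continuous_on ballI) (rule GDERIV_isCont[OF g[rule_format]])
  qed
  then have "continuous_on UNIV d" by (subst continuous_on_componentwise) blast
  then show ?thesis using d(1) by (auto simp: C1_def)
qed

text \<open>The function \<open>G\<close> is the coordinate in the direction \<open>e\<close> minus the function whose graph is the
  boundary, evaluated at the projection to the hyperplane orthogonal to \<open>e\<close>.\<close>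

lemma boundary_height:
  fixes \<Omega> :: "'a::euclidean_space set"
  assumes H: "Hoelder_boundary 2 \<alpha> \<Omega>" and \<Omega>: "open \<Omega>" and x0: "x0 \<in> frontier \<Omega>"
  shows "\<exists>r>0. \<exists>e G dG. norm e = 1 \<and> C1 G dG \<and> G x0 = 0 \<and> (\<forall>x s. G (x + s *\<^sub>R e) = G x + s) \<and>
    (\<forall>x. dG x \<bullet> e = 1) \<and> \<Omega> \<inter> ball x0 r = {x \<in> ball x0 r. 0 < G x}"
proof -
  obtain r e \<gamma> where r: "r > 0" and e: "norm e = 1" and \<gamma>: "derivs_satisfy (locally_Hoelder \<alpha>) 2 \<gamma>"
    and eq: "\<Omega> \<inter> ball x0 r = {x \<in> ball x0 r. \<gamma> (x - (x \<bullet> e) *\<^sub>R e) < x \<bullet> e}"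
    using H x0 unfolding Hoelder_boundary_def by blast
  obtain d where d: "C1 \<gamma> d" using derivs_satisfy_C1[OF \<gamma>] by blast
  have ee: "e \<bullet> e = 1" using e by (simp add: dot_square_norm)
  define \<pi> where "\<pi> x = x - (x \<bullet> e) *\<^sub>R e" for x
  have \<pi>c: "continuous_on UNIV \<pi>" unfolding \<pi>_def[abs_def] by (intro continuous_intros)
  have \<pi>l: "bounded_linear \<pi>" unfolding \<pi>_def[abs_def]
    by (intro bounded_linear_sub bounded_linear_ident bounded_linear_compose[OF bounded_linear_scaleR_left] bounded_linear_inner_left)
  define G where "G x = x \<bullet> e - \<gamma> (\<pi> x)" for x
  define dG where "dG x = e - \<pi> (d (\<pi> x))" for x
  have "C1 G dG"
    unfolding C1_def
  proof (intro conjI allI)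
    fix x
    have "(\<gamma> has_derivative (\<lambda>h. h \<bullet> d (\<pi> x))) (at (\<pi> x))" using d by (simp add: C1_def gderiv_def)
    with bounded_linear_imp_has_derivative[OF \<pi>l] have "((\<lambda>x. \<gamma> (\<pi> x)) has_derivative (\<lambda>h. \<pi> h \<bullet> d (\<pi> x))) (at x)"
      by (rule has_derivative_compose)
    then have "(G has_derivative (\<lambda>h. h \<bullet> e - \<pi> h \<bullet> d (\<pi> x))) (at x)" unfolding G_def[abs_def]
      by (intro has_derivative_diff bounded_linear_imp_has_derivative bounded_linear_inner_left)
    moreover have "(\<lambda>h. h \<bullet> e - \<pi> h \<bullet> d (\<pi> x)) = (\<lambda>h. h \<bullet> dG x)"
      by (rule ext) (simp add: dG_def \<pi>_def inner_diff_left inner_diff_right inner_commute mult.commute)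
    ultimately show "GDERIV G x :> dG x" by (simp add: gderiv_def)
  next
    have "continuous_on UNIV d" using d by (simp add: C1_def)
    then have "continuous_on UNIV (\<lambda>x. d (\<pi> x))" by (rule continuous_on_compose2[OF _ \<pi>c]) auto
    then have "continuous_on UNIV (\<lambda>x. \<pi> (d (\<pi> x)))" by (rule continuous_on_compose2[OF \<pi>c]) auto
    then show "continuous_on UNIV dG" unfolding dG_def[abs_def] by (intro continuous_intros)
  qed
  moreover have "G (x + s *\<^sub>R e) = G x + s" for x s
  proof -
    have "\<pi> (x + s *\<^sub>R e) = \<pi> x" by (simp add: \<pi>_def inner_add_left ee algebra_simps)
    then show ?thesis by (simp add: G_def inner_add_left ee)
  qed
  moreover have "dG x \<bullet> e = 1" for x by (simp add: dG_def \<pi>_def inner_diff_left ee)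
  moreover have eqG: "\<Omega> \<inter> ball x0 r = {x \<in> ball x0 r. 0 < G x}" using eq by (auto simp: G_def \<pi>_def)
  moreover have "G x0 = 0"
  proof (rule antisym)
    have "x0 \<notin> \<Omega>" using x0 \<Omega> by (simp add: frontier_def interior_open)
    then show "G x0 \<le> 0" using eqG r by (force simp: not_less)
    show "0 \<le> G x0"
    proof (rule ccontr)
      assume "\<not> 0 \<le> G x0"
      then have neg: "G x0 < 0" by simp
      have "open {x. G x < 0}" using C1_continuous[OF \<open>C1 G dG\<close>] by (intro open_Collect_less continuous_intros)
      then have "open ({x. G x < 0} \<inter> ball x0 r)" by auto
      moreover have "x0 \<in> {x. G x < 0} \<inter> ball x0 r" using neg r by simp
      moreover have "x0 \<in> closure \<Omega>" using x0 by (simp add: frontier_def)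
      ultimately have "\<Omega> \<inter> ({x. G x < 0} \<inter> ball x0 r) \<noteq> {}"
        using open_Int_closure_eq_empty[of "{x. G x < 0} \<inter> ball x0 r" \<Omega>] by blast
      then obtain z where "z \<in> \<Omega> \<inter> ball x0 r" "G z < 0" by blast
      then show False unfolding eqG by auto
    qed
  qed
  ultimately show ?thesis using r e by blast
qed

lemma farthest_boundary_point:
  fixes \<Omega> :: "'a::euclidean_space set"
  assumes \<Omega>: "open \<Omega>" "bounded \<Omega>" "b \<in> \<Omega>"
  shows "\<exists>x0\<in>frontier \<Omega>. \<Omega> \<subseteq> cball b (dist b x0)"
proof -
  have "compact (closure \<Omega>)" "closure \<Omega> \<noteq> {}" using \<Omega> by auto
  then obtain x0 where x0: "x0 \<in> closure \<Omega>" "\<And>y. y \<in> closure \<Omega> \<Longrightarrow> dist b y \<le> dist b x0"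
    using distance_attains_sup[of "closure \<Omega>" b] by blast
  have sub: "\<Omega> \<subseteq> cball b (dist b x0)" using x0(2) closure_subset by fastforce
  have "x0 \<notin> \<Omega>"
  proof
    assume "x0 \<in> \<Omega>"
    have "interior (cball b (dist b x0)) = ball b (dist b x0)" by simp
    then have "\<Omega> \<subseteq> ball b (dist b x0)" using sub \<Omega>(1) interior_maximal by metis
    then show False using \<open>x0 \<in> \<Omega>\<close> by auto
  qed
  then have "x0 \<in> frontier \<Omega>" using x0(1) \<Omega>(1) by (simp add: frontier_def interior_open)
  then show ?thesis using sub by blast
qed

text \<open>At the boundary point farthest from \<open>b\<close> the ray from \<open>b\<close> leaves the domain transversally,
  because the boundary is tangent to a sphere around \<open>b\<close>. Hence a dilation with factor \<open>t\<close>
  throws a layer of height comparable to \<open>t - 1\<close> out of the domain.\<close>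

lemma dilation_removes_layer:
  fixes \<Omega> :: "'a::euclidean_space set"
  assumes \<Omega>: "\<Omega> \<subseteq> cball b (dist b x0)" and bx: "x0 \<noteq> b" and r: "0 < r" and G: "C1 G dG" "G x0 = 0" "\<And>x. dG x \<bullet> e = 1"
    and eq: "\<Omega> \<inter> ball x0 r = {x \<in> ball x0 r. 0 < G x}"
  shows "\<exists>r1 \<kappa> \<tau>. 0 < r1 \<and> r1 \<le> r \<and> 0 < \<kappa> \<and> 1 < \<tau> \<and>
    (\<forall>t x. 1 < t \<longrightarrow> t < \<tau> \<longrightarrow> x \<in> ball x0 r1 \<longrightarrow> G x \<le> \<kappa> * (t - 1) \<longrightarrow> (1 - t) *\<^sub>R b + t *\<^sub>R x \<notin> \<Omega>)"
proof -
  define w where "w = x0 - b"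
  have w: "w \<bullet> w > 0" using bx by (simp add: w_def)
  have tang: "dG x0 \<bullet> h \<le> 0" if h: "h \<bullet> w > 0" for h
  proof (rule ccontr)
    assume "\<not> dG x0 \<bullet> h \<le> 0"
    then have pos: "dG x0 \<bullet> h > 0" by simp
    have "((\<lambda>s. G (x0 + s *\<^sub>R h)) has_real_derivative dG (x0 + 0 *\<^sub>R h) \<bullet> h) (at 0)" by (rule C1_line[OF G(1)])
    from DERIV_pos_inc_right[OF this] pos
    obtain \<delta> where \<delta>: "\<delta> > 0" "\<And>s. 0 < s \<Longrightarrow> s < \<delta> \<Longrightarrow> G (x0 + 0 *\<^sub>R h) < G (x0 + (0 + s) *\<^sub>R h)"
      by auto
    define s where "s = min (\<delta> / 2) (r / (2 * (norm h + 1)))"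
    have n: "norm h + 1 > 0" by (simp add: add_nonneg_pos)
    have s: "s > 0" "s < \<delta>" "s \<le> r / (2 * (norm h + 1))" using \<delta> r n by (auto simp: s_def)
    have "s * norm h \<le> r / (2 * (norm h + 1)) * norm h" using s by (intro mult_right_mono) auto
    also have "\<dots> < r" using r n by (simp add: field_simps add_nonneg_pos)
    finally have "x0 + s *\<^sub>R h \<in> ball x0 r" using s by (simp add: dist_norm)
    moreover have "G (x0 + s *\<^sub>R h) > 0" using \<delta>(2)[OF s(1,2)] G(2) by simp
    ultimately have "x0 + s *\<^sub>R h \<in> \<Omega>" using eq by blast
    then have "dist b (x0 + s *\<^sub>R h) \<le> dist b x0" using \<Omega> by auto
    then have "norm (w + s *\<^sub>R h) \<le> norm w" unfolding dist_norm w_def by (simp add: norm_minus_commute algebra_simps)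
    then have "(norm (w + s *\<^sub>R h))\<^sup>2 \<le> (norm w)\<^sup>2" by (intro power_mono) auto
    then have "2 * s * (h \<bullet> w) + s * s * (h \<bullet> h) \<le> 0"
      by (simp add: power2_norm_eq_inner inner_add_left inner_add_right inner_commute algebra_simps)
    moreover have "2 * s * (h \<bullet> w) > 0" "s * s * (h \<bullet> h) \<ge> 0" using s h by auto
    ultimately show False by linarith
  qed
  have neg: "dG x0 \<bullet> w < 0"
  proof (rule ccontr)
    assume "\<not> dG x0 \<bullet> w < 0"
    then have z: "dG x0 \<bullet> w = 0" using tang[OF w] by simp
    \<comment> \<open>as \<open>dG x0\<close> is orthogonal to \<open>w\<close>, the sum still points out of the ball\<close>
    have "(w + dG x0) \<bullet> w > 0" using w z by (simp add: inner_add_left)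
    from tang[OF this] have "dG x0 \<bullet> dG x0 \<le> 0" using z by (simp add: inner_add_right)
    then have "dG x0 = 0" using inner_gt_zero_iff not_less by blast
    then show False using G(3)[of x0] by simp
  qed
  define m0 where "m0 = - (dG x0 \<bullet> w)"
  have m0: "m0 > 0" using neg by (simp add: m0_def)
  have dGc: "continuous_on UNIV dG" using G(1) by (simp add: C1_def)
  have "continuous_on UNIV (\<lambda>z::'a \<times> 'a. dG (fst z))"
    by (rule continuous_on_compose2[OF dGc continuous_on_fst[OF continuous_on_id]]) auto
  then have "open {z. dG (fst z) \<bullet> (snd z - b) < - (m0 / 2)}"
    by (intro open_Collect_less continuous_on_inner continuous_on_diff continuous_on_snd continuous_on_id continuous_on_const)
  moreover have "(x0, x0) \<in> {z. dG (fst z) \<bullet> (snd z - b) < - (m0 / 2)}" using m0 by (simp add: m0_def w_def[symmetric])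
  ultimately have "\<exists>U V. open U \<and> open V \<and> (x0, x0) \<in> U \<times> V \<and> U \<times> V \<subseteq> {z. dG (fst z) \<bullet> (snd z - b) < - (m0 / 2)}"
    unfolding open_prod_def by blast
  then obtain U V where UV: "open U" "x0 \<in> U" "open V" "x0 \<in> V" "U \<times> V \<subseteq> {z. dG (fst z) \<bullet> (snd z - b) < - (m0 / 2)}"
    by blast
  obtain \<rho>1 where \<rho>1: "\<rho>1 > 0" "ball x0 \<rho>1 \<subseteq> U" using UV openE by blast
  obtain \<rho>2 where \<rho>2: "\<rho>2 > 0" "ball x0 \<rho>2 \<subseteq> V" using UV openE by blast
  define r1 where "r1 = min r (min \<rho>1 \<rho>2) / 2"
  have r1: "r1 > 0" "r1 \<le> r" "2 * r1 \<le> r" "2 * r1 \<le> \<rho>1" "r1 \<le> \<rho>2" using r \<rho>1 \<rho>2 by (auto simp: r1_def)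
  define R where "R = dist b x0 + r1"
  have R: "R > 0" using r1 by (simp add: R_def add_nonneg_pos)
  define \<tau> where "\<tau> = 1 + r1 / R"
  have "(1 - t) *\<^sub>R b + t *\<^sub>R x \<notin> \<Omega>" if t: "1 < t" "t < \<tau>" and x: "x \<in> ball x0 r1" and Gx: "G x \<le> m0 / 2 * (t - 1)" for t x
  proof -
    define h where "h = (t - 1) *\<^sub>R (x - b)"
    have "dist b x \<le> dist b x0 + dist x0 x" by (rule dist_triangle)
    then have "dist b x \<le> R" using x by (simp add: R_def)
    then have "norm h \<le> (t - 1) * R" using t by (simp add: h_def dist_norm norm_minus_commute)
    also have "\<dots> < r1"
    proof -
      have "t - 1 < r1 / R" using t by (simp add: \<tau>_def)
      then show ?thesis using R by (simp add: pos_less_divide_eq)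
    qed
    finally have hn: "norm h < r1" .
    have near: "x + s *\<^sub>R h \<in> ball x0 (2 * r1)" if "0 \<le> s" "s \<le> 1" for s
    proof -
      have "dist x0 (x + s *\<^sub>R h) \<le> dist x0 x + norm (s *\<^sub>R h)"
        using norm_triangle_ineq4[of "x0 - x" "s *\<^sub>R h"] by (simp add: dist_norm algebra_simps)
      also have "norm (s *\<^sub>R h) \<le> norm h" using that by (simp add: mult_left_le_one_le)
      finally show ?thesis using x hn by simp
    qed
    obtain s where s: "0 < s" "s < 1" "G (x + h) - G x = dG (x + s *\<^sub>R h) \<bullet> h" using C1_mvt[OF G(1)] .
    have "(x + s *\<^sub>R h, x) \<in> U \<times> V" using near[of s] s r1 x \<rho>1 \<rho>2 by auto
    then have "dG (x + s *\<^sub>R h) \<bullet> (x - b) < - (m0 / 2)" using UV(5) by auto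
    then have "(t - 1) * (dG (x + s *\<^sub>R h) \<bullet> (x - b)) < (t - 1) * - (m0 / 2)" using t by (intro mult_strict_left_mono) auto
    then have "G (x + h) < 0" using s(3) Gx by (simp add: h_def mult.commute)
    moreover have "x + h \<in> ball x0 r" using near[of 1] r1(3) by auto
    moreover have "\<not> G (x + h) < 0" if "x + h \<in> \<Omega> \<inter> ball x0 r" using that unfolding eq by simp
    ultimately have "x + h \<notin> \<Omega>" by blast
    then show ?thesis by (simp add: h_def algebra_simps)
  qed
  then show ?thesis using r1 m0 R by (intro exI[of _ r1] exI[of _ "m0/2"] exI[of _ \<tau>]) (auto simp: \<tau>_def)
qed

text \<open>Layers of height \<open>\<delta>\<close> have volume of order \<open>\<delta>\<close>: translates of a layer by multiples of
  \<open>\<delta> *\<^sub>R e\<close> are disjoint, and about \<open>1/\<delta>\<close> of them fit into a fixed ball.\<close>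

lemma strip_volume:
  fixes G :: "'a::euclidean_space \<Rightarrow> real"
  assumes e: "norm e = 1" and G: "continuous_on UNIV G" "\<And>x s. G (x + s *\<^sub>R e) = G x + s" and \<delta>: "0 < \<delta>" "\<delta> \<le> 1"
  shows "measure lborel {x \<in> ball x0 r. 0 < G x \<and> G x < \<delta>} \<le> 2 * measure lborel (ball x0 (r + 1)) * \<delta>"
proof -
  define S where "S = {x \<in> ball x0 r. 0 < G x \<and> G x < \<delta>}"
  define n where "n = nat \<lfloor>1 / \<delta>\<rfloor>"
  have [measurable]: "G \<in> borel_measurable borel" using G(1) by (rule borel_measurable_continuous_onI)
  have Sm[measurable]: "S \<in> sets borel" unfolding S_def by measurable
  have "1 \<le> 1 / \<delta>" using \<delta> by simp
  then have "1 \<le> \<lfloor>1 / \<delta>\<rfloor>" by (simp only: le_floor_iff of_int_1)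
  then have n: "real n = of_int \<lfloor>1 / \<delta>\<rfloor>" "(1::real) \<le> of_int \<lfloor>1 / \<delta>\<rfloor>" unfolding n_def by linarith+
  then have n1: "real n \<le> 1 / \<delta>" "1 / \<delta> < real n + 1" "1 \<le> real n" by linarith+
  define T where "T k = {x. x + (- (real k * \<delta>)) *\<^sub>R e \<in> S}" for k :: nat
  have Tm[measurable]: "T k \<in> sets borel" for k unfolding T_def by measurable
  have vol: "emeasure lborel (T k) = emeasure lborel S" for k
  proof -
    have "emeasure lborel S = (\<integral>\<^sup>+x. indicator S x \<partial>lborel)" by simp
    also have "\<dots> = (\<integral>\<^sup>+x. indicator S (- (real k * \<delta>) *\<^sub>R e + 1 *\<^sub>R x) \<partial>lborel)"
      by (subst lborel_nn_integral_affine[where c = 1 and t = "- (real k * \<delta>) *\<^sub>R e"]) simp_all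
    also have "\<dots> = (\<integral>\<^sup>+x. indicator (T k) x \<partial>lborel)"
      by (intro nn_integral_cong) (simp add: T_def indicator_def add.commute)
    finally show ?thesis by simp
  qed
  have heights: "real k * \<delta> < G x \<and> G x < (real k + 1) * \<delta>" if "x \<in> T k" for x k
    using that G(2)[of x "- (real k * \<delta>)"] by (simp add: T_def S_def algebra_simps)
  have disj: "disjoint_family_on T {..<n}"
    unfolding disjoint_family_on_def
  proof (intro ballI impI)
    fix k l assume "k \<in> {..<n}" "l \<in> {..<n}" "k \<noteq> l"
    show "T k \<inter> T l = {}"
    proof (rule ccontr)
      assume "T k \<inter> T l \<noteq> {}"
      then obtain x where "x \<in> T k" "x \<in> T l" by blast
      from heights[OF this(1)] heights[OF this(2)] have "real k * \<delta> < (real l + 1) * \<delta>" "real l * \<delta> < (real k + 1) * \<delta>" by linarith+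
      then have "real k < real l + 1" "real l < real k + 1" using \<delta> by (simp_all add: mult_less_cancel_right)
      then show False using \<open>k \<noteq> l\<close> by linarith
    qed
  qed
  have sub: "T k \<subseteq> ball x0 (r + 1)" if "k < n" for k
  proof
    fix x assume "x \<in> T k"
    then have "dist x0 (x - (real k * \<delta>) *\<^sub>R e) < r" by (simp add: T_def S_def)
    moreover have "real k * \<delta> \<le> 1"
    proof -
      have "real k \<le> 1 / \<delta>" using that n1(1) by linarith
      then show ?thesis using \<delta> by (simp add: pos_le_divide_eq)
    qed
    moreover have "dist x0 x \<le> dist x0 (x - (real k * \<delta>) *\<^sub>R e) + dist (x - (real k * \<delta>) *\<^sub>R e) x" by (rule dist_triangle)
    moreover have "dist (x - (real k * \<delta>) *\<^sub>R e) x = real k * \<delta>" using e \<delta> by (simp add: dist_norm)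
    ultimately show "x \<in> ball x0 (r + 1)" by simp
  qed
  have "of_nat n * emeasure lborel S = (\<Sum>k<n. emeasure lborel (T k))" by (simp add: vol)
  also have "\<dots> = emeasure lborel (\<Union>k<n. T k)" using disj by (intro sum_emeasure) auto
  also have "\<dots> \<le> emeasure lborel (ball x0 (r + 1))" using sub by (intro emeasure_mono) auto
  finally have "of_nat n * emeasure lborel S \<le> emeasure lborel (ball x0 (r + 1))" .
  moreover have "emeasure lborel S = ennreal (measure lborel S)"
  proof (rule emeasure_eq_ennreal_measure)
    have "bounded S" by (rule bounded_subset[OF bounded_ball[of x0 r]]) (auto simp: S_def)
    then show "emeasure lborel S \<noteq> top" using emeasure_bounded_finite[of S] by simp
  qed
  moreover have "emeasure lborel (ball x0 (r + 1)) = ennreal (measure lborel (ball x0 (r + 1)))"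
    by (rule emeasure_eq_ennreal_measure) (use emeasure_bounded_finite[of "ball x0 (r + 1)"] in auto)
  ultimately have "ennreal (real n * measure lborel S) \<le> ennreal (measure lborel (ball x0 (r + 1)))"
    by (simp add: ennreal_mult' ennreal_of_nat_eq_real_of_nat)
  then have le: "real n * measure lborel S \<le> measure lborel (ball x0 (r + 1))" by (simp add: ennreal_le_iff)
  have "1 / \<delta> \<le> 2 * real n" using n1 by linarith
  then have "1 / \<delta> * measure lborel S \<le> 2 * real n * measure lborel S" by (intro mult_right_mono) auto
  also have "\<dots> \<le> 2 * measure lborel (ball x0 (r + 1))" using le by simp
  finally have "measure lborel S / \<delta> \<le> 2 * measure lborel (ball x0 (r + 1))" by simp
  then have "measure lborel S \<le> 2 * measure lborel (ball x0 (r + 1)) * \<delta>" using \<delta>(1) by (simp only: pos_divide_le_eq)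
  then show ?thesis unfolding S_def .
qed

section \<open>The strong maximum principle\<close>

lemma ball_cutoff:
  fixes y :: "'a::euclidean_space"
  assumes \<rho>: "0 < \<rho>" "\<rho> < \<rho>2"
  shows "\<exists>\<eta> e. C1 \<eta> e \<and> (\<forall>x. 0 \<le> \<eta> x \<and> \<eta> x \<le> 1) \<and> (\<forall>x\<in>ball y \<rho>. \<eta> x = 1) \<and> (\<forall>x. x \<notin> cball y \<rho>2 \<longrightarrow> \<eta> x = 0)"
proof -
  define D where "D = \<rho>2\<^sup>2 - \<rho>\<^sup>2"
  have D: "D > 0" using \<rho> by (simp add: D_def power_strict_mono)
  have inn: "C1 (\<lambda>x. (x - y) \<bullet> (x - y)) (\<lambda>x. 2 *\<^sub>R (x - y))"
    unfolding C1_def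
  proof (intro conjI allI)
    fix x
    have "((\<lambda>x. (x - y) \<bullet> (x - y)) has_derivative (\<lambda>h. (x - y) \<bullet> h + h \<bullet> (x - y))) (at x)"
      by (rule has_derivative_inner) (auto intro!: derivative_eq_intros)
    moreover have "(\<lambda>h. (x - y) \<bullet> h + h \<bullet> (x - y)) = (\<lambda>h. h \<bullet> (2 *\<^sub>R (x - y)))"
      by (rule ext) (simp add: inner_commute)
    ultimately show "GDERIV (\<lambda>x. (x - y) \<bullet> (x - y)) x :> 2 *\<^sub>R (x - y)" by (simp only: gderiv_def)
  qed (intro continuous_intros)
  define \<eta> where "\<eta> x = ramp ((- 1 / D) * ((x - y) \<bullet> (x - y)) + \<rho>2\<^sup>2 / D)" for x
  have arg: "(- 1 / D) * ((x - y) \<bullet> (x - y)) + \<rho>2\<^sup>2 / D = (\<rho>2\<^sup>2 - (dist y x)\<^sup>2) / D" for x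
    by (simp add: dist_norm power2_norm_eq_inner norm_minus_commute diff_divide_distrib)
  have "\<eta> x = 1" if "x \<in> ball y \<rho>" for x
  proof -
    have "(dist y x)\<^sup>2 \<le> \<rho>\<^sup>2" using that by (intro power_mono) auto
    then have "1 \<le> (\<rho>2\<^sup>2 - (dist y x)\<^sup>2) / D" using D by (simp add: D_def)
    then show ?thesis unfolding \<eta>_def arg by (rule ramp_values)
  qed
  moreover have "\<eta> x = 0" if "x \<notin> cball y \<rho>2" for x
  proof -
    have "\<rho>2\<^sup>2 \<le> (dist y x)\<^sup>2" using that \<rho> by (intro power_mono) auto
    then have "(\<rho>2\<^sup>2 - (dist y x)\<^sup>2) / D \<le> 0" using D by (simp add: divide_le_0_iff)
    then show ?thesis unfolding \<eta>_def arg by (rule ramp_values)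
  qed
  moreover have "0 \<le> \<eta> x \<and> \<eta> x \<le> 1" for x by (simp add: \<eta>_def ramp_bounds)
  moreover have "\<exists>e. C1 \<eta> e" unfolding \<eta>_def[abs_def] using C1_ramp[OF inn] by blast
  ultimately show ?thesis by blast
qed

text \<open>The pointwise inequality behind the logarithmic estimate; \<open>s\<close> stands for a cutoff function and
  \<open>X\<close> for the length of the logarithmic gradient. The exponent \<open>k \<ge> p\<close> lets the cutoff survive
  in Young's inequality.\<close>

lemma log_young:
  fixes p c0 B :: real and k :: nat
  assumes p: "1 < p" and c: "0 < c0" and B: "0 \<le> B" and k: "p \<le> real k"
  shows "\<exists>C\<ge>0. \<forall>s X. 0 \<le> s \<longrightarrow> s \<le> 1 \<longrightarrow> 0 \<le> X \<longrightarrow>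
    B * (s ^ (k - 1) * X powr (p - 1)) \<le> c0 / 2 * (s ^ k * X powr p) + C"
proof -
  \<comment> \<open>weight for which Young's inequality has the leading coefficient \<open>c0 / 2\<close>\<close>
  define \<theta> where "\<theta> = (p * c0 / (2 * (p - 1))) powr (1 / p)"
  have p0: "p > 0" using p by simp
  have arg: "p * c0 / (2 * (p - 1)) > 0" using p c by simp
  have \<theta>: "\<theta> > 0" using arg less_irrefl unfolding \<theta>_def powr_gt_zero by metis
  have \<theta>p: "(1 - 1/p) * \<theta> powr p = c0 / 2"
  proof -
    have "(z powr (1 / p)) powr p = z" if "z > 0" for z using that p0 by (simp add: powr_powr)
    from this[OF arg] have "\<theta> powr p = p * c0 / (2 * (p - 1))" by (simp only: \<theta>_def)
    moreover have "(1 - 1/p) * (p * c0 / (2 * (p - 1))) = c0 / 2" using p by (simp add: field_simps)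
    ultimately show ?thesis by simp
  qed
  define b where "b = B * \<theta> powr (1 - p)"
  have b: "b \<ge> 0" using B by (simp add: b_def)
  have "B * (s ^ (k - 1) * X powr (p - 1)) \<le> c0 / 2 * (s ^ k * X powr p) + b powr p / p" if s: "0 \<le> s" "s \<le> 1" and X: "0 \<le> X" for s X :: real
  proof (cases "s = 0")
    case True
    have "k - 1 > 0" using p k by linarith
    then show ?thesis using True b p by (simp add: power_0_left)
  next
    case False
    then have s0: "s > 0" using s by simp
    define A where "A = s powr (real k / p) * X * \<theta>"
    have A: "A \<ge> 0" using X \<theta> by (simp add: A_def)
    have "real k * (p - 1) / p \<le> real k - 1" using p k by (simp add: field_simps)
    then have "s powr (real k - 1) \<le> s powr (real k * (p - 1) / p)" using s0 s by (intro powr_mono') auto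
    moreover have "s ^ (k - 1) = s powr (real k - 1)" using s0 p k by (simp add: powr_realpow[symmetric] of_nat_diff)
    ultimately have "s ^ (k - 1) \<le> s powr (real k * (p - 1) / p)" by simp
    then have "B * (s ^ (k - 1) * X powr (p - 1)) \<le> B * (s powr (real k * (p - 1) / p) * X powr (p - 1))"
      using B by (intro mult_left_mono mult_right_mono) auto
    also have "\<dots> = A powr (p - 1) * b"
    proof -
      have "A powr (p - 1) = s powr (real k * (p - 1) / p) * X powr (p - 1) * \<theta> powr (p - 1)"
        using s0 X \<theta> by (simp add: A_def powr_mult powr_powr)
      moreover have "\<theta> powr (p - 1) * \<theta> powr (1 - p) = 1" using \<theta> by (simp add: powr_add[symmetric])
      ultimately show ?thesis by (simp add: b_def mult_ac)
    qed
    also have "\<dots> \<le> (1 - 1/p) * A powr p + b powr p / p" by (rule powr_young[OF p A b])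
    also have "A powr p = (s ^ k * X powr p) * \<theta> powr p"
      using s0 X \<theta> p0 by (simp add: A_def powr_mult powr_powr powr_realpow)
    also have "(1 - 1/p) * ((s ^ k * X powr p) * \<theta> powr p) = ((1 - 1/p) * \<theta> powr p) * (s ^ k * X powr p)" by (simp only: mult_ac)
    finally show ?thesis unfolding \<theta>p .
  qed
  moreover have "b powr p / p \<ge> 0" using p by simp
  ultimately show ?thesis by blast
qed

context critical_problem
begin

text \<open>Test functions of the form \<open>\<zeta> * F v\<close> suffice for what follows. The point of the
  definition is that \<open>U\<close> may stick out of the domain, \<open>v\<close> being extended by zero.\<close>

definition supersolution :: "'a set \<Rightarrow> bool" where
  "supersolution U \<longleftrightarrow> (\<forall>\<zeta> e F F' M. C1c U \<zeta> e \<longrightarrow> (\<forall>x. 0 \<le> \<zeta> x) \<longrightarrow> (\<forall>s. (F has_real_derivative F' s) (at s)) \<longrightarrow>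
     continuous_on UNIV F' \<longrightarrow> (\<forall>s. \<bar>F' s\<bar> \<le> M) \<longrightarrow> (\<forall>s\<ge>0. 0 \<le> F s \<and> F s \<le> M) \<longrightarrow>
     0 \<le> (\<integral>x. a (g x) \<bullet> (\<zeta> x *\<^sub>R F' (v x) *\<^sub>R g x + F (v x) *\<^sub>R e x) \<partial>lborel))"

lemma C1c_bounds:
  fixes \<zeta> :: "'a \<Rightarrow> real"
  assumes "C1c U \<zeta> e" shows "\<exists>A>0. (\<forall>x. \<bar>\<zeta> x\<bar> \<le> A) \<and> (\<forall>x. norm (e x) \<le> A)"
proof -
  have C: "continuous_on UNIV \<zeta>" "continuous_on UNIV e"
    using C1_continuous[OF C1c_C1[OF assms]] C1c_C1[OF assms] by (simp_all add: C1_def)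
  obtain K where K: "compact K" "K \<subseteq> U" "\<And>x. x \<notin> K \<Longrightarrow> \<zeta> x = 0" "\<And>x. x \<notin> K \<Longrightarrow> e x = 0" using C1c_support[OF assms] by blast
  obtain A1 where A1: "A1 > 0" "\<And>x. norm (\<zeta> x) \<le> A1" using bounded_compact_support[OF C(1) K(1,3)] by blast
  obtain A2 where A2: "A2 > 0" "\<And>x. norm (e x) \<le> A2" using bounded_compact_support[OF C(2) K(1,4)] by blast
  have "\<bar>\<zeta> x\<bar> \<le> max A1 A2" "norm (e x) \<le> max A1 A2" for x using A1(2)[of x] A2(2)[of x] by (simp_all add: le_max_iff_disj)
  then show ?thesis using A1(1) by (intro exI[of _ "max A1 A2"]) auto
qed

lemma supersolution_domain:
  assumes l0: "lam = 0" shows "supersolution \<Omega>"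
  unfolding supersolution_def
proof (intro allI impI)
  fix \<zeta> :: "'a \<Rightarrow> real" and e F F' M
  assume \<zeta>: "C1c \<Omega> \<zeta> e" "\<forall>x. 0 \<le> \<zeta> x" and F: "\<forall>s. (F has_real_derivative F' s) (at s)" "continuous_on UNIV F'"
    "\<forall>s. \<bar>F' s\<bar> \<le> M" "\<forall>s\<ge>0. 0 \<le> F s \<and> F s \<le> M"
  obtain A where A: "\<And>x. \<bar>\<zeta> x\<bar> \<le> A" "\<And>x. norm (e x) \<le> A" using C1c_bounds[OF \<zeta>(1)] by blast
  have "sobolev0 p \<Omega> (\<lambda>x. \<zeta> x * F (v x)) (\<lambda>x. \<zeta> x *\<^sub>R F' (v x) *\<^sub>R g x + F (v x) *\<^sub>R e x)"
    using F \<zeta> A by (intro sobolev0_mult_compose[OF sob p0, where M = M and A = A and A' = A] C1c_C1[OF \<zeta>(1)]) auto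
  from weak[OF this] have "(\<integral>x. a (g x) \<bullet> (\<zeta> x *\<^sub>R F' (v x) *\<^sub>R g x + F (v x) *\<^sub>R e x) \<partial>lborel)
      = (\<integral>x. v x powr (q - 1) * (\<zeta> x * F (v x)) \<partial>lborel)" using l0 by simp
  also have "\<dots> \<ge> 0" using F(4) \<zeta>(2) v_nonneg by (intro integral_nonneg_AE) auto
  finally show "0 \<le> (\<integral>x. a (g x) \<bullet> (\<zeta> x *\<^sub>R F' (v x) *\<^sub>R g x + F (v x) *\<^sub>R e x) \<partial>lborel)" .
qed

lemma test_integrable:
  assumes \<zeta>: "C1c U \<zeta> e" and F: "\<And>s. (F has_real_derivative F' s) (at s)" "continuous_on UNIV F'"
    "\<And>s. \<bar>F' s\<bar> \<le> M" "\<And>s. 0 \<le> s \<Longrightarrow> 0 \<le> F s \<and> F s \<le> M"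
  shows "integrable lborel (\<lambda>x. a (g x) \<bullet> (\<zeta> x *\<^sub>R F' (v x) *\<^sub>R g x + F (v x) *\<^sub>R e x))"
proof (rule flux_integrable)
  have [measurable]: "F \<in> borel_measurable borel" "F' \<in> borel_measurable borel"
    using F(1,2) by (auto intro!: borel_measurable_continuous_onI DERIV_isCont continuous_at_imp_continuous_on)
  note [measurable] = C1c_measurable[OF \<zeta>]
  obtain A where A: "A > 0" "\<And>x. \<bar>\<zeta> x\<bar> \<le> A" "\<And>x. norm (e x) \<le> A" using C1c_bounds[OF \<zeta>] by blast
  have M: "M \<ge> 0" using F(3)[of 0] by linarith
  show "(\<lambda>x. \<zeta> x *\<^sub>R F' (v x) *\<^sub>R g x + F (v x) *\<^sub>R e x) \<in> borel_measurable borel" by measurable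
  have 1: "mass p (\<lambda>x. \<zeta> x *\<^sub>R F' (v x) *\<^sub>R g x) \<le> ennreal ((A * M) powr p) * mass p g"
  proof (rule mass_scale[OF p0 _ gm])
    show "0 \<le> A * M" using A M by simp
    fix x
    have "\<bar>\<zeta> x\<bar> * \<bar>F' (v x)\<bar> \<le> A * M" using A M F(3) by (intro mult_mono) auto
    from mult_right_mono[OF this, of "norm (g x)"]
    show "norm (\<zeta> x *\<^sub>R F' (v x) *\<^sub>R g x) \<le> A * M * norm (g x)" by (simp add: mult.assoc abs_mult)
  qed
  have 2: "mass p (\<lambda>x. F (v x) *\<^sub>R e x) \<le> ennreal (M powr p) * mass p e"
    using F(4)[OF v_nonneg] M by (intro mass_scale[OF p0 M]) (auto intro!: mult_right_mono)
  have "mass p (\<lambda>x. \<zeta> x *\<^sub>R F' (v x) *\<^sub>R g x + F (v x) *\<^sub>R e x) \<le> ennreal (2 powr p) * (mass p (\<lambda>x. \<zeta> x *\<^sub>R F' (v x) *\<^sub>R g x) + mass p (\<lambda>x. F (v x) *\<^sub>R e x))"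
    by (intro mass_add p0 norm_triangle_ineq) measurable
  also have "\<dots> \<le> ennreal (2 powr p) * (ennreal ((A * M) powr p) * mass p g + ennreal (M powr p) * mass p e)"
    by (intro mult_left_mono add_mono 1 2) auto
  also have "\<dots> < \<infinity>" using sobolev0D(6)[OF sob] C1c_mass(2)[OF \<zeta> p0]
    by (auto simp: ennreal_mult_less_top)
  finally show "mass p (\<lambda>x. \<zeta> x *\<^sub>R F' (v x) *\<^sub>R g x + F (v x) *\<^sub>R e x) < \<infinity>" .
qed

text \<open>On a supersolution, testing with \<open>\<eta> ^ k * (v + \<epsilon>) powr (1 - p)\<close> bounds the gradient
  of \<open>ln (v + \<epsilon>)\<close> independently of \<open>\<epsilon>\<close>.\<close>

lemma log_gradient_bound:
  assumes S: "supersolution U" and \<rho>: "0 < \<rho>" "\<rho> < \<rho>2" "cball y \<rho>2 \<subseteq> U"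
  shows "\<exists>C. \<forall>\<epsilon>>0. mass p (\<lambda>x. indicator (ball y \<rho>) x *\<^sub>R ((1 / (v x + \<epsilon>)) *\<^sub>R g x)) \<le> ennreal C"
proof -
  obtain \<eta> e where \<eta>: "C1 \<eta> e" "\<And>x. 0 \<le> \<eta> x" "\<And>x. \<eta> x \<le> 1" "\<And>x. x \<in> ball y \<rho> \<Longrightarrow> \<eta> x = 1" "\<And>x. x \<notin> cball y \<rho>2 \<Longrightarrow> \<eta> x = 0"
    using ball_cutoff[OF \<rho>(1,2), of y] by blast
  have \<eta>c: "C1c U \<eta> e" unfolding C1c_def using \<eta>(1,5) \<rho>(3) by (auto intro!: exI[of _ "cball y \<rho>2"])
  obtain A where A: "A > 0" "\<And>x. norm (e x) \<le> A" using C1c_bounds[OF \<eta>c] by blast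
  have e0: "e x = 0" if "x \<notin> cball y \<rho>2" for x using C1_support[OF \<eta>(1) compact_cball \<eta>(5) that] by simp
  obtain k :: nat where k: "p \<le> real k" using real_arch_simple by blast
  have k1: "k \<ge> 1" using k p by linarith
  define \<zeta> where "\<zeta> x = \<eta> x ^ k" for x
  define ez where "ez x = (real k * \<eta> x ^ (k - 1)) *\<^sub>R e x" for x
  have "C1 \<zeta> ez" unfolding \<zeta>_def[abs_def] ez_def[abs_def]
    by (rule C1_compose[OF \<eta>(1)]) (auto intro!: DERIV_pow continuous_intros)
  then have \<zeta>c: "C1c U \<zeta> ez" unfolding C1c_def using \<eta>(5) k1 \<rho>(3) by (auto intro!: exI[of _ "cball y \<rho>2"] simp: \<zeta>_def power_0_left)
  have \<zeta>0: "0 \<le> \<zeta> x" for x using \<eta>(2) by (simp add: \<zeta>_def)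
  define c0 where "c0 = (p - 1) * c"
  have c0: "c0 > 0" using p c by (simp add: c0_def)
  define B where "B = real k * m * A"
  have B: "B \<ge> 0" using A by (simp add: B_def)
  obtain C where C: "C \<ge> 0" "\<And>s X. 0 \<le> s \<Longrightarrow> s \<le> 1 \<Longrightarrow> 0 \<le> X \<Longrightarrow> B * (s ^ (k - 1) * X powr (p - 1)) \<le> c0 / 2 * (s ^ k * X powr p) + C"
    using log_young[OF p c0 B k] by blast
  define V where "V = measure lborel (cball y \<rho>2)"
  have "mass p (\<lambda>x. indicator (ball y \<rho>) x *\<^sub>R ((1 / (v x + \<epsilon>)) *\<^sub>R g x)) \<le> ennreal (2 * C * V / c0)" if \<epsilon>: "\<epsilon> > 0" for \<epsilon>
  proof -
    define f where "f s = (s + \<epsilon>) powr (1 - p)" for s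
    define f' where "f' s = (1 - p) * (s + \<epsilon>) powr (- p)" for s
    define F where "F s = f (max 0 s) + f' 0 * min 0 s" for s
    define F' where "F' s = f' (max 0 s)" for s
    define M where "M = max ((p - 1) * \<epsilon> powr (- p)) (\<epsilon> powr (1 - p))"
    have F: "(F has_real_derivative F' s) (at s)" for s unfolding F_def[abs_def] F'_def
    proof (rule C1_extension)
      fix s :: real assume "0 \<le> s"
      then have out: "((\<lambda>z. z powr (1 - p)) has_real_derivative (1 - p) * (s + \<epsilon>) powr (1 - p - 1)) (at (s + \<epsilon>))"
        using \<epsilon> by (intro has_real_derivative_powr) simp
      have "((\<lambda>s. s + \<epsilon>) has_real_derivative 1) (at s)" by (auto intro!: derivative_eq_intros)
      from DERIV_chain2[where g = "\<lambda>s. s + \<epsilon>" and x = s and s = UNIV, OF out this]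
      show "(f has_real_derivative f' s) (at s)" unfolding f_def[abs_def] f'_def by simp
    qed
    have F'c: "continuous_on UNIV F'" unfolding F'_def[abs_def] f'_def using \<epsilon>
      by (intro continuous_intros) (auto simp: max_def)
    have le1: "(s + \<epsilon>) powr (- p) \<le> \<epsilon> powr (- p)" "(s + \<epsilon>) powr (1 - p) \<le> \<epsilon> powr (1 - p)" if "0 \<le> s" for s
      using that \<epsilon> p by (auto intro!: powr_mono2')
    have F'M: "\<bar>F' s\<bar> \<le> M" for s
    proof -
      have "\<bar>F' s\<bar> = (p - 1) * (max 0 s + \<epsilon>) powr (- p)" using p by (simp add: F'_def f'_def abs_mult)
      also have "\<dots> \<le> (p - 1) * \<epsilon> powr (- p)" using p le1(1)[of "max 0 s"] by (intro mult_left_mono) auto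
      finally show ?thesis by (simp add: M_def)
    qed
    have FM: "0 \<le> F s \<and> F s \<le> M" if "0 \<le> s" for s
      using that le1(2)[of s] by (simp add: F_def f_def M_def)
    define W where "W x = a (g x) \<bullet> (\<zeta> x *\<^sub>R F' (v x) *\<^sub>R g x + F (v x) *\<^sub>R ez x)" for x
    have Wi: "integrable lborel W" unfolding W_def[abs_def] by (rule test_integrable[OF \<zeta>c F F'c F'M FM])
    have W0: "0 \<le> (\<integral>x. W x \<partial>lborel)"
      using S \<zeta>c \<zeta>0 F F'c F'M FM unfolding supersolution_def W_def by blast
    define X where "X x = norm (g x) / (v x + \<epsilon>)" for x
    have ve: "v x + \<epsilon> > 0" for x using v_nonneg[of x] \<epsilon> by linarith
    have X0: "X x \<ge> 0" for x using ve[of x] by (simp add: X_def)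
    have Wle: "W x \<le> C * indicator (cball y \<rho>2) x - c0 / 2 * (\<zeta> x * X x powr p)" for x
    proof (cases "x \<in> cball y \<rho>2")
      case False
      then show ?thesis using \<eta>(5)[OF False] k1 e0[OF False] by (simp add: W_def \<zeta>_def ez_def power_0_left)
    next
      case True
      have Fv: "F (v x) = (v x + \<epsilon>) powr (1 - p)" "F' (v x) = (1 - p) * (v x + \<epsilon>) powr (- p)"
        using v_nonneg[of x] by (simp_all add: F_def F'_def f_def f'_def)
      have 1: "a (g x) \<bullet> (\<zeta> x *\<^sub>R F' (v x) *\<^sub>R g x) \<le> - (c0 * (\<zeta> x * X x powr p))"
      proof -
        have "c * norm (g x) powr p \<le> N (g x)" by (rule lower)
        then have "((p - 1) * \<zeta> x * (v x + \<epsilon>) powr (- p)) * (c * norm (g x) powr p) \<le> ((p - 1) * \<zeta> x * (v x + \<epsilon>) powr (- p)) * N (g x)"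
          using p \<zeta>0 by (intro mult_left_mono) auto
        moreover have "X x powr p = (v x + \<epsilon>) powr (- p) * norm (g x) powr p"
          using ve[of x] by (simp add: X_def powr_divide powr_minus_divide)
        ultimately show ?thesis by (simp add: a_self Fv c0_def algebra_simps)
      qed
      have "a (g x) \<bullet> (F (v x) *\<^sub>R ez x) = ((v x + \<epsilon>) powr (1 - p) * (real k * \<eta> x ^ (k - 1))) * (a (g x) \<bullet> e x)"
        by (simp add: Fv ez_def)
      also have "\<dots> \<le> ((v x + \<epsilon>) powr (1 - p) * (real k * \<eta> x ^ (k - 1))) * ((m * norm (g x) powr (p - 1)) * A)"
      proof (rule mult_left_mono)
        have "a (g x) \<bullet> e x \<le> norm (a (g x)) * norm (e x)" by (rule norm_cauchy_schwarz)
        also have "\<dots> \<le> (m * norm (g x) powr (p - 1)) * A" by (intro mult_mono a_bound A) auto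
        finally show "a (g x) \<bullet> e x \<le> (m * norm (g x) powr (p - 1)) * A" .
      qed (use \<eta>(2) in simp)
      also have "\<dots> = B * (\<eta> x ^ (k - 1) * X x powr (p - 1))"
      proof -
        have "X x powr (p - 1) = norm (g x) powr (p - 1) * (v x + \<epsilon>) powr (1 - p)"
          using ve[of x] powr_minus_divide[of "v x + \<epsilon>" "p - 1"] by (simp add: X_def powr_divide)
        then show ?thesis by (simp add: B_def)
      qed
      also have "\<dots> \<le> c0 / 2 * (\<zeta> x * X x powr p) + C" unfolding \<zeta>_def by (rule C(2)[OF \<eta>(2,3) X0])
      finally show ?thesis using 1 True by (simp add: W_def inner_add_right)
    qed
    have [measurable]: "\<zeta> \<in> borel_measurable borel" by (rule C1c_measurable[OF \<zeta>c])
    have Xm[measurable]: "X \<in> borel_measurable borel" unfolding X_def[abs_def] by measurable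
    have bi: "integrable lborel (\<lambda>x. C * indicator (cball y \<rho>2) x)"
      using emeasure_bounded_finite[of "cball y \<rho>2"] by (intro integrable_mult_right integrable_real_indicator) auto
    have Xi: "integrable lborel (\<lambda>x. c0 / 2 * (\<zeta> x * X x powr p))"
    proof (rule Bochner_Integration.integrable_bound[of _ "\<lambda>x. C * indicator (cball y \<rho>2) x - W x"])
      show "integrable lborel (\<lambda>x. C * indicator (cball y \<rho>2) x - W x)" using bi Wi by (rule Bochner_Integration.integrable_diff)
      show "AE x in lborel. norm (c0 / 2 * (\<zeta> x * X x powr p)) \<le> norm (C * indicator (cball y \<rho>2) x - W x)"
      proof (rule AE_I2)
        fix x
        have "0 \<le> c0 / 2 * (\<zeta> x * X x powr p)" using c0 \<zeta>0[of x] by simp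
        then show "norm (c0 / 2 * (\<zeta> x * X x powr p)) \<le> norm (C * indicator (cball y \<rho>2) x - W x)"
          using Wle[of x] unfolding real_norm_def by linarith
      qed
    qed measurable
    have "(\<integral>x. c0 / 2 * (\<zeta> x * X x powr p) \<partial>lborel) \<le> (\<integral>x. C * indicator (cball y \<rho>2) x - W x \<partial>lborel)"
      using Wle by (intro integral_mono Xi Bochner_Integration.integrable_diff bi Wi) (simp add: algebra_simps)
    also have "\<dots> = C * V - (\<integral>x. W x \<partial>lborel)"
      by (subst Bochner_Integration.integral_diff[OF bi Wi]) (simp add: V_def)
    also have "\<dots> \<le> C * V" using W0 by simp
    finally have "c0 / 2 * (\<integral>x. \<zeta> x * X x powr p \<partial>lborel) \<le> C * V" by simp
    then have Ile: "(\<integral>x. \<zeta> x * X x powr p \<partial>lborel) \<le> 2 * C * V / c0" using c0 by (simp add: field_simps)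
    have Xi': "integrable lborel (\<lambda>x. \<zeta> x * X x powr p)" using integrable_mult_right[OF Xi, of "2 / c0"] c0 by simp
    have "mass p (\<lambda>x. indicator (ball y \<rho>) x *\<^sub>R ((1 / (v x + \<epsilon>)) *\<^sub>R g x)) \<le> (\<integral>\<^sup>+x. ennreal (\<zeta> x * X x powr p) \<partial>lborel)"
      unfolding mass_def
    proof (rule nn_integral_mono, rule ennreal_leI)
      fix x
      show "norm (indicator (ball y \<rho>) x *\<^sub>R ((1 / (v x + \<epsilon>)) *\<^sub>R g x)) powr p \<le> \<zeta> x * X x powr p"
        using \<eta>(4)[of x] \<zeta>0[of x] ve[of x] by (cases "x \<in> ball y \<rho>") (simp_all add: \<zeta>_def X_def)
    qed
    also have "\<dots> = ennreal (\<integral>x. \<zeta> x * X x powr p \<partial>lborel)" using Xi' \<zeta>0 by (intro nn_integral_eq_integral) auto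
    also have "\<dots> \<le> ennreal (2 * C * V / c0)" by (rule ennreal_leI[OF Ile])
    finally show ?thesis .
  qed
  then show ?thesis by blast
qed

end

context critical_problem
begin

text \<open>If \<open>v\<close> vanishes on a set of positive measure, the Poincare inequality for \<open>ln (1 + v/\<epsilon>)\<close>
  bounds this function uniformly in \<open>\<epsilon>\<close>, although it blows up wherever \<open>v > 0\<close>.\<close>

lemma zero_set_fills_ball:
  assumes S: "supersolution U" and \<rho>: "0 < \<rho>" "\<rho> < \<rho>2" "cball y \<rho>2 \<subseteq> U"
    and Z: "Z \<in> sets borel" "Z \<subseteq> ball y \<rho>" "AE x in lborel. x \<in> Z \<longrightarrow> v x = 0" "emeasure lborel Z \<noteq> 0"
  shows "AE x in lborel. x \<in> ball y \<rho> \<longrightarrow> v x = 0"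
proof -
  define Z0 where "Z0 = {x \<in> Z. v x = 0}"
  have Z0m[measurable]: "Z0 \<in> sets borel" using Z(1) unfolding Z0_def by measurable
  have Z0s: "Z0 \<subseteq> ball y \<rho>" using Z(2) by (auto simp: Z0_def)
  have "emeasure lborel Z0 = emeasure lborel Z"
    by (rule emeasure_eq_AE) (use Z(1,3) in \<open>auto simp: Z0_def\<close>)
  then have Z0p: "emeasure lborel Z0 \<noteq> 0" using Z(4) by simp
  have "emeasure lborel Z0 < \<infinity>"
    using emeasure_bounded_finite[OF bounded_subset[OF bounded_ball Z0s]] .
  then obtain z where z: "emeasure lborel Z0 = ennreal z" "z > 0"
    using Z0p by (cases "emeasure lborel Z0") (auto simp: less_le)
  obtain C where C: "\<And>\<epsilon>. \<epsilon> > 0 \<Longrightarrow> mass p (\<lambda>x. indicator (ball y \<rho>) x *\<^sub>R ((1 / (v x + \<epsilon>)) *\<^sub>R g x)) \<le> ennreal C"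
    using log_gradient_bound[OF S \<rho>] by blast
  define P where "P = (2 * \<rho>) powr p * (measure lborel (ball y \<rho>) * 2 ^ DIM('a)) * 2 powr p"
  have P0: "P \<ge> 0" by (simp add: P_def)
  have key: "mass p (\<lambda>x. indicator (ball y \<rho>) x * ln (1 + v x / \<epsilon>)) \<le> ennreal (P * max 0 C / z)" if \<epsilon>: "\<epsilon> > 0" for \<epsilon>
  proof -
    define f where "f s = ln (1 + s / \<epsilon>)" for s
    define f' where "f' s = 1 / (s + \<epsilon>)" for s
    define F where "F s = f (max 0 s) + f' 0 * min 0 s" for s
    define F' where "F' s = f' (max 0 s)" for s
    have F: "(F has_real_derivative F' s) (at s)" for s unfolding F_def[abs_def] F'_def
    proof (rule C1_extension)
      fix s :: real assume s: "0 \<le> s"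
      have pos: "1 + s / \<epsilon> > 0" using s \<epsilon> by (simp add: add_pos_nonneg)
      have "((\<lambda>s. 1 + s / \<epsilon>) has_real_derivative 1 / \<epsilon>) (at s)" using \<epsilon> by (auto intro!: derivative_eq_intros)
      from DERIV_chain2[where f = ln and g = "\<lambda>s. 1 + s / \<epsilon>" and x = s and s = UNIV, OF DERIV_ln_divide[OF pos] this]
      have "(f has_real_derivative 1 / (1 + s / \<epsilon>) * (1 / \<epsilon>)) (at s)" unfolding f_def[abs_def] .
      moreover have "1 / (1 + s / \<epsilon>) * (1 / \<epsilon>) = f' s" using s \<epsilon> by (simp add: f'_def distrib_right add.commute)
      ultimately show "(f has_real_derivative f' s) (at s)" by simp
    qed
    have F'c: "continuous_on UNIV F'" unfolding F'_def[abs_def] f'_def using \<epsilon>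
      by (intro continuous_intros) (auto simp: max_def)
    have F'M: "\<bar>F' s\<bar> \<le> 1 / \<epsilon>" for s using \<epsilon> by (simp add: F'_def f'_def frac_le)
    have Fv: "F (v x) = ln (1 + v x / \<epsilon>)" "F' (v x) = 1 / (v x + \<epsilon>)" for x
      using v_nonneg[of x] by (simp_all add: F_def F'_def f_def f'_def)
    have "sobolev0 p \<Omega> (\<lambda>x. F (v x)) (\<lambda>x. F' (v x) *\<^sub>R g x)"
      by (rule sobolev0_compose[OF sob p0 F F'c F'M]) (simp add: F_def f_def)
    from ball_poincare[OF this p \<rho>(1) Z0m Z0s]
    have "emeasure lborel Z0 * mass p (\<lambda>x. indicator (ball y \<rho>) x * F (v x)) \<le>
        ennreal P * mass p (\<lambda>x. indicator (ball y \<rho>) x *\<^sub>R (F' (v x) *\<^sub>R g x))"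
      unfolding P_def by (simp add: Z0_def F_def f_def)
    also have "\<dots> \<le> ennreal P * ennreal C" unfolding Fv by (intro mult_left_mono C \<epsilon>) auto
    also have "\<dots> \<le> ennreal (P * max 0 C)" using P0 by (simp add: ennreal_mult' ennreal_leI mult_left_mono)
    finally have le: "ennreal z * mass p (\<lambda>x. indicator (ball y \<rho>) x * ln (1 + v x / \<epsilon>)) \<le> ennreal (P * max 0 C)"
      unfolding Fv z(1) .
    have "mass p (\<lambda>x. indicator (ball y \<rho>) x * ln (1 + v x / \<epsilon>)) =
        ennreal (1 / z) * (ennreal z * mass p (\<lambda>x. indicator (ball y \<rho>) x * ln (1 + v x / \<epsilon>)))"
      using z(2) by (simp add: mult.assoc[symmetric] ennreal_mult'[symmetric])
    also have "\<dots> \<le> ennreal (1 / z) * ennreal (P * max 0 C)" by (rule mult_left_mono[OF le]) simp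
    also have "\<dots> = ennreal (P * max 0 C / z)" using z(2) by (simp add: ennreal_mult'[symmetric])
    finally show ?thesis .
  qed
  define f where "f n x = ennreal (norm (indicator (ball y \<rho>) x * ln (1 + v x / (1 / real (Suc n)))) powr p)" for n x
  have [measurable]: "ball y \<rho> \<in> sets borel" by simp
  have [measurable]: "f n \<in> borel_measurable borel" for n unfolding f_def[abs_def] by measurable
  have "(\<integral>\<^sup>+x. liminf (\<lambda>n. f n x) \<partial>lborel) \<le> liminf (\<lambda>n. \<integral>\<^sup>+x. f n x \<partial>lborel)"
    by (rule nn_integral_liminf) measurable
  also have "\<dots> \<le> ennreal (P * max 0 C / z)"
    unfolding f_def by (intro Liminf_le always_eventually allI key[unfolded mass_def]) auto
  finally have "(\<integral>\<^sup>+x. liminf (\<lambda>n. f n x) \<partial>lborel) \<noteq> \<infinity>" by (auto simp: top_unique)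
  then have "AE x in lborel. liminf (\<lambda>n. f n x) \<noteq> \<infinity>" by (intro nn_integral_PInf_AE) measurable
  then show ?thesis
  proof eventually_elim
    case (elim x)
    show ?case
    proof (rule impI, rule ccontr)
      assume x: "x \<in> ball y \<rho>" "v x \<noteq> 0"
      then have v: "v x > 0" using v_nonneg[of x] by simp
      have "filterlim (\<lambda>n. v x * real (Suc n)) at_top sequentially"
        using v filterlim_compose[OF filterlim_real_sequentially filterlim_Suc]
        by (intro filterlim_tendsto_pos_mult_at_top[OF tendsto_const]) auto
      then have "filterlim (\<lambda>n. ln (1 + v x * real (Suc n))) at_top sequentially"
        by (intro filterlim_compose[OF ln_at_top] filterlim_tendsto_add_at_top[OF tendsto_const])
      moreover from this have "\<forall>\<^sub>F n in sequentially. ln (1 + v x * real (Suc n)) \<le> ln (1 + v x * real (Suc n)) powr p"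
        unfolding filterlim_at_top[of _ sequentially]
        by (rule eventually_mono[OF spec[of _ 1]]) (use p powr_mono[of 1 p] in \<open>force simp del: of_nat_Suc\<close>)
      ultimately have "filterlim (\<lambda>n. ln (1 + v x * real (Suc n)) powr p) at_top sequentially"
        by (rule filterlim_at_top_mono)
      moreover have "f n x = ennreal (ln (1 + v x * real (Suc n)) powr p)" for n
        using x(1) v by (simp add: f_def del: of_nat_Suc)
      ultimately have "(\<lambda>n. f n x) \<longlonglongrightarrow> \<infinity>" by (simp add: ennreal_tendsto_top_eq_at_top del: of_nat_Suc)
      then show False using elim lim_imp_Liminf[OF sequentially_bot] by blast
    qed
  qed
qed

lemma ball_not_null: "0 < \<rho> \<Longrightarrow> emeasure lborel (ball (y::'a) \<rho>) \<noteq> 0"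
  using content_ball_pos[of \<rho> y] by (auto simp: measure_def)

text \<open>The points near which \<open>v\<close> vanishes form an open and relatively closed subset of the domain.\<close>

lemma vanishes_if_vanishes_somewhere:
  assumes S: "supersolution \<Omega>" and conn: "connected \<Omega>" and y: "y \<in> \<Omega>" "0 < \<rho>0" "AE x in lborel. x \<in> ball y \<rho>0 \<longrightarrow> v x = 0"
  shows "AE x in lborel. v x = 0"
proof -
  define \<Z> where "\<Z> = {x \<in> \<Omega>. \<exists>\<rho>>0. AE z in lborel. z \<in> ball x \<rho> \<longrightarrow> v z = 0}"
  have grow: "\<exists>\<rho>>0. ball x \<rho> \<subseteq> \<Omega> \<and> (ball x \<rho> \<inter> \<Z> \<noteq> {} \<longrightarrow> (AE z in lborel. z \<in> ball x \<rho> \<longrightarrow> v z = 0))" if x: "x \<in> \<Omega>" for x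
  proof -
    obtain \<rho>2 where \<rho>2: "\<rho>2 > 0" "cball x \<rho>2 \<subseteq> \<Omega>" using open_dom x open_contains_cball by blast
    have "AE z in lborel. z \<in> ball x (\<rho>2 / 2) \<longrightarrow> v z = 0" if ne: "ball x (\<rho>2 / 2) \<inter> \<Z> \<noteq> {}"
    proof -
      obtain w where w: "w \<in> ball x (\<rho>2 / 2)" "w \<in> \<Z>" using ne by blast
      obtain \<rho> where \<rho>: "\<rho> > 0" "AE z in lborel. z \<in> ball w \<rho> \<longrightarrow> v z = 0" using w(2) by (auto simp: \<Z>_def)
      have "open (ball x (\<rho>2 / 2) \<inter> ball w \<rho>)" by auto
      then obtain s where s: "s > 0" "ball w s \<subseteq> ball x (\<rho>2 / 2) \<inter> ball w \<rho>"
        using w(1) \<rho>(1) open_contains_ball by (metis IntI centre_in_ball)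
      have "AE z in lborel. z \<in> ball w s \<longrightarrow> v z = 0" using \<rho>(2) by eventually_elim (use s(2) in blast)
      then show ?thesis using s \<rho>2 ball_not_null[OF s(1)]
        by (intro zero_set_fills_ball[OF S, of "\<rho>2 / 2" \<rho>2 x "ball w s"]) auto
    qed
    moreover have "ball x (\<rho>2 / 2) \<subseteq> \<Omega>" using \<rho>2 by (auto intro: order_trans)
    ultimately show ?thesis using \<rho>2 by (intro exI[of _ "\<rho>2 / 2"]) simp
  qed
  have dich: "\<exists>\<rho>>0. ball x \<rho> \<subseteq> \<Z> \<or> ball x \<rho> \<subseteq> \<Omega> - \<Z>" if x: "x \<in> \<Omega>" for x
  proof -
    obtain \<rho> where \<rho>: "\<rho> > 0" "ball x \<rho> \<subseteq> \<Omega>" "ball x \<rho> \<inter> \<Z> \<noteq> {} \<longrightarrow> (AE z in lborel. z \<in> ball x \<rho> \<longrightarrow> v z = 0)"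
      using grow[OF x] by blast
    have "ball x \<rho> \<subseteq> \<Z>" if "ball x \<rho> \<inter> \<Z> \<noteq> {}"
    proof
      fix w assume w: "w \<in> ball x \<rho>"
      then obtain s where s: "s > 0" "ball w s \<subseteq> ball x \<rho>" using open_contains_ball[of "ball x \<rho>"] open_ball[of x \<rho>] by blast
      have "AE z in lborel. z \<in> ball x \<rho> \<longrightarrow> v z = 0" using \<rho>(3) that by blast
      then have "AE z in lborel. z \<in> ball w s \<longrightarrow> v z = 0" by eventually_elim (use s in blast)
      then show "w \<in> \<Z>" using w \<rho>(2) s(1) by (auto simp: \<Z>_def)
    qed
    then show ?thesis using \<rho> by blast
  qed
  have sub: "\<Z> \<subseteq> \<Omega>" by (auto simp: \<Z>_def)
  have "open \<Z>" unfolding open_contains_ball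
  proof
    fix x assume x: "x \<in> \<Z>"
    then obtain \<rho> where "\<rho> > 0" "ball x \<rho> \<subseteq> \<Z> \<or> ball x \<rho> \<subseteq> \<Omega> - \<Z>" using dich sub by blast
    moreover have "x \<in> ball x \<rho>" using \<open>\<rho> > 0\<close> by simp
    ultimately show "\<exists>e>0. ball x e \<subseteq> \<Z>" using x by blast
  qed
  moreover have "open (\<Omega> - \<Z>)" unfolding open_contains_ball
  proof
    fix x assume x: "x \<in> \<Omega> - \<Z>"
    then obtain \<rho> where "\<rho> > 0" "ball x \<rho> \<subseteq> \<Z> \<or> ball x \<rho> \<subseteq> \<Omega> - \<Z>" using dich by blast
    moreover have "x \<in> ball x \<rho>" using \<open>\<rho> > 0\<close> by simp
    ultimately show "\<exists>e>0. ball x e \<subseteq> \<Omega> - \<Z>" using x by blast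
  qed
  moreover have "y \<in> \<Z>" using y by (auto simp: \<Z>_def)
  ultimately have "\<Omega> - \<Z> = {}" using connectedD[OF conn, of \<Z> "\<Omega> - \<Z>"] sub by blast
  then have loc: "\<exists>\<rho>>0. AE z in lborel. z \<in> ball x \<rho> \<longrightarrow> v z = 0" if "x \<in> \<Omega>" for x using that by (auto simp: \<Z>_def)
  define \<B> where "\<B> = {ball x \<rho> |x \<rho>. AE z in lborel. z \<in> ball x \<rho> \<longrightarrow> v z = 0}"
  have "\<And>B. B \<in> \<B> \<Longrightarrow> open B" by (auto simp: \<B>_def)
  then obtain \<F> where \<F>: "\<F> \<subseteq> \<B>" "countable \<F>" "\<Union>\<F> = \<Union>\<B>" using Lindelof[of \<B>] by blast
  have "AE z in lborel. \<forall>B\<in>\<F>. z \<in> B \<longrightarrow> v z = 0"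
    unfolding AE_ball_countable[OF \<F>(2)] using \<F>(1) by (auto simp: \<B>_def)
  then show ?thesis
  proof eventually_elim
    case (elim z)
    show ?case
    proof (cases "z \<in> \<Omega>")
      case True
      then obtain \<rho> where "\<rho> > 0" "AE w in lborel. w \<in> ball z \<rho> \<longrightarrow> v w = 0" using loc by blast
      then have "ball z \<rho> \<in> \<B>" "z \<in> ball z \<rho>" by (auto simp: \<B>_def)
      then have "z \<in> \<Union>\<F>" unfolding \<F>(3) by blast
      then show ?thesis using elim by blast
    next
      case False
      then show ?thesis by (rule sobolev0D(3)[OF sob])
    qed
  qed
qed

end

section \<open>Nonexistence for a fixed norm\<close>

context critical_problem
begin

text \<open>Near the farthest boundary point, the extension of \<open>v\<close> by zero is a supersolution across the
  boundary. A priori the boundary contributes a negative measure, the flux through it; cutting off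
  in a layer of height \<open>\<delta>\<close> shows that this flux is bounded by \<open>1/\<delta>\<close> times the integral
  of \<open>norm (g x) powr (p - 1)\<close> over the layer, and this tends to zero by Hoelder's inequality,
  since the layer has volume \<open>O(\<delta>)\<close> and energy \<open>o(\<delta>)\<close>.\<close>

lemma supersolution_boundary:
  fixes t :: "nat \<Rightarrow> real"
  assumes l0: "lam = 0" and G: "C1 G dG" and eq: "\<Omega> \<inter> ball x0 r = {x \<in> ball x0 r. 0 < G x}" and \<kappa>: "0 < \<kappa>"
    and t: "\<And>j. t j > 1" "t \<longlonglongrightarrow> 1" "\<And>j. \<kappa> * (t j - 1) \<le> 1"
    and out: "\<And>j x. x \<in> ball x0 r \<Longrightarrow> G x \<le> \<kappa> * (t j - 1) \<Longrightarrow> dil b (t j) x \<notin> \<Omega>"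
    and energy: "(\<lambda>j. (\<integral>x. indicator {x. dil b (t j) x \<notin> \<Omega>} x * N (g x) \<partial>lborel) / (t j - 1)) \<longlonglongrightarrow> 0"
    and strip: "\<And>\<delta>. 0 < \<delta> \<Longrightarrow> \<delta> \<le> 1 \<Longrightarrow> measure lborel {x \<in> ball x0 r. 0 < G x \<and> G x < \<delta>} \<le> Cs * \<delta>" and Cs: "0 < Cs"
  shows "supersolution (ball x0 r)"
  unfolding supersolution_def
proof (intro allI impI)
  fix \<zeta> :: "'a \<Rightarrow> real" and e F F' M
  assume \<zeta>: "C1c (ball x0 r) \<zeta> e" "\<forall>x. 0 \<le> \<zeta> x" and "\<forall>s. (F has_real_derivative F' s) (at s)" and F'c: "continuous_on UNIV F'"
    and "\<forall>s. \<bar>F' s\<bar> \<le> M" "\<forall>s\<ge>0. 0 \<le> F s \<and> F s \<le> M"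
  then have F: "\<And>s. (F has_real_derivative F' s) (at s)" "\<And>s. \<bar>F' s\<bar> \<le> M" "\<And>s. 0 \<le> s \<Longrightarrow> 0 \<le> F s \<and> F s \<le> M" by auto
  have [measurable]: "\<Omega> \<in> sets borel" using open_dom by simp
  have Gc: "continuous_on UNIV G" using G by (rule C1_continuous)
  note [measurable] = C1_measurable[OF G] C1c_measurable[OF \<zeta>(1)]
  obtain A where A: "A > 0" "\<And>x. \<bar>\<zeta> x\<bar> \<le> A" "\<And>x. norm (e x) \<le> A" using C1c_bounds[OF \<zeta>(1)] by blast
  obtain K where K: "compact K" "K \<subseteq> ball x0 r" "\<And>x. x \<notin> K \<Longrightarrow> \<zeta> x = 0" "\<And>x. x \<notin> K \<Longrightarrow> e x = 0" using C1c_support[OF \<zeta>(1)] by blast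
  have "continuous_on K dG" using G by (auto simp: C1_def intro: continuous_on_subset)
  then have "bounded (dG ` K)" using K(1) by (intro compact_imp_bounded compact_continuous_image)
  then obtain D where D: "D > 0" "\<And>x. x \<in> K \<Longrightarrow> norm (dG x) \<le> D" unfolding bounded_pos by auto
  have M: "M \<ge> 0" using F(2)[of 0] by linarith
  \<comment> \<open>points of height less than \<open>\<delta> j\<close> are thrown out by the dilation with factor \<open>t j\<close>\<close>
  define \<delta> where "\<delta> j = \<kappa> * (t j - 1)" for j
  have \<delta>: "\<delta> j > 0" "\<delta> j \<le> 1" for j using \<kappa> t(1)[of j] t(3)[of j] by (auto simp: \<delta>_def)
  have \<delta>0: "\<delta> \<longlonglongrightarrow> 0" unfolding \<delta>_def[abs_def] using tendsto_mult[OF tendsto_const tendsto_diff[OF t(2) tendsto_const[of 1]], of \<kappa>] by simp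
  define H where "H j x = ramp (2 / \<delta> j * G x + - 1)" for j x
  define dH where "dH j x = (ramp' (2 / \<delta> j * G x + - 1) * (2 / \<delta> j)) *\<^sub>R dG x" for j x
  have HC: "C1 (H j) (dH j)" for j unfolding H_def[abs_def] dH_def[abs_def] by (rule C1_ramp[OF G])
  have Hb: "0 \<le> H j x" "H j x \<le> 1" for j x by (simp_all add: H_def ramp_bounds)
  note [measurable] = C1_measurable[OF HC]
  define \<zeta>j where "\<zeta>j j x = \<zeta> x * H j x" for j x
  define ej where "ej j x = \<zeta> x *\<^sub>R dH j x + H j x *\<^sub>R e x" for j x
  have \<zeta>jc: "C1c \<Omega> (\<zeta>j j) (ej j)" for j
    unfolding C1c_def
  proof (intro conjI exI allI impI)
    show "C1 (\<zeta>j j) (ej j)" unfolding \<zeta>j_def[abs_def] ej_def[abs_def] by (rule C1_mult[OF C1c_C1[OF \<zeta>(1)] HC])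
    have "closed {x. \<delta> j / 2 \<le> G x}" by (intro closed_Collect_le Gc continuous_on_const)
    then show "compact (K \<inter> {x. \<delta> j / 2 \<le> G x})" using K(1) by blast
    show "K \<inter> {x. \<delta> j / 2 \<le> G x} \<subseteq> \<Omega>"
    proof
      fix x assume x: "x \<in> K \<inter> {x. \<delta> j / 2 \<le> G x}"
      then have "0 < G x" using \<delta>(1)[of j] by simp
      then have "x \<in> \<Omega> \<inter> ball x0 r" unfolding eq using x K(2) by blast
      then show "x \<in> \<Omega>" by blast
    qed
    fix x assume x: "x \<notin> K \<inter> {x. \<delta> j / 2 \<le> G x}"
    show "\<zeta>j j x = 0"
    proof (cases "x \<in> K")
      case True
      then have "G x < \<delta> j / 2" using x by auto
      then have "2 / \<delta> j * G x + - 1 \<le> 0" using \<delta>(1)[of j] by (simp add: pos_divide_le_eq)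
      then show ?thesis by (simp add: \<zeta>j_def H_def ramp_values)
    qed (simp add: \<zeta>j_def K(3))
  qed
  define W where "W x = a (g x) \<bullet> (\<zeta> x *\<^sub>R F' (v x) *\<^sub>R g x + F (v x) *\<^sub>R e x)" for x
  define Wj where "Wj j x = a (g x) \<bullet> (\<zeta>j j x *\<^sub>R F' (v x) *\<^sub>R g x + F (v x) *\<^sub>R ej j x)" for j x
  define Rj where "Rj j x = F (v x) * \<zeta> x * (a (g x) \<bullet> dH j x)" for j x
  have Wi: "integrable lborel W" unfolding W_def[abs_def] by (rule test_integrable[OF \<zeta>(1) F(1) F'c F(2,3)])
  have Wji: "integrable lborel (Wj j)" for j unfolding Wj_def[abs_def] by (rule test_integrable[OF \<zeta>jc F(1) F'c F(2,3)])
  have Wm[measurable]: "W \<in> borel_measurable borel" using Wi by auto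
  have HWi: "integrable lborel (\<lambda>x. H j x * W x)" for j
  proof (rule Bochner_Integration.integrable_bound[OF Wi])
    show "AE x in lborel. norm (H j x * W x) \<le> norm (W x)"
      using Hb by (intro AE_I2) (simp add: abs_mult mult_left_le_one_le)
  qed measurable
  have split: "Wj j x = H j x * W x + Rj j x" for j x
    by (simp add: Wj_def W_def Rj_def \<zeta>j_def ej_def inner_add_right distrib_left mult_ac)
  have Rji: "integrable lborel (Rj j)" for j
    using Bochner_Integration.integrable_diff[OF Wji[of j] HWi[of j]] by (simp add: split)
  have ge: "0 \<le> (\<integral>x. H j x * W x \<partial>lborel) + (\<integral>x. Rj j x \<partial>lborel)" for j
  proof -
    have "0 \<le> (\<integral>x. Wj j x \<partial>lborel)"
      unfolding Wj_def
      by (rule supersolution_domain[OF l0, unfolded supersolution_def, rule_format, OF \<zeta>jc _ F(1) F'c F(2) F(3)])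
        (use \<zeta>(2) Hb in \<open>auto simp: \<zeta>j_def\<close>)
    then show ?thesis unfolding split Bochner_Integration.integral_add[OF HWi Rji] .
  qed
  have main: "(\<lambda>j. \<integral>x. H j x * W x \<partial>lborel) \<longlonglongrightarrow> (\<integral>x. W x \<partial>lborel)"
  proof (rule integral_dominated_convergence[where w = "\<lambda>x. norm (W x)"])
    show "integrable lborel (\<lambda>x. norm (W x))" using Wi by simp
    show "AE x in lborel. (\<lambda>j. H j x * W x) \<longlonglongrightarrow> W x"
    proof (rule AE_I2)
      fix x
      consider "G x > 0" | "x \<notin> K" | "G x \<le> 0" "x \<in> K" by linarith
      then show "(\<lambda>j. H j x * W x) \<longlonglongrightarrow> W x"
      proof cases
        case 1
        have "\<forall>\<^sub>F j in sequentially. \<delta> j < G x" using \<delta>0 1 by (rule order_tendstoD(2))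
        then have "\<forall>\<^sub>F j in sequentially. H j x * W x = W x"
        proof eventually_elim
          case (elim j)
          then have "1 \<le> 2 / \<delta> j * G x + - 1" using \<delta>(1)[of j] by (simp add: pos_le_divide_eq)
          then show ?case by (simp add: H_def ramp_values)
        qed
        then show ?thesis by (rule tendsto_eventually)
      next
        case 2
        then show ?thesis by (simp add: W_def K)
      next
        case 3
        then have "x \<notin> \<Omega> \<inter> ball x0 r" unfolding eq by simp
        then have "x \<notin> \<Omega>" using 3 K(2) by blast
        then have "g x = 0" by (rule sobolev0D(4)[OF sob])
        then show ?thesis by (simp add: W_def a_zero)
      qed
    qed
    show "AE x in lborel. norm (H j x * W x) \<le> norm (W x)" for j
      using Hb by (intro AE_I2) (simp add: abs_mult mult_left_le_one_le)
  qed measurable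
  define E where "E j = (\<integral>x. indicator {x. dil b (t j) x \<notin> \<Omega>} x * N (g x) \<partial>lborel)" for j
  \<comment> \<open>the second summand keeps the bound positive\<close>
  define \<eta> where "\<eta> j = E j / \<delta> j / c + 1 / real (Suc j)" for j
  have E0: "E j \<ge> 0" for j unfolding E_def using N_nonneg by (intro integral_nonneg_AE) auto
  have \<eta>0: "\<eta> j > 0" for j using E0[of j] \<delta>(1)[of j] c unfolding \<eta>_def by (intro add_nonneg_pos) auto
  have \<eta>lim: "\<eta> \<longlonglongrightarrow> 0"
  proof -
    have "(\<lambda>j. (E j / (t j - 1)) / \<kappa> / c + inverse (real (Suc j))) \<longlonglongrightarrow> 0 / \<kappa> / c + 0"
      using energy \<kappa> c unfolding E_def[symmetric]
      by (intro tendsto_add tendsto_divide tendsto_const LIMSEQ_inverse_real_of_nat) auto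
    then show ?thesis by (simp add: \<eta>_def[abs_def] \<delta>_def inverse_eq_divide mult.commute)
  qed
  define B where "B = 4 * M * A * m * D * Cs powr (1/p)"
  have err: "\<bar>\<integral>x. Rj j x \<partial>lborel\<bar> \<le> B * \<eta> j powr (1 - 1/p)" for j
  proof -
    define S where "S = {x. dil b (t j) x \<notin> \<Omega>}"
    define T where "T = {x \<in> ball x0 r. 0 < G x \<and> G x < \<delta> j}"
    have Sm[measurable]: "S \<in> sets borel" unfolding S_def by measurable
    have Tm[measurable]: "T \<in> sets borel" unfolding T_def by measurable
    have TS: "x \<in> S" if "x \<in> T" for x using that out[of x j] by (simp add: S_def T_def \<delta>_def)
    define B0 where "B0 = 4 * M * A * m * D / \<delta> j"
    have B00: "B0 \<ge> 0" using M A D \<delta>(1)[of j] by (simp add: B0_def)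
    define f where "f x = indicator S x * norm (g x) powr p" for x
    define h where "h x = (indicator T x :: real)" for x :: 'a
    have i1: "integrable lborel f" unfolding f_def[abs_def] using integrable_mult_indicator[OF _ g_int, of S] by simp
    have bT: "emeasure lborel T < \<infinity>"
      by (rule emeasure_bounded_finite) (rule bounded_subset[OF bounded_ball[of x0 r]], auto simp: T_def)
    have i2: "integrable lborel h" unfolding h_def[abs_def] using bT by (intro integrable_real_indicator) auto
    have SN: "integrable lborel (\<lambda>x. indicator S x * N (g x))" using integrable_mult_indicator[OF _ Ng_int, of S] by simp
    have "c * (\<integral>x. f x \<partial>lborel) = (\<integral>x. c * f x \<partial>lborel)" by simp
    also have "\<dots> \<le> (\<integral>x. indicator S x * N (g x) \<partial>lborel)"
      by (rule integral_mono[OF integrable_mult_right[OF i1] SN]) (use lower in \<open>simp add: f_def indicator_def\<close>)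
    also have "\<dots> = E j" by (simp add: E_def S_def)
    finally have "(\<integral>x. f x \<partial>lborel) \<le> E j / c" using c by (simp add: pos_le_divide_eq mult.commute)
    also have "\<dots> \<le> \<delta> j * \<eta> j"
    proof -
      have "\<delta> j * \<eta> j = E j / c + \<delta> j / real (Suc j)" using \<delta>(1)[of j] by (simp add: \<eta>_def distrib_left)
      then show ?thesis using \<delta>(1)[of j] by simp
    qed
    finally have I1: "(\<integral>x. f x \<partial>lborel) \<le> \<delta> j * \<eta> j" .
    have I2: "(\<integral>x. h x \<partial>lborel) \<le> Cs * \<delta> j" using strip[OF \<delta>] by (simp add: h_def[abs_def] T_def)
    have A1: "0 < \<delta> j * \<eta> j" "0 < Cs * \<delta> j" using \<delta>(1)[of j] \<eta>0[of j] Cs by simp_all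
    have ex: "0 < 1 - 1/p" "0 < 1/p" "1 - 1/p + 1/p = 1" using conj_exponent(3) p0 by auto
    have f0: "0 \<le> f x" and h0: "0 \<le> h x" for x by (simp_all add: f_def h_def)
    note hol = holder_bound[OF i1 i2 f0 h0 ex A1(1) I1 A1(2) I2]
    have pt: "\<bar>Rj j x\<bar> \<le> B0 * (f x powr (1 - 1/p) * h x powr (1/p))" for x
    proof (cases "x \<in> T \<and> x \<in> K")
      case True
      then have x: "x \<in> T" "x \<in> S" "x \<in> K" using TS by auto
      have fh: "f x powr (1 - 1/p) * h x powr (1/p) = norm (g x) powr (p - 1)"
      proof -
        have "p * (1 - 1/p) = p - 1" using p0 by (simp add: right_diff_distrib)
        then show ?thesis using x by (simp add: f_def h_def powr_powr)
      qed
      have 1: "\<bar>F (v x)\<bar> * \<bar>\<zeta> x\<bar> \<le> M * A" using F(3)[OF v_nonneg[of x]] A by (intro mult_mono) auto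
      have "norm (dH j x) = \<bar>ramp' (2 / \<delta> j * G x + - 1)\<bar> * (2 / \<delta> j) * norm (dG x)" using \<delta>(1)[of j] by (simp add: dH_def abs_mult)
      also have "\<dots> \<le> 2 * (2 / \<delta> j) * D" using ramp'_bounds(1) D x(3) \<delta>(1)[of j] by (intro mult_mono) auto
      finally have 2: "norm (dH j x) \<le> 4 * D / \<delta> j" by simp
      have "\<bar>a (g x) \<bullet> dH j x\<bar> \<le> norm (a (g x)) * norm (dH j x)" by (rule Cauchy_Schwarz_ineq2)
      also have "\<dots> \<le> (m * norm (g x) powr (p - 1)) * (4 * D / \<delta> j)" by (intro mult_mono a_bound 2) auto
      finally have "\<bar>F (v x)\<bar> * \<bar>\<zeta> x\<bar> * \<bar>a (g x) \<bullet> dH j x\<bar> \<le> (M * A) * ((m * norm (g x) powr (p - 1)) * (4 * D / \<delta> j))"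
        using M A(1) by (intro mult_mono[OF 1]) auto
      then show ?thesis unfolding fh by (simp add: Rj_def B0_def abs_mult mult_ac)
    next
      case False
      have "Rj j x = 0"
      proof (cases "x \<in> K")
        case True
        then have "G x \<le> 0 \<or> \<delta> j \<le> G x" using False K(2) by (auto simp: T_def)
        then have "ramp' (2 / \<delta> j * G x + - 1) = 0"
        proof
          assume "G x \<le> 0"
          then have "2 / \<delta> j * G x \<le> 0" using \<delta>(1)[of j] by (intro mult_nonneg_nonpos) auto
          then show ?thesis by (intro ramp'_bounds(2)) simp
        next
          assume "\<delta> j \<le> G x"
          then have "1 \<le> 2 / \<delta> j * G x + - 1" using \<delta>(1)[of j] by (simp add: pos_le_divide_eq)
          then show ?thesis by (rule ramp'_bounds(3))
        qed
        then show ?thesis by (simp add: Rj_def dH_def)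
      qed (simp add: Rj_def K(3))
      then show ?thesis using B00 by simp
    qed
    have "\<bar>\<integral>x. Rj j x \<partial>lborel\<bar> \<le> (\<integral>x. \<bar>Rj j x\<bar> \<partial>lborel)" by (rule integral_abs_bound)
    also have "\<dots> \<le> (\<integral>x. B0 * (f x powr (1 - 1/p) * h x powr (1/p)) \<partial>lborel)"
      using pt Rji[of j] hol(1) by (intro integral_mono integrable_abs integrable_mult_right)
    also have "\<dots> = B0 * (\<integral>x. f x powr (1 - 1/p) * h x powr (1/p) \<partial>lborel)" by simp
    also have "\<dots> \<le> B0 * ((\<delta> j * \<eta> j) powr (1 - 1/p) * (Cs * \<delta> j) powr (1/p))"
      by (rule mult_left_mono[OF hol(2) B00])
    also have "(\<delta> j * \<eta> j) powr (1 - 1/p) * (Cs * \<delta> j) powr (1/p) = \<delta> j * (\<eta> j powr (1 - 1/p) * Cs powr (1/p))"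
    proof -
      have "\<delta> j powr (1 - 1/p) * \<delta> j powr (1/p) = \<delta> j" using \<delta>(1)[of j] by (simp add: powr_add[symmetric])
      then show ?thesis using \<delta>(1)[of j] \<eta>0[of j] Cs by (simp add: powr_mult mult_ac)
    qed
    also have "B0 * (\<delta> j * (\<eta> j powr (1 - 1/p) * Cs powr (1/p))) = B * \<eta> j powr (1 - 1/p)"
      using \<delta>(1)[of j] by (simp add: B0_def B_def mult_ac)
    finally show ?thesis .
  qed
  have "(\<lambda>j. B * \<eta> j powr (1 - 1/p)) \<longlonglongrightarrow> B * 0 powr (1 - 1/p)"
    using \<eta>0 conj_exponent(3) by (intro tendsto_mult tendsto_const tendsto_powr' \<eta>lim) (auto simp: less_imp_le)
  then have "(\<lambda>j. B * \<eta> j powr (1 - 1/p)) \<longlonglongrightarrow> 0" by simp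
  then have R0: "(\<lambda>j. \<integral>x. Rj j x \<partial>lborel) \<longlonglongrightarrow> 0"
    by (rule Lim_null_comparison[rotated]) (use err in \<open>auto intro!: always_eventually\<close>)
  have "0 \<le> (\<integral>x. W x \<partial>lborel) + 0"
    by (rule LIMSEQ_le_const[OF tendsto_add[OF main R0]]) (use ge in blast)
  then show "0 \<le> (\<integral>x. a (g x) \<bullet> (\<zeta> x *\<^sub>R F' (v x) *\<^sub>R g x + F (v x) *\<^sub>R e x) \<partial>lborel)" by (simp add: W_def)
qed

text \<open>Outside \<open>cball b (dist b x0)\<close> there are points arbitrarily close to
  \<open>x0\<close>, so the zero extension of \<open>v\<close> vanishes on a set of positive measure near
  \<open>x0\<close>; the strong maximum principle carries the zeros across the boundary into the domain
  and from there everywhere.\<close>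

theorem trivial_on_starlike_domain:
  assumes Hb: "Hoelder_boundary 2 \<alpha> \<Omega>" and b: "b \<in> \<Omega>" and star: "\<And>x. x \<in> \<Omega> \<Longrightarrow> closed_segment b x \<subseteq> \<Omega>"
  shows "AE x in lborel. v x = 0"
proof (rule ccontr)
  assume nz: "\<not> (AE x in lborel. v x = 0)"
  obtain x0 where x0: "x0 \<in> frontier \<Omega>" "\<Omega> \<subseteq> cball b (dist b x0)"
    using farthest_boundary_point[OF open_dom bounded_dom b] by blast
  have bx: "x0 \<noteq> b" using x0(1) b open_dom by (auto simp: frontier_def interior_open)
  obtain r e G dG where r: "r > 0" and e: "norm e = 1" and G: "C1 G dG" "G x0 = 0" "\<And>x s. G (x + s *\<^sub>R e) = G x + s" "\<And>x. dG x \<bullet> e = 1"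
    and eq: "\<Omega> \<inter> ball x0 r = {x \<in> ball x0 r. 0 < G x}"
    using boundary_height[OF Hb open_dom x0(1)] by blast
  obtain r1 \<kappa> \<tau> where r1: "0 < r1" "r1 \<le> r" and \<kappa>: "0 < \<kappa>" and \<tau>: "1 < \<tau>"
    and out: "\<And>t x. 1 < t \<Longrightarrow> t < \<tau> \<Longrightarrow> x \<in> ball x0 r1 \<Longrightarrow> G x \<le> \<kappa> * (t - 1) \<Longrightarrow> (1 - t) *\<^sub>R b + t *\<^sub>R x \<notin> \<Omega>"
    using dilation_removes_layer[OF x0(2) bx r G(1,2,4) eq] by blast
  have "ball x0 r1 \<subseteq> ball x0 r" using r1(2) by auto
  then have eq1: "\<Omega> \<inter> ball x0 r1 = {x \<in> ball x0 r1. 0 < G x}" using eq by blast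
  note en = boundary_energy_negligible[OF star x0(2) zero_le_dist nz]
  obtain t :: "nat \<Rightarrow> real" where t: "\<And>j. t j > 1" "t \<longlonglongrightarrow> 1"
    "(\<lambda>j. (\<integral>x. indicator {x. dil b (t j) x \<notin> \<Omega>} x * N (g x) \<partial>lborel) / (t j - 1)) \<longlonglongrightarrow> 0"
    using en(2) by blast
  have "min \<tau> (1 + 1 / \<kappa>) > 1" using \<tau> \<kappa> by simp
  then have "\<forall>\<^sub>F j in sequentially. t j < min \<tau> (1 + 1 / \<kappa>)" by (rule order_tendstoD(2)[OF t(2)])
  then obtain J where J: "\<And>j. j \<ge> J \<Longrightarrow> t j < min \<tau> (1 + 1 / \<kappa>)" unfolding eventually_sequentially by blast
  have sup: "supersolution (ball x0 r1)"
  proof (rule supersolution_boundary[OF en(1) G(1) eq1 \<kappa>, of "\<lambda>j. t (j + J)" b "2 * measure lborel (ball x0 (r1 + 1))"])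
    fix j
    show "1 < t (j + J)" by (rule t(1))
    have "t (j + J) - 1 \<le> 1 / \<kappa>" using J[of "j + J"] by simp
    then show "\<kappa> * (t (j + J) - 1) \<le> 1" using \<kappa> by (simp add: pos_le_divide_eq mult.commute)
    fix x assume "x \<in> ball x0 r1" "G x \<le> \<kappa> * (t (j + J) - 1)"
    then show "dil b (t (j + J)) x \<notin> \<Omega>" unfolding dil_def using J[of "j + J"] by (intro out t(1)) auto
  next
    show "(\<lambda>j. t (j + J)) \<longlonglongrightarrow> 1" using t(2) by (rule LIMSEQ_ignore_initial_segment)
    show "(\<lambda>j. (\<integral>x. indicator {x. dil b (t (j + J)) x \<notin> \<Omega>} x * N (g x) \<partial>lborel) / (t (j + J) - 1)) \<longlonglongrightarrow> 0"
      using t(3) by (rule LIMSEQ_ignore_initial_segment)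
    show "measure lborel {x \<in> ball x0 r1. 0 < G x \<and> G x < \<delta>} \<le> 2 * measure lborel (ball x0 (r1 + 1)) * \<delta>" if "0 < \<delta>" "\<delta> \<le> 1" for \<delta>
      by (rule strip_volume[OF e C1_continuous[OF G(1)] G(3) that])
    show "0 < 2 * measure lborel (ball x0 (r1 + 1))" using content_ball_pos[of "r1 + 1" x0] r1(1) by simp
  qed
  define Z where "Z = ball x0 (r1 / 2) - cball b (dist b x0)"
  have Zo: "open Z" unfolding Z_def by (intro open_Diff) auto
  define s where "s = r1 / (4 * dist b x0)"
  have d0: "dist b x0 > 0" using bx by simp
  have s: "s > 0" using d0 r1 by (simp add: s_def)
  have "x0 + s *\<^sub>R (x0 - b) \<in> Z"
  proof -
    have "dist x0 (x0 + s *\<^sub>R (x0 - b)) = s * dist b x0" using s by (simp add: dist_norm norm_minus_commute)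
    also have "\<dots> < r1 / 2" using d0 r1 by (simp add: s_def)
    finally have 1: "x0 + s *\<^sub>R (x0 - b) \<in> ball x0 (r1 / 2)" by simp
    have "dist b (x0 + s *\<^sub>R (x0 - b)) = norm ((1 + s) *\<^sub>R (x0 - b))"
      unfolding dist_norm by (subst norm_minus_commute) (simp add: algebra_simps)
    also have "\<dots> = (1 + s) * dist b x0" using s by (simp add: dist_norm norm_minus_commute)
    also have "\<dots> > dist b x0" using s d0 by (simp add: distrib_right)
    finally show ?thesis using 1 by (simp add: Z_def)
  qed
  then obtain \<rho> where \<rho>: "\<rho> > 0" "ball (x0 + s *\<^sub>R (x0 - b)) \<rho> \<subseteq> Z" using Zo open_contains_ball by blast
  have Znn: "emeasure lborel Z \<noteq> 0"
  proof
    assume "emeasure lborel Z = 0"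
    moreover have "emeasure lborel (ball (x0 + s *\<^sub>R (x0 - b)) \<rho>) \<le> emeasure lborel Z" using \<rho>(2) Zo by (intro emeasure_mono) auto
    ultimately show False using ball_not_null[OF \<rho>(1)] by simp
  qed
  have Z0: "v x = 0" if "x \<in> Z" for x
  proof -
    have "x \<notin> \<Omega>" using that x0(2) by (auto simp: Z_def)
    then show ?thesis by (rule sobolev0D(3)[OF sob])
  qed
  have c34: "cball x0 (3 * r1 / 4) \<subseteq> ball x0 r1" "0 < r1 / 2" "r1 / 2 < 3 * r1 / 4" using r1(1) by auto
  have v0: "AE x in lborel. x \<in> ball x0 (r1 / 2) \<longrightarrow> v x = 0"
    by (rule zero_set_fills_ball[OF sup c34(2,3,1), of Z]) (use Zo Z0 Znn in \<open>auto simp: Z_def\<close>)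
  have "\<Omega> \<inter> ball x0 (r1 / 2) \<noteq> {}"
  proof -
    have "x0 \<in> closure \<Omega>" using x0(1) by (simp add: frontier_def)
    moreover have "x0 \<in> ball x0 (r1 / 2)" using c34(2) by simp
    ultimately show ?thesis using open_Int_closure_eq_empty[OF open_ball, of x0 "r1 / 2" \<Omega>] by blast
  qed
  then obtain y where y: "y \<in> \<Omega>" "y \<in> ball x0 (r1 / 2)" by blast
  then obtain \<rho>0 where \<rho>0: "\<rho>0 > 0" "ball y \<rho>0 \<subseteq> ball x0 (r1 / 2)" using open_contains_ball[of "ball x0 (r1 / 2)"] open_ball by blast
  have "AE x in lborel. x \<in> ball y \<rho>0 \<longrightarrow> v x = 0" using v0 by eventually_elim (use \<rho>0(2) in blast)
  moreover have "connected \<Omega>"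
  proof -
    have "starlike \<Omega>" unfolding starlike_def using b star by blast
    then show ?thesis by (rule starlike_imp_connected)
  qed
  ultimately have "AE x in lborel. v x = 0"
    using vanishes_if_vanishes_somewhere[OF supersolution_domain[OF en(1)] _ y(1) \<rho>0(1)] by blast
  then show False using nz by blast
qed

end

section \<open>Weak solutions of the affine equation\<close>

lemma sobolev0_cong_AE:
  assumes s: "sobolev0 p \<Omega> v g" and p: "0 < p" and v': "v' \<in> borel_measurable borel" "\<And>x. x \<notin> \<Omega> \<Longrightarrow> v' x = 0" "AE x in lborel. v' x = v x"
  shows "sobolev0 p \<Omega> v' g"
proof -
  note sD = sobolev0D[OF s]
  obtain \<phi> d where "approx_seq p \<Omega> v g \<phi> d" using s unfolding sobolev0_def by blast
  then have \<phi>: "\<And>k. C1c \<Omega> (\<phi> k) (d k)" and L: "Lp_null p (\<lambda>k x. \<phi> k x - v x)" "Lp_null p (\<lambda>k x. d k x - g x)"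
    by (auto simp: approx_seq_def)
  have "mass p (\<lambda>x. \<phi> k x - v' x) = mass p (\<lambda>x. \<phi> k x - v x)" for k
    by (rule mass_cong_AE) (use v'(3) in eventually_elim, simp)
  moreover have "(\<lambda>x. \<phi> k x - v' x) \<in> borel_measurable borel" for k
    using C1c_measurable(1)[OF \<phi>] v'(1) by measurable
  ultimately have "Lp_null p (\<lambda>k x. \<phi> k x - v' x)" using L(1) by (simp add: Lp_null_def)
  then show ?thesis using p v'(1,2) sD(2,4) \<phi> L(2) by (intro sobolev0I)
qed

text \<open>A nonzero test function comes for free with any nontrivial element of the Sobolev space.\<close>

lemma W0_nonzero_test_function:
  assumes u: "u \<in> W0 p \<Omega>" "\<not> (AE x in lebesgue_on \<Omega>. u x = 0)" and p: "0 < p"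
  shows "\<exists>\<phi> z. test_function \<Omega> \<phi> \<and> \<phi> z \<noteq> 0"
proof (rule ccontr)
  assume none: "\<not> (\<exists>\<phi> z. test_function \<Omega> \<phi> \<and> \<phi> z \<noteq> 0)"
  obtain \<phi> :: "nat \<Rightarrow> _" where \<phi>: "\<forall>k. test_function \<Omega> (\<phi> k)" "(\<lambda>k. Lp_norm p \<Omega> (\<lambda>x. \<phi> k x - u x)) \<longlonglongrightarrow> 0" and L: "in_Lp p \<Omega> u"
    using u(1) unfolding W0_def by blast
  have "\<phi> k x = 0" for k x using none \<phi>(1) by blast
  then have "(\<lambda>k::nat. Lp_norm p \<Omega> u) \<longlonglongrightarrow> 0" using \<phi>(2) by (simp add: Lp_norm_def)
  then have "Lp_norm p \<Omega> u = 0" by (simp add: LIMSEQ_const_iff)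
  then have "(\<integral>x. norm (u x) powr p \<partial>lebesgue_on \<Omega>) = 0" by (simp add: Lp_norm_def)
  then have "AE x in lebesgue_on \<Omega>. norm (u x) powr p = 0"
    using L unfolding in_Lp_def by (subst (asm) integral_nonneg_eq_0_iff_AE) auto
  then have "AE x in lebesgue_on \<Omega>. u x = 0" by eventually_elim simp
  then show False using u(2) by blast
qed

lemma represents_AE_iff:
  fixes f f' :: "'a::euclidean_space \<Rightarrow> real"
  assumes \<Omega>: "\<Omega> \<in> sets borel" and r: "represents \<Omega> f f'" and P: "P 0" "{s. P s} \<in> sets borel"
  shows "(AE x in lebesgue_on \<Omega>. P (f x)) \<longleftrightarrow> (AE x in lborel. P (f' x))"
proof -
  have f': "f' \<in> borel_measurable borel" "\<And>x. x \<notin> \<Omega> \<Longrightarrow> f' x = 0" and ae: "AE x in lborel. x \<in> \<Omega> \<longrightarrow> f x = f' x"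
    using r by (auto simp: represents_def)
  have [measurable]: "f' \<in> borel_measurable borel" "Measurable.pred borel P" using f'(1) P(2) by (auto simp: pred_def)
  have ael: "AE x in lebesgue. x \<in> \<Omega> \<longrightarrow> f x = f' x" by (rule AE_completion[OF ae])
  have "(AE x in lebesgue_on \<Omega>. P (f x)) \<longleftrightarrow> (AE x in lebesgue. x \<in> \<Omega> \<longrightarrow> P (f x))"
    using \<Omega> by (intro AE_restrict_space_iff) auto
  also have "\<dots> \<longleftrightarrow> (AE x in lebesgue. P (f' x))"
  proof
    assume "AE x in lebesgue. x \<in> \<Omega> \<longrightarrow> P (f x)"
    then show "AE x in lebesgue. P (f' x)" using ael
    proof eventually_elim
      case (elim x)
      then show ?case using f'(2)[of x] P(1) by (cases "x \<in> \<Omega>") auto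
    qed
  next
    assume "AE x in lebesgue. P (f' x)"
    then show "AE x in lebesgue. x \<in> \<Omega> \<longrightarrow> P (f x)" using ael by eventually_elim auto
  qed
  finally show ?thesis by (simp add: AE_completion_iff)
qed

theorem theorem1p5:
  fixes \<Omega> :: "(real ^ 'n) set" and p q \<alpha> lam :: real
  assumes "1 < p" and "p < real CARD('n)"
    and "open \<Omega>" and "bounded \<Omega>"
    and "0 < \<alpha>" and "\<alpha> < 1" and "Hoelder_boundary 2 \<alpha> \<Omega>"
    and "starlike \<Omega>"
    and "q = real CARD('n) * p / (real CARD('n) - p)"
    and "lam \<le> 0"
  shows "\<not> (\<exists>u. weak_solution p q lam \<Omega> u)"
proof
  assume "\<exists>u. weak_solution p q lam \<Omega> u"
  then obtain u where u: "u \<in> W0 p \<Omega>" "\<not> (AE x in lebesgue_on \<Omega>. u x = 0)" "AE x in lebesgue_on \<Omega>. 0 \<le> u x"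
    and weak: "\<And>\<phi>. \<phi> \<in> W0 p \<Omega> \<Longrightarrow>
        (\<integral>x. affine_flux p \<Omega> u (weak_grad \<Omega> u x) \<bullet> weak_grad \<Omega> \<phi> x \<partial>lebesgue_on \<Omega>) =
        (\<integral>x. u x powr (q - 1) * \<phi> x \<partial>lebesgue_on \<Omega>) + lam * (\<integral>x. u x powr (p - 1) * \<phi> x \<partial>lebesgue_on \<Omega>)"
    unfolding weak_solution_def by blast
  have p0: "0 < p" "1 \<le> p" using \<open>1 < p\<close> by auto
  have \<Omega>b: "\<Omega> \<in> sets borel" using \<open>open \<Omega>\<close> by simp
  obtain \<rho>0 z where \<rho>0: "test_function \<Omega> \<rho>0" "\<rho>0 z \<noteq> 0" using W0_nonzero_test_function[OF u(1,2) p0(1)] by blast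
  obtain v0 g where s0: "sobolev0 p \<Omega> v0 g" and r0: "represents \<Omega> u v0" and rg: "represents \<Omega> (weak_grad \<Omega> u) g"
    using W0_sobolev0[OF \<rho>0 u(1) p0(2) \<open>open \<Omega>\<close> \<open>bounded \<Omega>\<close>] by blast
  have v0: "v0 \<in> borel_measurable borel" "\<And>x. x \<notin> \<Omega> \<Longrightarrow> v0 x = 0" using sobolev0D[OF s0] by auto
  have nn: "AE x in lborel. 0 \<le> v0 x" using u(3) represents_AE_iff[OF \<Omega>b r0, of "\<lambda>s. 0 \<le> s"] by simp
  define v where "v x = max 0 (v0 x)" for x
  have vb: "v \<in> borel_measurable borel" "\<And>x. x \<notin> \<Omega> \<Longrightarrow> v x = 0" "AE x in lborel. v x = v0 x"
    using v0 nn by (auto simp: v_def[abs_def] elim: eventually_mono)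
  have s: "sobolev0 p \<Omega> v g" by (rule sobolev0_cong_AE[OF s0 p0(1) vb])
  have "AE x in lborel. x \<in> \<Omega> \<longrightarrow> u x = v0 x" using r0 by (simp add: represents_def)
  then have uv: "AE x in lborel. x \<in> \<Omega> \<longrightarrow> u x = v x" using vb(3) by eventually_elim simp
  then have rv: "represents \<Omega> u v" using vb by (simp add: represents_def)
  have nz: "\<not> (AE x in lborel. v x = 0)" using u(2) represents_AE_iff[OF \<Omega>b rv, of "\<lambda>s. s = 0"] by simp
  obtain \<mu> c where \<mu>: "directional_average \<mu> p c" and fl: "\<And>\<zeta>. affine_flux p \<Omega> u \<zeta> = avg_flux \<mu> p \<zeta>"
    using affine_flux_structure[OF s rg \<open>1 < p\<close> \<open>open \<Omega>\<close> \<open>bounded \<Omega>\<close> nz] by blast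
  interpret directional_average \<mu> p c by (rule \<mu>)
  have card: "real DIM(real ^ 'n) = real CARD('n)" by simp
  have gm: "g \<in> borel_measurable borel" using sobolev0D[OF s] by auto
  have "critical_problem \<mu> p c \<Omega> v g q lam"
  proof (intro critical_problem.intro \<mu> critical_problem_axioms.intro)
    show "0 \<le> v x" for x by (simp add: v_def)
    fix \<phi> :: "real ^ 'n \<Rightarrow> real" and h
    assume sp: "sobolev0 p \<Omega> \<phi> h"
    note b = sobolev0_in_W0[OF \<rho>0 sp p0(2) \<open>open \<Omega>\<close> \<open>bounded \<Omega>\<close>]
    note D = sobolev0D[OF sp]
    have "AE x in lborel. x \<in> \<Omega> \<longrightarrow> weak_grad \<Omega> \<phi> x = h x" "AE x in lborel. x \<in> \<Omega> \<longrightarrow> weak_grad \<Omega> u x = g x"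
      using b(2) rg by (simp_all add: represents_def)
    then have "AE x in lborel. x \<in> \<Omega> \<longrightarrow> affine_flux p \<Omega> u (weak_grad \<Omega> u x) \<bullet> weak_grad \<Omega> \<phi> x = avg_flux \<mu> p (g x) \<bullet> h x"
      by eventually_elim (simp add: fl)
    moreover have "(\<lambda>x. avg_flux \<mu> p (g x) \<bullet> h x) \<in> borel_measurable borel" using gm D(2) by measurable
    ultimately have 1: "represents \<Omega> (\<lambda>x. affine_flux p \<Omega> u (weak_grad \<Omega> u x) \<bullet> weak_grad \<Omega> \<phi> x) (\<lambda>x. avg_flux \<mu> p (g x) \<bullet> h x)"
      using D(4) by (simp add: represents_def)
    have 2: "represents \<Omega> (\<lambda>x. u x powr r * \<phi> x) (\<lambda>x. v x powr r * \<phi> x)" for r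
    proof -
      have "AE x in lborel. x \<in> \<Omega> \<longrightarrow> u x powr r * \<phi> x = v x powr r * \<phi> x" using uv by eventually_elim simp
      moreover have "(\<lambda>x. v x powr r * \<phi> x) \<in> borel_measurable borel" using vb(1) D(1) by measurable
      ultimately show ?thesis using D(3) by (simp add: represents_def)
    qed
    show "(\<integral>x. avg_flux \<mu> p (g x) \<bullet> h x \<partial>lborel) = (\<integral>x. v x powr (q - 1) * \<phi> x \<partial>lborel) + lam * (\<integral>x. v x powr (p - 1) * \<phi> x \<partial>lborel)"
      using weak[OF b(1)] unfolding represents_integral(1)[OF \<Omega>b 1] represents_integral(1)[OF \<Omega>b 2] .
  qed (use assms s card in auto)
  then interpret critical_problem \<mu> p c \<Omega> v g q lam .
  obtain b where b: "b \<in> \<Omega>" "\<And>x. x \<in> \<Omega> \<Longrightarrow> closed_segment b x \<subseteq> \<Omega>" using \<open>starlike \<Omega>\<close> unfolding starlike_def by blast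
  show False using trivial_on_starlike_domain[OF \<open>Hoelder_boundary 2 \<alpha> \<Omega>\<close> b] nz by blast
qed


end
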